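(* Let $J,\mu\in\mathbb R$, $U>0$ and $C>0$. Then there exists a constant $C(J,\mu,U)>0$ (depending only on $J,\mu,U$ and $C$, not on $d$, $L$, $t$) such that the following holds for all $d\ge1$, $L\ge3$. Let $\gamma_d(0)$ be a positive trace class operator on $\mathcal F$ with $\mathrm{Tr}(\gamma_d(0))=1$, let $\gamma_d(t)$ be the solution of $i\partial_t\gamma_d(t)=[H_d,\gamma_d(t)]$ with this initial datum, and let $\varphi$ be the solution of $i\partial_t\varphi(t)=h^{\varphi(t)}\varphi(t)$ with initial datum $\varphi(0)\in\ell^2(\mathbb C)$, $\|\varphi(0)\|_{\ell^2}=1$. Write $p_\varphi(t)=|\varphi(t)\rangle\langle\varphi(t)|$, $q_\varphi(t)=1-p_\varphi(t)$. If $$\mathrm{Tr}\big(p_\varphi(0)\mathcal N^4\big)\le C,$$ then for all $t\ge0$ $$\big\|\gamma_d^{(1)}(t)-p_\varphi(t)\big\|_{\mathcal L^1}\le C(J,\mu,U)\,e^{C(J,\mu,U)(1+t^7)}\left(\mathrm{Tr}\Big(\gamma_d^{(1)}(0)\big(q_\varphi(0)\mathcal N^2q_\varphi(0)+q_\varphi(0)\big)\Big)+\frac1d\right)^{1/2}.$$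
   Context: $\mathbb N=\{0,1,2,\dots\}$. $\ell^2(\mathbb C)=\ell^2(\mathbb N;\mathbb C)$ is the one-site Hilbert space with canonical basis $(|n\rangle)_{n\in\mathbb N}$; $a|0\rangle=0$, $a|n\rangle=\sqrt n|n-1\rangle$, $a^*|n\rangle=\sqrt{n+1}|n+1\rangle$, $\mathcal N=a^*a$. $\Lambda=(\mathbb Z/L\mathbb Z)^d$, $|\Lambda|=L^d$; $x\sim y$ means nearest neighbours (each site has $2d$ nearest neighbours); $\sum_{\langle x,y\rangle}$ is the sum over unordered nearest-neighbour pairs. $\mathcal F=\ell^2(\mathbb C)^{\otimes|\Lambda|}$ (one tensor factor per site). For a one-site operator $B$, $B_x$ is $B$ acting on the factor at $x$ and the identity elsewhere. Bose–Hubbard Hamiltonian: $$H_d=-\frac{J}{2d}\sum_{\langle x,y\rangle}(a_x^*a_y+a_y^*a_x)+(J-\mu)\sum_{x\in\Lambda}\mathcal N_x+\frac U2\sum_{x\in\Lambda}\mathcal N_x(\mathcal N_x-1).$$ It commutes with $\sum_x\mathcal N_x$ and is self-adjoint as a direct sum over its finite-dimensional eigenspaces; the solution of the von Neumann equation is $\gamma_d(t)=e^{-itH_d}\gamma_d(0)e^{itH_d}$. Mean-field operator: $h^\varphi=-J(\alpha_\varphi a^*+\overline{\alpha_\varphi}a-|\alpha_\varphi|^2)+(J-\mu)\mathcal N+\frac U2\mathcal N(\mathcal N-1)$, with $\alpha_\varphi=\langle\varphi,a\varphi\rangle$. A solution of the mean-field equation is $\varphi\in C(\mathbb R;\mathcal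 D(\mathcal N^2))\cap C^1(\mathbb R;\ell^2(\mathbb C))$ satisfying $i\partial_t\varphi(t)=h^{\varphi(t)}\varphi(t)$. One-lattice-site reduced density matrix: $\gamma_d^{(1)}=\frac1{|\Lambda|}\sum_{x\in\Lambda}\mathrm{Tr}_{\Lambda\setminus\{x\}}(\gamma_d)$ (partial trace over all sites except $x$), an operator on $\ell^2(\mathbb C)$. $\|\cdot\|_{\mathcal L^1}$ is the trace norm. Traces of positive operators may be $+\infty$, in which case the inequality is trivial. *)

theory Defs
  imports "HOL-Analysis.Analysis"
begin

section \<open>The Hilbert space of square-summable families\<close>

typedef 'i ell2 = "{f :: 'i \<Rightarrow> complex. (\<lambda>i. (cmod (f i))\<^sup>2) summable_on UNIV}"
  morphisms coord Abs_ell2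
  by (rule exI[of _ "\<lambda>_. 0"]) simp

setup_lifting type_definition_ell2

lemma coord_summable: "(\<lambda>i. (cmod (coord \<psi> i))\<^sup>2) summable_on UNIV"
  using coord[of \<psi>] by simp

lemma square_summable_add:
  fixes f g :: "'i \<Rightarrow> complex"
  assumes "(\<lambda>i. (cmod (f i))\<^sup>2) summable_on UNIV" "(\<lambda>i. (cmod (g i))\<^sup>2) summable_on UNIV"
  shows "(\<lambda>i. (cmod (f i + g i))\<^sup>2) summable_on UNIV"
proof (rule summable_on_comparison_test)
  show "(\<lambda>i. 2 * (cmod (f i))\<^sup>2 + 2 * (cmod (g i))\<^sup>2) summable_on UNIV"
    by (intro summable_on_add summable_on_cmult_right assms)
  fix i
  have "(cmod (f i + g i))\<^sup>2 \<le> (cmod (f i) + cmod (g i))\<^sup>2"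
    by (intro power_mono norm_triangle_ineq) auto
  also have "\<dots> \<le> 2 * (cmod (f i))\<^sup>2 + 2 * (cmod (g i))\<^sup>2"
    using sum_squares_bound[of "cmod (f i)" "cmod (g i)"] by (simp add: power2_sum)
  finally show "(cmod (f i + g i))\<^sup>2 \<le> 2 * (cmod (f i))\<^sup>2 + 2 * (cmod (g i))\<^sup>2" .
qed auto

lemma square_summable_cmult:
  fixes f :: "'i \<Rightarrow> complex"
  assumes "(\<lambda>i. (cmod (f i))\<^sup>2) summable_on UNIV"
  shows "(\<lambda>i. (cmod (c * f i))\<^sup>2) summable_on UNIV"
  using summable_on_cmult_right[OF assms, of "(cmod c)\<^sup>2"] by (simp add: norm_mult power_mult_distrib)

lift_definition cscale :: "complex \<Rightarrow> 'i ell2 \<Rightarrow> 'i ell2" (infixr "*\<^sub>C" 75)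
  is "\<lambda>c f i. c * f i" by (rule square_summable_cmult)

definition cinner :: "'i ell2 \<Rightarrow> 'i ell2 \<Rightarrow> complex" where
  "cinner \<psi> \<eta> = (\<Sum>\<^sub>\<infinity>i. cnj (coord \<psi> i) * coord \<eta> i)"

lemma cinner_abs_summable: "(\<lambda>i. norm (cnj (coord \<psi> i) * coord \<eta> i)) summable_on UNIV"
proof (rule summable_on_comparison_test)
  show "(\<lambda>i. (cmod (coord \<psi> i))\<^sup>2 + (cmod (coord \<eta> i))\<^sup>2) summable_on UNIV"
    by (intro summable_on_add coord_summable)
  fix i
  have "2 * (cmod (coord \<psi> i) * cmod (coord \<eta> i)) \<le> (cmod (coord \<psi> i))\<^sup>2 + (cmod (coord \<eta> i))\<^sup>2"
    using sum_squares_bound[of "cmod (coord \<psi> i)" "cmod (coord \<eta> i)"] by (simp add: mult.assoc)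
  moreover have "0 \<le> cmod (coord \<psi> i) * cmod (coord \<eta> i)" by simp
  ultimately show "norm (cnj (coord \<psi> i) * coord \<eta> i) \<le> (cmod (coord \<psi> i))\<^sup>2 + (cmod (coord \<eta> i))\<^sup>2"
    by (simp add: norm_mult del: mult_nonneg_nonneg zero_le_mult_iff)
qed auto

lemma cinner_summable: "(\<lambda>i. cnj (coord \<psi> i) * coord \<eta> i) summable_on UNIV"
  by (rule abs_summable_summable[OF cinner_abs_summable])

instantiation ell2 :: (type) real_vector
begin

lift_definition zero_ell2 :: "'a ell2" is "\<lambda>_. 0" by simp
lift_definition plus_ell2 :: "'a ell2 \<Rightarrow> 'a ell2 \<Rightarrow> 'a ell2" is "\<lambda>f g i. f i + g i"
  by (rule square_summable_add)
lift_definition uminus_ell2 :: "'a ell2 \<Rightarrow> 'a ell2" is "\<lambda>f i. - f i" by simp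
lift_definition minus_ell2 :: "'a ell2 \<Rightarrow> 'a ell2 \<Rightarrow> 'a ell2" is "\<lambda>f g i. f i - g i"
  subgoal for f g using square_summable_add[of f "\<lambda>i. - g i"] by simp
  done
lift_definition scaleR_ell2 :: "real \<Rightarrow> 'a ell2 \<Rightarrow> 'a ell2" is "\<lambda>r f i. complex_of_real r * f i"
  by (rule square_summable_cmult)

instance
  by standard (transfer; simp add: fun_eq_iff algebra_simps)+

end

instantiation ell2 :: (type) real_inner
begin

definition inner_ell2 :: "'a ell2 \<Rightarrow> 'a ell2 \<Rightarrow> real" where
  "inner_ell2 \<psi> \<eta> = Re (cinner \<psi> \<eta>)"
definition norm_ell2 :: "'a ell2 \<Rightarrow> real" where
  "norm_ell2 \<psi> = sqrt (inner \<psi> \<psi>)"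
definition dist_ell2 :: "'a ell2 \<Rightarrow> 'a ell2 \<Rightarrow> real" where
  "dist_ell2 \<psi> \<eta> = norm (\<psi> - \<eta>)"
definition sgn_ell2 :: "'a ell2 \<Rightarrow> 'a ell2" where
  "sgn_ell2 \<psi> = inverse (norm \<psi>) *\<^sub>R \<psi>"
definition uniformity_ell2 :: "('a ell2 \<times> 'a ell2) filter" where
  "uniformity_ell2 = (INF e\<in>{0 <..}. principal {(\<psi>, \<eta>). dist \<psi> \<eta> < e})"
definition open_ell2 :: "'a ell2 set \<Rightarrow> bool" where
  "open_ell2 U \<longleftrightarrow> (\<forall>x\<in>U. \<forall>\<^sub>F (x', y) in uniformity. x' = x \<longrightarrow> y \<in> U)"

lemma inner_ell2_eq: "inner \<psi> \<psi> = (\<Sum>\<^sub>\<infinity>i. (cmod (coord \<psi> i))\<^sup>2)" for \<psi> :: "'a ell2"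
  unfolding inner_ell2_def cinner_def infsum_Re[symmetric, OF cinner_summable]
  by (intro infsum_cong) (simp only: cmod_power2, simp add: power2_eq_square)

instance
proof
  fix x y z :: "'a ell2" and r :: real
  have s: "(\<lambda>i. Re (cnj (coord u i) * coord v i)) summable_on UNIV" for u v :: "'a ell2"
    by (rule summable_on_Re[OF cinner_summable])
  have i: "inner u v = (\<Sum>\<^sub>\<infinity>i. Re (cnj (coord u i) * coord v i))" for u v :: "'a ell2"
    unfolding inner_ell2_def cinner_def by (rule infsum_Re[symmetric, OF cinner_summable])
  show "inner x y = inner y x"
    unfolding i by (intro infsum_cong) simp
  show "inner (x + y) z = inner x z + inner y z"
    unfolding i infsum_add[OF s s, symmetric]
    by (intro infsum_cong) (simp add: plus_ell2.rep_eq algebra_simps)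
  show "inner (r *\<^sub>R x) y = r * inner x y"
    unfolding i infsum_cmult_right'[symmetric]
    by (intro infsum_cong) (simp add: scaleR_ell2.rep_eq algebra_simps)
  show nn: "0 \<le> inner x x" unfolding inner_ell2_eq by (rule infsum_nonneg) simp
  show "inner x x = 0 \<longleftrightarrow> x = 0"
  proof
    assume "inner x x = 0"
    then have "(cmod (coord x i))\<^sup>2 = 0" for i
      using nonneg_infsum_le_0D[of "\<lambda>i. (cmod (coord x i))\<^sup>2" UNIV i] coord_summable[of x]
      unfolding inner_ell2_eq by auto
    then show "x = 0" by (auto simp: coord_inject[symmetric] zero_ell2.rep_eq)
  next
    assume "x = 0" then show "inner x x = 0" by (simp add: inner_ell2_eq zero_ell2.rep_eq)
  qed
qed (simp_all add: norm_ell2_def dist_ell2_def sgn_ell2_def uniformity_ell2_def open_ell2_def)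

end

lift_definition ket :: "'i \<Rightarrow> 'i ell2" is "\<lambda>j i. of_bool (i = j)"
  by (rule finite_nonzero_values_imp_summable_on) (auto intro: finite_subset[of _ "{j}" for j])

section \<open>Bounded operators, trace, trace norm\<close>

definition bounded_clinear :: "('i ell2 \<Rightarrow> 'j ell2) \<Rightarrow> bool" where
  "bounded_clinear A \<longleftrightarrow> bounded_linear A \<and> (\<forall>c \<psi>. A (c *\<^sub>C \<psi>) = c *\<^sub>C A \<psi>)"

definition positive_op :: "('i ell2 \<Rightarrow> 'i ell2) \<Rightarrow> bool" where
  "positive_op A \<longleftrightarrow> bounded_clinear A \<and> (\<forall>\<psi>. cinner \<psi> (A \<psi>) \<in> \<real>\<^sub>\<ge>\<^sub>0)"

definition adj :: "('i ell2 \<Rightarrow> 'i ell2) \<Rightarrow> 'i ell2 \<Rightarrow> 'i ell2" where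
  "adj A = (THE B. \<forall>\<psi> \<eta>. cinner (B \<psi>) \<eta> = cinner \<psi> (A \<eta>))"

definition sqrt_op :: "('i ell2 \<Rightarrow> 'i ell2) \<Rightarrow> 'i ell2 \<Rightarrow> 'i ell2" where
  "sqrt_op A = (THE S. positive_op S \<and> S \<circ> S = A)"

definition abs_op :: "('i ell2 \<Rightarrow> 'i ell2) \<Rightarrow> 'i ell2 \<Rightarrow> 'i ell2" where
  "abs_op A = sqrt_op (adj A \<circ> A)"

text \<open>Trace of a positive operator, with values in \<open>[0, \<infinity>]\<close>.\<close>

definition trace_pos :: "('i ell2 \<Rightarrow> 'i ell2) \<Rightarrow> ennreal" where
  "trace_pos A = (\<Sum>\<^sub>\<infinity>i. ennreal (Re (cinner (ket i) (A (ket i)))))"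

definition trace_norm :: "('i ell2 \<Rightarrow> 'i ell2) \<Rightarrow> ennreal" where
  "trace_norm A = trace_pos (abs_op A)"

definition trace_class :: "('i ell2 \<Rightarrow> 'i ell2) \<Rightarrow> bool" where
  "trace_class A \<longleftrightarrow> bounded_clinear A \<and> trace_norm A < \<infinity>"

text \<open>
  For positive bounded \<open>G\<close> and a positive, possibly unbounded \<open>B\<close> with quadratic form
  \<open>b \<psi> = \<langle>\<psi>, B \<psi>\<rangle> \<in> [0, \<infinity>]\<close>, the trace \<open>Tr (G B)\<close> is understood as
  \<open>Tr (S B S) = \<Sum>i. b (S e\<^sub>i) \<in> [0, \<infinity>]\<close> with \<open>S = sqrt_op G\<close>.
\<close>

definition trace_form :: "('i ell2 \<Rightarrow> 'i ell2) \<Rightarrow> ('i ell2 \<Rightarrow> ennreal) \<Rightarrow> ennreal" where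
  "trace_form G b = (\<Sum>\<^sub>\<infinity>i. b (sqrt_op G (ket i)))"

section \<open>Unbounded operators\<close>

text \<open>
  An unbounded operator is given by its formal action on all families of coordinates; as an
  operator on \<open>\<ell>\<^sup>2\<close> it is taken on its maximal domain.
\<close>

type_synonym 'i formal_op = "('i \<Rightarrow> complex) \<Rightarrow> ('i \<Rightarrow> complex)"

definition op_dom :: "'i formal_op \<Rightarrow> 'i ell2 set" where
  "op_dom B = {\<psi>. (\<lambda>i. (cmod (B (coord \<psi>) i))\<^sup>2) summable_on UNIV}"

definition op_app :: "'i formal_op \<Rightarrow> 'i ell2 \<Rightarrow> 'i ell2" where
  "op_app B \<psi> = Abs_ell2 (B (coord \<psi>))"

section \<open>One-site operators\<close>

definition ann :: "nat formal_op" where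
  "ann \<psi> = (\<lambda>n. complex_of_real (sqrt (real (n + 1))) * \<psi> (n + 1))"

definition cre :: "nat formal_op" where
  "cre \<psi> = (\<lambda>n. complex_of_real (sqrt (real n)) * \<psi> (n - 1))"

definition num :: "nat formal_op" where
  "num \<psi> = cre (ann \<psi>)"

definition num_pair :: "nat formal_op" where \<comment> \<open>\<open>N (N - 1)\<close>\<close>
  "num_pair \<psi> = num (\<lambda>n. num \<psi> n - \<psi> n)"

lemma ann_ket: "ann (coord (ket n)) = (\<lambda>m. complex_of_real (sqrt (real n)) * (if n = 0 then 0 else coord (ket (n - 1)) m))"
  by (auto simp: ann_def ket.rep_eq fun_eq_iff)

lemma cre_ket: "cre (coord (ket n)) = (\<lambda>m. complex_of_real (sqrt (real (n + 1))) * coord (ket (n + 1)) m)"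
  by (auto simp: cre_def ket.rep_eq fun_eq_iff)

lemma num_eq: "num \<psi> n = of_nat n * \<psi> n"
  by (cases n) (simp_all add: num_def cre_def ann_def flip: of_real_mult mult.assoc)

text \<open>The quadratic form \<open>\<langle>\<psi>, N\<^sup>k \<psi>\<rangle>\<close>, equal to \<open>\<infinity>\<close> outside the form domain.\<close>

definition num_form :: "nat \<Rightarrow> nat ell2 \<Rightarrow> ennreal" where
  "num_form k \<psi> = (\<Sum>\<^sub>\<infinity>n. ennreal (Re (cnj (coord \<psi> n) * (num ^^ k) (coord \<psi>) n)))"

section \<open>The mean-field equation\<close>

definition mf_alpha :: "nat ell2 \<Rightarrow> complex" where
  "mf_alpha \<phi> = cinner \<phi> (op_app ann \<phi>)"

definition mf_op :: "real \<Rightarrow> real \<Rightarrow> real \<Rightarrow> nat ell2 \<Rightarrow> nat formal_op" where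
  "mf_op J \<mu> U \<phi> \<psi> = (\<lambda>n.
     - complex_of_real J * (mf_alpha \<phi> * cre \<psi> n + cnj (mf_alpha \<phi>) * ann \<psi> n
                            - complex_of_real ((cmod (mf_alpha \<phi>))\<^sup>2) * \<psi> n)
     + complex_of_real (J - \<mu>) * num \<psi> n
     + complex_of_real (U / 2) * num_pair \<psi> n)"

text \<open>
  The first three conjuncts say \<open>\<phi> \<in> C(\<real>; D(N\<^sup>2))\<close>, where \<open>D(N\<^sup>2)\<close> carries the graph norm.
\<close>

definition mf_solution :: "real \<Rightarrow> real \<Rightarrow> real \<Rightarrow> (real \<Rightarrow> nat ell2) \<Rightarrow> bool" where
  "mf_solution J \<mu> U \<phi> \<longleftrightarrow>
     (\<forall>t. \<phi> t \<in> op_dom (num ^^ 2)) \<and>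
     continuous_on UNIV \<phi> \<and>
     continuous_on UNIV (\<lambda>t. op_app (num ^^ 2) (\<phi> t)) \<and>
     (\<exists>\<phi>'. continuous_on UNIV \<phi>' \<and>
        (\<forall>t. (\<phi> has_vector_derivative \<phi>' t) (at t)) \<and>
        (\<forall>t. \<i> *\<^sub>C \<phi>' t = op_app (mf_op J \<mu> U (\<phi> t)) (\<phi> t)))"

definition proj :: "'i ell2 \<Rightarrow> 'i ell2 \<Rightarrow> 'i ell2" where \<comment> \<open>\<open>|\<phi>\<rangle>\<langle>\<phi>|\<close>\<close>
  "proj \<phi> \<psi> = cinner \<phi> \<psi> *\<^sub>C \<phi>"

definition coproj :: "'i ell2 \<Rightarrow> 'i ell2 \<Rightarrow> 'i ell2" where
  "coproj \<phi> \<psi> = \<psi> - proj \<phi> \<psi>"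

text \<open>The quadratic form of \<open>q N\<^sup>2 q + q\<close> with \<open>q = coproj \<phi>\<close>.\<close>

definition qNNq_plus_q_form :: "nat ell2 \<Rightarrow> nat ell2 \<Rightarrow> ennreal" where
  "qNNq_plus_q_form \<phi> \<psi> = num_form 2 (coproj \<phi> \<psi>) + ennreal (Re (cinner \<psi> (coproj \<phi> \<psi>)))"

section \<open>The lattice and its Fock space\<close>

type_synonym site = "nat \<Rightarrow> nat"

definition lattice :: "nat \<Rightarrow> nat \<Rightarrow> site set" where
  "lattice d L = {..<d} \<rightarrow>\<^sub>E {..<L}"

definition neighbour :: "nat \<Rightarrow> nat \<Rightarrow> site \<Rightarrow> site \<Rightarrow> bool" where
  "neighbour d L x y \<longleftrightarrow>
     (\<exists>i<d. (y i = (x i + 1) mod L \<or> x i = (y i + 1) mod L) \<and> (\<forall>j<d. j \<noteq> i \<longrightarrow> x j = y j))"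

text \<open>
  The tensor product of copies of \<open>\<ell>\<^sup>2(\<nat>)\<close> over the sites of a finite set \<open>\<Lambda>\<close> is realised in its
  occupation number basis: it is the space of square-summable families indexed by the occupation
  numbers of the sites. Since \<open>\<Lambda>\<close> varies, it is embedded as the closed subspace \<open>fock \<Lambda>\<close> of a
  fixed \<open>\<ell>\<^sup>2\<close>, occupation numbers being extended by 0 outside \<open>\<Lambda>\<close>.
\<close>

type_synonym config = "site \<Rightarrow> nat"

definition configs :: "site set \<Rightarrow> config set" where
  "configs \<Lambda> = {c. \<forall>x. x \<notin> \<Lambda> \<longrightarrow> c x = 0}"

definition fock :: "site set \<Rightarrow> config ell2 set" where
  "fock \<Lambda> = {\<Psi>. \<forall>c. c \<notin> configs \<Lambda> \<longrightarrow> coord \<Psi> c = 0}"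

text \<open>Operators on \<open>fock \<Lambda>\<close> are extended by 0 to the orthogonal complement.\<close>

definition op_on_fock :: "site set \<Rightarrow> (config ell2 \<Rightarrow> config ell2) \<Rightarrow> bool" where
  "op_on_fock \<Lambda> A \<longleftrightarrow>
     (\<forall>\<Psi>. A \<Psi> \<in> fock \<Lambda>) \<and> (\<forall>\<Psi>. (\<forall>X\<in>fock \<Lambda>. cinner X \<Psi> = 0) \<longrightarrow> A \<Psi> = 0)"

definition at_site :: "site \<Rightarrow> nat formal_op \<Rightarrow> config formal_op" where
  "at_site x B \<Psi> = (\<lambda>c. B (\<lambda>m. \<Psi> (c(x := m))) (c x))"

text \<open>
  The sum over ordered pairs counts every unordered pair of neighbours twice (there are no
  loops for \<open>L \<ge> 2\<close>), whence the factor 1/2.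
\<close>

definition hamiltonian :: "real \<Rightarrow> real \<Rightarrow> real \<Rightarrow> nat \<Rightarrow> nat \<Rightarrow> config formal_op" where
  "hamiltonian J \<mu> U d L \<Psi> = (\<lambda>c.
     - complex_of_real (J / (2 * real d)) *
         ((1 / 2) * (\<Sum>(x, y) \<in> {(x, y) \<in> lattice d L \<times> lattice d L. neighbour d L x y}.
            at_site x cre (at_site y ann \<Psi>) c + at_site y cre (at_site x ann \<Psi>) c))
     + complex_of_real (J - \<mu>) * (\<Sum>x\<in>lattice d L. at_site x num \<Psi> c)
     + complex_of_real (U / 2) * (\<Sum>x\<in>lattice d L. at_site x num_pair \<Psi> c))"

text \<open>
  The Hamiltonian preserves the particle number and each coordinate of \<open>H \<Psi>\<close> is a finite
  combination of coordinates of \<open>\<Psi>\<close> in the same sector. Hence \<open>exp (- i t H)\<close>, the direct sum of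
  the exponentials on the finite-dimensional sectors of fixed particle number, is given
  coordinatewise by the exponential series on the sector of the given coordinate.
\<close>

definition sector :: "site set \<Rightarrow> nat \<Rightarrow> config formal_op" where
  "sector \<Lambda> N \<Psi> = (\<lambda>c. if (\<Sum>x\<in>\<Lambda>. c x) = N then \<Psi> c else 0)"

definition evolution :: "real \<Rightarrow> real \<Rightarrow> real \<Rightarrow> nat \<Rightarrow> nat \<Rightarrow> real \<Rightarrow> config formal_op" where
  "evolution J \<mu> U d L t \<Psi> = (\<lambda>c.
     \<Sum>k. (- \<i> * complex_of_real t) ^ k / fact k *
          (hamiltonian J \<mu> U d L ^^ k) (sector (lattice d L) (\<Sum>x\<in>lattice d L. c x) \<Psi>) c)"

definition von_neumann ::
  "real \<Rightarrow> real \<Rightarrow> real \<Rightarrow> nat \<Rightarrow> nat \<Rightarrow> (config ell2 \<Rightarrow> config ell2) \<Rightarrow> real \<Rightarrow> (config ell2 \<Rightarrow> config ell2)"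
  where "von_neumann J \<mu> U d L \<gamma> t =
     op_app (evolution J \<mu> U d L t) \<circ> \<gamma> \<circ> op_app (evolution J \<mu> U d L (- t))"

section \<open>Partial traces\<close>

text \<open>
  For an occupation \<open>c\<close> of the sites other than \<open>x\<close>, \<open>insert_site x c \<psi>\<close> is \<open>\<psi> \<otimes> |c\<rangle>\<close> with \<open>\<psi>\<close> at
  the site \<open>x\<close>, and \<open>extract_site x c\<close> is the adjoint map.
\<close>

lift_definition insert_site :: "site \<Rightarrow> config \<Rightarrow> nat ell2 \<Rightarrow> config ell2" is
  "\<lambda>x c f c'. if c' = c(x := c' x) then f (c' x) else 0"
proof -
  fix x :: site and c :: config and f :: "nat \<Rightarrow> complex"
  assume f: "(\<lambda>i. (cmod (f i))\<^sup>2) summable_on UNIV"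
  let ?g = "\<lambda>c'. (cmod (if c' = c(x := c' x) then f (c' x) else 0))\<^sup>2"
  have inj: "inj (\<lambda>m. c(x := m))" by (auto simp: inj_def fun_eq_iff split: if_splits)
  have "?g \<circ> (\<lambda>m. c(x := m)) = (\<lambda>m. (cmod (f m))\<^sup>2)" by auto
  then have "?g summable_on range (\<lambda>m. c(x := m))"
    using f summable_on_reindex[OF inj, of ?g] by simp
  then show "?g summable_on UNIV"
    by (rule summable_on_cong_neutral[THEN iffD1, rotated -1]) (auto split: if_splits)
qed

lift_definition extract_site :: "site \<Rightarrow> config \<Rightarrow> config ell2 \<Rightarrow> nat ell2" is
  "\<lambda>x c f m. f (c(x := m))"
proof -
  fix x :: site and c :: config and f :: "config \<Rightarrow> complex"
  assume f: "(\<lambda>i. (cmod (f i))\<^sup>2) summable_on UNIV"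
  have inj: "inj (\<lambda>m. c(x := m))" by (auto simp: inj_def fun_eq_iff split: if_splits)
  have "(\<lambda>i. (cmod (f i))\<^sup>2) summable_on range (\<lambda>m. c(x := m))"
    using f by (rule summable_on_subset) simp
  then show "(\<lambda>m. (cmod (f (c(x := m))))\<^sup>2) summable_on UNIV"
    using summable_on_reindex[OF inj, of "\<lambda>i. (cmod (f i))\<^sup>2"] by (simp add: o_def)
qed

definition partial_trace ::
  "site set \<Rightarrow> site \<Rightarrow> (config ell2 \<Rightarrow> config ell2) \<Rightarrow> nat ell2 \<Rightarrow> nat ell2" where
  "partial_trace \<Lambda> x A \<psi> =
     (\<Sum>\<^sub>\<infinity>c\<in>configs (\<Lambda> - {x}). extract_site x c (A (insert_site x c \<psi>)))"

definition reduced_density ::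
  "nat \<Rightarrow> nat \<Rightarrow> (config ell2 \<Rightarrow> config ell2) \<Rightarrow> nat ell2 \<Rightarrow> nat ell2" where
  "reduced_density d L \<gamma> \<psi> =
     (1 / real (card (lattice d L))) *\<^sub>R (\<Sum>x\<in>lattice d L. partial_trace (lattice d L) x \<gamma> \<psi>)"

end

theory Submission
  imports Defs "HOL-Computational_Algebra.Formal_Power_Series"
begin

text \<open>
  Let \<open>q\<^sub>x = 1 - |\<phi>\<rangle>\<langle>\<phi>|\<close> act at the site \<open>x\<close>. For a pure state \<open>\<Psi>\<close> the quantity
  \<open>w\<^sub>x\<^sup>2 = \<langle>\<Psi>, q\<^sub>x (1 + N\<^sub>x) q\<^sub>x \<Psi>\<rangle>\<close> satisfies
  \<open>d/dt \<Sum>\<^sub>x w\<^sub>x\<^sup>2 \<le> C |J| \<nu>\<^sup>3 (\<Sum>\<^sub>x w\<^sub>x\<^sup>2 + |\<Lambda>| \<parallel>\<Psi>\<parallel>\<^sup>2 / d)\<close> with \<open>\<nu> = \<parallel>(1 + N) \<phi>\<parallel>\<close>. Indeed, subtracting the mean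
  field from the hopping leaves \<open>(a\<^sub>x\<^sup>* - \<alpha>\<^sup>*) (a\<^sub>y - \<alpha>)\<close> on each bond; its commutator with
  \<open>q\<^sub>x (1 + N\<^sub>x) q\<^sub>x\<close> still carries one factor \<open>q\<^sub>x\<close>, and \<open>a\<^sub>y - \<alpha>\<close> either meets \<open>q\<^sub>y\<close> or produces an
  excitation of \<open>\<phi>\<close> at \<open>y\<close>. Excitations at the \<open>2d\<close> different neighbours \<open>y\<close> are orthogonal up to
  further factors \<open>q\<^sub>y\<close>, so that their sum has norm of order \<open>\<surd>d\<close> rather than \<open>d\<close>: this is the gain
  \<open>1/d\<close>. Along the mean-field flow \<open>\<nu>\<close> grows at most linearly in time, and Gronwall's inequality
  gives the factor \<open>exp (C (1 + t)\<^sup>4)\<close>.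

  A mixed state is written as \<open>\<Sum>\<^sub>i |\<psi>\<^sub>i\<rangle>\<langle>\<psi>\<^sub>i|\<close> with \<open>\<psi>\<^sub>i = \<surd>\<gamma> e\<^sub>i\<close>. Since the evolution preserves the particle
  number, the differential inequality is only needed for vectors with at most \<open>M\<close> particles, the
  rest being arbitrarily small. Finally \<open>Tr (q G q)\<close>, where \<open>G\<close> is the reduced density matrix, is at
  most the average of the \<open>w\<^sub>x\<^sup>2\<close>, and \<open>\<parallel>G - |\<phi>\<rangle>\<langle>\<phi>|\<parallel>\<^sub>1 \<le> 4 \<surd>(Tr (q G q))\<close>.
\<close>

text \<open>Products of \<open>a\<close>, its adjoint and \<open>N\<close> have awkward domains, so
  the differential inequality is proved on finitely supported families, where every operator has a
  total adjoint. There it is a statement about an arbitrary unit vector \<phi> and an arbitrary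
  vector \<Psi> at one instant; neither has to solve an equation of motion. This makes it stable
  under approximation: \<phi>(t) is cut off and renormalised at a fixed time, and the cut-off is
  removed in the inequality itself, so no truncated mean-field dynamics occurs. On the many-body
  side the cut at \<open>M\<close> particles is exact, since it commutes with the Hamiltonian. The
  weight \<open>1 + N\<close> is one that closes: its commutator with \<open>a\<close> returns
  \<open>a\<close>, and a single norm controls the identity, \<open>a\<close> and its adjoint on the
  range of \<open>q\<close>. The expectation of \<open>1 + N\<close> in \<phi> is conserved because
  \<alpha> is self-consistent. This freezes one coefficient of the functional and bounds \<alpha>
  for all times, after which the second moment has a square root with bounded derivative. At time 0
  the weight is compared with the given one through \<open>n + 1 \<le> 2 (n^2 + 1)\<close>.\<close>

lemma infsum_ennreal_eq_SUP:
  fixes f :: "'a \<Rightarrow> ennreal"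
  shows "infsum f A = (SUP F\<in>{F. finite F \<and> F \<subseteq> A}. sum f F)"
  by (rule nonneg_infsum_complete) simp

lemma sum_le_infsum_ennreal:
  fixes f :: "'a \<Rightarrow> ennreal"
  assumes "finite F" "F \<subseteq> A"
  shows "sum f F \<le> infsum f A"
  unfolding infsum_ennreal_eq_SUP using assms by (intro SUP_upper) auto

lemma infsum_le_ennreal:
  fixes f :: "'a \<Rightarrow> ennreal"
  assumes "\<And>F. finite F \<Longrightarrow> F \<subseteq> A \<Longrightarrow> sum f F \<le> b"
  shows "infsum f A \<le> b"
  unfolding infsum_ennreal_eq_SUP using assms by (intro SUP_least) auto

lemma summable_on_ennreal_UNIV: "(f :: 'a \<Rightarrow> ennreal) summable_on A"
  by (rule nonneg_summable_on_complete) simp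

lemma infsum_mono_ennreal:
  fixes f g :: "'a \<Rightarrow> ennreal"
  assumes "\<And>x. x \<in> A \<Longrightarrow> f x \<le> g x"
  shows "infsum f A \<le> infsum g A"
  by (intro infsum_mono assms summable_on_ennreal_UNIV)

lemma infsum_cmult_ennreal:
  fixes f :: "'a \<Rightarrow> ennreal"
  shows "infsum (\<lambda>x. c * f x) A = c * infsum f A"
  unfolding infsum_ennreal_eq_SUP
  by (subst SUP_mult_left_ennreal) (auto simp: sum_distrib_left)

lemma infsum_add_ennreal:
  fixes f :: "'a \<Rightarrow> ennreal"
  shows "infsum (\<lambda>x. f x + g x) A = infsum f A + infsum g A"
  by (intro infsum_add summable_on_ennreal_UNIV)

lemma infsum_sum_ennreal:
  fixes f :: "'b \<Rightarrow> 'a \<Rightarrow> ennreal"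
  shows "infsum (\<lambda>x. \<Sum>y\<in>B. f y x) A = (\<Sum>y\<in>B. infsum (f y) A)"
  by (induction B rule: infinite_finite_induct) (auto simp: infsum_add_ennreal)

text \<open>Tonelli over arbitrary index sets: an \<open>ennreal\<close> sum is the supremum of its
  finite partial sums, so both inequalities reduce to finite rectangles. The later interchanges of
  basis sums, slices and sums over pure states rest on it.\<close>

lemma infsum_Times_ennreal:
  fixes f :: "'a \<Rightarrow> 'b \<Rightarrow> ennreal"
  shows "infsum (\<lambda>x. infsum (f x) B) A = infsum (\<lambda>(x, y). f x y) (A \<times> B)"
proof (rule antisym)
  show "infsum (\<lambda>x. infsum (f x) B) A \<le> infsum (\<lambda>(x, y). f x y) (A \<times> B)"
  proof (rule infsum_le_ennreal)
    fix F assume F: "finite F" "F \<subseteq> A"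
    have "(\<Sum>x\<in>F. infsum (f x) B) = infsum (\<lambda>y. \<Sum>x\<in>F. f x y) B"
      by (rule infsum_sum_ennreal[symmetric])
    also have "\<dots> \<le> infsum (\<lambda>(x, y). f x y) (A \<times> B)"
    proof (rule infsum_le_ennreal)
      fix G assume G: "finite G" "G \<subseteq> B"
      have "(\<Sum>y\<in>G. \<Sum>x\<in>F. f x y) = (\<Sum>(x, y)\<in>F \<times> G. f x y)"
        by (subst sum.swap) (simp add: sum.cartesian_product)
      also have "\<dots> \<le> infsum (\<lambda>(x, y). f x y) (A \<times> B)"
        using F G by (intro sum_le_infsum_ennreal) auto
      finally show "(\<Sum>y\<in>G. \<Sum>x\<in>F. f x y) \<le> infsum (\<lambda>(x, y). f x y) (A \<times> B)" .
    qed
    finally show "(\<Sum>x\<in>F. infsum (f x) B) \<le> infsum (\<lambda>(x, y). f x y) (A \<times> B)" .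
  qed
  show "infsum (\<lambda>(x, y). f x y) (A \<times> B) \<le> infsum (\<lambda>x. infsum (f x) B) A"
  proof (rule infsum_le_ennreal)
    fix F assume F: "finite F" "F \<subseteq> A \<times> B"
    have "(\<Sum>(x, y)\<in>F. f x y) \<le> (\<Sum>(x, y)\<in>fst ` F \<times> snd ` F. f x y)"
      using F by (intro sum_mono2) (auto simp: rev_image_eqI)
    also have "\<dots> = (\<Sum>x\<in>fst ` F. \<Sum>y\<in>snd ` F. f x y)"
      by (simp add: sum.cartesian_product)
    also have "\<dots> \<le> (\<Sum>x\<in>fst ` F. infsum (f x) B)"
      using F by (intro sum_mono sum_le_infsum_ennreal) auto
    also have "\<dots> \<le> infsum (\<lambda>x. infsum (f x) B) A"
      using F by (intro sum_le_infsum_ennreal) auto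
    finally show "(\<Sum>(x, y)\<in>F. f x y) \<le> infsum (\<lambda>x. infsum (f x) B) A" .
  qed
qed

lemma infsum_swap_ennreal:
  fixes f :: "'a \<Rightarrow> 'b \<Rightarrow> ennreal"
  shows "infsum (\<lambda>x. infsum (f x) B) A = infsum (\<lambda>y. infsum (\<lambda>x. f x y) A) B"
proof -
  have "infsum (\<lambda>(x, y). f x y) (A \<times> B) = infsum (\<lambda>(y, x). f x y) (B \<times> A)"
    by (rule infsum_reindex_bij_witness[of _ prod.swap prod.swap]) auto
  then show ?thesis by (simp add: infsum_Times_ennreal)
qed

lemma ennreal_infsum:
  assumes "f summable_on A" "\<And>x. x \<in> A \<Longrightarrow> f x \<ge> 0"
  shows "ennreal (infsum f A) = infsum (\<lambda>x. ennreal (f x)) A"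
proof -
  have "(\<Sum>x\<in>F. ennreal (f x)) = ennreal (sum f F)" if "F \<in> {F. finite F \<and> F \<subseteq> A}" for F
    using assms(2) that by (intro sum_ennreal) auto
  then show ?thesis
    by (simp only: infsum_nonneg_is_SUPREMUM_ennreal[OF assms] infsum_ennreal_eq_SUP[of "\<lambda>x. ennreal (f x)" A]
        cong: SUP_cong)
qed

text \<open>The bridge between two kinds of sums: estimates run in \<open>ennreal\<close>, where
  every family is summable, and finiteness of the result returns summability of the real
  family.\<close>

lemma summable_on_iff_ennreal:
  assumes "\<And>x. x \<in> A \<Longrightarrow> f x \<ge> (0::real)"
  shows "f summable_on A \<longleftrightarrow> infsum (\<lambda>x. ennreal (f x)) A < \<infinity>"
proof
  assume "f summable_on A"
  then show "infsum (\<lambda>x. ennreal (f x)) A < \<infinity>"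
    using ennreal_infsum[of f A] assms ennreal_less_top[of "infsum f A"] by simp
next
  assume fin: "infsum (\<lambda>x. ennreal (f x)) A < \<infinity>"
  show "f summable_on A"
  proof (rule nonneg_bdd_above_summable_on[OF assms])
    show "bdd_above (sum f ` {F. F \<subseteq> A \<and> finite F})"
    proof (rule bdd_aboveI2)
      fix F assume F: "F \<in> {F. F \<subseteq> A \<and> finite F}"
      have "ennreal (sum f F) \<le> infsum (\<lambda>x. ennreal (f x)) A"
        using F assms by (subst sum_ennreal[symmetric]) (auto intro!: sum_le_infsum_ennreal)
      then show "sum f F \<le> enn2real (infsum (\<lambda>x. ennreal (f x)) A)"
        using fin enn2real_mono[of "ennreal (sum f F)" "infsum (\<lambda>x. ennreal (f x)) A"] F assms
          enn2real_ennreal[of "sum f F"] sum_nonneg[of F f] by (auto simp: subset_iff)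
    qed
  qed
qed

lemma infsum_ennreal_le_real:
  assumes "\<And>F. finite F \<Longrightarrow> F \<subseteq> A \<Longrightarrow> sum f F \<le> b" "\<And>x. x \<in> A \<Longrightarrow> f x \<ge> (0::real)"
  shows "f summable_on A" "infsum f A \<le> b"
proof -
  show s: "f summable_on A"
    using assms by (intro nonneg_bdd_above_summable_on bdd_aboveI2[of _ _ b]) auto
  show "infsum f A \<le> b" by (rule infsum_le_finite_sums[OF s assms(1)])
qed

section \<open>Hilbert space geometry of \<open>ell2\<close>\<close>

lemmas coord_simps = plus_ell2.rep_eq minus_ell2.rep_eq uminus_ell2.rep_eq zero_ell2.rep_eq
  scaleR_ell2.rep_eq cscale.rep_eq ket.rep_eq

lemma ell2_eqI: "(\<And>i. coord \<psi> i = coord \<eta> i) \<Longrightarrow> \<psi> = \<eta>"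
  by (simp add: coord_inject[symmetric] fun_eq_iff)

lemma coord_add: "coord (\<psi> + \<eta>) i = coord \<psi> i + coord \<eta> i" by (simp add: coord_simps)
lemma coord_diff: "coord (\<psi> - \<eta>) i = coord \<psi> i - coord \<eta> i" by (simp add: coord_simps)
lemma scaleR_cscale: "r *\<^sub>R \<psi> = complex_of_real r *\<^sub>C \<psi>"
  by (rule ell2_eqI) (simp add: coord_simps)

lemma cinner_add_right: "cinner \<psi> (\<eta> + \<xi>) = cinner \<psi> \<eta> + cinner \<psi> \<xi>"
  unfolding cinner_def
  by (subst infsum_add[OF cinner_summable cinner_summable, symmetric])
     (auto simp: coord_simps algebra_simps)

lemma cinner_scale_right: "cinner \<psi> (c *\<^sub>C \<eta>) = c * cinner \<psi> \<eta>"
  unfolding cinner_def by (subst infsum_cmult_right'[symmetric]) (auto simp: coord_simps algebra_simps)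

lemma cinner_cnj: "cinner \<eta> \<psi> = cnj (cinner \<psi> \<eta>)"
  unfolding cinner_def by (subst infsum_cnj[symmetric]) (auto intro!: infsum_cong simp: mult.commute)

lemma cinner_add_left: "cinner (\<eta> + \<xi>) \<psi> = cinner \<eta> \<psi> + cinner \<xi> \<psi>"
  by (subst (1 2 3) cinner_cnj) (simp add: cinner_add_right)

lemma cinner_scale_left: "cinner (c *\<^sub>C \<eta>) \<psi> = cnj c * cinner \<eta> \<psi>"
  by (subst (1 2) cinner_cnj) (simp add: cinner_scale_right)

lemma cscale_minus_one: "(-1) *\<^sub>C \<psi> = - \<psi>"
  by (rule ell2_eqI) (simp add: coord_simps)

lemma cinner_minus_right: "cinner \<psi> (- \<eta>) = - cinner \<psi> \<eta>"
  by (simp add: cscale_minus_one[symmetric] cinner_scale_right del: cscale_minus_one)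

lemma cinner_diff_right: "cinner \<psi> (\<eta> - \<xi>) = cinner \<psi> \<eta> - cinner \<psi> \<xi>"
  using cinner_add_right[of \<psi> \<eta> "- \<xi>"] by (simp add: cinner_minus_right)

lemma cinner_diff_left: "cinner (\<eta> - \<xi>) \<psi> = cinner \<eta> \<psi> - cinner \<xi> \<psi>"
  by (subst (1 2 3) cinner_cnj) (simp add: cinner_diff_right)

lemma cinner_zero [simp]: "cinner \<psi> 0 = 0" "cinner 0 \<psi> = 0"
  by (simp_all add: cinner_def coord_simps)

lemma cinner_scaleR_right: "cinner \<psi> (r *\<^sub>R \<eta>) = complex_of_real r * cinner \<psi> \<eta>"
  by (simp add: scaleR_cscale cinner_scale_right)

lemma cinner_scaleR_left: "cinner (r *\<^sub>R \<eta>) \<psi> = complex_of_real r * cinner \<eta> \<psi>"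
  by (simp add: scaleR_cscale cinner_scale_left)

lemma cinner_self: "cinner \<psi> \<psi> = complex_of_real ((norm \<psi>)\<^sup>2)"
proof -
  have "Im (cinner \<psi> \<psi>) = 0"
    using arg_cong[OF cinner_cnj[of \<psi> \<psi>], of Im] by simp
  moreover have "Re (cinner \<psi> \<psi>) = (norm \<psi>)\<^sup>2"
    by (simp add: power2_norm_eq_inner inner_ell2_def)
  ultimately show ?thesis by (simp add: complex_eq_iff)
qed

lemma norm_cscale: "norm (c *\<^sub>C \<psi>) = cmod c * norm (\<psi> :: 'i ell2)"
proof -
  have "complex_of_real ((norm (c *\<^sub>C \<psi>))\<^sup>2) = (c * cnj c) * cinner \<psi> \<psi>"
    unfolding cinner_self[symmetric] by (simp only: cinner_scale_right cinner_scale_left mult_ac)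
  also have "\<dots> = complex_of_real ((cmod c * norm \<psi>)\<^sup>2)"
    by (simp only: cinner_self complex_norm_square[symmetric] of_real_mult[symmetric] power_mult_distrib)
  finally have "complex_of_real ((norm (c *\<^sub>C \<psi>))\<^sup>2) = complex_of_real ((cmod c * norm \<psi>)\<^sup>2)" .
  then have "(norm (c *\<^sub>C \<psi>))\<^sup>2 = (cmod c * norm \<psi>)\<^sup>2" using of_real_eq_iff by blast
  then show ?thesis by (rule power2_eq_imp_eq) auto
qed

lemma cmod_cinner_le: "cmod (cinner \<psi> \<eta>) \<le> norm \<psi> * norm (\<eta> :: 'i ell2)"
proof (cases "cinner \<psi> \<eta> = 0")
  case False
  \<comment> \<open>The phase that makes the inner product real and nonnegative, so that the real
    Cauchy-Schwarz inequality of \<open>real_inner\<close> applies.\<close>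
  define c where "c = cnj (cinner \<psi> \<eta>) / cmod (cinner \<psi> \<eta>)"
  have "cmod c = 1" using False by (simp add: c_def norm_divide)
  have "cinner \<psi> (c *\<^sub>C \<eta>) = (cinner \<psi> \<eta> * cnj (cinner \<psi> \<eta>)) / cmod (cinner \<psi> \<eta>)"
    by (simp add: cinner_scale_right c_def)
  also have "\<dots> = cmod (cinner \<psi> \<eta>)"
    using False by (simp add: complex_norm_square[symmetric] power2_eq_square)
  finally have "cinner \<psi> (c *\<^sub>C \<eta>) = cmod (cinner \<psi> \<eta>)" .
  then have "cmod (cinner \<psi> \<eta>) = inner \<psi> (c *\<^sub>C \<eta>)" by (simp add: inner_ell2_def)
  also have "\<dots> \<le> norm \<psi> * norm (c *\<^sub>C \<eta>)" by (rule norm_cauchy_schwarz)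
  finally show ?thesis using \<open>cmod c = 1\<close> by (simp add: norm_cscale)
qed auto

lemma coord_ket: "coord (ket i) j = of_bool (j = i)" by (simp add: ket.rep_eq)

lemma cinner_ket_left: "cinner (ket i) \<psi> = coord \<psi> i"
proof -
  have "cinner (ket i) \<psi> = (\<Sum>\<^sub>\<infinity>j\<in>{i}. cnj (coord (ket i) j) * coord \<psi> j)"
    unfolding cinner_def by (rule infsum_cong_neutral) (auto simp: coord_ket)
  then show ?thesis by (simp add: coord_ket)
qed

lemma cinner_ket_right: "cinner \<psi> (ket i) = cnj (coord \<psi> i)"
  by (subst cinner_cnj) (simp add: cinner_ket_left)

lemma norm_ket [simp]: "norm (ket i) = 1"
proof -
  have "complex_of_real ((norm (ket i))\<^sup>2) = complex_of_real 1"
    unfolding cinner_self[symmetric] by (simp add: cinner_ket_left coord_ket)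
  then have "(norm (ket i))\<^sup>2 = 1\<^sup>2" by (simp only: of_real_eq_iff) simp
  then show ?thesis by (rule power2_eq_imp_eq) auto
qed

lemma coord_le_norm: "cmod (coord \<psi> i) \<le> norm \<psi>"
  using cmod_cinner_le[of "ket i" \<psi>] by (simp add: cinner_ket_left)

lemma norm_eq_infsum: "(norm \<psi>)\<^sup>2 = (\<Sum>\<^sub>\<infinity>i. (cmod (coord \<psi> i))\<^sup>2)"
  by (simp add: power2_norm_eq_inner inner_ell2_eq)

lemma ennreal_norm_eq: "ennreal ((norm \<psi>)\<^sup>2) = (\<Sum>\<^sub>\<infinity>i. ennreal ((cmod (coord \<psi> i))\<^sup>2))"
  unfolding norm_eq_infsum by (rule ennreal_infsum[OF coord_summable]) auto

lemma sum_coord_le: "finite F \<Longrightarrow> (\<Sum>i\<in>F. (cmod (coord \<psi> i))\<^sup>2) \<le> (norm \<psi>)\<^sup>2"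
  unfolding norm_eq_infsum by (rule finite_sum_le_infsum[OF coord_summable]) auto

lemma coord_Abs: "(\<lambda>i. (cmod (f i))\<^sup>2) summable_on UNIV \<Longrightarrow> coord (Abs_ell2 f) = f"
  by (rule Abs_ell2_inverse) simp

lemma ell2_from_bound:
  assumes "\<And>F. finite F \<Longrightarrow> (\<Sum>i\<in>F. (cmod (f i))\<^sup>2) \<le> b\<^sup>2" "b \<ge> 0"
  shows "coord (Abs_ell2 f) = f" "norm (Abs_ell2 f) \<le> b"
proof -
  have s: "(\<lambda>i. (cmod (f i))\<^sup>2) summable_on UNIV" "(\<Sum>\<^sub>\<infinity>i. (cmod (f i))\<^sup>2) \<le> b\<^sup>2"
    using assms by (auto intro!: infsum_ennreal_le_real)
  show 1: "coord (Abs_ell2 f) = f" by (rule coord_Abs[OF s(1)])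
  then have "(norm (Abs_ell2 f))\<^sup>2 \<le> b\<^sup>2" using s(2) by (simp add: norm_eq_infsum)
  then show "norm (Abs_ell2 f) \<le> b" using assms(2) by (rule power2_le_imp_le)
qed

lemma cinner_eqI: "(\<And>\<eta>. cinner \<eta> \<psi> = cinner \<eta> \<xi>) \<Longrightarrow> \<psi> = \<xi>"
proof (rule ell2_eqI)
  fix i assume "\<And>\<eta>. cinner \<eta> \<psi> = cinner \<eta> \<xi>"
  from this[of "ket i"] show "coord \<psi> i = coord \<xi> i" by (simp only: cinner_ket_left)
qed

lemma bounded_linear_cinner: "bounded_linear (cinner \<psi>)"
  by (rule bounded_linear_intro[where K="norm \<psi>"])
     (auto simp: cinner_add_right cinner_scaleR_right scaleR_conv_of_real mult.commute
        intro: order_trans[OF cmod_cinner_le])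

lemma bounded_linear_coord: "bounded_linear (\<lambda>\<psi>. coord \<psi> i)"
  using bounded_linear_cinner[of "ket i"] unfolding cinner_ket_left .

text \<open>The coordinatewise limit \<open>f\<close> of a Cauchy sequence is not known in advance
  to be square-summable. The differences \<open>X k - f\<close> are, by bounds on finite partial
  sums, and the limit is recovered as \<open>X m - D m\<close>.\<close>

instance ell2 :: (type) complete_space
proof
  fix X :: "nat \<Rightarrow> 'a ell2" assume X: "Cauchy X"
  have "\<exists>f. \<forall>i. (\<lambda>n. coord (X n) i) \<longlonglongrightarrow> f i"
  proof (rule choice, rule allI)
    fix i
    have "Cauchy (\<lambda>n. coord (X n) i)" using bounded_linear.Cauchy[OF bounded_linear_coord X] .
    then show "\<exists>l. (\<lambda>n. coord (X n) i) \<longlonglongrightarrow> l" by (simp add: Cauchy_convergent_iff convergent_def)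
  qed
  then obtain f where f: "\<And>i. (\<lambda>n. coord (X n) i) \<longlonglongrightarrow> f i" by blast
  have fin: "(\<Sum>i\<in>F. (cmod (coord (X m) i - f i))\<^sup>2) \<le> e\<^sup>2"
    if "finite F" "\<forall>n\<ge>m. norm (X m - X n) \<le> e" for F m e
  proof (rule LIMSEQ_le_const2)
    show "(\<lambda>n. \<Sum>i\<in>F. (cmod (coord (X m) i - coord (X n) i))\<^sup>2) \<longlonglongrightarrow> (\<Sum>i\<in>F. (cmod (coord (X m) i - f i))\<^sup>2)"
      by (intro tendsto_intros f)
    have "(\<Sum>i\<in>F. (cmod (coord (X m) i - coord (X n) i))\<^sup>2) \<le> e\<^sup>2" if "n \<ge> m" for n
    proof -
      have "(\<Sum>i\<in>F. (cmod (coord (X m) i - coord (X n) i))\<^sup>2) \<le> (norm (X m - X n))\<^sup>2"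
        using sum_coord_le[OF \<open>finite F\<close>, of "X m - X n"] by (simp add: coord_diff)
      also have "\<dots> \<le> e\<^sup>2" using that \<open>\<forall>n\<ge>m. _\<close> by (intro power_mono) auto
      finally show ?thesis .
    qed
    then show "\<exists>N. \<forall>n\<ge>N. (\<Sum>i\<in>F. (cmod (coord (X m) i - coord (X n) i))\<^sup>2) \<le> e\<^sup>2" by blast
  qed
  have cau: "\<exists>m. \<forall>k\<ge>m. \<forall>n\<ge>k. norm (X k - X n) \<le> e" if "e > 0" for e
    using X that unfolding Cauchy_def dist_norm by (meson le_trans less_imp_le)
  obtain m where m: "\<forall>n\<ge>m. norm (X m - X n) \<le> 1" using cau[of 1] by auto
  define D where "D k = Abs_ell2 (\<lambda>i. coord (X k) i - f i)" for k
  have D: "coord (D k) = (\<lambda>i. coord (X k) i - f i)" "norm (D k) \<le> e" if "\<forall>n\<ge>k. norm (X k - X n) \<le> e" "e > 0" for k e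
    unfolding D_def using ell2_from_bound[of "\<lambda>i. coord (X k) i - f i" e] fin that by auto
  define Y where "Y = X m - D m"
  have Y: "coord Y i = f i" for i using D(1)[OF m] by (simp add: Y_def coord_diff)
  have "X \<longlonglongrightarrow> Y"
    unfolding LIMSEQ_def dist_norm
  proof (intro allI impI)
    fix e :: real assume "e > 0"
    then obtain k where k: "\<forall>k'\<ge>k. \<forall>n\<ge>k'. norm (X k' - X n) \<le> e / 2" using cau[of "e/2"] by auto
    have "norm (X n - Y) < e" if "n \<ge> k" for n
    proof -
      have h: "\<forall>n'\<ge>n. norm (X n - X n') \<le> e/2" using k that by auto
      have "X n - Y = D n" using D(1)[OF h] \<open>e > 0\<close> by (intro ell2_eqI) (simp add: coord_diff Y)
      then show ?thesis using D(2)[OF h] \<open>e > 0\<close> by simp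
    qed
    then show "\<exists>no. \<forall>n\<ge>no. norm (X n - Y) < e" by blast
  qed
  then show "convergent X" by (auto simp: convergent_def)
qed

instance ell2 :: (type) banach ..

section \<open>Bounded and positive operators\<close>

lemma bounded_clinear_linear: "bounded_clinear A \<Longrightarrow> bounded_linear A"
  by (simp add: bounded_clinear_def)

lemma bounded_clinear_add: "bounded_clinear A \<Longrightarrow> A (\<psi> + \<eta>) = A \<psi> + A \<eta>"
  using linear_add[OF bounded_linear.linear] by (auto simp: bounded_clinear_def)

lemma bounded_clinear_diff: "bounded_clinear A \<Longrightarrow> A (\<psi> - \<eta>) = A \<psi> - A \<eta>"
  using linear_diff[OF bounded_linear.linear] by (auto simp: bounded_clinear_def)

lemma bounded_clinear_scale: "bounded_clinear A \<Longrightarrow> A (c *\<^sub>C \<psi>) = c *\<^sub>C A \<psi>"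
  by (simp add: bounded_clinear_def)

lemma bounded_clinear_compose: "bounded_clinear A \<Longrightarrow> bounded_clinear B \<Longrightarrow> bounded_clinear (\<lambda>\<psi>. A (B \<psi>))"
  by (auto simp: bounded_clinear_def intro: bounded_linear_compose)

lemma bounded_clinearI:
  assumes "\<And>\<psi> \<eta>. A (\<psi> + \<eta>) = A \<psi> + A \<eta>" "\<And>c \<psi>. A (c *\<^sub>C \<psi>) = c *\<^sub>C A \<psi>" "\<And>\<psi>. norm (A \<psi>) \<le> K * norm \<psi>"
  shows "bounded_clinear A"
  unfolding bounded_clinear_def
  using assms by (auto intro!: bounded_linear_intro[where K=K] simp: scaleR_cscale mult.commute)

definition symmetric_op :: "('i ell2 \<Rightarrow> 'i ell2) \<Rightarrow> bool" where
  "symmetric_op A \<longleftrightarrow> (\<forall>\<psi> \<eta>. cinner \<psi> (A \<eta>) = cinner (A \<psi>) \<eta>)"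

lemma symmetric_opD: "symmetric_op A \<Longrightarrow> cinner \<psi> (A \<eta>) = cinner (A \<psi>) \<eta>"
  by (simp add: symmetric_op_def)

lemma positive_op_clinear: "positive_op A \<Longrightarrow> bounded_clinear A"
  by (simp add: positive_op_def)

lemma positive_op_form:
  assumes "positive_op A"
  shows "Re (cinner \<psi> (A \<psi>)) \<ge> 0" "Im (cinner \<psi> (A \<psi>)) = 0"
  using assms by (auto simp: positive_op_def complex_nonneg_Reals_iff)

text \<open>Polarisation: reality of the form at \<open>\<psi> + \<eta>\<close> compares the
  imaginary parts of the two off-diagonal entries, reality at \<open>\<psi> + \<i> \<eta>\<close>
  their real parts.\<close>

lemma symmetric_op_if_real_form:
  assumes A: "bounded_clinear A" and r: "\<And>\<psi>. Im (cinner \<psi> (A \<psi>)) = 0"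
  shows "symmetric_op A"
  unfolding symmetric_op_def
proof (intro allI)
  fix \<psi> \<eta>
  note l = bounded_clinear_add[OF A] bounded_clinear_scale[OF A] cinner_add_left cinner_add_right
    cinner_scale_left cinner_scale_right
  have 1: "Im (cinner \<psi> (A \<eta>)) + Im (cinner \<eta> (A \<psi>)) = 0"
    using r[of "\<psi> + \<eta>"] r[of \<psi>] r[of \<eta>] by (simp add: l)
  have 2: "Re (cinner \<psi> (A \<eta>)) - Re (cinner \<eta> (A \<psi>)) = 0"
    using r[of "\<psi> + \<i> *\<^sub>C \<eta>"] r[of \<psi>] r[of \<eta>] by (simp add: l)
  show "cinner \<psi> (A \<eta>) = cinner (A \<psi>) \<eta>"
    using 1 2 cinner_cnj[of "A \<psi>" \<eta>] by (simp add: complex_eq_iff)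
qed

lemma positive_op_symmetric: "positive_op A \<Longrightarrow> symmetric_op A"
  by (intro symmetric_op_if_real_form positive_op_clinear positive_op_form(2))

lemma positive_opI:
  assumes "bounded_clinear A" "\<And>\<psi>. cinner \<psi> (A \<psi>) = complex_of_real (r \<psi>)" "\<And>\<psi>. r \<psi> \<ge> 0"
  shows "positive_op A"
  using assms by (auto simp: positive_op_def complex_nonneg_Reals_iff)

text \<open>The Hilbert-Schmidt norms of a map and of its adjoint agree because their matrices are
  conjugate transposes. In the trace norm estimate this plays the part of cyclicity of the
  trace.\<close>

lemma infsum_norm_swap:
  fixes A :: "'i ell2 \<Rightarrow> 'j ell2" and B :: "'j ell2 \<Rightarrow> 'i ell2"
  assumes "\<And>\<psi> \<eta>. cinner \<eta> (A \<psi>) = cinner (B \<eta>) \<psi>"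
  shows "(\<Sum>\<^sub>\<infinity>i. ennreal ((norm (A (ket i)))\<^sup>2)) = (\<Sum>\<^sub>\<infinity>j. ennreal ((norm (B (ket j)))\<^sup>2))"
proof -
  have "coord (A (ket i)) j = cnj (coord (B (ket j)) i)" for i j
    using assms[of "ket j" "ket i"] by (simp add: cinner_ket_left cinner_ket_right)
  then show ?thesis
    unfolding ennreal_norm_eq by (subst infsum_swap_ennreal) simp
qed

section \<open>Square roots of positive operators\<close>

text \<open>Positivity of the form at \<open>\<psi> - (r * cnj z) \<eta>\<close>, with
  \<open>z\<close> the off-diagonal entry, is a quadratic polynomial in the real variable
  \<open>r\<close>, evaluated at its minimum \<open>r = 1/b\<close>.\<close>

lemma positive_op_form_cauchy_schwarz:
  assumes A: "positive_op A"
  shows "(cmod (cinner \<psi> (A \<eta>)))\<^sup>2 \<le> Re (cinner \<psi> (A \<psi>)) * Re (cinner \<eta> (A \<eta>))"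
proof (cases "cinner \<psi> (A \<eta>) = 0")
  case True
  then show ?thesis using positive_op_form(1)[OF A] by simp
next
  case False
  note c = positive_op_clinear[OF A]
  define z where "z = cinner \<psi> (A \<eta>)"
  define a where "a = Re (cinner \<psi> (A \<psi>))"
  define b where "b = Re (cinner \<eta> (A \<eta>))"
  have z': "cinner \<eta> (A \<psi>) = cnj z"
    unfolding z_def using symmetric_opD[OF positive_op_symmetric[OF A], of \<eta> \<psi>] cinner_cnj[of "A \<eta>" \<psi>] by simp
  have b0: "a \<ge> 0" "b \<ge> 0" using positive_op_form(1)[OF A] by (auto simp: a_def b_def)
  have eval: "Re (cinner (\<psi> - (of_real r * cnj z) *\<^sub>C \<eta>) (A (\<psi> - (of_real r * cnj z) *\<^sub>C \<eta>)))
      = a - 2 * r * (cmod z)\<^sup>2 + r\<^sup>2 * (cmod z)\<^sup>2 * b" for r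
  proof -
    have "cinner (\<psi> - (of_real r * cnj z) *\<^sub>C \<eta>) (A (\<psi> - (of_real r * cnj z) *\<^sub>C \<eta>))
      = cinner \<psi> (A \<psi>) - 2 * of_real r * (z * cnj z) + of_real (r\<^sup>2) * (z * cnj z) * cinner \<eta> (A \<eta>)"
      by (simp add: bounded_clinear_diff[OF c] bounded_clinear_scale[OF c] cinner_diff_left cinner_diff_right
          cinner_scale_left cinner_scale_right z' z_def[symmetric] power2_eq_square algebra_simps)
    then show ?thesis
      unfolding a_def b_def complex_norm_square[symmetric]
      by (simp add: of_real_mult[symmetric] del: of_real_mult of_real_power)
  qed
  have pos: "a - 2 * r * (cmod z)\<^sup>2 + r\<^sup>2 * (cmod z)\<^sup>2 * b \<ge> 0" for r
    unfolding eval[symmetric] by (rule positive_op_form(1)[OF A])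
  have zp: "(cmod z)\<^sup>2 > 0" using False by (simp add: z_def)
  \<comment> \<open>For \<open>b = 0\<close> the polynomial would be linear with negative slope, and
    a large \<open>r\<close> contradicts positivity.\<close>
  have "b \<noteq> 0"
  proof
    assume "b = 0"
    then show False using pos[of "(a + 1) / (2 * (cmod z)\<^sup>2)"] zp by (simp add: field_simps)
  qed
  then have "b > 0" using b0 by simp
  have "a - 2 * (1/b) * (cmod z)\<^sup>2 + (1/b)\<^sup>2 * (cmod z)\<^sup>2 * b = a - (cmod z)\<^sup>2 / b"
    using \<open>b > 0\<close> by (simp add: power2_eq_square field_simps)
  then have "a - (cmod z)\<^sup>2 / b \<ge> 0" using pos[of "1/b"] by simp
  then have "(cmod z)\<^sup>2 \<le> a * b" using \<open>b > 0\<close> by (simp add: field_simps)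
  then show ?thesis by (simp add: z_def a_def b_def)
qed

text \<open>The operator inequality \<open>A^2 \<le> K A\<close>: Cauchy-Schwarz for the form of
  \<open>A\<close> at \<open>\<psi>\<close> and \<open>A \<psi>\<close>, divided by the square of
  \<open>norm (A \<psi>)\<close>. It is what makes \<open>1 - A/K\<close> a contraction.\<close>

lemma positive_op_norm_le_form:
  assumes A: "positive_op A" and K: "\<And>\<psi>. norm (A \<psi>) \<le> K * norm \<psi>"
  shows "(norm (A \<psi>))\<^sup>2 \<le> K * Re (cinner \<psi> (A \<psi>))"
proof (cases "A \<psi> = 0")
  case True then show ?thesis by simp
next
  case False
  have "((norm (A \<psi>))\<^sup>2)\<^sup>2 = (cmod (cinner (A \<psi>) (A \<psi>)))\<^sup>2" by (simp add: cinner_self norm_power del: of_real_power)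
  also have "cinner (A \<psi>) (A \<psi>) = cinner \<psi> (A (A \<psi>))"
    by (rule symmetric_opD[OF positive_op_symmetric[OF A], symmetric])
  also have "(cmod (cinner \<psi> (A (A \<psi>))))\<^sup>2 \<le> Re (cinner \<psi> (A \<psi>)) * Re (cinner (A \<psi>) (A (A \<psi>)))"
    by (rule positive_op_form_cauchy_schwarz[OF A])
  also have "Re (cinner (A \<psi>) (A (A \<psi>))) \<le> norm (A \<psi>) * norm (A (A \<psi>))"
    using order_trans[OF complex_Re_le_cmod cmod_cinner_le] .
  also have "norm (A \<psi>) * norm (A (A \<psi>)) \<le> norm (A \<psi>) * (K * norm (A \<psi>))"
    by (intro mult_left_mono K) auto
  finally have "((norm (A \<psi>))\<^sup>2)\<^sup>2 \<le> Re (cinner \<psi> (A \<psi>)) * (norm (A \<psi>) * (K * norm (A \<psi>)))"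
    using positive_op_form(1)[OF A] by (simp add: mult_left_mono)
  then have "(norm (A \<psi>))\<^sup>2 * (norm (A \<psi>))\<^sup>2 \<le> (norm (A \<psi>))\<^sup>2 * (K * Re (cinner \<psi> (A \<psi>)))"
    by (simp only: power2_eq_square mult_ac)
  then show ?thesis using False by (subst (asm) mult_le_cancel_left_pos) auto
qed

lemma infsum_bounded_linear':
  "bounded_linear T \<Longrightarrow> f summable_on A \<Longrightarrow> infsum (\<lambda>x. T (f x)) A = T (infsum f A)"
  by (rule infsumI[OF has_sum_bounded_linear[OF _ has_sum_infsum]])

section \<open>The Taylor series of \<open>sqrt (1 - x)\<close> evaluated at contractions\<close>

definition sqrt_coeff :: "nat \<Rightarrow> real" where
  "sqrt_coeff k = (-1) ^ k * ((1/2) gchoose k)"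

lemma sqrt_coeff_0 [simp]: "sqrt_coeff 0 = 1" by (simp add: sqrt_coeff_def)

lemma sqrt_coeff_rec: "real (Suc k) * sqrt_coeff (Suc k) = (real k - 1/2) * sqrt_coeff k"
proof -
  have "(1/2) * ((1/2::real) gchoose k) = real k * ((1/2) gchoose k) + real (Suc k) * ((1/2) gchoose Suc k)"
    by (rule gbinomial_mult_1)
  then have e: "real (Suc k) * ((1/2) gchoose Suc k) = (1/2 - real k) * ((1/2) gchoose k)"
    by (simp add: algebra_simps)
  have "real (Suc k) * sqrt_coeff (Suc k) = - ((-1) ^ k) * (real (Suc k) * ((1/2) gchoose Suc k))"
    by (simp add: sqrt_coeff_def)
  also have "\<dots> = (real k - 1/2) * sqrt_coeff k"
    unfolding e by (simp add: sqrt_coeff_def algebra_simps)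
  finally show ?thesis .
qed

lemma sqrt_coeff_nonpos: "sqrt_coeff (Suc k) \<le> 0"
proof (induction k)
  case 0
  show ?case using sqrt_coeff_rec[of 0] by simp
next
  case (Suc k)
  have "real (Suc (Suc k)) * sqrt_coeff (Suc (Suc k)) \<le> 0"
    unfolding sqrt_coeff_rec using Suc by (intro mult_nonneg_nonpos) auto
  then show ?case by (simp add: mult_le_0_iff)
qed

text \<open>All coefficients after the first are nonpositive, so for \<open>x < 1\<close> the
  absolute partial sums are at most \<open>1 - sqrt (1 - x) \<le> 1\<close>; then \<open>x\<close>
  tends to 1. Absolute convergence thus reaches the boundary of the disc, as is required for
  contractions of norm exactly 1.\<close>

lemma sqrt_coeff_abs_sum_le: "(\<Sum>k<n. \<bar>sqrt_coeff (Suc k)\<bar>) \<le> 1"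
proof -
  have le: "(\<Sum>k<n. \<bar>sqrt_coeff (Suc k)\<bar> * x ^ Suc k) \<le> 1" if x: "0 < x" "x < 1" for x :: real
  proof -
    have s: "(\<lambda>k. sqrt_coeff k * x ^ k) sums ((1 + (-x)) powr (1/2))"
      using gen_binomial_real[of "-x" "1/2"] x
      by (simp add: sqrt_coeff_def power_minus[of x] mult_ac)
    then have s2: "(\<lambda>k. sqrt_coeff (Suc k) * x ^ Suc k) sums ((1 + (-x)) powr (1/2) - 1)"
      using sums_Suc_iff[of "\<lambda>k. sqrt_coeff k * x ^ k" "(1 + (-x)) powr (1/2) - 1"] by simp
    have s3: "(\<lambda>k. \<bar>sqrt_coeff (Suc k)\<bar> * x ^ Suc k) sums (1 - (1 + (-x)) powr (1/2))"
      using sums_minus[OF s2] sqrt_coeff_nonpos by (simp add: abs_of_nonpos)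
    have "(\<Sum>k<n. \<bar>sqrt_coeff (Suc k)\<bar> * x ^ Suc k) \<le> 1 - (1 + (-x)) powr (1/2)"
      using sum_le_suminf[of "\<lambda>k. \<bar>sqrt_coeff (Suc k)\<bar> * x ^ Suc k" "{..<n}"] s3 x
      by (auto simp: sums_iff)
    then show ?thesis using powr_ge_zero[of "1 + (-x)" "1/2"] by linarith
  qed
  have "((\<lambda>x. \<Sum>k<n. \<bar>sqrt_coeff (Suc k)\<bar> * x ^ Suc k) \<longlongrightarrow> (\<Sum>k<n. \<bar>sqrt_coeff (Suc k)\<bar> * 1 ^ Suc k)) (at_left (1::real))"
    by (intro tendsto_intros)
  moreover have "eventually (\<lambda>x. (\<Sum>k<n. \<bar>sqrt_coeff (Suc k)\<bar> * x ^ Suc k) \<le> 1) (at_left (1::real))"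
    using eventually_at_left_real[OF zero_less_one] by (rule eventually_mono) (rule le, auto)
  ultimately have "(\<Sum>k<n. \<bar>sqrt_coeff (Suc k)\<bar> * 1 ^ Suc k) \<le> 1"
    by (rule tendsto_upperbound) simp
  then show ?thesis by simp
qed

lemma sqrt_coeff_has_sum_abs:
  "(\<lambda>k. \<bar>sqrt_coeff k\<bar>) summable_on UNIV" "(\<Sum>\<^sub>\<infinity>k\<in>UNIV-{0}. \<bar>sqrt_coeff k\<bar>) \<le> 1"
proof -
  have b: "(\<Sum>k\<in>F. \<bar>sqrt_coeff k\<bar>) \<le> 1" if F: "finite F" and F0: "F \<subseteq> UNIV - {0}" for F :: "nat set"
  proof -
    obtain n where n: "F \<subseteq> {..n}" using F unfolding finite_nat_iff_bounded_le by blast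
    have "(\<Sum>k\<in>F. \<bar>sqrt_coeff k\<bar>) \<le> (\<Sum>k\<in>Suc ` {..<n}. \<bar>sqrt_coeff k\<bar>)"
    proof (intro sum_mono2)
      show "F \<subseteq> Suc ` {..<n}"
      proof
        fix k assume "k \<in> F"
        then have "k \<noteq> 0" "k \<le> n" using n F0 by auto
        then show "k \<in> Suc ` {..<n}" by (intro image_eqI[of _ _ "k - 1"]) auto
      qed
    qed auto
    also have "\<dots> = (\<Sum>k<n. \<bar>sqrt_coeff (Suc k)\<bar>)" by (subst sum.reindex) auto
    finally show ?thesis using sqrt_coeff_abs_sum_le[of n] by simp
  qed
  have s: "(\<lambda>k. \<bar>sqrt_coeff k\<bar>) summable_on UNIV - {0}" "(\<Sum>\<^sub>\<infinity>k\<in>UNIV-{0}. \<bar>sqrt_coeff k\<bar>) \<le> 1"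
    using infsum_ennreal_le_real[of "UNIV - {0}" "\<lambda>k. \<bar>sqrt_coeff k\<bar>" 1] b by auto
  show "(\<Sum>\<^sub>\<infinity>k\<in>UNIV-{0}. \<bar>sqrt_coeff k\<bar>) \<le> 1" by (rule s)
  have "(\<lambda>k. \<bar>sqrt_coeff k\<bar>) summable_on insert 0 (UNIV - {0})"
    by (subst summable_on_insert_iff) (rule s(1))
  then show "(\<lambda>k. \<bar>sqrt_coeff k\<bar>) summable_on UNIV" by (simp add: insert_Diff)
qed

text \<open>The coefficients of \<open>1 - x\<close>, read off from the Vandermonde convolution at
  \<open>1/2 + 1/2 = 1\<close>.\<close>

lemma sqrt_coeff_square: "(\<Sum>j\<le>n. sqrt_coeff j * sqrt_coeff (n - j)) = (if n = 0 then 1 else if n = 1 then -1 else 0)"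
proof -
  have "(\<Sum>j\<le>n. sqrt_coeff j * sqrt_coeff (n - j)) = (-1) ^ n * (\<Sum>j\<le>n. ((1/2) gchoose j) * ((1/2) gchoose (n - j)))"
    unfolding sum_distrib_left
  proof (rule sum.cong)
    fix j assume "j \<in> {..n}"
    then have "(-1::real) ^ n = (-1) ^ j * (-1) ^ (n - j)" by (simp add: power_add[symmetric])
    then show "sqrt_coeff j * sqrt_coeff (n - j) = (-1) ^ n * (((1/2) gchoose j) * ((1/2) gchoose (n - j)))"
      by (simp add: sqrt_coeff_def mult_ac)
  qed simp
  also have "(\<Sum>j\<le>n. ((1/2) gchoose j) * ((1/2::real) gchoose (n - j))) = (1 gchoose n)"
    using gbinomial_Vandermonde[of "1/2::real" "1/2" n] by (simp add: atLeast0AtMost)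
  also have "((1::real) gchoose n) = real (1 choose n)"
    using binomial_gbinomial[of 1 n, where ?'a=real] by simp
  also have "(-1) ^ n * real (1 choose n) = (if n = 0 then 1 else if n = 1 then -1 else 0)"
    by (auto simp: binomial_eq_0)
  finally show ?thesis .
qed

lemma norm_funpow_le:
  fixes B :: "'a::real_normed_vector \<Rightarrow> 'a"
  assumes "\<And>\<psi>. norm (B \<psi>) \<le> norm \<psi>"
  shows "norm ((B ^^ k) \<psi>) \<le> norm \<psi>"
  by (induction k) (auto intro: order_trans[OF assms])

definition sqrt_series :: "('a \<Rightarrow> 'a) \<Rightarrow> 'a \<Rightarrow> 'a::banach" where
  "sqrt_series B \<psi> = (\<Sum>\<^sub>\<infinity>k. sqrt_coeff k *\<^sub>R (B ^^ k) \<psi>)"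

context
  fixes B :: "'a::banach \<Rightarrow> 'a"
  assumes lin: "bounded_linear B" and contr: "\<And>\<psi>. norm (B \<psi>) \<le> norm \<psi>"
begin

lemma sqrt_series_abs_summable: "(\<lambda>k. norm (sqrt_coeff k *\<^sub>R (B ^^ k) \<psi>)) summable_on UNIV"
  by (rule summable_on_comparison_test[OF summable_on_cmult_left[OF sqrt_coeff_has_sum_abs(1), of "norm \<psi>"]])
     (auto intro!: mult_left_mono norm_funpow_le contr)

lemma sqrt_series_summable: "(\<lambda>k. sqrt_coeff k *\<^sub>R (B ^^ k) \<psi>) summable_on UNIV"
  by (rule abs_summable_summable[OF sqrt_series_abs_summable])

lemma bounded_linear_funpow: "bounded_linear (B ^^ k)"
  by (induction k) (auto intro!: bounded_linear_compose[OF lin] bounded_linear_ident simp: id_def o_def)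

lemma sqrt_series_commute:
  assumes T: "bounded_linear T" and c: "\<And>\<psi>. T (B \<psi>) = B (T \<psi>)"
  shows "T (sqrt_series B \<psi>) = sqrt_series B (T \<psi>)"
proof -
  have "T ((B ^^ k) \<psi>) = (B ^^ k) (T \<psi>)" for k by (induction k) (simp_all add: c)
  then have "T (sqrt_coeff k *\<^sub>R (B ^^ k) \<psi>) = sqrt_coeff k *\<^sub>R (B ^^ k) (T \<psi>)" for k
    by (simp add: linear_scale[OF bounded_linear.linear[OF T]])
  then show ?thesis
    unfolding sqrt_series_def by (subst infsum_bounded_linear'[OF T sqrt_series_summable, symmetric]) simp
qed

text \<open>The Cauchy product of an absolutely convergent double series, regrouped along
  \<open>n = j + k\<close>; only \<open>n = 0\<close> and \<open>n = 1\<close> survive.\<close>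

lemma sqrt_series_square: "sqrt_series B (sqrt_series B \<psi>) = \<psi> - B \<psi>"
proof -
  define f where "f = (\<lambda>(j, k). (sqrt_coeff j * sqrt_coeff k) *\<^sub>R (B ^^ (j + k)) \<psi>)"
  have "(\<lambda>p. norm (f p)) summable_on Sigma UNIV (\<lambda>_. UNIV)"
    unfolding Infinite_Sum.abs_summable_on_Sigma_iff
  proof (intro conjI ballI)
    have 1: "(\<lambda>k. norm (f (j, k))) summable_on UNIV" for j
      by (rule summable_on_comparison_test[OF summable_on_cmult_right[OF sqrt_coeff_has_sum_abs(1), of "\<bar>sqrt_coeff j\<bar> * norm \<psi>"]])
         (auto simp: f_def abs_mult mult.assoc mult.commute[of "norm \<psi>"] intro!: mult_left_mono norm_funpow_le contr)
    then show "(\<lambda>k. norm (f (j, k))) summable_on UNIV" for j .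
    define c where "c = (\<Sum>\<^sub>\<infinity>k. \<bar>sqrt_coeff k\<bar>)"
    have le: "(\<Sum>\<^sub>\<infinity>k. norm (f (j, k))) \<le> \<bar>sqrt_coeff j\<bar> * (norm \<psi> * c)" for j
    proof -
      have "(\<Sum>\<^sub>\<infinity>k. norm (f (j, k))) \<le> (\<Sum>\<^sub>\<infinity>k. (\<bar>sqrt_coeff j\<bar> * norm \<psi>) * \<bar>sqrt_coeff k\<bar>)"
        by (rule infsum_mono[OF 1 summable_on_cmult_right[OF sqrt_coeff_has_sum_abs(1)]])
           (auto simp: f_def abs_mult mult.assoc mult.commute[of "norm \<psi>"] intro!: mult_left_mono norm_funpow_le contr)
      then show ?thesis by (simp add: infsum_cmult_right' c_def mult.assoc)
    qed
    show "(\<lambda>j. norm (\<Sum>\<^sub>\<infinity>k. norm (f (j, k)))) summable_on UNIV"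
      by (rule summable_on_comparison_test[OF summable_on_cmult_left[OF sqrt_coeff_has_sum_abs(1), of "norm \<psi> * c"]])
         (use le in \<open>auto simp: infsum_nonneg\<close>)
  qed
  then have fs: "f summable_on UNIV \<times> UNIV" by (rule abs_summable_summable)
  have fn: "(B ^^ j) (sqrt_coeff k *\<^sub>R (B ^^ k) \<psi>) = sqrt_coeff k *\<^sub>R (B ^^ (j + k)) \<psi>" for j k
    by (simp add: linear_scale[OF bounded_linear.linear[OF bounded_linear_funpow]] funpow_add)
  have "sqrt_series B (sqrt_series B \<psi>) = (\<Sum>\<^sub>\<infinity>j. \<Sum>\<^sub>\<infinity>k. f (j, k))"
  proof -
    have "sqrt_coeff j *\<^sub>R (B ^^ j) (sqrt_series B \<psi>) = (\<Sum>\<^sub>\<infinity>k. f (j, k))" for j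
    proof -
      have "sqrt_coeff j *\<^sub>R (B ^^ j) (sqrt_series B \<psi>) =
        (\<Sum>\<^sub>\<infinity>k. sqrt_coeff j *\<^sub>R (B ^^ j) (sqrt_coeff k *\<^sub>R (B ^^ k) \<psi>))"
        unfolding sqrt_series_def
        by (rule infsum_bounded_linear'[symmetric, OF _ sqrt_series_summable])
           (intro bounded_linear_scaleR_right[THEN bounded_linear_compose] bounded_linear_funpow)
      then show ?thesis by (simp add: fn f_def)
    qed
    then show ?thesis unfolding sqrt_series_def[of B "sqrt_series B \<psi>"] by simp
  qed
  also have "\<dots> = infsum f (UNIV \<times> UNIV)"
    by (rule infsum_Sigma_banach[OF fs])
  also have "\<dots> = infsum (\<lambda>(n, j). (sqrt_coeff j * sqrt_coeff (n - j)) *\<^sub>R (B ^^ n) \<psi>) (SIGMA n:UNIV. {..n})"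
    by (rule infsum_reindex_bij_witness[of _ "\<lambda>(n, j). (j, n - j)" "\<lambda>(j, k). (j + k, j)"]) (auto simp: f_def)
  also have "\<dots> = (\<Sum>\<^sub>\<infinity>n. \<Sum>\<^sub>\<infinity>j\<in>{..n}. (sqrt_coeff j * sqrt_coeff (n - j)) *\<^sub>R (B ^^ n) \<psi>)"
  proof (rule infsum_Sigma'_banach[symmetric])
    show "(\<lambda>(n, j). (sqrt_coeff j * sqrt_coeff (n - j)) *\<^sub>R (B ^^ n) \<psi>) summable_on (SIGMA n:UNIV. {..n})"
      by (rule summable_on_reindex_bij_witness[of _ "\<lambda>(n, j). (j, n - j)" "\<lambda>(j, k). (j + k, j)", THEN iffD1, OF _ _ _ _ _ fs])
         (auto simp: f_def)
  qed
  also have "\<dots> = (\<Sum>\<^sub>\<infinity>n. (if n = 0 then 1 else if n = 1 then -1 else (0::real)) *\<^sub>R (B ^^ n) \<psi>)"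
    by (simp add: scaleR_left.sum[symmetric] sqrt_coeff_square del: One_nat_def)
  also have "\<dots> = (\<Sum>\<^sub>\<infinity>n\<in>{0,1}. (if n = 0 then 1 else if n = 1 then -1 else (0::real)) *\<^sub>R (B ^^ n) \<psi>)"
    by (rule infsum_cong_neutral) auto
  also have "\<dots> = \<psi> - B \<psi>" by simp
  finally show ?thesis .
qed

end

lemma positive_op_scaleR:
  assumes "positive_op A" "r \<ge> 0"
  shows "positive_op (\<lambda>\<psi>. r *\<^sub>R A \<psi>)"
proof (rule positive_opI[where r="\<lambda>\<psi>. r * Re (cinner \<psi> (A \<psi>))"])
  note c = positive_op_clinear[OF assms(1)]
  show "bounded_clinear (\<lambda>\<psi>. r *\<^sub>R A \<psi>)"
    using c bounded_linear_compose[OF bounded_linear_scaleR_right[of r] bounded_clinear_linear[OF c]]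
    unfolding bounded_clinear_def by (auto intro!: ell2_eqI simp: coord_simps)
  show "cinner \<psi> (r *\<^sub>R A \<psi>) = complex_of_real (r * Re (cinner \<psi> (A \<psi>)))" for \<psi>
    using positive_op_form(2)[OF assms(1), of \<psi>] by (simp add: cinner_scaleR_right complex_eq_iff)
  show "0 \<le> r * Re (cinner \<psi> (A \<psi>))" for \<psi>
    using assms(2) positive_op_form(1)[OF assms(1)] by (rule mult_nonneg_nonneg)
qed

text \<open>Write \<open>A = K (1 - B)\<close> with a symmetric contraction \<open>B\<close> and
  take \<open>sqrt K\<close> times the series in \<open>B\<close>. Whatever commutes with
  \<open>A\<close> commutes with the series; this clause is carried along because uniqueness of the
  root depends on it.\<close>

theorem positive_op_sqrt_exists:
  assumes A: "positive_op A"
  shows "\<exists>S. positive_op S \<and> S \<circ> S = A \<and> (\<forall>T. bounded_clinear T \<longrightarrow> T \<circ> A = A \<circ> T \<longrightarrow> T \<circ> S = S \<circ> T)"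
proof -
  note c = positive_op_clinear[OF A]
  obtain K where K: "K > 0" "\<And>\<psi>. norm (A \<psi>) \<le> K * norm \<psi>"
    using bounded_linear.pos_bounded[OF bounded_clinear_linear[OF c]] by (auto simp: mult.commute)
  define B where "B = (\<lambda>\<psi>. \<psi> - (1/K) *\<^sub>R A \<psi>)"
  have Blin: "bounded_linear B"
    unfolding B_def by (intro bounded_linear_sub bounded_linear_ident
        bounded_linear_scaleR_right[THEN bounded_linear_compose] bounded_clinear_linear c)
  have formB: "cinner \<psi> (B \<psi>) = complex_of_real ((norm \<psi>)\<^sup>2 - Re (cinner \<psi> (A \<psi>)) / K)" for \<psi>
    using positive_op_form(2)[OF A, of \<psi>]
    by (simp add: B_def cinner_diff_right cinner_scaleR_right cinner_self complex_eq_iff del: of_real_power)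
  have contr: "norm (B \<psi>) \<le> norm \<psi>" for \<psi>
  proof -
    have "(norm (B \<psi>))\<^sup>2 = (norm \<psi>)\<^sup>2 - 2 * (Re (cinner \<psi> (A \<psi>)) / K) + (norm (A \<psi>))\<^sup>2 / K\<^sup>2"
      unfolding B_def power2_norm_eq_inner
      by (simp add: inner_diff_left inner_diff_right inner_commute[of "A \<psi>" \<psi>] inner_ell2_def[of \<psi> "A \<psi>"] power2_eq_square diff_divide_distrib)
    also have "(norm (A \<psi>))\<^sup>2 / K\<^sup>2 \<le> (K * Re (cinner \<psi> (A \<psi>))) / K\<^sup>2"
      by (intro divide_right_mono positive_op_norm_le_form[OF A K(2)]) auto
    also have "\<dots> = Re (cinner \<psi> (A \<psi>)) / K" using K by (simp add: power2_eq_square)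
    finally have "(norm (B \<psi>))\<^sup>2 \<le> (norm \<psi>)\<^sup>2 - Re (cinner \<psi> (A \<psi>)) / K" by simp
    also have "\<dots> \<le> (norm \<psi>)\<^sup>2" using K positive_op_form(1)[OF A] by simp
    finally show ?thesis by (rule power2_le_imp_le) simp
  qed
  define S where "S = (\<lambda>\<psi>. sqrt K *\<^sub>R sqrt_series B \<psi>)"
  have comm: "T (sqrt_series B \<psi>) = sqrt_series B (T \<psi>)" if "bounded_clinear T" "\<And>\<psi>. T (A \<psi>) = A (T \<psi>)" for T \<psi>
  proof (rule sqrt_series_commute[OF Blin contr])
    show "bounded_linear T" using that(1) by (rule bounded_clinear_linear)
    show "T (B \<psi>) = B (T \<psi>)" for \<psi>
      using that(2) linear_scale[OF bounded_linear.linear[OF \<open>bounded_linear T\<close>]]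
      by (simp add: B_def bounded_clinear_diff[OF that(1)])
  qed
  have add: "sqrt_series B (\<psi> + \<eta>) = sqrt_series B \<psi> + sqrt_series B \<eta>" for \<psi> \<eta>
    unfolding sqrt_series_def
    by (subst infsum_add[symmetric, OF sqrt_series_summable[OF Blin contr] sqrt_series_summable[OF Blin contr]])
       (simp add: linear_add[OF bounded_linear.linear[OF bounded_linear_funpow[OF Blin contr]]] scaleR_add_right)
  have cs: "bounded_clinear (\<lambda>\<psi>. z *\<^sub>C \<psi>)" for z :: complex
    by (rule bounded_clinearI[where K="cmod z"]) (auto intro!: ell2_eqI simp: coord_simps norm_cscale algebra_simps)
  have scale: "sqrt_series B (z *\<^sub>C \<psi>) = z *\<^sub>C sqrt_series B \<psi>" for z \<psi>
    by (rule comm[symmetric, OF cs]) (simp add: bounded_clinear_scale[OF c])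
  \<comment> \<open>The series without its leading term. The remaining coefficients have absolute
    sum at most 1, so this part cannot outweigh \<open>(norm \<psi>)\<^sup>2\<close>; that is the
    positivity of the root.\<close>
  define r where "r \<psi> = (\<Sum>\<^sub>\<infinity>k\<in>UNIV-{0}. cinner \<psi> (sqrt_coeff k *\<^sub>R (B ^^ k) \<psi>))" for \<psi>
  have form: "cinner \<psi> (sqrt_series B \<psi>) = complex_of_real ((norm \<psi>)\<^sup>2) + r \<psi>" for \<psi>
  proof -
    have "cinner \<psi> (sqrt_series B \<psi>) = (\<Sum>\<^sub>\<infinity>k. cinner \<psi> (sqrt_coeff k *\<^sub>R (B ^^ k) \<psi>))"
      unfolding sqrt_series_def
      by (rule infsum_bounded_linear'[symmetric, OF bounded_linear_cinner sqrt_series_summable[OF Blin contr]])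
    also have "\<dots> = (\<Sum>\<^sub>\<infinity>k\<in>insert 0 (UNIV-{0}). cinner \<psi> (sqrt_coeff k *\<^sub>R (B ^^ k) \<psi>))" by (simp add: insert_Diff)
    also have "\<dots> = cinner \<psi> (sqrt_coeff 0 *\<^sub>R (B ^^ 0) \<psi>) + r \<psi>"
      unfolding r_def
    proof (rule infsum_insert)
      have "(\<lambda>k. cinner \<psi> (sqrt_coeff k *\<^sub>R (B ^^ k) \<psi>)) summable_on UNIV"
        by (rule summable_on_bounded_linear[OF bounded_linear_cinner sqrt_series_summable[OF Blin contr]])
      then show "(\<lambda>k. cinner \<psi> (sqrt_coeff k *\<^sub>R (B ^^ k) \<psi>)) summable_on UNIV - {0}"
        by (rule summable_on_subset) auto
    qed auto
    finally show ?thesis by (simp add: cinner_self)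
  qed
  have Bsym: "cinner \<psi> (B \<eta>) = cinner (B \<psi>) \<eta>" for \<psi> \<eta>
    using symmetric_opD[OF positive_op_symmetric[OF A], of \<psi> \<eta>]
    by (simp add: B_def cinner_diff_left cinner_diff_right cinner_scaleR_left cinner_scaleR_right)
  have r_real: "Im (r \<psi>) = 0" for \<psi>
  proof -
    have B0: "Im (cinner \<psi> (B \<psi>)) = 0" for \<psi> by (simp add: formB)
    have "cinner ((B ^^ k) \<psi>) \<eta> = cinner \<psi> ((B ^^ k) \<eta>)" for k \<eta>
    proof (induction k arbitrary: \<eta>)
      case (Suc k)
      have "cinner ((B ^^ Suc k) \<psi>) \<eta> = cinner ((B ^^ k) \<psi>) (B \<eta>)" by (simp add: Bsym)
      also have "\<dots> = cinner \<psi> ((B ^^ Suc k) \<eta>)" by (subst Suc.IH) (simp add: funpow_swap1)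
      finally show ?case .
    qed simp
    then have "cnj (cinner \<psi> ((B ^^ k) \<psi>)) = cinner \<psi> ((B ^^ k) \<psi>)" for k
      using cinner_cnj[of "(B ^^ k) \<psi>" \<psi>] by simp
    then have "cnj (r \<psi>) = r \<psi>"
      unfolding r_def by (subst infsum_cnj[symmetric]) (simp add: cinner_scaleR_right)
    from arg_cong[OF this, of Im] show ?thesis by simp
  qed
  have r_bound: "cmod (r \<psi>) \<le> (norm \<psi>)\<^sup>2" for \<psi>
  proof -
    have sm: "(\<lambda>k. \<bar>sqrt_coeff k\<bar> * (norm \<psi>)\<^sup>2) summable_on UNIV - {0}"
      by (rule summable_on_cmult_left[OF summable_on_subset[OF sqrt_coeff_has_sum_abs(1)]]) auto
    have le: "norm (cinner \<psi> (sqrt_coeff k *\<^sub>R (B ^^ k) \<psi>)) \<le> \<bar>sqrt_coeff k\<bar> * (norm \<psi>)\<^sup>2" for k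
    proof -
      have "cmod (cinner \<psi> ((B ^^ k) \<psi>)) \<le> norm \<psi> * norm ((B ^^ k) \<psi>)" by (rule cmod_cinner_le)
      also have "\<dots> \<le> norm \<psi> * norm \<psi>" by (intro mult_left_mono norm_funpow_le contr) auto
      finally show ?thesis by (simp add: cinner_scaleR_right norm_mult power2_eq_square mult_left_mono)
    qed
    have "norm (r \<psi>) \<le> (\<Sum>\<^sub>\<infinity>k\<in>UNIV-{0}. \<bar>sqrt_coeff k\<bar> * (norm \<psi>)\<^sup>2)"
      unfolding r_def by (rule norm_infsum_le[OF has_sum_infsum has_sum_infsum[OF sm] le])
        (rule summable_on_subset[OF summable_on_bounded_linear[OF bounded_linear_cinner sqrt_series_summable[OF Blin contr]]], auto)
    also have "\<dots> = (\<Sum>\<^sub>\<infinity>k\<in>UNIV-{0}. \<bar>sqrt_coeff k\<bar>) * (norm \<psi>)\<^sup>2"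
      by (rule infsum_cmult_left')
    also have "\<dots> \<le> 1 * (norm \<psi>)\<^sup>2" by (intro mult_right_mono sqrt_coeff_has_sum_abs) auto
    finally show ?thesis by simp
  qed
  have norm_le: "norm (sqrt_series B \<psi>) \<le> (\<Sum>\<^sub>\<infinity>k. \<bar>sqrt_coeff k\<bar>) * norm \<psi>" for \<psi>
  proof -
    have "norm (sqrt_series B \<psi>) \<le> (\<Sum>\<^sub>\<infinity>k. \<bar>sqrt_coeff k\<bar> * norm \<psi>)"
      unfolding sqrt_series_def
      by (rule norm_infsum_le[OF has_sum_infsum[OF sqrt_series_summable[OF Blin contr]]
            has_sum_infsum[OF summable_on_cmult_left[OF sqrt_coeff_has_sum_abs(1)]]])
         (auto intro!: mult_left_mono norm_funpow_le contr)
    then show ?thesis by (simp add: infsum_cmult_left')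
  qed
  have pos0: "positive_op (sqrt_series B)"
  proof (rule positive_opI[where r="\<lambda>\<psi>. (norm \<psi>)\<^sup>2 + Re (r \<psi>)"])
    show "bounded_clinear (sqrt_series B)" by (rule bounded_clinearI[OF add scale norm_le])
    show "cinner \<psi> (sqrt_series B \<psi>) = complex_of_real ((norm \<psi>)\<^sup>2 + Re (r \<psi>))" for \<psi>
      unfolding form using r_real[of \<psi>] by (simp add: complex_eq_iff)
    show "0 \<le> (norm \<psi>)\<^sup>2 + Re (r \<psi>)" for \<psi>
      using r_bound[of \<psi>] abs_Re_le_cmod[of "r \<psi>"] by linarith
  qed
  have "positive_op S" unfolding S_def using K by (intro positive_op_scaleR pos0) auto
  moreover have "S \<circ> S = A"
  proof
    fix \<psi>
    have sc: "sqrt_series B (x *\<^sub>R \<eta>) = x *\<^sub>R sqrt_series B \<eta>" for x \<eta> by (simp add: scaleR_cscale scale)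
    show "(S \<circ> S) \<psi> = A \<psi>"
      using K by (simp add: S_def sc sqrt_series_square[OF Blin contr]) (simp add: B_def)
  qed
  moreover have "T \<circ> S = S \<circ> T" if T: "bounded_clinear T" "T \<circ> A = A \<circ> T" for T
  proof
    fix \<psi>
    have "T (A \<eta>) = A (T \<eta>)" for \<eta> using fun_cong[OF T(2), of \<eta>] by simp
    then show "(T \<circ> S) \<psi> = (S \<circ> T) \<psi>"
      using comm[OF T(1), of \<psi>] by (simp add: S_def scaleR_cscale bounded_clinear_scale[OF T(1)])
  qed
  ultimately show ?thesis by blast
qed

lemma positive_op_zero_form:
  assumes "positive_op A" "Re (cinner \<psi> (A \<psi>)) = 0"
  shows "A \<psi> = 0"
proof -
  obtain K where "\<And>\<psi>. norm (A \<psi>) \<le> K * norm \<psi>"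
    using bounded_linear.pos_bounded[OF bounded_clinear_linear[OF positive_op_clinear[OF assms(1)]]]
    by (auto simp: mult.commute)
  from positive_op_norm_le_form[OF assms(1) this, of \<psi>] assms(2) show ?thesis by simp
qed

text \<open>For \<open>\<zeta> = (S - R) \<psi>\<close> one has \<open>(S + R) \<zeta> = 0\<close>.
  The two nonnegative forms at \<open>\<zeta>\<close> then vanish separately, so \<open>S\<close>
  and \<open>R\<close> annihilate \<open>\<zeta>\<close>, and symmetry makes \<open>\<zeta>\<close>
  orthogonal to \<open>S \<psi> - R \<psi>\<close>, which is \<open>\<zeta>\<close> itself.\<close>

lemma positive_op_sqrt_unique_aux:
  assumes S: "positive_op S" and R: "positive_op R" and sq: "S \<circ> S = R \<circ> R" and comm: "R \<circ> S = S \<circ> R"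
  shows "S = R"
proof
  fix \<psi>
  note cS = positive_op_clinear[OF S] and cR = positive_op_clinear[OF R]
  define \<zeta> where "\<zeta> = S \<psi> - R \<psi>"
  have "S \<zeta> + R \<zeta> = S (S \<psi>) - R (R \<psi>)"
    using fun_cong[OF comm, of \<psi>] by (simp add: \<zeta>_def bounded_clinear_diff[OF cS] bounded_clinear_diff[OF cR])
  also have "\<dots> = 0" using fun_cong[OF sq, of \<psi>] by simp
  finally have "cinner \<zeta> (S \<zeta>) + cinner \<zeta> (R \<zeta>) = 0"
    unfolding cinner_add_right[symmetric] by simp
  from arg_cong[OF this, of Re] have "Re (cinner \<zeta> (S \<zeta>)) + Re (cinner \<zeta> (R \<zeta>)) = 0" by simp
  then have "S \<zeta> = 0" "R \<zeta> = 0"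
    using positive_op_form(1)[OF S, of \<zeta>] positive_op_form(1)[OF R, of \<zeta>] S R
    using positive_op_zero_form[OF S, of \<zeta>] positive_op_zero_form[OF R, of \<zeta>] by auto
  then have "cinner \<zeta> (S \<psi>) = 0" "cinner \<zeta> (R \<psi>) = 0"
    using symmetric_opD[OF positive_op_symmetric[OF S], of \<zeta> \<psi>] symmetric_opD[OF positive_op_symmetric[OF R], of \<zeta> \<psi>]
    by simp_all
  then have "cinner \<zeta> \<zeta> = 0" using cinner_diff_right[of \<zeta> "S \<psi>" "R \<psi>"] by (simp add: \<zeta>_def[symmetric])
  then show "S \<psi> = R \<psi>" by (simp add: cinner_self \<zeta>_def)
qed

text \<open>Any root \<open>T\<close> commutes with \<open>T \<circ> T = A\<close>, hence with the
  root given by the series, and the commuting case applies. This turns the definite description in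
  \<open>sqrt_op\<close> into a usable value.\<close>

lemma sqrt_op_unique:
  assumes R: "positive_op R" "R \<circ> R = A"
  shows "sqrt_op A = R"
proof -
  have A: "positive_op A"
  proof (rule positive_opI[where r="\<lambda>\<psi>. (norm (R \<psi>))\<^sup>2"])
    have A': "A = (\<lambda>\<psi>. R (R \<psi>))" by (simp only: R(2)[symmetric] o_def)
    show "bounded_clinear A" unfolding A' by (rule bounded_clinear_compose[OF positive_op_clinear[OF R(1)] positive_op_clinear[OF R(1)]])
    show "cinner \<psi> (A \<psi>) = complex_of_real ((norm (R \<psi>))\<^sup>2)" for \<psi>
      unfolding A' using symmetric_opD[OF positive_op_symmetric[OF R(1)]] by (simp add: cinner_self)
  qed auto
  obtain S where S: "positive_op S" "S \<circ> S = A" "\<forall>T. bounded_clinear T \<longrightarrow> T \<circ> A = A \<circ> T \<longrightarrow> T \<circ> S = S \<circ> T"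
    using positive_op_sqrt_exists[OF A] by (elim exE conjE)
  have *: "T = S" if T: "positive_op T" "T \<circ> T = A" for T
  proof -
    have "T \<circ> (T \<circ> T) = (T \<circ> T) \<circ> T" by (simp only: o_assoc)
    then have "T \<circ> S = S \<circ> T" unfolding T(2) by (rule S(3)[rule_format, OF positive_op_clinear[OF T(1)]])
    with positive_op_sqrt_unique_aux[OF S(1) T(1)] S(2) T(2) have "S = T" by metis
    then show ?thesis ..
  qed
  show ?thesis
    unfolding sqrt_op_def
  proof (rule the_equality)
    show "positive_op R \<and> R \<circ> R = A" using R by simp
    show "T = R" if "positive_op T \<and> T \<circ> T = A" for T
    proof -
      from that have "T = S" by (intro *) auto
      moreover have "R = S" using R by (intro *) auto
      ultimately show ?thesis by simp
    qed
  qed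
qed

lemma
  assumes A: "positive_op A"
  shows positive_sqrt_op: "positive_op (sqrt_op A)"
    and sqrt_op_square: "sqrt_op A (sqrt_op A \<psi>) = A \<psi>"
proof -
  obtain S where S: "positive_op S" "S \<circ> S = A"
    using positive_op_sqrt_exists[OF A] by (elim exE conjE)
  then have "sqrt_op A = S" by (rule sqrt_op_unique)
  then show "positive_op (sqrt_op A)" "sqrt_op A (sqrt_op A \<psi>) = A \<psi>"
    using S(1) fun_cong[OF S(2), of \<psi>] by simp_all
qed

lemma sqrt_op_commute:
  assumes A: "positive_op A" and T: "bounded_clinear T" "\<And>\<psi>. T (A \<psi>) = A (T \<psi>)"
  shows "T (sqrt_op A \<psi>) = sqrt_op A (T \<psi>)"
proof -
  obtain S where S: "positive_op S" "S \<circ> S = A" "\<forall>T. bounded_clinear T \<longrightarrow> T \<circ> A = A \<circ> T \<longrightarrow> T \<circ> S = S \<circ> T"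
    using positive_op_sqrt_exists[OF A] by (elim exE conjE)
  have e: "sqrt_op A = S" by (rule sqrt_op_unique[OF S(1,2)])
  have "T \<circ> A = A \<circ> T" using T(2) by (simp add: fun_eq_iff)
  then have "T \<circ> S = S \<circ> T" using S(3) T(1) by blast
  from fun_cong[OF this, of \<psi>] show ?thesis unfolding e by simp
qed

lemma norm_sqrt_op:
  assumes A: "positive_op A"
  shows "(norm (sqrt_op A \<psi>))\<^sup>2 = Re (cinner \<psi> (A \<psi>))"
proof -
  have "cinner (sqrt_op A \<psi>) (sqrt_op A \<psi>) = cinner \<psi> (sqrt_op A (sqrt_op A \<psi>))"
    by (rule symmetric_opD[OF positive_op_symmetric[OF positive_sqrt_op[OF A]], symmetric])
  then have "complex_of_real ((norm (sqrt_op A \<psi>))\<^sup>2) = cinner \<psi> (A \<psi>)"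
    by (simp only: cinner_self sqrt_op_square[OF A])
  from arg_cong[OF this, of Re] show ?thesis by simp
qed

section \<open>Trace norm distance to a rank one projection\<close>

lemma adj_symmetric:
  assumes "symmetric_op A"
  shows "adj A = A"
  unfolding adj_def
proof (rule the_equality)
  show "\<forall>\<psi> \<eta>. cinner (A \<psi>) \<eta> = cinner \<psi> (A \<eta>)" using assms by (simp add: symmetric_op_def)
  fix B assume B: "\<forall>\<psi> \<eta>. cinner (B \<psi>) \<eta> = cinner \<psi> (A \<eta>)"
  show "B = A"
  proof
    fix \<psi>
    show "B \<psi> = A \<psi>"
    proof (rule cinner_eqI)
      fix \<eta>
      have "cinner (B \<psi>) \<eta> = cinner (A \<psi>) \<eta>" using B symmetric_opD[OF assms] by simp
      then show "cinner \<eta> (B \<psi>) = cinner \<eta> (A \<psi>)"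
        using cinner_cnj[of \<eta> "B \<psi>"] cinner_cnj[of \<eta> "A \<psi>"] by simp
    qed
  qed
qed

lemma positive_op_square:
  assumes A: "bounded_clinear A" "symmetric_op A"
  shows "positive_op (A \<circ> A)"
proof (rule positive_opI[where r="\<lambda>\<psi>. (norm (A \<psi>))\<^sup>2"])
  show "bounded_clinear (A \<circ> A)" unfolding o_def by (rule bounded_clinear_compose[OF A(1) A(1)])
  show "cinner \<psi> ((A \<circ> A) \<psi>) = complex_of_real ((norm (A \<psi>))\<^sup>2)" for \<psi>
    using symmetric_opD[OF A(2), of \<psi> "A \<psi>"] by (simp add: cinner_self)
qed auto

text \<open>\<open>P = R + e\<close> is inverted by the damped iteration
  \<open>x - (P x - \<psi>)/k\<close>. It contracts with factor \<open>sqrt (1 - e/k)\<close>,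
  because the form of \<open>P\<close> is at least \<open>e\<close> and its norm at most
  \<open>k\<close>.\<close>

lemma resolvent_exists:
  assumes R: "positive_op R" and e: "e > 0"
  shows "\<exists>x. R x + e *\<^sub>R x = \<psi>"
proof -
  note c = positive_op_clinear[OF R]
  obtain K where K: "K > 0" "\<And>\<psi>. norm (R \<psi>) \<le> K * norm \<psi>"
    using bounded_linear.pos_bounded[OF bounded_clinear_linear[OF c]] by (auto simp: mult.commute)
  define P where "P = (\<lambda>\<psi>. R \<psi> + e *\<^sub>R \<psi>)"
  have P: "positive_op P"
  proof (rule positive_opI[where r="\<lambda>\<psi>. Re (cinner \<psi> (R \<psi>)) + e * (norm \<psi>)\<^sup>2"])
    show "bounded_clinear P"
    proof (rule bounded_clinearI[where K="K + e"])
      show "norm (P \<psi>) \<le> (K + e) * norm \<psi>" for \<psi>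
        using norm_triangle_ineq[of "R \<psi>" "e *\<^sub>R \<psi>"] K(2)[of \<psi>] e by (simp add: P_def algebra_simps)
    qed (auto simp: P_def bounded_clinear_add[OF c] bounded_clinear_scale[OF c] intro!: ell2_eqI
        simp: coord_simps algebra_simps)
    show "cinner \<psi> (P \<psi>) = complex_of_real (Re (cinner \<psi> (R \<psi>)) + e * (norm \<psi>)\<^sup>2)" for \<psi>
      using positive_op_form(2)[OF R, of \<psi>]
      by (simp add: P_def cinner_add_right cinner_scaleR_right cinner_self complex_eq_iff del: of_real_power)
    show "0 \<le> Re (cinner \<psi> (R \<psi>)) + e * (norm \<psi>)\<^sup>2" for \<psi>
      using positive_op_form(1)[OF R, of \<psi>] e by simp
  qed
  define k where "k = K + e"
  have k: "k > 0" using K e by (simp add: k_def)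
  have Pk: "norm (P y) \<le> k * norm y" for y
    using norm_triangle_ineq[of "R y" "e *\<^sub>R y"] K(2)[of y] e by (simp add: P_def k_def algebra_simps)
  have ge: "Re (cinner y (P y)) \<ge> e * (norm y)\<^sup>2" for y
    using positive_op_form(1)[OF R, of y]
    by (simp add: P_def cinner_add_right cinner_scaleR_right cinner_self del: of_real_power)
  define \<rho> where "\<rho> = sqrt (1 - e / k)"
  have ek: "e / k < 1" "e / k > 0" using K e by (simp_all add: k_def)
  have contr: "norm (y - (1/k) *\<^sub>R P y) \<le> \<rho> * norm y" for y
  proof -
    have "(norm (y - (1/k) *\<^sub>R P y))\<^sup>2 = (norm y)\<^sup>2 - 2 * (Re (cinner y (P y)) / k) + (norm (P y))\<^sup>2 / k\<^sup>2"
      unfolding power2_norm_eq_inner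
      by (simp add: inner_diff_left inner_diff_right inner_commute[of "P y" y] inner_ell2_def[of y "P y"] power2_eq_square diff_divide_distrib)
    also have "(norm (P y))\<^sup>2 / k\<^sup>2 \<le> (k * Re (cinner y (P y))) / k\<^sup>2"
      by (intro divide_right_mono positive_op_norm_le_form[OF P Pk]) auto
    also have "\<dots> = Re (cinner y (P y)) / k" using k by (simp add: power2_eq_square)
    finally have "(norm (y - (1/k) *\<^sub>R P y))\<^sup>2 \<le> (norm y)\<^sup>2 - Re (cinner y (P y)) / k" by simp
    also have "\<dots> \<le> (norm y)\<^sup>2 - (e * (norm y)\<^sup>2) / k"
      using divide_right_mono[OF ge[of y], of k] k by simp
    also have "\<dots> = (\<rho> * norm y)\<^sup>2"
    proof -
      have "\<rho>\<^sup>2 = 1 - e / k" using ek by (simp add: \<rho>_def)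
      then have "(\<rho> * norm y)\<^sup>2 = (1 - e / k) * (norm y)\<^sup>2" by (simp only: power_mult_distrib)
      then show ?thesis by (simp add: left_diff_distrib)
    qed
    finally show ?thesis by (rule power2_le_imp_le) (use ek in \<open>auto simp: \<rho>_def\<close>)
  qed
  define f where "f = (\<lambda>x. x - (1/k) *\<^sub>R P x + (1/k) *\<^sub>R \<psi>)"
  have Plin: "P (x - y) = P x - P y" for x y by (rule bounded_clinear_diff[OF positive_op_clinear[OF P]])
  have "\<exists>!x. f x = x"
  proof (rule banach_fix_type[where c=\<rho>])
    show "\<rho> < 1" "0 \<le> \<rho>" using ek by (auto simp: \<rho>_def)
    show "\<forall>x y. dist (f x) (f y) \<le> \<rho> * dist x y"
    proof (intro allI)
      fix x y
      have "f x - f y = (x - y) - (1/k) *\<^sub>R P (x - y)"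
        by (simp add: f_def Plin scaleR_diff_right)
      then show "dist (f x) (f y) \<le> \<rho> * dist x y" using contr[of "x - y"] by (simp add: dist_norm)
    qed
  qed
  then obtain x where "f x = x" by blast
  then have "(1/k) *\<^sub>R \<psi> = (1/k) *\<^sub>R P x" unfolding f_def by (metis add_diff_cancel_left' diff_add_eq diff_diff_eq2)
  then have "P x = \<psi>" using k by simp
  then show ?thesis by (auto simp: P_def)
qed

text \<open>With \<open>R = |A|\<close>, the contraction \<open>A (R + \<epsilon>)\<^sup>-\<^sup>1\<close> replaces the partial isometry of the polar decomposition.\<close>

lemma polar_contraction:
  assumes A: "bounded_clinear A" "symmetric_op A" and e: "e > 0"
  shows "\<exists>W. symmetric_op W \<and> (\<forall>x. norm (W x) \<le> norm x) \<and>
    (\<forall>x. norm x = 1 \<longrightarrow> Re (cinner x (sqrt_op (A \<circ> A) x)) \<le> cmod (cinner (W x) (A x)) + e)"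
proof -
  define R where "R = sqrt_op (A \<circ> A)"
  note AA = positive_op_square[OF A]
  have R: "positive_op R" unfolding R_def by (rule positive_sqrt_op[OF AA])
  note cR = positive_op_clinear[OF R]
  have RR: "R (R x) = A (A x)" for x unfolding R_def using sqrt_op_square[OF AA, of x] by simp
  have RA: "A (R x) = R (A x)" for x
    unfolding R_def by (rule sqrt_op_commute[OF AA A(1)]) simp
  define P where "P = (\<lambda>x. R x + e *\<^sub>R x)"
  obtain T where T: "\<And>x. P (T x) = x" using resolvent_exists[OF R e] unfolding P_def by metis
  have Pnorm: "norm (P x) \<ge> norm (R x)" "norm (P x) \<ge> e * norm x" for x
  proof -
    have "(norm (P x))\<^sup>2 = (norm (R x))\<^sup>2 + 2 * e * Re (cinner x (R x)) + (e * norm x)\<^sup>2"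
      unfolding power2_norm_eq_inner power_mult_distrib
      by (simp add: P_def inner_add_left inner_add_right inner_commute[of "R x" x] inner_ell2_def[of x "R x"] power2_eq_square algebra_simps)
    moreover have "2 * e * Re (cinner x (R x)) \<ge> 0"
      using positive_op_form(1)[OF R, of x] e by (intro mult_nonneg_nonneg) auto
    ultimately have 1: "(norm (R x))\<^sup>2 \<le> (norm (P x))\<^sup>2" and 2: "(e * norm x)\<^sup>2 \<le> (norm (P x))\<^sup>2"
      using zero_le_power2[of "norm (R x)"] zero_le_power2[of "e * norm x"] by linarith+
    show "norm (P x) \<ge> norm (R x)" by (rule power2_le_imp_le[OF 1]) simp
    show "norm (P x) \<ge> e * norm x" by (rule power2_le_imp_le[OF 2]) simp
  qed
  have Pd: "P (x - y) = P x - P y" for x y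
    by (simp add: P_def bounded_clinear_diff[OF cR] scaleR_diff_right)
  have Pinj: "x = y" if "P x = P y" for x y
    using Pnorm(2)[of "x - y"] that e by (simp add: Pd mult_le_0_iff)
  have Psym: "cinner x (P y) = cinner (P x) y" for x y
    using symmetric_opD[OF positive_op_symmetric[OF R], of x y]
    by (simp add: P_def cinner_add_left cinner_add_right cinner_scaleR_left cinner_scaleR_right)
  have Tsym: "cinner x (T y) = cinner (T x) y" for x y
    using Psym[of "T x" "T y"] by (simp add: T)
  have PA: "A (P x) = P (A x)" for x
    by (simp add: P_def bounded_clinear_add[OF A(1)] RA scaleR_cscale bounded_clinear_scale[OF A(1)])
  have TA: "A (T x) = T (A x)" for x by (rule Pinj) (simp add: PA[symmetric] T)
  have PR: "R (P x) = P (R x)" for x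
    by (simp add: P_def bounded_clinear_add[OF cR] scaleR_cscale bounded_clinear_scale[OF cR])
  have TR: "R (T x) = T (R x)" for x by (rule Pinj) (simp add: PR[symmetric] T)
  have nA: "norm (A x) = norm (R x)" for x
  proof -
    have "cinner (A x) (A x) = cinner (R x) (R x)"
      using symmetric_opD[OF A(2), of x "A x"] symmetric_opD[OF positive_op_symmetric[OF R], of x "R x"] by (simp add: RR)
    then have "(norm (A x))\<^sup>2 = (norm (R x))\<^sup>2" by (simp only: cinner_self of_real_eq_iff)
    then show ?thesis by simp
  qed
  have nT: "norm (R (T x)) \<le> norm x" for x using Pnorm(1)[of "T x"] by (simp add: T)
  define W where "W = (\<lambda>x. A (T x))"
  have "symmetric_op W"
    unfolding symmetric_op_def
  proof (intro allI)
    fix x y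
    have "cinner x (A (T y)) = cinner (A x) (T y)" by (rule symmetric_opD[OF A(2)])
    also have "\<dots> = cinner (T (A x)) y" by (rule Tsym)
    finally show "cinner x (W y) = cinner (W x) y" by (simp add: W_def TA)
  qed
  moreover have "\<forall>x. norm (W x) \<le> norm x" using nT by (simp add: W_def nA)
  moreover have "Re (cinner x (R x)) \<le> cmod (cinner (W x) (A x)) + e" if "norm x = 1" for x
  proof -
    \<comment> \<open>From \<open>(R + e) T = 1\<close> and \<open>R R = A A\<close>. The first term
      is the polar form with \<open>W\<close>; the second is an error of size \<open>e\<close>,
      because \<open>R T\<close> is a contraction.\<close>
    have Rx: "R x = T (A (A x)) + e *\<^sub>R T (R x)"
    proof (rule Pinj)
      have "P (a + e *\<^sub>R b) = P a + e *\<^sub>R P b" for a b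
        by (simp add: P_def bounded_clinear_add[OF cR] scaleR_cscale[of _ "_ :: 'a ell2"] bounded_clinear_scale[OF cR])
           (auto intro!: ell2_eqI simp: coord_simps algebra_simps)
      then show "P (R x) = P (T (A (A x)) + e *\<^sub>R T (R x))"
        by (simp add: T RR[symmetric]) (simp add: P_def)
    qed
    have "cinner x (R x) = cinner x (T (A (A x))) + e * cinner x (T (R x))"
      by (subst Rx) (simp add: cinner_add_right cinner_scaleR_right)
    also have "cinner x (T (A (A x))) = cinner (W x) (A x)"
      by (simp add: Tsym W_def TA symmetric_opD[OF A(2)])
    finally have "Re (cinner x (R x)) = Re (cinner (W x) (A x)) + e * Re (cinner x (T (R x)))" by simp
    also have "Re (cinner (W x) (A x)) \<le> cmod (cinner (W x) (A x))" by (rule complex_Re_le_cmod)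
    also have "Re (cinner x (T (R x))) \<le> norm x * norm (T (R x))"
      using order_trans[OF complex_Re_le_cmod cmod_cinner_le] .
    also have "norm x * norm (T (R x)) \<le> 1" using nT[of x] that by (simp add: TR)
    finally show ?thesis using e by (simp add: mult_left_le)
  qed
  ultimately show ?thesis unfolding R_def by blast
qed

lemma finite_sum_le_if_infsum_ennreal_le:
  assumes "(\<Sum>\<^sub>\<infinity>i. ennreal (f i)) \<le> ennreal b" "finite F" "\<And>i. f i \<ge> 0" "b \<ge> 0"
  shows "sum f F \<le> b"
proof -
  have "ennreal (sum f F) = (\<Sum>i\<in>F. ennreal (f i))" using assms(3) by simp
  also have "\<dots> \<le> (\<Sum>\<^sub>\<infinity>i. ennreal (f i))" using assms(2) by (intro sum_le_infsum_ennreal) auto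
  finally show ?thesis using assms(1,4) by (meson ennreal_le_iff order_trans)
qed

lemma sum_mult_le_sqrt:
  fixes f g :: "'a \<Rightarrow> real"
  assumes "(\<Sum>i\<in>F. (f i)\<^sup>2) \<le> a" "(\<Sum>i\<in>F. (g i)\<^sup>2) \<le> b" "\<And>i. f i \<ge> 0" "\<And>i. g i \<ge> 0"
  shows "(\<Sum>i\<in>F. f i * g i) \<le> sqrt a * sqrt b"
proof -
  have "(\<Sum>i\<in>F. f i * g i) = (\<Sum>i\<in>F. \<bar>f i\<bar> * \<bar>g i\<bar>)" using assms by simp
  also have "\<dots> \<le> L2_set f F * L2_set g F" by (rule L2_set_mult_ineq)
  also have "\<dots> \<le> sqrt a * sqrt b" unfolding L2_set_def
    using assms(1,2) sum_nonneg[of F "\<lambda>i. (g i)\<^sup>2"] sum_nonneg[of F "\<lambda>i. (f i)\<^sup>2"]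
    by (intro mult_mono real_sqrt_le_mono) auto
  finally show ?thesis .
qed

lemma coproj_props:
  assumes "norm \<phi> = 1"
  shows coproj_orth: "cinner \<phi> (coproj \<phi> \<psi>) = 0"
    and coproj_sym: "cinner \<eta> (coproj \<phi> \<psi>) = cinner (coproj \<phi> \<eta>) \<psi>"
    and coproj_norm: "(norm \<psi>)\<^sup>2 = (norm (coproj \<phi> \<psi>))\<^sup>2 + (cmod (cinner \<phi> \<psi>))\<^sup>2"
    and coproj_decomp: "\<psi> = cinner \<phi> \<psi> *\<^sub>C \<phi> + coproj \<phi> \<psi>"
    and coproj_form: "cinner \<psi> (coproj \<phi> \<psi>) = complex_of_real ((norm (coproj \<phi> \<psi>))\<^sup>2)"
proof -
  have 1: "cinner \<phi> \<phi> = 1" using assms by (simp add: cinner_self)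
  show orth: "cinner \<phi> (coproj \<phi> \<psi>) = 0" for \<psi>
    by (simp add: coproj_def proj_def cinner_diff_right cinner_scale_right 1)
  show sym: "cinner \<eta> (coproj \<phi> \<psi>) = cinner (coproj \<phi> \<eta>) \<psi>" for \<eta> \<psi>
    using cinner_cnj[of \<eta> \<phi>]
    by (simp add: coproj_def proj_def cinner_diff_right cinner_diff_left cinner_scale_right cinner_scale_left)
  show dec: "\<psi> = cinner \<phi> \<psi> *\<^sub>C \<phi> + coproj \<phi> \<psi>" by (simp add: coproj_def proj_def)
  show form: "cinner \<psi> (coproj \<phi> \<psi>) = complex_of_real ((norm (coproj \<phi> \<psi>))\<^sup>2)"
  proof -
    have "cinner \<psi> (coproj \<phi> \<psi>) = cinner (cinner \<phi> \<psi> *\<^sub>C \<phi> + coproj \<phi> \<psi>) (coproj \<phi> \<psi>)" using dec by simp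
    then show ?thesis by (simp add: cinner_add_left cinner_scale_left orth cinner_self)
  qed
  have "cinner \<psi> \<psi> = cinner \<psi> (cinner \<phi> \<psi> *\<^sub>C \<phi> + coproj \<phi> \<psi>)" using dec by simp
  also have "\<dots> = cinner \<phi> \<psi> * cinner \<psi> \<phi> + complex_of_real ((norm (coproj \<phi> \<psi>))\<^sup>2)"
    by (simp only: cinner_add_right cinner_scale_right form)
  also have "cinner \<phi> \<psi> * cinner \<psi> \<phi> = complex_of_real ((cmod (cinner \<phi> \<psi>))\<^sup>2)"
    using cinner_cnj[of \<psi> \<phi>] by (simp only: complex_norm_square)
  finally show "(norm \<psi>)\<^sup>2 = (norm (coproj \<phi> \<psi>))\<^sup>2 + (cmod (cinner \<phi> \<psi>))\<^sup>2"
    by (simp only: cinner_self of_real_add[symmetric] of_real_eq_iff)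
qed

lemma infsum_coord_cnj: "(\<Sum>\<^sub>\<infinity>i. ennreal ((cmod (cinner \<psi> (ket i)))\<^sup>2)) = ennreal ((norm \<psi>)\<^sup>2)"
  by (simp add: cinner_ket_right ennreal_norm_eq)

text \<open>\<open>A = G - p\<close> is cut into blocks by \<open>1 = p + q\<close>. The
  \<open>p p\<close> block is the number \<open>-e\<close> with \<open>e = Tr (q G q)\<close>, and
  the others contain \<open>S q\<close> once or twice. Pairing with a contraction \<open>W\<close>
  in place of the polar isometry and using Cauchy-Schwarz for Hilbert-Schmidt norms bounds them by
  \<open>sqrt e\<close>, \<open>sqrt e\<close> and \<open>e\<close>.\<close>

theorem trace_norm_diff_proj_le:
  assumes G: "positive_op G" and tr: "trace_pos G = 1" and phi: "norm \<phi> = 1"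
    and eps: "(\<Sum>\<^sub>\<infinity>n. ennreal (Re (cinner (coproj \<phi> (ket n)) (G (coproj \<phi> (ket n)))))) \<le> ennreal \<epsilon>" "\<epsilon> \<ge> 0"
  shows "trace_norm (\<lambda>\<psi>. G \<psi> - proj \<phi> \<psi>) \<le> ennreal (4 * sqrt \<epsilon>)"
proof -
  define S where "S = sqrt_op G"
  have S: "positive_op S" unfolding S_def by (rule positive_sqrt_op[OF G])
  have SS: "S (S x) = G x" for x unfolding S_def by (rule sqrt_op_square[OF G])
  note cS = positive_op_clinear[OF S] and cG = positive_op_clinear[OF G]
  note symS = symmetric_opD[OF positive_op_symmetric[OF S]]
  note q = coproj_props[OF phi]
  have nS: "(norm (S x))\<^sup>2 = Re (cinner x (G x))" for x unfolding S_def by (rule norm_sqrt_op[OF G])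
  define A where "A = (\<lambda>\<psi>. G \<psi> - proj \<phi> \<psi>)"
  have Gsym: "cinner x (G y) = cinner (S x) (S y)" for x y by (simp add: SS[symmetric] symS)
  have Asym: "symmetric_op A"
    unfolding symmetric_op_def A_def
    using symmetric_opD[OF positive_op_symmetric[OF G]] cinner_cnj[of _ \<phi>]
    by (auto simp: cinner_diff_left cinner_diff_right proj_def cinner_scale_left cinner_scale_right)
  have Acl: "bounded_clinear A"
  proof -
    obtain K where K: "\<And>\<psi>. norm (G \<psi>) \<le> K * norm \<psi>"
      using bounded_linear.pos_bounded[OF bounded_clinear_linear[OF cG]] by (auto simp: mult.commute)
    show ?thesis
    proof (rule bounded_clinearI[where K="K + 1"])
      fix \<psi>
      have "norm (proj \<phi> \<psi>) \<le> norm \<psi>" using cmod_cinner_le[of \<phi> \<psi>] phi by (simp add: proj_def norm_cscale)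
      then show "norm (A \<psi>) \<le> (K + 1) * norm \<psi>"
        using norm_triangle_ineq4[of "G \<psi>" "proj \<phi> \<psi>"] K[of \<psi>] by (simp add: A_def algebra_simps)
    qed (auto simp: A_def proj_def bounded_clinear_add[OF cG] bounded_clinear_scale[OF cG] cinner_add_right
        cinner_scale_right coord_simps algebra_simps intro!: ell2_eqI)
  qed
  define E where "E = (\<Sum>\<^sub>\<infinity>n. ennreal ((norm (S (coproj \<phi> (ket n))))\<^sup>2))"
  have E_le: "E \<le> ennreal \<epsilon>" using eps(1) by (simp add: E_def nS)
  have swap: "(\<Sum>\<^sub>\<infinity>n. ennreal ((norm (coproj \<phi> (S (ket n))))\<^sup>2)) = E"
    unfolding E_def by (rule infsum_norm_swap) (simp add: q(2) symS)
  have trS: "(\<Sum>\<^sub>\<infinity>n. ennreal ((norm (S (ket n)))\<^sup>2)) = 1" using tr by (simp add: trace_pos_def nS)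
  \<comment> \<open>Trace one splits into \<open>Tr (q G q)\<close> and the expectation of
    \<open>G\<close> in \<phi>, so \<open>e\<close> is also the amount by which that expectation
    falls short of 1.\<close>
  have "(\<Sum>\<^sub>\<infinity>n. ennreal ((norm (S (ket n)))\<^sup>2)) =
    (\<Sum>\<^sub>\<infinity>n. ennreal ((norm (coproj \<phi> (S (ket n))))\<^sup>2) + ennreal ((cmod (cinner (S \<phi>) (ket n)))\<^sup>2))"
    by (intro infsum_cong) (simp add: q(3)[of "S (ket _)"] symS ennreal_plus[symmetric] del: ennreal_plus)
  also have "\<dots> = E + ennreal ((norm (S \<phi>))\<^sup>2)"
    by (simp add: infsum_add_ennreal swap infsum_coord_cnj)
  finally have sum1: "E + ennreal ((norm (S \<phi>))\<^sup>2) = 1" by (simp add: trS)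
  have "E \<le> E + ennreal ((norm (S \<phi>))\<^sup>2)" by simp
  then have "E \<le> 1" by (simp only: sum1)
  then have "E \<noteq> top" by (metis ennreal_one_less_top leD)
  then obtain e where e: "E = ennreal e" "e \<ge> 0" by (cases E) auto
  have e1: "e + (norm (S \<phi>))\<^sup>2 = 1"
    using sum1 e by (simp add: ennreal_plus[symmetric] del: ennreal_plus)
  have e_le: "e \<le> \<epsilon>" using E_le e eps(2) by simp
  have S\<phi>: "norm (S \<phi>) \<le> 1" by (rule power2_le_imp_le) (use e1 e(2) in auto)
  have ee: "e \<le> 1" using e1 zero_le_power2[of "norm (S \<phi>)"] by linarith
  have AG: "cinner \<phi> (G \<phi>) - 1 = - complex_of_real e"
    using e1 by (simp add: Gsym cinner_self complex_eq_iff del: of_real_power)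
  have phi1: "cinner \<phi> \<phi> = 1" using phi by (simp add: cinner_self)
  have fin: "(\<Sum>i\<in>F. Re (cinner (ket i) (sqrt_op (A \<circ> A) (ket i)))) \<le> 4 * sqrt e + \<delta> * card F"
    if F: "finite F" and \<delta>: "\<delta> > 0" for F and \<delta> :: real
  proof -
    obtain W where W: "symmetric_op W" "\<And>x. norm (W x) \<le> norm x"
      "\<And>x. norm x = 1 \<Longrightarrow> Re (cinner x (sqrt_op (A \<circ> A) x)) \<le> cmod (cinner (W x) (A x)) + \<delta>"
      using polar_contraction[OF Acl Asym \<delta>] by blast
    define c where "c i = cmod (cinner \<phi> (ket i))" for i
    define d where "d i = cmod (cinner \<phi> (W (ket i)))" for i
    define s where "s i = norm (S (coproj \<phi> (ket i)))" for i
    define w where "w i = norm (S (coproj \<phi> (W (ket i))))" for i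
    have nn: "c i \<ge> 0" "d i \<ge> 0" "s i \<ge> 0" "w i \<ge> 0" for i by (auto simp: c_def d_def s_def w_def)
    have c2: "(\<Sum>i\<in>F. (c i)\<^sup>2) \<le> 1"
      unfolding c_def by (rule finite_sum_le_if_infsum_ennreal_le[OF _ F]) (auto simp: infsum_coord_cnj phi)
    have d2: "(\<Sum>i\<in>F. (d i)\<^sup>2) \<le> 1"
    proof -
      have "(norm (W \<phi>))\<^sup>2 \<le> 1" using W(2)[of \<phi>] phi by (simp add: power_le_one)
      then show ?thesis
        unfolding d_def symmetric_opD[OF W(1)]
        by (intro finite_sum_le_if_infsum_ennreal_le[OF _ F]) (auto simp: infsum_coord_cnj)
    qed
    have s2: "(\<Sum>i\<in>F. (s i)\<^sup>2) \<le> e"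
      unfolding s_def using e by (intro finite_sum_le_if_infsum_ennreal_le[OF _ F]) (auto simp: E_def[symmetric])
    have w2: "(\<Sum>i\<in>F. (w i)\<^sup>2) \<le> e"
    proof -
      have "(\<Sum>\<^sub>\<infinity>i. ennreal ((w i)\<^sup>2)) = (\<Sum>\<^sub>\<infinity>i. ennreal ((norm (W (coproj \<phi> (S (ket i)))))\<^sup>2))"
        unfolding w_def by (rule infsum_norm_swap) (simp add: q(2) symS symmetric_opD[OF W(1)])
      also have "\<dots> \<le> (\<Sum>\<^sub>\<infinity>i. ennreal ((norm (coproj \<phi> (S (ket i))))\<^sup>2))"
        by (intro infsum_mono_ennreal ennreal_leI power_mono W) auto
      also have "\<dots> = ennreal e" by (simp add: swap e)
      finally show ?thesis using e by (intro finite_sum_le_if_infsum_ennreal_le[OF _ F]) auto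
    qed
    have each: "cmod (cinner (W (ket i)) (A (ket i))) \<le> d i * c i * e + d i * s i + c i * w i + w i * s i" for i
    proof -
      define x where "x = ket i"
      define y where "y = W (ket i)"
      have Ax: "A x = cinner \<phi> x *\<^sub>C (G \<phi>) + G (coproj \<phi> x) - cinner \<phi> x *\<^sub>C \<phi>"
        unfolding A_def proj_def
        by (subst (1) q(4)[of x]) (simp add: bounded_clinear_add[OF cG] bounded_clinear_scale[OF cG])
      have y: "cinner y z = cinner y \<phi> * cinner \<phi> z + cinner (coproj \<phi> y) z" for z
        using cinner_cnj[of y \<phi>] by (subst (1) q(4)[of y]) (simp add: cinner_add_left cinner_scale_left)
      have "cinner y (A x) = cinner y \<phi> * cinner \<phi> (A x) + cinner (coproj \<phi> y) (A x)" by (rule y)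
      also have "cinner \<phi> (A x) = cinner \<phi> x * (cinner \<phi> (G \<phi>) - 1) + cinner (S \<phi>) (S (coproj \<phi> x))"
        by (simp add: Ax cinner_add_right cinner_diff_right cinner_scale_right phi1 Gsym algebra_simps)
      also have "cinner (coproj \<phi> y) (A x) = cinner \<phi> x * cinner (S (coproj \<phi> y)) (S \<phi>) + cinner (S (coproj \<phi> y)) (S (coproj \<phi> x))"
        using q(1)[of y] cinner_cnj[of "coproj \<phi> y" \<phi>]
        by (simp add: Ax cinner_add_right cinner_diff_right cinner_scale_right Gsym)
      finally have eq: "cinner y (A x) = cinner y \<phi> * (cinner \<phi> x * (- complex_of_real e)) + cinner y \<phi> * cinner (S \<phi>) (S (coproj \<phi> x))
        + (cinner \<phi> x * cinner (S (coproj \<phi> y)) (S \<phi>) + cinner (S (coproj \<phi> y)) (S (coproj \<phi> x)))"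
        by (simp only: AG distrib_left)
      have dy: "cmod (cinner y \<phi>) = d i" unfolding d_def y_def by (subst cinner_cnj) simp
      have t1: "cmod (cinner y \<phi> * (cinner \<phi> x * (- complex_of_real e))) \<le> d i * c i * e"
        using e(2) by (simp add: norm_mult dy c_def x_def mult.assoc)
      have t2: "cmod (cinner y \<phi> * cinner (S \<phi>) (S (coproj \<phi> x))) \<le> d i * s i"
      proof -
        have "cmod (cinner (S \<phi>) (S (coproj \<phi> x))) \<le> norm (S \<phi>) * s i" unfolding s_def x_def by (rule cmod_cinner_le)
        also have "\<dots> \<le> 1 * s i" using S\<phi> by (intro mult_right_mono nn) auto
        finally show ?thesis using nn by (simp add: norm_mult dy mult_left_mono)
      qed
      have t3: "cmod (cinner \<phi> x * cinner (S (coproj \<phi> y)) (S \<phi>)) \<le> c i * w i"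
      proof -
        have "cmod (cinner (S (coproj \<phi> y)) (S \<phi>)) \<le> w i * norm (S \<phi>)" unfolding w_def y_def by (rule cmod_cinner_le)
        also have "\<dots> \<le> w i * 1" using S\<phi> by (intro mult_left_mono nn) auto
        finally show ?thesis using nn by (simp add: norm_mult c_def x_def mult_left_mono)
      qed
      have t4: "cmod (cinner (S (coproj \<phi> y)) (S (coproj \<phi> x))) \<le> w i * s i"
        unfolding w_def s_def x_def y_def by (rule cmod_cinner_le)
      have "cmod (cinner y (A x)) \<le> d i * c i * e + d i * s i + (c i * w i + w i * s i)"
        unfolding eq using t1 t2 t3 t4 by (intro order_trans[OF norm_triangle_ineq] add_mono) auto
      then show ?thesis by (simp add: x_def y_def)
    qed
    have "(\<Sum>i\<in>F. Re (cinner (ket i) (sqrt_op (A \<circ> A) (ket i)))) \<le> (\<Sum>i\<in>F. (d i * c i * e + d i * s i + c i * w i + w i * s i) + \<delta>)"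
      by (intro sum_mono order_trans[OF W(3)] add_right_mono each) auto
    also have "\<dots> = (\<Sum>i\<in>F. d i * c i) * e + (\<Sum>i\<in>F. d i * s i) + (\<Sum>i\<in>F. c i * w i) + (\<Sum>i\<in>F. w i * s i) + \<delta> * card F"
      by (simp add: sum.distrib sum_distrib_right)
    also have "\<dots> \<le> (sqrt 1 * sqrt 1) * e + sqrt 1 * sqrt e + sqrt 1 * sqrt e + sqrt e * sqrt e + \<delta> * card F"
      using e(2) by (intro add_mono mult_right_mono sum_mult_le_sqrt c2 d2 s2 w2 nn order_refl)
    \<comment> \<open>The four blocks give \<open>e + sqrt e + sqrt e + e\<close>; since
      \<open>e \<le> 1\<close>, this is at most \<open>4 * sqrt e\<close>.\<close>
    also have "\<dots> = 2 * e + 2 * sqrt e + \<delta> * card F" using e(2) by simp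
    also have "\<dots> \<le> 4 * sqrt e + \<delta> * card F"
    proof -
      have "e = sqrt e * sqrt e" using e(2) by simp
      also have "\<dots> \<le> sqrt e * 1" using ee e(2) by (intro mult_left_mono) auto
      finally show ?thesis by simp
    qed
    finally show ?thesis .
  qed
  \<comment> \<open>The error \<delta> of the regularised polar decomposition is paid once per basis
    vector, so it is removed on each finite set before the supremum is taken.\<close>
  have fin': "(\<Sum>i\<in>F. Re (cinner (ket i) (sqrt_op (A \<circ> A) (ket i)))) \<le> 4 * sqrt e" if F: "finite F" for F
  proof (rule field_le_epsilon)
    fix r :: real assume r: "r > 0"
    have "r / (real (card F) + 1) * card F \<le> r" using r by (simp add: field_simps)
    then show "(\<Sum>i\<in>F. Re (cinner (ket i) (sqrt_op (A \<circ> A) (ket i)))) \<le> 4 * sqrt e + r"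
      using fin[OF F, of "r / (real (card F) + 1)"] r by fastforce
  qed
  have absA: "abs_op A = sqrt_op (A \<circ> A)" by (simp add: abs_op_def adj_symmetric[OF Asym])
  have "trace_norm A \<le> ennreal (4 * sqrt e)"
    unfolding trace_norm_def trace_pos_def absA
  proof (rule infsum_le_ennreal)
    fix F :: "'a set" assume F: "finite F"
    have "(\<Sum>i\<in>F. ennreal (Re (cinner (ket i) (sqrt_op (A \<circ> A) (ket i)))))
       = ennreal (\<Sum>i\<in>F. Re (cinner (ket i) (sqrt_op (A \<circ> A) (ket i))))"
      by (rule sum_ennreal) (rule positive_op_form(1)[OF positive_sqrt_op[OF positive_op_square[OF Acl Asym]]])
    also have "\<dots> \<le> ennreal (4 * sqrt e)" by (rule ennreal_leI[OF fin'[OF F]])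
    finally show "(\<Sum>i\<in>F. ennreal (Re (cinner (ket i) (sqrt_op (A \<circ> A) (ket i))))) \<le> ennreal (4 * sqrt e)" .
  qed
  also have "\<dots> \<le> ennreal (4 * sqrt \<epsilon>)" using e_le by (intro ennreal_leI) simp
  finally show ?thesis by (simp add: A_def)
qed

section \<open>Finitely supported vectors and their operators\<close>

text \<open>On finitely supported families all operators are total and have total adjoints, so that operator
  identities need no domain conditions; the passage to \<open>\<ell>\<^sup>2\<close> is by density.\<close>

typedef 'i fs = "{f :: 'i \<Rightarrow> complex. finite {i. f i \<noteq> 0}}"
  morphisms fc Abs_fs
  by (rule exI[of _ "\<lambda>_. 0"]) simp

setup_lifting type_definition_fs

lemma fc_finite: "finite {i. fc f i \<noteq> 0}" using fc[of f] by simp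

lemma fs_eqI: "(\<And>i. fc f i = fc g i) \<Longrightarrow> f = g"
  by (simp add: fc_inject[symmetric] fun_eq_iff)

lift_definition fscale :: "complex \<Rightarrow> 'i fs \<Rightarrow> 'i fs" (infixr "*\<^sub>F" 75)
  is "\<lambda>c f i. c * f i" by (auto elim: rev_finite_subset)

lift_definition emb :: "'i fs \<Rightarrow> 'i ell2" is "\<lambda>f. f"
  by (rule finite_nonzero_values_imp_summable_on) simp

instantiation fs :: (type) real_vector
begin

lift_definition zero_fs :: "'a fs" is "\<lambda>_. 0" by simp
lift_definition plus_fs :: "'a fs \<Rightarrow> 'a fs \<Rightarrow> 'a fs" is "\<lambda>f g i. f i + g i"
  subgoal for f g by (rule finite_subset[of _ "{i. f i \<noteq> 0} \<union> {i. g i \<noteq> 0}"]) auto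
  done
lift_definition uminus_fs :: "'a fs \<Rightarrow> 'a fs" is "\<lambda>f i. - f i" by simp
lift_definition minus_fs :: "'a fs \<Rightarrow> 'a fs \<Rightarrow> 'a fs" is "\<lambda>f g i. f i - g i"
  subgoal for f g by (rule finite_subset[of _ "{i. f i \<noteq> 0} \<union> {i. g i \<noteq> 0}"]) auto
  done
lift_definition scaleR_fs :: "real \<Rightarrow> 'a fs \<Rightarrow> 'a fs" is "\<lambda>r f i. complex_of_real r * f i"
  by (auto elim: rev_finite_subset)

instance
  by standard (transfer; simp add: fun_eq_iff algebra_simps)+

end

lemmas fc_simps = plus_fs.rep_eq minus_fs.rep_eq uminus_fs.rep_eq zero_fs.rep_eq scaleR_fs.rep_eq fscale.rep_eq

lemma coord_emb: "coord (emb f) i = fc f i" by (simp add: emb.rep_eq)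

lemma emb_add: "emb (f + g) = emb f + emb g" by (rule ell2_eqI) (simp add: coord_emb coord_simps fc_simps)
lemma emb_diff: "emb (f - g) = emb f - emb g" by (rule ell2_eqI) (simp add: coord_emb coord_simps fc_simps)
lemma emb_scale: "emb (c *\<^sub>F g) = c *\<^sub>C emb g" by (rule ell2_eqI) (simp add: coord_emb coord_simps fc_simps)
lemma emb_scaleR: "emb (r *\<^sub>R g) = r *\<^sub>R emb g" by (rule ell2_eqI) (simp add: coord_emb coord_simps fc_simps)
lemma emb_zero: "emb f = 0 \<longleftrightarrow> f = 0"
proof
  assume "emb f = 0"
  then have "fc f i = 0" for i using coord_emb[of f i] by (simp add: coord_simps)
  then show "f = 0" by (intro fs_eqI) (simp add: fc_simps)
qed (auto intro!: ell2_eqI simp: coord_emb coord_simps fc_simps)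

definition cip :: "'i fs \<Rightarrow> 'i fs \<Rightarrow> complex" where
  "cip f g = cinner (emb f) (emb g)"

instantiation fs :: (type) real_inner
begin

definition inner_fs :: "'a fs \<Rightarrow> 'a fs \<Rightarrow> real" where "inner_fs \<psi> \<eta> = inner (emb \<psi>) (emb \<eta>)"
definition norm_fs :: "'a fs \<Rightarrow> real" where "norm_fs \<psi> = sqrt (inner \<psi> \<psi>)"
definition dist_fs :: "'a fs \<Rightarrow> 'a fs \<Rightarrow> real" where "dist_fs \<psi> \<eta> = norm (\<psi> - \<eta>)"
definition sgn_fs :: "'a fs \<Rightarrow> 'a fs" where "sgn_fs \<psi> = inverse (norm \<psi>) *\<^sub>R \<psi>"
definition uniformity_fs :: "('a fs \<times> 'a fs) filter" where
  "uniformity_fs = (INF e\<in>{0 <..}. principal {(\<psi>, \<eta>). dist \<psi> \<eta> < e})"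
definition open_fs :: "'a fs set \<Rightarrow> bool" where
  "open_fs U \<longleftrightarrow> (\<forall>x\<in>U. \<forall>\<^sub>F (x', y) in uniformity. x' = x \<longrightarrow> y \<in> U)"

instance
  by standard
    (simp_all add: norm_fs_def dist_fs_def sgn_fs_def uniformity_fs_def open_fs_def inner_fs_def
      emb_add emb_scaleR emb_zero inner_commute inner_add_left inner_add_right)

end

lemma norm_emb: "norm (emb f) = norm f" by (simp add: norm_fs_def inner_fs_def norm_eq_sqrt_inner)

lemma cip_infsum: "cip f g = (\<Sum>\<^sub>\<infinity>i. cnj (fc f i) * fc g i)"
  by (simp add: cip_def cinner_def coord_emb)

lemma cip_sum:
  assumes "finite S" "\<And>i. i \<notin> S \<Longrightarrow> fc f i = 0 \<or> fc g i = 0"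
  shows "cip f g = (\<Sum>i\<in>S. cnj (fc f i) * fc g i)"
proof -
  have "cip f g = (\<Sum>\<^sub>\<infinity>i\<in>S. cnj (fc f i) * fc g i)"
    unfolding cip_infsum by (rule infsum_cong_neutral) (use assms(2) in auto)
  then show ?thesis using assms(1) by simp
qed

lemma cip_add_left: "cip (f + g) h = cip f h + cip g h" by (simp add: cip_def emb_add cinner_add_left)
lemma cip_add_right: "cip h (f + g) = cip h f + cip h g" by (simp add: cip_def emb_add cinner_add_right)
lemma cip_diff_left: "cip (f - g) h = cip f h - cip g h" by (simp add: cip_def emb_diff cinner_diff_left)
lemma cip_diff_right: "cip h (f - g) = cip h f - cip h g" by (simp add: cip_def emb_diff cinner_diff_right)
lemma cip_scale_left: "cip (c *\<^sub>F f) h = cnj c * cip f h" by (simp add: cip_def emb_scale cinner_scale_left)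
lemma cip_scale_right: "cip h (c *\<^sub>F f) = c * cip h f" by (simp add: cip_def emb_scale cinner_scale_right)
lemma cip_zero [simp]: "cip 0 f = 0" "cip f 0 = 0" by (simp_all add: cip_infsum fc_simps)
lemma cip_uminus_left: "cip (- f) h = - cip f h" using cip_diff_left[of 0 f h] by simp
lemma cip_sum_right: "cip h (\<Sum>x\<in>A. f x) = (\<Sum>x\<in>A. cip h (f x))"
  by (induction A rule: infinite_finite_induct) (auto simp: cip_add_right)
lemma cip_sum_left: "cip (\<Sum>x\<in>A. f x) h = (\<Sum>x\<in>A. cip (f x) h)"
  by (induction A rule: infinite_finite_induct) (auto simp: cip_add_left)
lemma cip_cnj: "cip g f = cnj (cip f g)" unfolding cip_def by (rule cinner_cnj)
lemma cip_self: "cip f f = complex_of_real ((norm f)\<^sup>2)" by (simp add: cip_def cinner_self norm_emb)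
lemma cmod_cip_le: "cmod (cip f g) \<le> norm f * norm g"
  using cmod_cinner_le[of "emb f" "emb g"] by (simp add: cip_def norm_emb)
lemma norm_fscale: "norm (c *\<^sub>F f) = cmod c * norm f"
  using norm_cscale[of c "emb f"] by (simp add: emb_scale[symmetric] norm_emb)

lemmas cip_simps = cip_add_left cip_add_right cip_diff_left cip_diff_right cip_scale_left cip_scale_right

lemma cip_eqI:
  assumes "\<And>h. cip h f = cip h g"
  shows "f = g"
proof -
  have "cip (f - g) (f - g) = 0" using assms[of "f - g"] by (simp add: cip_diff_right)
  then show ?thesis by (simp add: cip_self)
qed

section \<open>Adjoint pairs and the operators at one site\<close>

definition adjp :: "('i fs \<Rightarrow> 'j fs) \<Rightarrow> ('j fs \<Rightarrow> 'i fs) \<Rightarrow> bool" where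
  "adjp T T' \<longleftrightarrow> (\<forall>f g. cip f (T g) = cip (T' f) g)"

lemma adjpD: "adjp T T' \<Longrightarrow> cip f (T g) = cip (T' f) g" by (simp add: adjp_def)

lemma adjp_sym: "adjp T T' \<Longrightarrow> adjp T' T"
  unfolding adjp_def by (metis cip_cnj)

lemma adjp_add: "adjp T T' \<Longrightarrow> T (f + g) = T f + T g"
  by (rule cip_eqI) (simp add: adjpD cip_add_right)
lemma adjp_diff: "adjp T T' \<Longrightarrow> T (f - g) = T f - T g"
  by (rule cip_eqI) (simp add: adjpD cip_diff_right)
lemma adjp_scale: "adjp T T' \<Longrightarrow> T (c *\<^sub>F g) = c *\<^sub>F T g"
  by (rule cip_eqI) (simp add: adjpD cip_scale_right)
text \<open>An operator is determined by its adjoint, so identities in which \<open>kbf\<close> acts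
  last follow from the coordinatewise ones in which it acts first. The linearity rules above
  likewise come from the pairing alone.\<close>

lemma adjp_eq:
  assumes "adjp T T'" "adjp R R'" "\<And>f. T' f = R' f"
  shows "T f = R f"
  by (rule cip_eqI) (simp add: adjpD[OF assms(1)] adjpD[OF assms(2)] assms(3))

lemma adjp_compose: "adjp T T' \<Longrightarrow> adjp R R' \<Longrightarrow> adjp (\<lambda>f. T (R f)) (\<lambda>f. R' (T' f))"
  by (simp add: adjp_def)

text \<open>With \<open>B\<^sub>x\<close> for \<open>B\<close> acting at the site \<open>x\<close>: \<open>anf x\<close> is \<open>a\<^sub>x\<close>, \<open>crf x\<close> is \<open>a\<^sub>x\<^sup>*\<close>, \<open>dgf r x\<close> is \<open>r(N\<^sub>x)\<close>, and
  \<open>kbf x w z\<close> is \<open>|w\<rangle>\<langle>z|\<^sub>x\<close>; \<open>an1\<close>, \<open>cr1\<close>, \<open>dg1\<close> are the one-site operators.\<close>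

lift_definition anf :: "'s \<Rightarrow> ('s \<Rightarrow> nat) fs \<Rightarrow> ('s \<Rightarrow> nat) fs"
  is "\<lambda>x f c. complex_of_real (sqrt (real (c x + 1))) * f (c(x := c x + 1))"
  subgoal for x f
    by (rule finite_subset[of _ "(\<lambda>c. c(x := c x - 1)) ` {c. f c \<noteq> 0}"])
       (auto intro!: image_eqI[of _ _ "c(x := Suc (c x))" for c])
  done

lift_definition crf :: "'s \<Rightarrow> ('s \<Rightarrow> nat) fs \<Rightarrow> ('s \<Rightarrow> nat) fs"
  is "\<lambda>x f c. complex_of_real (sqrt (real (c x))) * f (c(x := c x - 1))"
  subgoal for x f
    by (rule finite_subset[of _ "(\<lambda>c. c(x := c x + 1)) ` {c. f c \<noteq> 0}"])
       (auto intro!: image_eqI[of _ _ "c(x := c x - 1)" for c])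
  done

lift_definition dgf :: "(nat \<Rightarrow> real) \<Rightarrow> 's \<Rightarrow> ('s \<Rightarrow> nat) fs \<Rightarrow> ('s \<Rightarrow> nat) fs"
  is "\<lambda>r x f c. complex_of_real (r (c x)) * f c"
  by (auto elim: rev_finite_subset)

lift_definition an1 :: "nat fs \<Rightarrow> nat fs" is "\<lambda>f n. complex_of_real (sqrt (real (n + 1))) * f (n + 1)"
  subgoal for f
    by (rule finite_subset[of _ "(\<lambda>n. n - 1) ` {c. f c \<noteq> 0}"])
       (auto intro!: image_eqI[of _ _ "Suc c" for c])
  done

lift_definition cr1 :: "nat fs \<Rightarrow> nat fs" is "\<lambda>f n. complex_of_real (sqrt (real n)) * f (n - 1)"
  subgoal for f
    by (rule finite_subset[of _ "Suc ` {c. f c \<noteq> 0}"])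
       (auto intro!: image_eqI[of _ _ "c - 1" for c])
  done

lift_definition dg1 :: "(nat \<Rightarrow> real) \<Rightarrow> nat fs \<Rightarrow> nat fs" is "\<lambda>r f n. complex_of_real (r n) * f n"
  by (auto elim: rev_finite_subset)

lift_definition kbf :: "'s \<Rightarrow> nat fs \<Rightarrow> nat fs \<Rightarrow> ('s \<Rightarrow> nat) fs \<Rightarrow> ('s \<Rightarrow> nat) fs"
  is "\<lambda>x w z f c. w (c x) * (\<Sum>\<^sub>\<infinity>n. cnj (z n) * f (c(x := n)))"
  subgoal for x w z f
  proof (rule finite_subset)
    show "{c. w (c x) * (\<Sum>\<^sub>\<infinity>n. cnj (z n) * f (c(x := n))) \<noteq> 0} \<subseteq>
      (\<lambda>(c, m). c(x := m)) ` ({c. f c \<noteq> 0} \<times> {m. w m \<noteq> 0})"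
    proof
      fix c assume "c \<in> {c. w (c x) * (\<Sum>\<^sub>\<infinity>n. cnj (z n) * f (c(x := n))) \<noteq> 0}"
      then have w: "w (c x) \<noteq> 0" and s: "(\<Sum>\<^sub>\<infinity>n. cnj (z n) * f (c(x := n))) \<noteq> 0" by auto
      from s obtain n where "f (c(x := n)) \<noteq> 0" by (metis (mono_tags, lifting) infsum_0 mult_zero_right)
      with w show "c \<in> (\<lambda>(c, m). c(x := m)) ` ({c. f c \<noteq> 0} \<times> {m. w m \<noteq> 0})"
        by (intro image_eqI[of _ _ "(c(x := n), c x)"]) auto
    qed
  qed auto
  done

lemmas op_rep = anf.rep_eq crf.rep_eq dgf.rep_eq an1.rep_eq cr1.rep_eq dg1.rep_eq kbf.rep_eq fc_simps

lemma adjp_anf: "adjp (anf x) (crf x)"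
  unfolding adjp_def
proof (intro allI)
  fix f g :: "('a \<Rightarrow> nat) fs"
  have "cip f (anf x g) = (\<Sum>\<^sub>\<infinity>c. cnj (fc f c) * (complex_of_real (sqrt (real (c x + 1))) * fc g (c(x := c x + 1))))"
    by (simp add: cip_infsum op_rep)
  \<comment> \<open>The shift by one particle misses the configurations with \<open>c x = 0\<close>;
    there the factor \<open>sqrt (real (c x))\<close> vanishes, which also hides the truncated
    subtraction in \<open>crf\<close>.\<close>
  also have "\<dots> = (\<Sum>\<^sub>\<infinity>c\<in>{c. c x > 0}. cnj (complex_of_real (sqrt (real (c x))) * fc f (c(x := c x - 1))) * fc g c)"
    by (rule infsum_reindex_bij_witness[of _ "\<lambda>c. c(x := c x - 1)" "\<lambda>c. c(x := c x + 1)"]) auto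
  also have "\<dots> = (\<Sum>\<^sub>\<infinity>c. cnj (complex_of_real (sqrt (real (c x))) * fc f (c(x := c x - 1))) * fc g c)"
    by (rule infsum_cong_neutral) auto
  also have "\<dots> = cip (crf x f) g" by (simp add: cip_infsum op_rep)
  finally show "cip f (anf x g) = cip (crf x f) g" .
qed

lemma adjp_crf: "adjp (crf x) (anf x)" by (rule adjp_sym[OF adjp_anf])

lemma adjp_dgf: "adjp (dgf r x) (dgf r x)"
  by (simp add: adjp_def cip_infsum op_rep mult_ac)

lemma adjp_an1: "adjp an1 cr1"
  unfolding adjp_def
proof (intro allI)
  fix f g :: "nat fs"
  have "cip f (an1 g) = (\<Sum>\<^sub>\<infinity>c. cnj (fc f c) * (complex_of_real (sqrt (real (c + 1))) * fc g (c + 1)))"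
    by (simp add: cip_infsum op_rep)
  also have "\<dots> = (\<Sum>\<^sub>\<infinity>c\<in>{0<..}. cnj (complex_of_real (sqrt (real c)) * fc f (c - 1)) * fc g c)"
    by (rule infsum_reindex_bij_witness[of _ "\<lambda>c. c - 1" "\<lambda>c. c + 1"]) auto
  also have "\<dots> = (\<Sum>\<^sub>\<infinity>c. cnj (complex_of_real (sqrt (real c)) * fc f (c - 1)) * fc g c)"
    by (rule infsum_cong_neutral) auto
  also have "\<dots> = cip (cr1 f) g" by (simp add: cip_infsum op_rep)
  finally show "cip f (an1 g) = cip (cr1 f) g" .
qed

lemma adjp_cr1: "adjp cr1 an1" by (rule adjp_sym[OF adjp_an1])

lemma adjp_dg1: "adjp (dg1 r) (dg1 r)"
  by (simp add: adjp_def cip_infsum op_rep mult_ac)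

text \<open>Both sides expand into double sums over a configuration and one extra occupation number.
  The involution that exchanges this number with \<open>c x\<close> carries one sum into the
  other.\<close>

lemma adjp_kbf: "adjp (kbf x w z) (kbf x z w)"
  unfolding adjp_def
proof (intro allI)
  fix f g :: "('a \<Rightarrow> nat) fs"
  define T where "T = (\<lambda>(c, n). cnj (fc f c) * fc w (c x) * (cnj (fc z n) * fc g (c(x := n))))"
  have fin: "finite {p. T p \<noteq> 0}"
    by (rule finite_subset[of _ "{c. fc f c \<noteq> 0} \<times> {n. fc z n \<noteq> 0}"]) (auto simp: T_def fc_finite)
  have sT: "T summable_on Sigma UNIV (\<lambda>_. UNIV)"
    by (rule finite_nonzero_values_imp_summable_on) (use fin in simp)
  define T' where "T' = (\<lambda>(c, n). cnj (fc z (c x)) * (fc w n * cnj (fc f (c(x := n)))) * fc g c)"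
  have T': "T' (c(x := n), c x) = T (c, n)" for c n by (simp add: T_def T'_def)
  have inv: "(\<lambda>(c, n). (c(x := n), c x)) ((\<lambda>(c, n). (c(x := n), c x)) p) = p" for p :: "('a \<Rightarrow> nat) \<times> nat" by (cases p) simp
  have sT': "T' summable_on Sigma UNIV (\<lambda>_. UNIV)"
  proof (rule finite_nonzero_values_imp_summable_on)
    have "{p. T' p \<noteq> 0} \<subseteq> (\<lambda>(c, n). (c(x := n), c x)) ` {p. T p \<noteq> 0}"
    proof
      fix p assume p: "p \<in> {p. T' p \<noteq> 0}"
      obtain c n where cn: "p = (c, n)" by (cases p)
      have "T (c(x := n), c x) = T' p" by (simp add: T_def T'_def cn mult_ac)
      then show "p \<in> (\<lambda>(c, n). (c(x := n), c x)) ` {p. T p \<noteq> 0}"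
        using p by (intro image_eqI[of _ _ "(c(x := n), c x)"]) (auto simp: cn)
    qed
    then show "finite {p \<in> Sigma UNIV (\<lambda>_. UNIV). T' p \<noteq> 0}" using fin by (auto intro: finite_subset)
  qed
  have "cip f (kbf x w z g) = (\<Sum>\<^sub>\<infinity>c. \<Sum>\<^sub>\<infinity>n. T (c, n))"
    by (simp add: cip_infsum op_rep T_def infsum_cmult_right' mult.assoc)
  also have "\<dots> = infsum T (Sigma UNIV (\<lambda>_. UNIV))" by (rule infsum_Sigma_banach[OF sT])
  also have "\<dots> = infsum T' (Sigma UNIV (\<lambda>_. UNIV))"
    by (rule infsum_reindex_bij_witness[of _ "\<lambda>(c, n). (c(x := n), c x)" "\<lambda>(c, n). (c(x := n), c x)"]) (auto simp: T')
  also have "\<dots> = (\<Sum>\<^sub>\<infinity>c. \<Sum>\<^sub>\<infinity>n. T' (c, n))" by (rule infsum_Sigma_banach[OF sT', symmetric])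
  also have "\<dots> = cip (kbf x z w f) g"
  proof -
    have "(\<Sum>\<^sub>\<infinity>n. T' (c, n)) = cnj (fc (kbf x z w f) c) * fc g c" for c
    proof -
      have "cnj (fc (kbf x z w f) c) * fc g c = cnj (fc z (c x)) * (\<Sum>\<^sub>\<infinity>n. fc w n * cnj (fc f (c(x := n)))) * fc g c"
        by (simp add: op_rep infsum_cnj[symmetric] del: infsum_cnj)
      also have "\<dots> = (\<Sum>\<^sub>\<infinity>n. T' (c, n))"
        by (simp add: T'_def infsum_cmult_right' infsum_cmult_left')
      finally show ?thesis by simp
    qed
    then show ?thesis by (simp add: cip_infsum)
  qed
  finally show "cip f (kbf x w z g) = cip (kbf x z w f) g" .
qed

lemma kbf_kbf: "kbf x w z (kbf x w' z' f) = cip z w' *\<^sub>F kbf x w z' f"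
proof (rule fs_eqI)
  fix c
  have "(\<Sum>\<^sub>\<infinity>n. cnj (fc z n) * (fc w' n * s)) = cip z w' * s" for s
    by (simp add: cip_infsum infsum_cmult_left'[symmetric] mult.assoc)
  then show "fc (kbf x w z (kbf x w' z' f)) c = fc (cip z w' *\<^sub>F kbf x w z' f) c"
    by (simp add: op_rep)
qed

lemma fs_sum_swap:
  "(\<Sum>\<^sub>\<infinity>n. cnj (fc z n) * (\<Sum>\<^sub>\<infinity>m. cnj (fc z' m) * F n m)) = (\<Sum>\<^sub>\<infinity>m. cnj (fc z' m) * (\<Sum>\<^sub>\<infinity>n. cnj (fc z n) * F n m))"
proof -
  have "(\<lambda>(n, m). cnj (fc z n) * (cnj (fc z' m) * F n m)) summable_on UNIV \<times> UNIV"
    by (rule finite_nonzero_values_imp_summable_on)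
       (rule finite_subset[of _ "{n. fc z n \<noteq> 0} \<times> {n. fc z' n \<noteq> 0}"], auto simp: fc_finite)
  from infsum_swap_banach[OF this] show ?thesis
    by (simp add: infsum_cmult_right'[symmetric] mult.left_commute)
qed

lemma fs_sum_pull: "(\<Sum>\<^sub>\<infinity>n. cnj (fc z n) * (k * F n)) = k * (\<Sum>\<^sub>\<infinity>n. cnj (fc z n) * F n)"
  by (simp add: infsum_cmult_right'[symmetric] mult.left_commute)

lemma kbf_kbf_commute:
  assumes "x \<noteq> y"
  shows "kbf x w z (kbf y w' z' f) = kbf y w' z' (kbf x w z f)"
proof (rule fs_eqI)
  fix c
  have "fc (kbf x w z (kbf y w' z' f)) c =
    fc w (c x) * (fc w' (c y) * (\<Sum>\<^sub>\<infinity>n. cnj (fc z n) * (\<Sum>\<^sub>\<infinity>m. cnj (fc z' m) * fc f (c(x := n, y := m)))))"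
    using assms by (simp add: op_rep fs_sum_pull)
  also have "\<dots> = fc w (c x) * (fc w' (c y) * (\<Sum>\<^sub>\<infinity>m. cnj (fc z' m) * (\<Sum>\<^sub>\<infinity>n. cnj (fc z n) * fc f (c(x := n, y := m)))))"
    by (simp only: fs_sum_swap[of z z' "\<lambda>n m. fc f (c(x := n, y := m))"])
  also have "\<dots> = fc (kbf y w' z' (kbf x w z f)) c"
    using assms by (simp add: op_rep fs_sum_pull fun_upd_twist)
  finally show "fc (kbf x w z (kbf y w' z' f)) c = fc (kbf y w' z' (kbf x w z f)) c" .
qed

lemma anf_kbf: "anf x (kbf x w z f) = kbf x (an1 w) z f"
  by (rule fs_eqI) (simp add: op_rep mult_ac)
lemma crf_kbf: "crf x (kbf x w z f) = kbf x (cr1 w) z f"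
  by (rule fs_eqI) (simp add: op_rep mult_ac)
lemma dgf_kbf: "dgf r x (kbf x w z f) = kbf x (dg1 r w) z f"
  by (rule fs_eqI) (simp add: op_rep mult_ac)

lemma kbf_anf: "kbf x w z (anf x f) = kbf x w (cr1 z) f"
  by (rule adjp_eq[OF adjp_compose[OF adjp_kbf adjp_anf] adjp_kbf]) (simp add: crf_kbf)
lemma kbf_crf: "kbf x w z (crf x f) = kbf x w (an1 z) f"
  by (rule adjp_eq[OF adjp_compose[OF adjp_kbf adjp_crf] adjp_kbf]) (simp add: anf_kbf)
lemma kbf_dgf: "kbf x w z (dgf r x f) = kbf x w (dg1 r z) f"
  by (rule adjp_eq[OF adjp_compose[OF adjp_kbf adjp_dgf] adjp_kbf]) (simp add: dgf_kbf)

lemma kbf_anf_commute: "x \<noteq> y \<Longrightarrow> kbf x w z (anf y f) = anf y (kbf x w z f)"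
  by (rule fs_eqI) (simp add: op_rep fs_sum_pull fun_upd_twist)
lemma kbf_crf_commute: "x \<noteq> y \<Longrightarrow> kbf x w z (crf y f) = crf y (kbf x w z f)"
  by (rule adjp_eq[OF adjp_compose[OF adjp_kbf adjp_crf] adjp_compose[OF adjp_crf adjp_kbf]]) (simp add: kbf_anf_commute)
lemma kbf_dgf_commute: "x \<noteq> y \<Longrightarrow> kbf x w z (dgf r y f) = dgf r y (kbf x w z f)"
  by (rule fs_eqI) (simp add: op_rep fs_sum_pull fun_upd_twist)

lemma dgf_anf_commute: "x \<noteq> y \<Longrightarrow> dgf r x (anf y f) = anf y (dgf r x f)"
  by (rule fs_eqI) (simp add: op_rep mult_ac)
lemma dgf_crf_commute: "x \<noteq> y \<Longrightarrow> dgf r x (crf y f) = crf y (dgf r x f)"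
  by (rule fs_eqI) (simp add: op_rep mult_ac)
lemma dgf_dgf_commute: "dgf r x (dgf s y f) = dgf s y (dgf r x f)"
  by (rule fs_eqI) (simp add: op_rep mult_ac)

lemma sqrt_mult_self_complex: "complex_of_real (sqrt (real n)) * (complex_of_real (sqrt (real n)) * z) = of_nat n * z"
  by (simp add: mult.assoc[symmetric] of_real_mult[symmetric] del: of_real_mult)

lemma crf_anf: "crf x (anf x f) = dgf real x f"
proof (rule fs_eqI)
  fix c show "fc (crf x (anf x f)) c = fc (dgf real x f) c"
    by (cases "c x = 0") (simp_all add: op_rep sqrt_mult_self_complex)
qed
lemma anf_crf: "anf x (crf x f) = dgf (\<lambda>n. real n + 1) x f"
  by (rule fs_eqI) (simp add: op_rep sqrt_mult_self_complex[of "Suc _", simplified] add.commute)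
lemma cr1_an1: "cr1 (an1 f) = dg1 real f"
proof (rule fs_eqI)
  fix n show "fc (cr1 (an1 f)) n = fc (dg1 real f) n"
    by (cases "n = 0") (simp_all add: op_rep sqrt_mult_self_complex)
qed
lemma an1_cr1: "an1 (cr1 f) = dg1 (\<lambda>n. real n + 1) f"
  by (rule fs_eqI) (simp add: op_rep sqrt_mult_self_complex[of "Suc _", simplified] add.commute)

lemma dgf_add: "dgf (\<lambda>n. r n + s n) x f = dgf r x f + dgf s x f"
  by (rule fs_eqI) (simp add: op_rep algebra_simps)
lemma dgf_one: "dgf (\<lambda>n. 1) x f = f" by (rule fs_eqI) (simp add: op_rep)
lemma dg1_add: "dg1 (\<lambda>n. r n + s n) f = dg1 r f + dg1 s f"
  by (rule fs_eqI) (simp add: op_rep algebra_simps)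
lemma dg1_one: "dg1 (\<lambda>n. 1) f = f" by (rule fs_eqI) (simp add: op_rep)

lemma kbf_add1: "kbf x (w + w') z f = kbf x w z f + kbf x w' z f"
  by (rule fs_eqI) (simp add: op_rep algebra_simps)
lemma kbf_diff1: "kbf x (w - w') z f = kbf x w z f - kbf x w' z f"
  by (rule fs_eqI) (simp add: op_rep algebra_simps)
lemma kbf_scale1: "kbf x (c *\<^sub>F w) z f = c *\<^sub>F kbf x w z f"
  by (rule fs_eqI) (simp add: op_rep algebra_simps)
lemma kbf_add2: "kbf x w (z + z') f = kbf x w z f + kbf x w z' f"
  by (rule cip_eqI) (simp add: adjpD[OF adjp_kbf] kbf_add1 cip_simps)
lemma kbf_diff2: "kbf x w (z - z') f = kbf x w z f - kbf x w z' f"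
  by (rule cip_eqI) (simp add: adjpD[OF adjp_kbf] kbf_diff1 cip_simps)
lemma kbf_scale2: "kbf x w (c *\<^sub>F z) f = cnj c *\<^sub>F kbf x w z f"
  by (rule cip_eqI) (simp add: adjpD[OF adjp_kbf] kbf_scale1 cip_simps)

text \<open>The operator norm is obtained from algebra rather than from coordinates:
  \<open>kbf x z z\<close> is symmetric and its square is \<open>(norm z)\<^sup>2\<close> times
  itself, and the general case reduces to it through \<open>kbf x z w (kbf x w z f)\<close>.\<close>

lemma norm_kbf_le: "norm (kbf x w z f) \<le> norm w * norm z * norm f"
proof -
  have diag: "norm (kbf x z z f) \<le> (norm z)\<^sup>2 * norm f"
  proof (cases "kbf x z z f = 0")
    case False
    have "complex_of_real ((norm (kbf x z z f))\<^sup>2) = cip f (kbf x z z (kbf x z z f))"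
      using adjpD[OF adjp_kbf[of x z z], of f "kbf x z z f"] by (simp add: cip_self)
    also have "\<dots> = complex_of_real ((norm z)\<^sup>2) * cip f (kbf x z z f)" by (simp add: kbf_kbf cip_simps cip_self)
    finally have "norm (complex_of_real ((norm (kbf x z z f))\<^sup>2)) = norm (complex_of_real ((norm z)\<^sup>2)) * cmod (cip f (kbf x z z f))"
      by (simp only: norm_mult)
    then have "(norm (kbf x z z f))\<^sup>2 = (norm z)\<^sup>2 * cmod (cip f (kbf x z z f))"
      by (simp only: norm_of_real abs_power2)
    also have "\<dots> \<le> (norm z)\<^sup>2 * (norm f * norm (kbf x z z f))" by (intro mult_left_mono cmod_cip_le) auto
    finally have "norm (kbf x z z f) * norm (kbf x z z f) \<le> ((norm z)\<^sup>2 * norm f) * norm (kbf x z z f)"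
      by (simp only: power2_eq_square mult.assoc)
    then show ?thesis using False by (subst (asm) mult_le_cancel_right_pos) auto
  qed simp
  have "complex_of_real ((norm (kbf x w z f))\<^sup>2) = cip f (kbf x z w (kbf x w z f))"
    using adjpD[OF adjp_kbf[of x z w], of f "kbf x w z f"] by (simp add: cip_self)
  also have "\<dots> = complex_of_real ((norm w)\<^sup>2) * cip f (kbf x z z f)" by (simp add: kbf_kbf cip_simps cip_self)
  finally have "norm (complex_of_real ((norm (kbf x w z f))\<^sup>2)) = norm (complex_of_real ((norm w)\<^sup>2)) * cmod (cip f (kbf x z z f))"
    by (simp only: norm_mult)
  then have "(norm (kbf x w z f))\<^sup>2 = (norm w)\<^sup>2 * cmod (cip f (kbf x z z f))"
    by (simp only: norm_of_real abs_power2)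
  also have "\<dots> \<le> (norm w)\<^sup>2 * (norm f * ((norm z)\<^sup>2 * norm f))"
    by (intro mult_left_mono order_trans[OF cmod_cip_le] diag) auto
  also have "\<dots> = (norm w * norm z * norm f)\<^sup>2" by (simp only: power2_eq_square mult_ac)
  finally show ?thesis by (rule power2_le_imp_le) simp
qed

section \<open>The growth estimate for finitely supported vectors\<close>

abbreviation nh :: "nat \<Rightarrow> real" where "nh \<equiv> \<lambda>n. real n + 1"

lemma fscale_simps: "c *\<^sub>F (d *\<^sub>F f) = (c * d) *\<^sub>F f" "1 *\<^sub>F f = f"
  by (rule fs_eqI, simp add: fc_simps)+

lemma dg1_dg1: "dg1 r (dg1 s f) = dg1 (\<lambda>n. r n * s n) f"
  by (rule fs_eqI) (simp add: op_rep)

lemma norm_fs_infsum: "(norm f)\<^sup>2 = (\<Sum>\<^sub>\<infinity>i. (cmod (fc f i))\<^sup>2)"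
  using norm_eq_infsum[of "emb f"] by (simp add: norm_emb coord_emb)

lemma norm_dg1_mono:
  assumes "\<And>n. \<bar>r n\<bar> \<le> \<bar>s n\<bar>"
  shows "norm (dg1 r f) \<le> norm (dg1 s f)"
proof (rule power2_le_imp_le)
  have fin: "(\<lambda>i. (cmod (fc (dg1 r f) i))\<^sup>2) summable_on UNIV" for r :: "nat \<Rightarrow> real"
    using coord_summable[of "emb (dg1 r f)"] by (simp add: coord_emb)
  show "(norm (dg1 r f))\<^sup>2 \<le> (norm (dg1 s f))\<^sup>2"
    unfolding norm_fs_infsum
    by (rule infsum_mono[OF fin fin]) (auto simp: op_rep norm_mult assms intro!: power_mono mult_right_mono)
qed simp

lemma norm_an1: "norm (an1 f) = norm (dg1 (\<lambda>n. sqrt (real n)) f)"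
proof -
  have "complex_of_real ((norm (an1 f))\<^sup>2) = cip f (dg1 real f)"
    using adjpD[OF adjp_cr1, of f "an1 f"] by (simp add: cip_self cr1_an1)
  also have "\<dots> = complex_of_real ((norm (dg1 (\<lambda>n. sqrt (real n)) f))\<^sup>2)"
    using adjpD[OF adjp_dg1, of f "\<lambda>n. sqrt (real n)" "dg1 (\<lambda>n. sqrt (real n)) f"]
    by (simp add: cip_self dg1_dg1 of_nat_sum)
  finally have "(norm (an1 f))\<^sup>2 = (norm (dg1 (\<lambda>n. sqrt (real n)) f))\<^sup>2" by (simp only: of_real_eq_iff)
  then show ?thesis by simp
qed

lemma norm_cr1: "norm (cr1 f) = norm (dg1 (\<lambda>n. sqrt (real n + 1)) f)"
proof -
  have "complex_of_real ((norm (cr1 f))\<^sup>2) = cip f (dg1 nh f)"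
    using adjpD[OF adjp_an1, of f "cr1 f"] by (simp add: cip_self an1_cr1)
  also have "\<dots> = complex_of_real ((norm (dg1 (\<lambda>n. sqrt (real n + 1)) f))\<^sup>2)"
    using adjpD[OF adjp_dg1, of f "\<lambda>n. sqrt (real n + 1)" "dg1 (\<lambda>n. sqrt (real n + 1)) f"]
    by (simp add: cip_self dg1_dg1)
  finally have "(norm (cr1 f))\<^sup>2 = (norm (dg1 (\<lambda>n. sqrt (real n + 1)) f))\<^sup>2" by (simp only: of_real_eq_iff)
  then show ?thesis by simp
qed

text \<open>The canonical commutation relation in quadratic form. Because of it the single quantity
  \<open>e f x\<close> below dominates \<open>q f\<close>, \<open>a q f\<close> and the creation
  operator on \<open>q f\<close> together.\<close>

lemma norm_crf: "(norm (crf x f))\<^sup>2 = (norm f)\<^sup>2 + (norm (anf x f))\<^sup>2"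
proof -
  have "complex_of_real ((norm (crf x f))\<^sup>2) = cip f (dgf nh x f)"
    using adjpD[OF adjp_anf, of f x "crf x f"] by (simp add: cip_self anf_crf)
  also have "dgf nh x f = crf x (anf x f) + f"
    by (simp only: dgf_add dgf_one crf_anf)
  also have "cip f (crf x (anf x f) + f) = complex_of_real ((norm f)\<^sup>2 + (norm (anf x f))\<^sup>2)"
    using adjpD[OF adjp_crf, of f x "anf x f"] by (simp add: cip_self cip_add_right)
  finally show ?thesis by (simp only: of_real_eq_iff)
qed

lemma anf_nh: "anf x (dgf nh x f) = dgf nh x (anf x f) + anf x f"
  by (rule fs_eqI) (simp add: op_rep algebra_simps)

lemma dg1_nh_cr1: "dg1 nh (cr1 f) = cr1 (dg1 nh f) + cr1 f"
proof (rule fs_eqI)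
  fix n show "fc (dg1 nh (cr1 f)) n = fc (cr1 (dg1 nh f) + cr1 f) n"
    by (cases n) (simp_all add: op_rep algebra_simps)
qed

section \<open>Fluctuations of one site around a fixed unit vector\<close>

locale mean_field =
  fixes \<phi> :: "nat fs" and J :: real and v :: "nat \<Rightarrow> real" and \<nu> :: real
  assumes norm_phi: "norm \<phi> = 1" and nu: "norm (dg1 nh \<phi>) \<le> \<nu>"
begin

definition \<alpha> :: complex where "\<alpha> = cip \<phi> (an1 \<phi>)"
text \<open>\<open>u\<close> and \<open>w\<close> are what \<open>a - \<alpha>\<close> and its
  adjoint make of \<phi>. The choice of \<alpha> makes both orthogonal to \<phi>, so that
  \<open>kbf x u \<phi>\<close> and \<open>kbf x w \<phi>\<close> create genuine excitations. The
  gain in the sum over neighbours depends on this.\<close>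

definition u :: "nat fs" where "u = an1 \<phi> - \<alpha> *\<^sub>F \<phi>"
definition w :: "nat fs" where "w = cr1 \<phi> - cnj \<alpha> *\<^sub>F \<phi>"
definition q :: "'s \<Rightarrow> ('s \<Rightarrow> nat) fs \<Rightarrow> ('s \<Rightarrow> nat) fs" where "q x f = f - kbf x \<phi> \<phi> f"
definition bn :: "'s \<Rightarrow> ('s \<Rightarrow> nat) fs \<Rightarrow> ('s \<Rightarrow> nat) fs" where "bn x f = anf x f - \<alpha> *\<^sub>F f"
definition bc :: "'s \<Rightarrow> ('s \<Rightarrow> nat) fs \<Rightarrow> ('s \<Rightarrow> nat) fs" where "bc x f = crf x f - cnj \<alpha> *\<^sub>F f"
definition W :: "'s \<Rightarrow> ('s \<Rightarrow> nat) fs \<Rightarrow> ('s \<Rightarrow> nat) fs" where "W x f = q x (dgf nh x (q x f))"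
text \<open>Since \<open>a a\<^sup>* = 1 + N\<close>, the square of \<open>e f x\<close> is \<open>\<langle>f, q\<^sub>x (1 + N\<^sub>x) q\<^sub>x f\<rangle>\<close>.\<close>

definition e :: "('s \<Rightarrow> nat) fs \<Rightarrow> 's \<Rightarrow> real" where "e f x = norm (crf x (q x f))"
definition h1 :: "nat fs \<Rightarrow> nat fs" where
  "h1 z = dg1 v z - complex_of_real J *\<^sub>F (\<alpha> *\<^sub>F cr1 z + cnj \<alpha> *\<^sub>F an1 z - complex_of_real ((cmod \<alpha>)\<^sup>2) *\<^sub>F z)"
definition hx :: "'s \<Rightarrow> ('s \<Rightarrow> nat) fs \<Rightarrow> ('s \<Rightarrow> nat) fs" where
  "hx x f = dgf v x f - complex_of_real J *\<^sub>F (\<alpha> *\<^sub>F crf x f + cnj \<alpha> *\<^sub>F anf x f - complex_of_real ((cmod \<alpha>)\<^sup>2) *\<^sub>F f)"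

lemma phi1: "cip \<phi> \<phi> = 1" by (simp add: cip_self norm_phi)

lemma nu1: "\<nu> \<ge> 1"
proof -
  have "norm (dg1 (\<lambda>_. 1) \<phi>) \<le> norm (dg1 nh \<phi>)" by (rule norm_dg1_mono) simp
  then show ?thesis using nu by (simp add: dg1_one norm_phi)
qed

lemma nu_powers: "\<nu> \<le> \<nu>\<^sup>2" "1 \<le> \<nu>\<^sup>2" "\<nu> \<le> \<nu>^3" "\<nu>\<^sup>2 \<le> \<nu>^3" "0 < \<nu>"
  using nu1 power_increasing[of 1 2 \<nu>] power_increasing[of 1 3 \<nu>] power_increasing[of 2 3 \<nu>] by (auto simp: one_le_power)

lemma sqrt_le_nh: "\<bar>sqrt (real n)\<bar> \<le> \<bar>nh n\<bar>" "\<bar>sqrt (real n + 1)\<bar> \<le> \<bar>nh n\<bar>"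
proof -
  have "sqrt (real n + 1) \<le> sqrt ((real n + 1)\<^sup>2)" by (intro real_sqrt_le_mono) (simp add: power2_eq_square)
  then have 1: "sqrt (real n + 1) \<le> real n + 1" by simp
  then show "\<bar>sqrt (real n + 1)\<bar> \<le> \<bar>nh n\<bar>" by simp
  have 2: "sqrt (real n) \<le> sqrt (real n + 1)" by simp
  have "sqrt (real n) \<le> real n + 1" using 1 2 by (rule order_trans[rotated])
  then show "\<bar>sqrt (real n)\<bar> \<le> \<bar>nh n\<bar>" by simp
qed

lemma an_phi: "norm (an1 \<phi>) \<le> \<nu>" "norm (cr1 \<phi>) \<le> \<nu>"
  unfolding norm_an1 norm_cr1 using sqrt_le_nh by (auto intro!: order_trans[OF norm_dg1_mono nu])

lemma alpha_le: "cmod \<alpha> \<le> \<nu>"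
  using order_trans[OF cmod_cip_le[of \<phi> "an1 \<phi>"]] an_phi(1) by (simp add: \<alpha>_def norm_phi)

text \<open>Two annihilations cost one full power of \<open>N\<close>, since
  \<open>sqrt (n (n - 1)) \<le> n + 1\<close>; so \<nu> already controls them.\<close>

lemma an_an_phi: "norm (an1 (an1 \<phi>)) \<le> \<nu>"
proof -
  have "dg1 (\<lambda>n. sqrt (real n)) (an1 \<phi>) = an1 (dg1 (\<lambda>n. sqrt (real (n - 1))) \<phi>)"
    by (rule fs_eqI) (simp add: op_rep)
  then have "norm (an1 (an1 \<phi>)) = norm (dg1 (\<lambda>n. sqrt (real n) * sqrt (real (n - 1))) \<phi>)"
    by (simp add: norm_an1[of "an1 \<phi>"]) (simp add: norm_an1 dg1_dg1)
  also have "\<dots> \<le> norm (dg1 nh \<phi>)"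
  proof (rule norm_dg1_mono)
    fix n
    have "sqrt (real n) * sqrt (real (n - 1)) \<le> sqrt (real n + 1) * sqrt (real n + 1)"
      by (intro mult_mono) auto
    then show "\<bar>sqrt (real n) * sqrt (real (n - 1))\<bar> \<le> \<bar>nh n\<bar>" by simp
  qed
  finally show ?thesis using nu by simp
qed

lemma uw_norm: "norm u \<le> 2 * \<nu>" "norm w \<le> 2 * \<nu>"
  unfolding u_def w_def using an_phi alpha_le
  by (auto intro!: order_trans[OF norm_triangle_ineq4] simp: norm_fscale norm_phi)

lemma an_uw_norm: "norm (an1 u) \<le> 2 * \<nu>\<^sup>2" "norm (an1 w) \<le> 2 * \<nu>\<^sup>2"
proof -
  have a: "cmod \<alpha> * norm (an1 \<phi>) \<le> \<nu>\<^sup>2"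
    unfolding power2_eq_square using nu_powers(5) by (intro mult_mono alpha_le an_phi) auto
  have "an1 u = an1 (an1 \<phi>) - \<alpha> *\<^sub>F an1 \<phi>" "an1 w = dg1 nh \<phi> - cnj \<alpha> *\<^sub>F an1 \<phi>"
    by (simp_all add: u_def w_def adjp_diff[OF adjp_an1] adjp_scale[OF adjp_an1] an1_cr1)
  then show "norm (an1 u) \<le> 2 * \<nu>\<^sup>2" "norm (an1 w) \<le> 2 * \<nu>\<^sup>2"
    using norm_triangle_ineq4[of "an1 (an1 \<phi>)" "\<alpha> *\<^sub>F an1 \<phi>"] norm_triangle_ineq4[of "dg1 nh \<phi>" "cnj \<alpha> *\<^sub>F an1 \<phi>"]
      an_an_phi nu a nu_powers(1) by (auto simp: norm_fscale)
qed

lemma phi_u: "cip \<phi> u = 0" by (simp add: u_def cip_diff_right cip_scale_right phi1 \<alpha>_def)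
lemma phi_w: "cip \<phi> w = 0"
  using adjpD[OF adjp_cr1, of \<phi> \<phi>] cip_cnj[of "an1 \<phi>" \<phi>]
  by (simp add: w_def cip_diff_right cip_scale_right phi1 \<alpha>_def)
lemma adjp_q: "adjp (q x) (q x)"
  unfolding adjp_def q_def by (simp add: cip_simps adjpD[OF adjp_kbf])
lemma adjp_bn: "adjp (bn x) (bc x)"
  unfolding adjp_def bn_def bc_def by (simp add: cip_simps adjpD[OF adjp_anf])
lemma adjp_bc: "adjp (bc x) (bn x)" by (rule adjp_sym[OF adjp_bn])
lemma adjp_W: "adjp (W x) (W x)"
  unfolding adjp_def W_def by (simp add: adjpD[OF adjp_q] adjpD[OF adjp_dgf])

lemma q_idem: "q x (q x f) = q x f"
  by (simp add: q_def adjp_diff[OF adjp_kbf] kbf_kbf phi1 fscale_simps)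

lemma q_norm: "norm (q x f) \<le> norm f"
proof (cases "q x f = 0")
  case False
  have "complex_of_real ((norm (q x f))\<^sup>2) = cip f (q x f)"
    using adjpD[OF adjp_q, of f x "q x f"] by (simp add: cip_self q_idem)
  then have "norm (complex_of_real ((norm (q x f))\<^sup>2)) \<le> norm f * norm (q x f)" using cmod_cip_le by metis
  then have "norm (q x f) * norm (q x f) \<le> norm f * norm (q x f)"
    by (simp only: norm_of_real abs_power2) (simp only: power2_eq_square)
  then show ?thesis using False by (subst (asm) mult_le_cancel_right_pos) auto
qed simp

lemma q_kbf: "cip \<phi> z = 0 \<Longrightarrow> q x (kbf x z z' f) = kbf x z z' f"
  by (rule fs_eqI) (simp add: q_def kbf_kbf fc_simps)
lemma kbf_orth_q: "cip z \<phi> = 0 \<Longrightarrow> kbf x z' z f = kbf x z' z (q x f)"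
  by (rule fs_eqI) (simp add: q_def adjp_diff[OF adjp_kbf] kbf_kbf fc_simps)

lemma e_props: "norm (q x f) \<le> e f x" "norm (anf x (q x f)) \<le> e f x" "norm (crf x (q x f)) \<le> e f x"
  "(e f x)\<^sup>2 = (norm (q x f))\<^sup>2 + (norm (anf x (q x f)))\<^sup>2" "0 \<le> e f x"
proof -
  show 1: "(e f x)\<^sup>2 = (norm (q x f))\<^sup>2 + (norm (anf x (q x f)))\<^sup>2" unfolding e_def by (rule norm_crf)
  show "norm (q x f) \<le> e f x" by (rule power2_le_imp_le) (simp_all add: 1, simp add: e_def)
  show "norm (anf x (q x f)) \<le> e f x" by (rule power2_le_imp_le) (simp_all add: 1, simp add: e_def)
qed (simp_all add: e_def)

lemma q_commute: "x \<noteq> y \<Longrightarrow> q x (bn y f) = bn y (q x f)" "x \<noteq> y \<Longrightarrow> q x (kbf y z z' f) = kbf y z z' (q x f)"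
  "x \<noteq> y \<Longrightarrow> q x (anf y f) = anf y (q x f)" "x \<noteq> y \<Longrightarrow> q x (crf y f) = crf y (q x f)"
  "x \<noteq> y \<Longrightarrow> q x (dgf r y f) = dgf r y (q x f)"
  by (simp_all add: q_def bn_def adjp_diff[OF adjp_kbf] adjp_scale[OF adjp_kbf] kbf_anf_commute adjp_diff[OF adjp_anf]
      kbf_crf_commute adjp_diff[OF adjp_crf] kbf_dgf_commute adjp_diff[OF adjp_dgf] kbf_kbf_commute)
     (rule fs_eqI, simp add: fc_simps algebra_simps)

lemma W_commute: "x \<noteq> y \<Longrightarrow> W x (anf y f) = anf y (W x f)" "x \<noteq> y \<Longrightarrow> W x (crf y f) = crf y (W x f)"
  "x \<noteq> y \<Longrightarrow> W x (dgf r y f) = dgf r y (W x f)"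
  by (simp_all add: W_def q_commute dgf_anf_commute dgf_crf_commute dgf_dgf_commute[of nh x])

lemma W_bn_commute: "x \<noteq> y \<Longrightarrow> W x (bn y f) = bn y (W x f)"
  by (simp add: bn_def adjp_diff[OF adjp_W] adjp_scale[OF adjp_W] W_commute)

lemma bn_kbf: "bn x (kbf x \<phi> z f) = kbf x u z f"
  by (simp add: bn_def anf_kbf u_def kbf_diff1 kbf_scale1)
lemma bc_kbf: "bc x (kbf x \<phi> z f) = kbf x w z f"
  by (simp add: bc_def crf_kbf w_def kbf_diff1 kbf_scale1)
lemma kbf_bn: "kbf x z z' (bn x f) = kbf x z (cr1 z' - cnj \<alpha> *\<^sub>F z') f"
  by (simp add: bn_def adjp_diff[OF adjp_kbf] adjp_scale[OF adjp_kbf] kbf_anf kbf_diff2 kbf_scale2)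

text \<open>The part of the commutator of \<open>bn x\<close> with \<open>W x\<close> that carries
  \<open>q x\<close> on both sides. The two other parts in \<open>commutator\<close> have \<phi> on
  one side and are summed over the neighbours before they are estimated.\<close>

definition Y :: "'s \<Rightarrow> ('s \<Rightarrow> nat) fs \<Rightarrow> ('s \<Rightarrow> nat) fs" where
  "Y x f = q x (anf x (q x f)) - kbf x u (dg1 nh \<phi>) (q x f) + q x (kbf x (dg1 nh \<phi>) w (q x f))"

lemma decomp: "f = q x f + kbf x \<phi> \<phi> f" by (simp add: q_def)

lemma bn_decomp: "bn x f = bn x (q x f) + kbf x u \<phi> f"
  using adjp_add[OF adjp_bn, of x "q x f" "kbf x \<phi> \<phi> f"] by (simp add: bn_kbf decomp[symmetric])
lemma bc_decomp: "bc x f = bc x (q x f) + kbf x w \<phi> f"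
  using adjp_add[OF adjp_bc, of x "q x f" "kbf x \<phi> \<phi> f"] by (simp add: bc_kbf decomp[symmetric])

lemma commutator:
  "bn x (W x f) - W x (bn x f) = Y x f + kbf x \<phi> (dg1 nh w) (q x f) - q x (kbf x (dg1 nh u) \<phi> f)"
proof -
  let ?X = "q x f"
  have n1: "bn x (dgf nh x ?X) = dgf nh x (bn x ?X) + anf x ?X"
    by (simp add: bn_def anf_nh adjp_diff[OF adjp_dgf] adjp_scale[OF adjp_dgf])
  have "bn x (W x f) = bn x (dgf nh x ?X) - bn x (kbf x \<phi> \<phi> (dgf nh x ?X))"
    by (simp add: W_def q_def[of x "dgf nh x ?X"] adjp_diff[OF adjp_bn])
  then have L: "bn x (W x f) = dgf nh x (bn x ?X) + anf x ?X - kbf x u (dg1 nh \<phi>) ?X"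
    by (simp add: n1 bn_kbf kbf_dgf)
  have qb: "q x (bn x f) = bn x ?X - kbf x \<phi> w ?X + kbf x u \<phi> f"
    by (simp add: bn_decomp[of x f] adjp_add[OF adjp_q] q_kbf[OF phi_u]) (simp add: q_def[of x "bn x ?X"] kbf_bn w_def)
  have R: "W x (bn x f) = q x (dgf nh x (bn x ?X)) - q x (kbf x (dg1 nh \<phi>) w ?X) + q x (kbf x (dg1 nh u) \<phi> f)"
    by (simp add: W_def qb adjp_add[OF adjp_dgf] adjp_diff[OF adjp_dgf] dgf_kbf adjp_add[OF adjp_q] adjp_diff[OF adjp_q])
  have R1: "q x (dgf nh x (bn x ?X)) = dgf nh x (bn x ?X) - kbf x \<phi> (cr1 (dg1 nh \<phi>) - cnj \<alpha> *\<^sub>F dg1 nh \<phi>) ?X"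
    by (simp add: q_def[of x "dgf nh x (bn x ?X)"] kbf_dgf kbf_bn)
  have A: "anf x ?X = q x (anf x ?X) + kbf x \<phi> (cr1 \<phi>) ?X"
    by (simp add: q_def[of x "anf x ?X"] kbf_anf)
  \<comment> \<open>The term \<open>cr1 \<phi>\<close> split off from \<open>anf x (q x f)\<close>
    is precisely the commutator of \<open>nh\<close> with \<open>cr1\<close>, which completes
    \<open>dg1 nh w\<close>.\<close>
  have nw: "dg1 nh w = (cr1 (dg1 nh \<phi>) - cnj \<alpha> *\<^sub>F dg1 nh \<phi>) + cr1 \<phi>"
    by (simp add: w_def adjp_diff[OF adjp_dg1] adjp_scale[OF adjp_dg1] dg1_nh_cr1)
  show ?thesis
    unfolding L R R1 Y_def nw kbf_add2 by (subst A) simp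
qed

lemma Y_norm: "norm (Y x f) \<le> 5 * \<nu>\<^sup>2 * e f x"
proof -
  let ?X = "q x f"
  have 1: "norm (q x (anf x ?X)) \<le> e f x" by (rule order_trans[OF q_norm e_props(2)])
  have 2: "norm (kbf x u (dg1 nh \<phi>) ?X) \<le> (2 * \<nu>) * \<nu> * e f x"
    using nu_powers(5) by (intro order_trans[OF norm_kbf_le] mult_mono uw_norm nu e_props(1)) auto
  have 3: "norm (q x (kbf x (dg1 nh \<phi>) w ?X)) \<le> \<nu> * (2 * \<nu>) * e f x"
    using nu_powers(5) by (intro order_trans[OF q_norm] order_trans[OF norm_kbf_le] mult_mono uw_norm nu e_props(1)) auto
  have "norm (Y x f) \<le> norm (q x (anf x ?X)) + norm (kbf x u (dg1 nh \<phi>) ?X) + norm (q x (kbf x (dg1 nh \<phi>) w ?X))"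
    unfolding Y_def by (intro order_trans[OF norm_triangle_ineq] add_right_mono norm_triangle_ineq4)
  also have "\<dots> \<le> e f x + 4 * \<nu>\<^sup>2 * e f x" using 1 2 3 by (simp add: power2_eq_square)
  also have "\<dots> \<le> \<nu>\<^sup>2 * e f x + 4 * \<nu>\<^sup>2 * e f x"
    using mult_right_mono[OF nu_powers(2) e_props(5)[of f x]] by (simp add: mult.commute)
  finally show ?thesis by (simp add: mult_ac)
qed

lemma q_Y: "q x (Y x f) = Y x f"
  by (simp add: Y_def adjp_add[OF adjp_q] adjp_diff[OF adjp_q] q_idem q_kbf[OF phi_u])

text \<open>For \<open>z = u\<close> or \<open>z = w\<close>, bounding
  \<open>norm (dg1 nh z)\<close> directly would call for a third moment of \<phi>. Instead
  \<open>1 + N\<close> is written as creation after annihilation plus 1; the creation operator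
  passes to \<open>q x f\<close> as an annihilation, which \<open>e f x\<close> controls, and only
  \<open>an1 z\<close> remains.\<close>

lemma kbf_nh_norm:
  assumes "norm z \<le> 2 * \<nu>" "norm (an1 z) \<le> 2 * \<nu>\<^sup>2"
  shows "norm (kbf x \<phi> (dg1 nh z) (q x f)) \<le> 4 * \<nu>\<^sup>2 * e f x"
proof -
  have "dg1 nh z = cr1 (an1 z) + z" by (simp only: dg1_add dg1_one cr1_an1)
  then have "kbf x \<phi> (dg1 nh z) (q x f) = kbf x \<phi> (an1 z) (anf x (q x f)) + kbf x \<phi> z (q x f)"
    by (simp add: kbf_add2 kbf_anf)
  also have "norm \<dots> \<le> 1 * (2 * \<nu>\<^sup>2) * e f x + 1 * (2 * \<nu>) * e f x"
    using nu_powers(5) norm_phi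
    by (intro order_trans[OF norm_triangle_ineq] add_mono order_trans[OF norm_kbf_le] mult_mono assms e_props) auto
  also have "\<dots> \<le> 2 * \<nu>\<^sup>2 * e f x + 2 * \<nu>\<^sup>2 * e f x"
    using mult_right_mono[OF nu_powers(1) e_props(5)[of f x]] by (simp add: mult.commute)
  finally show ?thesis by (simp add: mult_ac)
qed

lemma bn_norm: "norm (bn x (q x f)) \<le> 2 * \<nu> * e f x" "norm (bc x (q x f)) \<le> 2 * \<nu> * e f x"
proof -
  have a: "cmod \<alpha> * norm (q x f) \<le> \<nu> * e f x"
    using nu_powers(5) by (intro mult_mono alpha_le e_props) auto
  have b: "e f x \<le> \<nu> * e f x" using mult_right_mono[OF nu1 e_props(5)[of f x]] by simp
  show "norm (bn x (q x f)) \<le> 2 * \<nu> * e f x"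
    using norm_triangle_ineq4[of "anf x (q x f)" "\<alpha> *\<^sub>F q x f"] e_props(2)[of x f] a b by (simp add: bn_def norm_fscale)
  show "norm (bc x (q x f)) \<le> 2 * \<nu> * e f x"
    using norm_triangle_ineq4[of "crf x (q x f)" "cnj \<alpha> *\<^sub>F q x f"] e_props(3)[of x f] a b by (simp add: bc_def norm_fscale)
qed

text \<open>Either \<open>bn y\<close> meets \<open>q y\<close>, or it creates \<open>u\<close> out
  of \<phi> at \<open>y\<close>. The second case costs \<open>e f x\<close> rather than
  \<open>norm f\<close>, because \<open>q x\<close> is already present.\<close>

lemma bn_q_norm:
  assumes "x \<noteq> y"
  shows "norm (bn y (q x f)) \<le> 2 * \<nu> * e f y + 2 * \<nu> * e f x"
proof -
  have "bn y (q x f) = q x (bn y (q y f)) + kbf y u \<phi> (q x f)"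
    using q_commute(1)[OF assms, of f] q_commute(2)[OF assms, of u \<phi> f]
    by (simp add: bn_decomp[of y f] adjp_add[OF adjp_q])
  also have "norm \<dots> \<le> 2 * \<nu> * e f y + 2 * \<nu> * 1 * e f x"
    using nu_powers(5) norm_phi
    by (intro order_trans[OF norm_triangle_ineq] add_mono order_trans[OF q_norm bn_norm(1)] order_trans[OF norm_kbf_le] mult_mono uw_norm e_props) auto
  finally show ?thesis by simp
qed

text \<open>Each of the three terms retains a factor \<open>q x\<close>. In the last one
  \<open>q x\<close> and then the rank-one operator are moved across the inner product, and
  \<open>bn y\<close> returns as its adjoint on \<open>f\<close>; thus the sum over \<open>y\<close>
  falls on a vector independent of the rest.\<close>

lemma comm_form:
  assumes "x \<noteq> y"
  shows "cip (bn x (W x f) - W x (bn x f)) (bn y f) =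
    cip (Y x f) (bn y (q x f)) + cip (kbf x \<phi> (dg1 nh w) (q x f)) (bn y f) - cip (bc y f) (kbf x \<phi> (dg1 nh u) (q x f))"
proof -
  have 1: "cip (Y x f) (bn y f) = cip (Y x f) (bn y (q x f))"
    using adjpD[OF adjp_q, of "Y x f" x "bn y f"] by (simp add: q_Y q_commute(1)[OF assms])
  have "cip (q x (kbf x (dg1 nh u) \<phi> f)) (bn y f) = cip (kbf x (dg1 nh u) \<phi> f) (bn y (q x f))"
    using adjpD[OF adjp_q, of "kbf x (dg1 nh u) \<phi> f" x "bn y f"] by (simp add: q_commute(1)[OF assms])
  also have "\<dots> = cip f (kbf x \<phi> (dg1 nh u) (bn y (q x f)))" by (simp add: adjpD[OF adjp_kbf])
  also have "kbf x \<phi> (dg1 nh u) (bn y (q x f)) = bn y (kbf x \<phi> (dg1 nh u) (q x f))"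
    using assms by (simp add: bn_def adjp_diff[OF adjp_kbf] adjp_scale[OF adjp_kbf] kbf_anf_commute)
  also have "cip f \<dots> = cip (bc y f) (kbf x \<phi> (dg1 nh u) (q x f))" by (rule adjpD[OF adjp_bn])
  finally show ?thesis by (simp add: commutator cip_add_left cip_diff_left 1)
qed

text \<open>Operators at different sites commute, so for \<open>y \<noteq> y'\<close> the overlap of
  \<open>g y\<close> and \<open>g y'\<close> equals that of \<open>kbf y' \<phi> z f\<close> and
  \<open>kbf y \<phi> z f\<close>. As \<open>z\<close> is orthogonal to \<phi>, each of these sees
  only the \<open>q\<close> part of \<open>f\<close> and is at most \<open>norm z\<close> times
  \<open>e f\<close>. Only the diagonal keeps \<open>norm f\<close>, which therefore comes with one
  power of \<open>card B\<close> instead of two.\<close>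

lemma sum_kbf_norm:
  assumes z: "cip \<phi> z = 0" and B: "finite B"
  shows "(norm (\<Sum>y\<in>B. kbf y z \<phi> f))\<^sup>2 \<le> (norm z)\<^sup>2 * (card B * ((norm f)\<^sup>2 + (\<Sum>y\<in>B. (e f y)\<^sup>2)))"
proof -
  define g where "g y = kbf y z \<phi> f" for y
  have z': "cip z \<phi> = 0" by (subst cip_cnj) (simp add: z)
  have t: "cmod (cip (g y) (g y')) \<le> (norm z)\<^sup>2 * ((if y = y' then (norm f)\<^sup>2 else 0) + e f y * e f y')" for y y'
  proof (cases "y = y'")
    case True
    have "cmod (cip (g y) (g y)) \<le> (norm z * norm \<phi> * norm f) * (norm z * norm \<phi> * norm f)"
      unfolding g_def by (intro order_trans[OF cmod_cip_le] mult_mono norm_kbf_le) auto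
    also have "\<dots> = (norm z)\<^sup>2 * (norm f)\<^sup>2" by (simp add: norm_phi power2_eq_square)
    also have "\<dots> \<le> (norm z)\<^sup>2 * ((norm f)\<^sup>2 + e f y * e f y)" by (intro mult_left_mono) auto
    finally show ?thesis using True by simp
  next
    case False
    have "cip (g y) (g y') = cip f (kbf y \<phi> z (kbf y' z \<phi> f))" by (simp add: g_def adjpD[OF adjp_kbf])
    also have "\<dots> = cip (kbf y' \<phi> z f) (kbf y \<phi> z f)"
      using False by (simp add: kbf_kbf_commute adjpD[OF adjp_kbf])
    also have "\<dots> = cip (kbf y' \<phi> z (q y' f)) (kbf y \<phi> z (q y f))" by (simp add: kbf_orth_q[OF z', symmetric])
    also have "cmod \<dots> \<le> (norm \<phi> * norm z * e f y') * (norm \<phi> * norm z * e f y)"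
      by (intro order_trans[OF cmod_cip_le] mult_mono order_trans[OF norm_kbf_le] mult_left_mono e_props) (auto simp: e_props)
    also have "\<dots> = (norm z)\<^sup>2 * (e f y * e f y')" by (simp add: norm_phi power2_eq_square)
    finally show ?thesis using False by simp
  qed
  have "(norm (\<Sum>y\<in>B. g y))\<^sup>2 = cmod (cip (\<Sum>y\<in>B. g y) (\<Sum>y\<in>B. g y))"
    by (simp only: cip_self norm_of_real abs_power2)
  also have "\<dots> = cmod (\<Sum>y\<in>B. \<Sum>y'\<in>B. cip (g y) (g y'))"
    by (simp add: cip_sum_left cip_sum_right) (subst sum.swap, rule refl)
  also have "\<dots> \<le> (\<Sum>y\<in>B. \<Sum>y'\<in>B. (norm z)\<^sup>2 * ((if y = y' then (norm f)\<^sup>2 else 0) + e f y * e f y'))"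
    by (intro order_trans[OF norm_sum] sum_mono t)
  also have "\<dots> = (norm z)\<^sup>2 * (card B * (norm f)\<^sup>2 + (\<Sum>y\<in>B. e f y)\<^sup>2)"
    using B by (simp add: sum_distrib_left[symmetric] sum.distrib sum_product power2_eq_square)
  also have "\<dots> \<le> (norm z)\<^sup>2 * (card B * (norm f)\<^sup>2 + card B * (\<Sum>y\<in>B. (e f y)\<^sup>2))"
    using sum_squared_le_sum_of_squares[of "e f" B] by (intro mult_left_mono add_left_mono) (auto simp: mult.commute)
  finally show ?thesis by (simp add: g_def distrib_left)
qed

lemma commutator_sum_le:
  assumes B: "finite B" "x \<notin> B"
  shows "\<bar>\<Sum>y\<in>B. Im (cip (bn x (W x f) - W x (bn x f)) (bn y f))\<bar> \<le>
    \<nu>^3 * (31 * card B * (e f x)\<^sup>2 + 21 * (\<Sum>y\<in>B. (e f y)\<^sup>2) + 8 * (norm f)\<^sup>2)"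
proof -
  define E where "E = (\<Sum>y\<in>B. (e f y)\<^sup>2)"
  define P where "P = (norm f)\<^sup>2"
  define m where "m = real (card B)"
  define s where "s = e f x"
  define g where "g = kbf x \<phi> (dg1 nh w) (q x f)"
  define g' where "g' = kbf x \<phi> (dg1 nh u) (q x f)"
  have s: "s \<ge> 0" by (simp add: s_def e_props)
  have E0: "E \<ge> 0" by (simp add: E_def sum_nonneg)
  have P0: "P \<ge> 0" by (simp add: P_def)
  have ne: "x \<noteq> y" if "y \<in> B" for y using that B by auto
  have gn: "norm g \<le> 4 * \<nu>\<^sup>2 * s" "norm g' \<le> 4 * \<nu>\<^sup>2 * s"
    unfolding g_def g'_def s_def by (intro kbf_nh_norm uw_norm an_uw_norm)+
  have Ssum: "(\<Sum>y\<in>B. s * e f y) \<le> (m * s\<^sup>2 + E) / 2"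
  proof -
    have "(\<Sum>y\<in>B. s * e f y) \<le> (\<Sum>y\<in>B. (s\<^sup>2 + (e f y)\<^sup>2) / 2)"
      by (intro sum_mono) (use sum_squares_bound[of s "e f y" for y] in \<open>simp add: field_simps\<close>)
    also have "\<dots> = (m * s\<^sup>2 + E) / 2" by (simp add: sum_divide_distrib[symmetric] sum.distrib E_def m_def)
    finally show ?thesis .
  qed
  \<comment> \<open>The factor \<open>sqrt m\<close> is paired with \<open>s\<close> by the
    arithmetic-geometric mean. So \<open>P\<close> stands without \<open>m\<close> and becomes
    \<open>P\<close> over the number of neighbours after division: the origin of the
    \<open>1/d\<close>.\<close>
  have LLN: "s * norm (\<Sum>y\<in>B. kbf y z \<phi> f) \<le> 2 * \<nu> * ((m * s\<^sup>2 + P + E) / 2)"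
    if z: "cip \<phi> z = 0" "norm z \<le> 2 * \<nu>" for z
  proof -
    have "(norm (\<Sum>y\<in>B. kbf y z \<phi> f))\<^sup>2 \<le> (norm z)\<^sup>2 * (m * (P + E))"
      using sum_kbf_norm[OF z(1) B(1), of f] by (simp add: m_def P_def E_def)
    also have "\<dots> \<le> (2 * \<nu>)\<^sup>2 * (m * (P + E))" using z(2) E0 P0 by (intro mult_right_mono power_mono) (auto simp: m_def)
    also have "\<dots> = (2 * \<nu> * sqrt m * sqrt (P + E))\<^sup>2" using E0 P0 by (simp add: power_mult_distrib m_def)
    finally have "norm (\<Sum>y\<in>B. kbf y z \<phi> f) \<le> 2 * \<nu> * sqrt m * sqrt (P + E)"
      by (rule power2_le_imp_le) (use nu_powers E0 P0 in \<open>auto simp: m_def\<close>)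
    then have "s * norm (\<Sum>y\<in>B. kbf y z \<phi> f) \<le> s * (2 * \<nu> * sqrt m * sqrt (P + E))" by (rule mult_left_mono[OF _ s])
    also have "\<dots> = 2 * \<nu> * ((sqrt m * s) * sqrt (P + E))" by simp
    also have "\<dots> \<le> 2 * \<nu> * ((m * s\<^sup>2 + P + E) / 2)"
      using sum_squares_bound[of "sqrt m * s" "sqrt (P + E)"] E0 P0 nu_powers(5)
      by (intro mult_left_mono) (auto simp: power_mult_distrib m_def)
    finally show ?thesis .
  qed
  have T1: "cmod (\<Sum>y\<in>B. cip (Y x f) (bn y (q x f))) \<le> 10 * \<nu>^3 * ((m * s\<^sup>2 + E) / 2 + m * s\<^sup>2)"
  proof -
    have "cmod (\<Sum>y\<in>B. cip (Y x f) (bn y (q x f))) \<le> (\<Sum>y\<in>B. (5 * \<nu>\<^sup>2 * s) * (2 * \<nu> * e f y + 2 * \<nu> * s))"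
      unfolding s_def using nu_powers(5) by (intro order_trans[OF norm_sum] sum_mono order_trans[OF cmod_cip_le] mult_mono Y_norm bn_q_norm ne)
        (auto simp: e_props)
    also have "\<dots> = 10 * \<nu>^3 * ((\<Sum>y\<in>B. s * e f y) + m * s\<^sup>2)"
      by (simp add: sum.distrib sum_distrib_left algebra_simps power2_eq_square power3_eq_cube m_def)
    also have "\<dots> \<le> 10 * \<nu>^3 * ((m * s\<^sup>2 + E) / 2 + m * s\<^sup>2)" using Ssum nu_powers(5) by (intro mult_left_mono) auto
    finally show ?thesis .
  qed
  have T23: "(4 * \<nu>\<^sup>2 * s) * ((\<Sum>y\<in>B. 2 * \<nu> * e f y) + norm (\<Sum>y\<in>B. kbf y z \<phi> f))
      \<le> 8 * \<nu>^3 * ((m * s\<^sup>2 + E) / 2 + (m * s\<^sup>2 + P + E) / 2)"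
    if z: "cip \<phi> z = 0" "norm z \<le> 2 * \<nu>" for z
  proof -
    have "(4 * \<nu>\<^sup>2 * s) * ((\<Sum>y\<in>B. 2 * \<nu> * e f y) + norm (\<Sum>y\<in>B. kbf y z \<phi> f))
      = 8 * \<nu>^3 * (\<Sum>y\<in>B. s * e f y) + 4 * \<nu>\<^sup>2 * (s * norm (\<Sum>y\<in>B. kbf y z \<phi> f))"
      by (simp add: sum_distrib_left algebra_simps power2_eq_square power3_eq_cube)
    also have "\<dots> \<le> 8 * \<nu>^3 * ((m * s\<^sup>2 + E) / 2) + 4 * \<nu>\<^sup>2 * (2 * \<nu> * ((m * s\<^sup>2 + P + E) / 2))"
      using Ssum LLN[OF z] nu_powers(5) by (intro add_mono mult_left_mono) auto
    also have "\<dots> = 8 * \<nu>^3 * ((m * s\<^sup>2 + E) / 2 + (m * s\<^sup>2 + P + E) / 2)"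
      by (simp add: algebra_simps power2_eq_square power3_eq_cube)
    finally show ?thesis .
  qed
  have sumn: "norm (\<Sum>y\<in>B. bn y f) \<le> (\<Sum>y\<in>B. 2 * \<nu> * e f y) + norm (\<Sum>y\<in>B. kbf y u \<phi> f)"
    "norm (\<Sum>y\<in>B. bc y f) \<le> (\<Sum>y\<in>B. 2 * \<nu> * e f y) + norm (\<Sum>y\<in>B. kbf y w \<phi> f)"
  proof -
    have b: "(\<Sum>y\<in>B. bn y f) = (\<Sum>y\<in>B. bn y (q y f)) + (\<Sum>y\<in>B. kbf y u \<phi> f)"
      unfolding sum.distrib[symmetric] by (rule sum.cong[OF refl bn_decomp])
    have c: "(\<Sum>y\<in>B. bc y f) = (\<Sum>y\<in>B. bc y (q y f)) + (\<Sum>y\<in>B. kbf y w \<phi> f)"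
      unfolding sum.distrib[symmetric] by (rule sum.cong[OF refl bc_decomp])
    show "norm (\<Sum>y\<in>B. bn y f) \<le> (\<Sum>y\<in>B. 2 * \<nu> * e f y) + norm (\<Sum>y\<in>B. kbf y u \<phi> f)"
      unfolding b by (intro order_trans[OF norm_triangle_ineq] add_right_mono sum_norm_le bn_norm)
    show "norm (\<Sum>y\<in>B. bc y f) \<le> (\<Sum>y\<in>B. 2 * \<nu> * e f y) + norm (\<Sum>y\<in>B. kbf y w \<phi> f)"
      unfolding c by (intro order_trans[OF norm_triangle_ineq] add_right_mono sum_norm_le bn_norm)
  qed
  have T2: "cmod (cip g (\<Sum>y\<in>B. bn y f)) \<le> 8 * \<nu>^3 * ((m * s\<^sup>2 + E) / 2 + (m * s\<^sup>2 + P + E) / 2)"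
    by (rule order_trans[OF cmod_cip_le order_trans[OF mult_mono[OF gn(1) sumn(1)] T23[OF phi_u uw_norm(1)]]])
       (use s in auto)
  have T3: "cmod (cip (\<Sum>y\<in>B. bc y f) g') \<le> 8 * \<nu>^3 * ((m * s\<^sup>2 + E) / 2 + (m * s\<^sup>2 + P + E) / 2)"
    by (subst cip_cnj, subst complex_mod_cnj)
       (rule order_trans[OF cmod_cip_le order_trans[OF mult_mono[OF gn(2) sumn(2)] T23[OF phi_w uw_norm(2)]]],
        use s in auto)
  have "(\<Sum>y\<in>B. Im (cip (bn x (W x f) - W x (bn x f)) (bn y f))) =
    Im ((\<Sum>y\<in>B. cip (Y x f) (bn y (q x f))) + cip g (\<Sum>y\<in>B. bn y f) - cip (\<Sum>y\<in>B. bc y f) g')"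
  proof -
    have "(\<Sum>y\<in>B. cip (bn x (W x f) - W x (bn x f)) (bn y f)) =
      (\<Sum>y\<in>B. cip (Y x f) (bn y (q x f)) + cip g (bn y f) - cip (bc y f) g')"
      unfolding g_def g'_def by (rule sum.cong[OF refl]) (simp add: comm_form[OF ne])
    also have "\<dots> = (\<Sum>y\<in>B. cip (Y x f) (bn y (q x f))) + cip g (\<Sum>y\<in>B. bn y f) - cip (\<Sum>y\<in>B. bc y f) g'"
      by (simp add: sum.distrib sum_subtractf cip_sum_left cip_sum_right)
    finally show ?thesis unfolding Im_sum[symmetric] by (rule arg_cong[where f=Im])
  qed
  also have "\<bar>\<dots>\<bar> \<le> cmod ((\<Sum>y\<in>B. cip (Y x f) (bn y (q x f))) + cip g (\<Sum>y\<in>B. bn y f) - cip (\<Sum>y\<in>B. bc y f) g')"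
    by (rule abs_Im_le_cmod)
  also have "\<dots> \<le> cmod (\<Sum>y\<in>B. cip (Y x f) (bn y (q x f))) + cmod (cip g (\<Sum>y\<in>B. bn y f)) + cmod (cip (\<Sum>y\<in>B. bc y f) g')"
    by (intro order_trans[OF norm_triangle_ineq4] add_right_mono norm_triangle_ineq)
  also have "\<dots> \<le> 10 * \<nu>^3 * ((m * s\<^sup>2 + E) / 2 + m * s\<^sup>2) + 8 * \<nu>^3 * ((m * s\<^sup>2 + E) / 2 + (m * s\<^sup>2 + P + E) / 2)
     + 8 * \<nu>^3 * ((m * s\<^sup>2 + E) / 2 + (m * s\<^sup>2 + P + E) / 2)"
    by (intro add_mono T1 T2 T3)
  \<comment> \<open>\<open>31 = 15 + 8 + 8\<close>, \<open>21 = 5 + 8 + 8\<close> and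
    \<open>8 = 4 + 4\<close>, from \<open>T1\<close>, \<open>T2\<close> and
    \<open>T3\<close>.\<close>
  also have "\<dots> = \<nu>^3 * (31 * m * s\<^sup>2 + 21 * E + 8 * P)" by (simp add: algebra_simps)
  finally show ?thesis by (simp add: m_def s_def E_def P_def)
qed


lemma hx_q:
  "hx x (kbf x \<phi> \<phi> f) = kbf x (h1 \<phi>) \<phi> f" "kbf x \<phi> \<phi> (hx x f) = kbf x \<phi> (h1 \<phi>) f"
proof -
  show "hx x (kbf x \<phi> \<phi> f) = kbf x (h1 \<phi>) \<phi> f"
    by (simp add: hx_def h1_def dgf_kbf crf_kbf anf_kbf kbf_diff1 kbf_add1 kbf_scale1)
  show "kbf x \<phi> \<phi> (hx x f) = kbf x \<phi> (h1 \<phi>) f"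
    by (simp add: hx_def h1_def adjp_diff[OF adjp_kbf] adjp_add[OF adjp_kbf] adjp_scale[OF adjp_kbf]
        kbf_dgf kbf_crf kbf_anf kbf_diff2 kbf_add2 kbf_scale2) (simp add: add.commute)
qed

lemma hx_diff: "hx x (f - g) = hx x f - hx x g"
  by (rule fs_eqI) (simp add: hx_def op_rep algebra_simps)

text \<open>The time derivative of \<open>q x\<close>, applied to \<open>f\<close>, when \<phi>
  moves by \<open>i \<phi>' = h1 \<phi>\<close>.\<close>

definition dq :: "'s \<Rightarrow> ('s \<Rightarrow> nat) fs \<Rightarrow> ('s \<Rightarrow> nat) fs" where
  "dq x f = \<i> *\<^sub>F (kbf x (h1 \<phi>) \<phi> f - kbf x \<phi> (h1 \<phi>) f)"

text \<open>The diagonal part commutes with \<open>1 + N\<close> and contributes nothing. The linear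
  part is symmetric, so only its commutator with \<open>1 + N\<close> remains, a single
  \<open>anf x\<close> on \<open>q x f\<close> with coefficient \<alpha>.\<close>

lemma Im_one_site: "\<bar>Im (cip (dgf nh x (q x f)) (hx x (q x f)))\<bar> \<le> \<bar>J\<bar> * \<nu> * (e f x)\<^sup>2"
proof -
  let ?X = "q x f"
  define a where "a = cip (anf x ?X) (dgf nh x ?X)"
  have 1: "cip (dgf nh x ?X) (crf x ?X) = a + cip (anf x ?X) ?X"
  proof -
    have "cip (dgf nh x ?X) (crf x ?X) = cip (anf x (dgf nh x ?X)) ?X" by (rule adjpD[OF adjp_crf])
    also have "\<dots> = cip (dgf nh x (anf x ?X)) ?X + cip (anf x ?X) ?X" by (simp add: anf_nh cip_add_left)
    also have "cip (dgf nh x (anf x ?X)) ?X = a" unfolding a_def by (rule adjpD[OF adjp_dgf, symmetric])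
    finally show ?thesis .
  qed
  have 2: "cip (dgf nh x ?X) (anf x ?X) = cnj a" unfolding a_def by (rule cip_cnj)
  have real: "Im (cip (dgf nh x ?X) (dgf v x ?X)) = 0" "Im (cip (dgf nh x ?X) ?X) = 0"
  proof -
    have "cip (dgf nh x ?X) (dgf v x ?X) = cnj (cip (dgf nh x ?X) (dgf v x ?X))"
      using adjpD[OF adjp_dgf, of "dgf v x ?X" nh x ?X] adjpD[OF adjp_dgf, of "?X" v x "dgf nh x ?X"]
        cip_cnj[of "dgf nh x ?X" "dgf v x ?X"] adjpD[OF adjp_dgf, of "dgf nh x ?X" v x ?X]
      by (simp add: dgf_dgf_commute[of nh x v x])
    from arg_cong[OF this, of Im] show "Im (cip (dgf nh x ?X) (dgf v x ?X)) = 0" by simp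
    have "cip (dgf nh x ?X) ?X = cnj (cip (dgf nh x ?X) ?X)"
      using adjpD[OF adjp_dgf, of "?X" nh x ?X] cip_cnj[of "dgf nh x ?X" ?X] by simp
    from arg_cong[OF this, of Im] show "Im (cip (dgf nh x ?X) ?X) = 0" by simp
  qed
  have "cip (dgf nh x ?X) (hx x ?X) = cip (dgf nh x ?X) (dgf v x ?X)
      - complex_of_real J * (\<alpha> * (a + cip (anf x ?X) ?X) + cnj \<alpha> * cnj a - complex_of_real ((cmod \<alpha>)\<^sup>2) * cip (dgf nh x ?X) ?X)"
    by (simp add: hx_def cip_simps 1 2)
  also have "Im \<dots> = - J * Im (\<alpha> * cip (anf x ?X) ?X)"
    using real by (simp add: algebra_simps)
  finally have eq: "Im (cip (dgf nh x ?X) (hx x ?X)) = - J * Im (\<alpha> * cip (anf x ?X) ?X)" .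
  have "\<bar>Im (\<alpha> * cip (anf x ?X) ?X)\<bar> \<le> cmod \<alpha> * cmod (cip (anf x ?X) ?X)"
    using abs_Im_le_cmod[of "\<alpha> * cip (anf x ?X) ?X"] by (simp add: norm_mult)
  also have "\<dots> \<le> \<nu> * (e f x * e f x)"
    using nu_powers(5) by (intro mult_mono alpha_le order_trans[OF cmod_cip_le] e_props) (auto simp: e_props)
  finally show ?thesis by (simp add: eq abs_mult power2_eq_square mult_left_mono mult.assoc)
qed

end

section \<open>The derivative estimate on a loop-free regular graph\<close>

definition lattice_ham ::
  "(nat \<Rightarrow> real) \<Rightarrow> real \<Rightarrow> 's set \<Rightarrow> ('s \<Rightarrow> 's set) \<Rightarrow> nat \<Rightarrow> ('s \<Rightarrow> nat) fs \<Rightarrow> ('s \<Rightarrow> nat) fs" where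
  "lattice_ham v J \<Lambda> nb k f =
     (\<Sum>x\<in>\<Lambda>. dgf v x f) - complex_of_real (J / k) *\<^sub>F (\<Sum>p\<in>Sigma \<Lambda> nb. crf (fst p) (anf (snd p) f))"

locale mean_field_lattice = mean_field \<phi> J v \<nu>
  for \<phi> J v \<nu> +
  fixes \<Lambda> :: "'s set" and nb :: "'s \<Rightarrow> 's set" and k :: nat
  assumes fin: "finite \<Lambda>" and nb_sub: "\<And>x. x \<in> \<Lambda> \<Longrightarrow> nb x \<subseteq> \<Lambda>" and nb_sym: "\<And>x y. y \<in> nb x \<Longrightarrow> x \<in> nb y"
    and nb_irr: "\<And>x. x \<notin> nb x" and nb_card: "\<And>x. x \<in> \<Lambda> \<Longrightarrow> card (nb x) = k" and k_pos: "k > 0"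
begin

abbreviation H :: "('s \<Rightarrow> nat) fs \<Rightarrow> ('s \<Rightarrow> nat) fs" where "H \<equiv> lattice_ham v J \<Lambda> nb k"

lemma nb_fin: "x \<in> \<Lambda> \<Longrightarrow> finite (nb x)" using finite_subset[OF nb_sub fin] .

text \<open>A term that commutes with \<open>W x\<close> has its conjugate as expectation of the
  adjoint term. So symmetric terms lose their imaginary part, and pairs of mutually adjoint terms
  cancel; everything in \<open>H\<close> away from \<open>x\<close> disappears in this way.\<close>

lemma W_symm:
  assumes "\<And>f. W x (T f) = T (W x f)" "adjp T T'"
  shows "cip (W x f) (T f) = cnj (cip (W x f) (T' f))"
proof -
  have "cip (W x f) (T f) = cip f (W x (T f))" by (rule adjpD[OF adjp_W, symmetric])
  also have "\<dots> = cip (T' f) (W x f)" by (simp add: assms(1) adjpD[OF assms(2)])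
  also have "\<dots> = cnj (cip (W x f) (T' f))" by (rule cip_cnj)
  finally show ?thesis .
qed

lemma W_H:
  assumes x: "x \<in> \<Lambda>"
  shows "Im (cip (W x f) (H f)) = Im (cip (W x f) (dgf v x f))
     - J / k * (\<Sum>y\<in>nb x. Im (cip (W x f) (crf x (anf y f))) + Im (cip (W x f) (crf y (anf x f))))"
proof -
  define t where "t p = Im (cip (W x f) (crf (fst p) (anf (snd p) f)))" for p
  \<comment> \<open>The bonds avoiding \<open>x\<close>. Reversing a bond gives the adjoint hop, so
    their contributions cancel in pairs.\<close>
  define R where "R = {p \<in> Sigma \<Lambda> nb. fst p \<noteq> x \<and> snd p \<noteq> x}"
  have fS: "finite (Sigma \<Lambda> nb)" using fin nb_fin by auto
  have Rsw: "prod.swap ` R = R"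
    unfolding R_def using nb_sub nb_sym by (auto simp: image_iff) blast+
  have "sum t R = sum t (prod.swap ` R)" by (simp add: Rsw)
  also have "\<dots> = (\<Sum>p\<in>R. t (prod.swap p))" by (subst sum.reindex) auto
  also have "\<dots> = (\<Sum>p\<in>R. - t p)"
  proof (rule sum.cong[OF refl])
    fix p assume p: "p \<in> R"
    then have ne: "fst p \<noteq> x" "snd p \<noteq> x" by (auto simp: R_def)
    have "fst p \<noteq> snd p" using p nb_irr by (auto simp: R_def)
    have "cip (W x f) (crf (snd p) (anf (fst p) f)) = cnj (cip (W x f) (crf (fst p) (anf (snd p) f)))"
    proof (rule W_symm)
      show "W x (crf (snd p) (anf (fst p) f)) = crf (snd p) (anf (fst p) (W x f))" for f using ne by (simp add: W_commute)
      show "adjp (\<lambda>f. crf (snd p) (anf (fst p) f)) (\<lambda>f. crf (fst p) (anf (snd p) f))"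
        by (rule adjp_compose[OF adjp_crf adjp_anf])
    qed
    then show "t (prod.swap p) = - t p" by (simp add: t_def)
  qed
  finally have R0: "sum t R = 0" by (simp add: sum_negf)
  have split: "Sigma \<Lambda> nb = R \<union> (Pair x ` nb x \<union> (\<lambda>y. (y, x)) ` nb x)"
    unfolding R_def using x nb_sub nb_sym by (auto simp: image_iff)
  have "sum t (Sigma \<Lambda> nb) = sum t R + (sum t (Pair x ` nb x) + sum t ((\<lambda>y. (y, x)) ` nb x))"
    unfolding split
  proof (subst sum.union_disjoint)
    show "finite R" using fS by (simp add: R_def)
    show "finite (Pair x ` nb x \<union> (\<lambda>y. (y, x)) ` nb x)" using nb_fin[OF x] by auto
    show "R \<inter> (Pair x ` nb x \<union> (\<lambda>y. (y, x)) ` nb x) = {}" by (auto simp: R_def)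
    show "sum t R + sum t (Pair x ` nb x \<union> (\<lambda>y. (y, x)) ` nb x) = sum t R + (sum t (Pair x ` nb x) + sum t ((\<lambda>y. (y, x)) ` nb x))"
      using nb_fin[OF x] nb_irr by (subst sum.union_disjoint) auto
  qed
  also have "\<dots> = (\<Sum>y\<in>nb x. Im (cip (W x f) (crf x (anf y f))) + Im (cip (W x f) (crf y (anf x f))))"
    unfolding R0 by (simp add: sum.reindex inj_on_def sum.distrib t_def)
  finally have hop: "sum t (Sigma \<Lambda> nb) = (\<Sum>y\<in>nb x. Im (cip (W x f) (crf x (anf y f))) + Im (cip (W x f) (crf y (anf x f))))" .
  have "(\<Sum>y\<in>\<Lambda>. Im (cip (W x f) (dgf v y f))) = (\<Sum>y\<in>{x}. Im (cip (W x f) (dgf v y f)))"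
  proof (rule sum.mono_neutral_right[OF fin])
    show "\<forall>y\<in>\<Lambda> - {x}. Im (cip (W x f) (dgf v y f)) = 0"
    proof
      fix y assume "y \<in> \<Lambda> - {x}"
      then have "x \<noteq> y" by auto
      then have "W x (dgf v y f) = dgf v y (W x f)" for f by (rule W_commute(3))
      from W_symm[OF this adjp_dgf, of f] have "Im (cip (W x f) (dgf v y f)) = - Im (cip (W x f) (dgf v y f))"
        by (metis cnj.sel(2))
      then show "Im (cip (W x f) (dgf v y f)) = 0" by simp
    qed
  qed (use x in auto)
  then have pot: "(\<Sum>y\<in>\<Lambda>. Im (cip (W x f) (dgf v y f))) = Im (cip (W x f) (dgf v x f))" by simp
  have "cip (W x f) (H f) = (\<Sum>y\<in>\<Lambda>. cip (W x f) (dgf v y f)) -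
      complex_of_real (J / k) * (\<Sum>p\<in>Sigma \<Lambda> nb. cip (W x f) (crf (fst p) (anf (snd p) f)))"
    by (simp add: lattice_ham_def cip_diff_right cip_scale_right cip_sum_right)
  then have "Im (cip (W x f) (H f)) = (\<Sum>y\<in>\<Lambda>. Im (cip (W x f) (dgf v y f))) - J / k * sum t (Sigma \<Lambda> nb)"
    by (simp add: t_def Im_sum)
  then show ?thesis by (simp only: pot hop)
qed

text \<open>The hop across the bond minus the mean field at \<open>x\<close> differs from
  \<open>bc x (bn y f) + bc y (bn x f)\<close> only by one-site terms at \<open>y\<close>. These
  commute with \<open>W x\<close> and are symmetric in total, hence have no imaginary part.\<close>

lemma pair_identity:
  assumes "x \<noteq> y"
  shows "Im (cip (W x f) (crf x (anf y f))) + Im (cip (W x f) (crf y (anf x f)))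
     - Im (cip (W x f) (\<alpha> *\<^sub>F crf x f + cnj \<alpha> *\<^sub>F anf x f - complex_of_real ((cmod \<alpha>)\<^sup>2) *\<^sub>F f))
   = Im (cip (bn x (W x f) - W x (bn x f)) (bn y f))"
proof -
  have c: "(cmod \<alpha>)\<^sup>2 = Re (\<alpha> * cnj \<alpha>)" by (simp add: complex_norm_square[symmetric])
  have vec: "crf x (anf y f) + crf y (anf x f) - (\<alpha> *\<^sub>F crf x f + cnj \<alpha> *\<^sub>F anf x f - complex_of_real ((cmod \<alpha>)\<^sup>2) *\<^sub>F f)
     = bc x (bn y f) + bc y (bn x f) + (cnj \<alpha> *\<^sub>F anf y f + \<alpha> *\<^sub>F crf y f - complex_of_real ((cmod \<alpha>)\<^sup>2) *\<^sub>F f)"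
    by (rule fs_eqI, simp only: complex_norm_square)
       (simp add: bc_def bn_def adjp_diff[OF adjp_crf] adjp_scale[OF adjp_crf] fc_simps algebra_simps)
  have 1: "Im (cip (W x f) (cnj \<alpha> *\<^sub>F anf y f + \<alpha> *\<^sub>F crf y f - complex_of_real ((cmod \<alpha>)\<^sup>2) *\<^sub>F f)) = 0"
  proof -
    have "cip (W x f) (anf y f) = cnj (cip (W x f) (crf y f))"
      by (rule W_symm[OF _ adjp_anf]) (use assms in \<open>simp add: W_commute\<close>)
    moreover have "cip (W x f) f = cnj (cip (W x f) f)"
      by (rule W_symm[of x "\<lambda>f. f" "\<lambda>f. f"]) (auto simp: adjp_def)
    then have "Im (cip (W x f) f) = 0" by (metis cnj.sel(2) equal_neg_zero)
    ultimately show ?thesis by (simp add: cip_simps)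
  qed
  have 2: "cip (W x f) (bc x (bn y f)) = cip (bn x (W x f)) (bn y f)" by (rule adjpD[OF adjp_bc])
  have 3: "Im (cip (W x f) (bc y (bn x f))) = - Im (cip (W x (bn x f)) (bn y f))"
  proof -
    have "cip (W x f) (bc y (bn x f)) = cip (bn y (W x f)) (bn x f)" by (rule adjpD[OF adjp_bc])
    also have "\<dots> = cip (bn y f) (W x (bn x f))" using assms by (simp add: W_bn_commute[symmetric] adjpD[OF adjp_W])
    finally show ?thesis using cip_cnj[of "bn y f" "W x (bn x f)"] by simp
  qed
  have "Im (cip (W x f) (crf x (anf y f))) + Im (cip (W x f) (crf y (anf x f)))
     - Im (cip (W x f) (\<alpha> *\<^sub>F crf x f + cnj \<alpha> *\<^sub>F anf x f - complex_of_real ((cmod \<alpha>)\<^sup>2) *\<^sub>F f))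
     = Im (cip (W x f) (crf x (anf y f) + crf y (anf x f) - (\<alpha> *\<^sub>F crf x f + cnj \<alpha> *\<^sub>F anf x f - complex_of_real ((cmod \<alpha>)\<^sup>2) *\<^sub>F f)))"
    by (simp only: cip_diff_right cip_add_right minus_complex.sel plus_complex.sel)
  also have "\<dots> = Im (cip (W x f) (bc x (bn y f))) + Im (cip (W x f) (bc y (bn x f)))"
    by (simp only: vec cip_add_right[of "W x f" "bc x (bn y f) + bc y (bn x f)"] plus_complex.sel 1)
       (simp add: cip_add_right)
  also have "\<dots> = Im (cip (bn x (W x f) - W x (bn x f)) (bn y f))"
    by (simp add: 2 3 cip_diff_left)
  finally show ?thesis .
qed

text \<open>The time derivative of \<open>(e f x)\<^sup>2\<close> when \<open>i f' = H f\<close> and \<open>i \<phi>' = h1 \<phi>\<close>.\<close>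

definition deriv_e :: "('s \<Rightarrow> nat) fs \<Rightarrow> 's \<Rightarrow> real" where
  "deriv_e f x = 2 * Im (cip (W x f) (H f)) + 2 * Re (cip (dq x f) (dgf nh x (q x f)))"

lemma deriv_e_eq:
  assumes x: "x \<in> \<Lambda>"
  shows "deriv_e f x = 2 * Im (cip (dgf nh x (q x f)) (hx x (q x f)))
    - 2 * J / k * (\<Sum>y\<in>nb x. Im (cip (bn x (W x f) - W x (bn x f)) (bn y f)))"
proof -
  let ?n = "dgf nh x (q x f)"
  let ?Z = "\<alpha> *\<^sub>F crf x f + cnj \<alpha> *\<^sub>F anf x f - complex_of_real ((cmod \<alpha>)\<^sup>2) *\<^sub>F f"
  have "cip (dq x f) ?n = - \<i> * cnj (cip ?n (kbf x (h1 \<phi>) \<phi> f - kbf x \<phi> (h1 \<phi>) f))"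
    using cip_cnj[of "kbf x (h1 \<phi>) \<phi> f - kbf x \<phi> (h1 \<phi>) f" ?n] by (simp add: dq_def cip_scale_left)
  then have 1: "Re (cip (dq x f) ?n) = - Im (cip ?n (kbf x (h1 \<phi>) \<phi> f - kbf x \<phi> (h1 \<phi>) f))" by simp
  \<comment> \<open>The motion of \<open>q x\<close> compensates its commutator with the mean-field
    operator, so only \<open>hx x\<close> acting on \<open>q x f\<close> is left.\<close>
  have "hx x (q x f) = q x (hx x f) - (kbf x (h1 \<phi>) \<phi> f - kbf x \<phi> (h1 \<phi>) f)"
    by (simp add: q_def hx_diff hx_q)
  then have 2: "cip ?n (kbf x (h1 \<phi>) \<phi> f - kbf x \<phi> (h1 \<phi>) f) = cip (W x f) (hx x f) - cip ?n (hx x (q x f))"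
    by (simp add: W_def adjpD[OF adjp_q, symmetric] cip_diff_right)
  have hx: "Im (cip (W x f) (hx x f)) = Im (cip (W x f) (dgf v x f)) - J * Im (cip (W x f) ?Z)"
    by (simp add: hx_def cip_diff_right cip_scale_right)
  \<comment> \<open>The mean field at \<open>x\<close> is shared equally among the \<open>k\<close>
    neighbours, so that it can be subtracted bond by bond.\<close>
  have kZ: "J * Im (cip (W x f) ?Z) = J / k * (\<Sum>y\<in>nb x. Im (cip (W x f) ?Z))"
    using k_pos by (simp add: nb_card[OF x])
  have "(\<Sum>y\<in>nb x. Im (cip (W x f) (crf x (anf y f))) + Im (cip (W x f) (crf y (anf x f))))
      - (\<Sum>y\<in>nb x. Im (cip (W x f) ?Z)) = (\<Sum>y\<in>nb x. Im (cip (bn x (W x f) - W x (bn x f)) (bn y f)))"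
    unfolding sum_subtractf[symmetric]
    by (rule sum.cong[OF refl], rule pair_identity) (use nb_irr in auto)
  then have "2 * (Im (cip (W x f) (H f)) - Im (cip (W x f) (hx x f))) = 2 * - (J / k) * (\<Sum>y\<in>nb x. Im (cip (bn x (W x f) - W x (bn x f)) (bn y f)))"
    unfolding W_H[OF x] hx kZ by (simp add: algebra_simps)
  then show ?thesis unfolding deriv_e_def 1 2 by (simp add: algebra_simps)
qed

text \<open>\<open>106 = 64 + 42\<close>: twice 31 plus 2 from the one-site term, and twice 21 from
  the neighbour sums, in which each site occurs \<open>k\<close> times. The 16 is twice 8.\<close>

theorem deriv_e_sum_le:
  "(\<Sum>x\<in>\<Lambda>. deriv_e f x) \<le> \<bar>J\<bar> * \<nu>^3 * (106 * (\<Sum>x\<in>\<Lambda>. (e f x)\<^sup>2) + 16 * card \<Lambda> * (norm f)\<^sup>2 / k)"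
proof -
  define E where "E x = (\<Sum>y\<in>nb x. (e f y)\<^sup>2)" for x
  have each: "deriv_e f x \<le> \<bar>J\<bar> * \<nu>^3 * (64 * (e f x)\<^sup>2 + 42 * E x / k + 16 * (norm f)\<^sup>2 / k)" if x: "x \<in> \<Lambda>" for x
  proof -
    define S where "S = (\<Sum>y\<in>nb x. Im (cip (bn x (W x f) - W x (bn x f)) (bn y f)))"
    have S: "\<bar>S\<bar> \<le> \<nu>^3 * (31 * k * (e f x)\<^sup>2 + 21 * E x + 8 * (norm f)\<^sup>2)"
      using commutator_sum_le[OF nb_fin[OF x] nb_irr, of f] by (simp add: S_def nb_card[OF x] E_def)
    have "- (2 * J / k * S) \<le> \<bar>2 * J / k * S\<bar>" by (rule abs_ge_minus_self)
    also have "\<dots> = 2 * \<bar>J\<bar> / k * \<bar>S\<bar>" by (simp add: abs_mult)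
    also have "\<dots> \<le> 2 * \<bar>J\<bar> / k * (\<nu>^3 * (31 * k * (e f x)\<^sup>2 + 21 * E x + 8 * (norm f)\<^sup>2))"
      by (intro mult_left_mono S) auto
    also have "\<dots> = \<bar>J\<bar> * \<nu>^3 * (62 * (e f x)\<^sup>2 + 42 * E x / k + 16 * (norm f)\<^sup>2 / k)"
      using k_pos by (simp add: field_simps)
    finally have 1: "- (2 * J / k * S) \<le> \<bar>J\<bar> * \<nu>^3 * (62 * (e f x)\<^sup>2 + 42 * E x / k + 16 * (norm f)\<^sup>2 / k)" .
    have "Im (cip (dgf nh x (q x f)) (hx x (q x f))) \<le> \<bar>J\<bar> * \<nu> * (e f x)\<^sup>2" using Im_one_site[of x f] by simp
    also have "\<dots> \<le> \<bar>J\<bar> * \<nu>^3 * (e f x)\<^sup>2" by (intro mult_right_mono mult_left_mono nu_powers) auto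
    finally have "2 * Im (cip (dgf nh x (q x f)) (hx x (q x f))) \<le> \<bar>J\<bar> * \<nu>^3 * (2 * (e f x)\<^sup>2)" by simp
    with 1 show ?thesis unfolding deriv_e_eq[OF x] S_def[symmetric] by (simp add: algebra_simps)
  qed
  have E_sum: "(\<Sum>x\<in>\<Lambda>. E x) = k * (\<Sum>x\<in>\<Lambda>. (e f x)\<^sup>2)"
  proof -
    have "(\<Sum>x\<in>\<Lambda>. E x) = (\<Sum>x\<in>\<Lambda>. \<Sum>y\<in>{y\<in>\<Lambda>. y \<in> nb x}. (e f y)\<^sup>2)"
      unfolding E_def by (intro sum.cong refl) (use nb_sub in auto)
    also have "\<dots> = (\<Sum>y\<in>\<Lambda>. \<Sum>x\<in>{x\<in>\<Lambda>. y \<in> nb x}. (e f y)\<^sup>2)" by (rule sum.swap_restrict[OF fin fin])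
    also have "\<dots> = (\<Sum>y\<in>\<Lambda>. \<Sum>x\<in>nb y. (e f y)\<^sup>2)"
      by (intro sum.cong refl) (use nb_sub nb_sym in auto)
    also have "\<dots> = k * (\<Sum>x\<in>\<Lambda>. (e f x)\<^sup>2)" by (simp add: nb_card sum_distrib_left)
    finally show ?thesis .
  qed
  have "(\<Sum>x\<in>\<Lambda>. deriv_e f x) \<le> (\<Sum>x\<in>\<Lambda>. \<bar>J\<bar> * \<nu>^3 * (64 * (e f x)\<^sup>2 + 42 * E x / k + 16 * (norm f)\<^sup>2 / k))"
    by (intro sum_mono each)
  also have "\<dots> = \<bar>J\<bar> * \<nu>^3 * (64 * (\<Sum>x\<in>\<Lambda>. (e f x)\<^sup>2) + 42 * (\<Sum>x\<in>\<Lambda>. E x) / k + 16 * card \<Lambda> * (norm f)\<^sup>2 / k)"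
    by (simp add: sum_distrib_left[symmetric] sum.distrib sum_divide_distrib[symmetric])
  also have "\<dots> = \<bar>J\<bar> * \<nu>^3 * (106 * (\<Sum>x\<in>\<Lambda>. (e f x)\<^sup>2) + 16 * card \<Lambda> * (norm f)\<^sup>2 / k)"
    unfolding E_sum using k_pos by simp
  finally show ?thesis .
qed

end

section \<open>Moments of the mean-field solution\<close>

definition site_energy :: "real \<Rightarrow> real \<Rightarrow> real \<Rightarrow> nat \<Rightarrow> real" where
  "site_energy J \<mu> U n = (J - \<mu>) * real n + U / 2 * (real n * (real n - 1))"

lemma num_funpow: "(num ^^ k) \<psi> n = of_nat n ^ k * \<psi> n"
  by (induction k arbitrary: n) (simp_all add: num_eq)

lemma mf_op_coord:
  "mf_op J \<mu> U \<phi> \<psi> n = complex_of_real (site_energy J \<mu> U n) * \<psi> n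
     - complex_of_real J * (mf_alpha \<phi> * (complex_of_real (sqrt (real n)) * \<psi> (n - 1))
        + cnj (mf_alpha \<phi>) * (complex_of_real (sqrt (real (n + 1))) * \<psi> (n + 1))
        - complex_of_real ((cmod (mf_alpha \<phi>))\<^sup>2) * \<psi> n)"
  by (simp add: mf_op_def site_energy_def num_pair_def num_eq cre_def ann_def algebra_simps)

lemma square_summable_comparison:
  fixes f g :: "'i \<Rightarrow> complex"
  assumes "(\<lambda>i. (cmod (g i))\<^sup>2) summable_on UNIV" "\<And>i. cmod (f i) \<le> c * cmod (g i)"
  shows "(\<lambda>i. (cmod (f i))\<^sup>2) summable_on UNIV"
proof (rule summable_on_comparison_test)
  show "(\<lambda>i. c\<^sup>2 * (cmod (g i))\<^sup>2) summable_on UNIV" by (intro summable_on_cmult_right assms)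
  show "(cmod (f i))\<^sup>2 \<le> c\<^sup>2 * (cmod (g i))\<^sup>2" for i
    using power_mono[OF assms(2), of i 2] by (simp add: power_mult_distrib)
qed auto

text \<open>The weight \<open>1 + n^2\<close> combines a vector and its image under
  \<open>N^2\<close> in one condition, against which all weights of quadratic growth can be
  compared.\<close>

definition sq_dom :: "nat ell2 \<Rightarrow> bool" where
  "sq_dom \<psi> \<longleftrightarrow> (\<lambda>n. (cmod ((1 + (of_nat n)\<^sup>2) * coord \<psi> n))\<^sup>2) summable_on UNIV"

lemma cmod_one_plus_sq: "cmod (1 + (of_nat n)\<^sup>2) = 1 + (real n)\<^sup>2"
proof -
  have "1 + (of_nat n)\<^sup>2 = complex_of_real (1 + (real n)\<^sup>2)" by simp
  then show ?thesis by (simp only: norm_of_real) simp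
qed

lemma sq_dom_iff: "sq_dom \<psi> \<longleftrightarrow> \<psi> \<in> op_dom (num ^^ 2)"
proof -
  have "sq_dom \<psi>" if "(\<lambda>n. (cmod (of_nat n ^ 2 * coord \<psi> n))\<^sup>2) summable_on UNIV"
    using square_summable_add[OF coord_summable[of \<psi>] that] by (simp add: sq_dom_def algebra_simps)
  moreover have "(\<lambda>n. (cmod (of_nat n ^ 2 * coord \<psi> n))\<^sup>2) summable_on UNIV" if "sq_dom \<psi>"
    using that[unfolded sq_dom_def]
  proof (rule square_summable_comparison)
    fix n
    have "(real n)\<^sup>2 * cmod (coord \<psi> n) \<le> (1 + (real n)\<^sup>2) * cmod (coord \<psi> n)" by (intro mult_right_mono) auto
    then show "cmod (of_nat n ^ 2 * coord \<psi> n) \<le> 1 * cmod ((1 + (of_nat n)\<^sup>2) * coord \<psi> n)"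
      by (simp add: norm_mult norm_power cmod_one_plus_sq)
  qed
  ultimately show ?thesis by (auto simp: op_dom_def num_funpow)
qed

text \<open>Multiplication by \<open>r n / (1 + n\<^sup>2)\<close> is bounded when \<open>r\<close> grows at most quadratically, so
  \<open>r\<close> times a path is continuous in \<open>\<ell>\<^sup>2\<close> as soon as the path is continuous in the graph norm of \<open>N\<^sup>2\<close>.\<close>

definition quad_growth :: "(nat \<Rightarrow> real) \<Rightarrow> bool" where
  "quad_growth r \<longleftrightarrow> (\<exists>c\<ge>0. \<forall>n. \<bar>r n\<bar> \<le> c * (1 + (real n)\<^sup>2))"

definition wt :: "(nat \<Rightarrow> real) \<Rightarrow> nat ell2 \<Rightarrow> nat ell2" where
  "wt r \<psi> = Abs_ell2 (\<lambda>n. complex_of_real (r n) * coord \<psi> n)"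

lemma wt_summable:
  assumes "sq_dom \<psi>" "quad_growth r"
  shows "(\<lambda>n. (cmod (complex_of_real (r n) * coord \<psi> n))\<^sup>2) summable_on UNIV"
proof -
  obtain c where c: "c \<ge> 0" "\<And>n. \<bar>r n\<bar> \<le> c * (1 + (real n)\<^sup>2)" using assms(2) by (auto simp: quad_growth_def)
  show ?thesis
    using assms(1)[unfolded sq_dom_def]
  proof (rule square_summable_comparison)
    fix n
    show "cmod (complex_of_real (r n) * coord \<psi> n) \<le> c * cmod ((1 + (of_nat n)\<^sup>2) * coord \<psi> n)"
      using mult_right_mono[OF c(2)[of n], of "cmod (coord \<psi> n)"]
      by (simp add: norm_mult cmod_one_plus_sq mult.assoc)
  qed
qed

lemma coord_wt: "sq_dom \<psi> \<Longrightarrow> quad_growth r \<Longrightarrow> coord (wt r \<psi>) n = complex_of_real (r n) * coord \<psi> n"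
  unfolding wt_def by (subst coord_Abs[OF wt_summable]) auto

lemma quad_growthI: "c \<ge> 0 \<Longrightarrow> (\<And>n. \<bar>r n\<bar> \<le> c * (1 + (real n)\<^sup>2)) \<Longrightarrow> quad_growth r"
  by (auto simp: quad_growth_def)

lemma quad_growth_sq: "quad_growth (\<lambda>n. 1 + (real n)\<^sup>2)"
  by (rule quad_growthI[of 1]) auto

lemma norm_le_coord:
  assumes "\<And>i. cmod (coord x i) \<le> c * cmod (coord y i)" "c \<ge> 0"
  shows "norm x \<le> c * norm y"
proof (rule power2_le_imp_le)
  have "(norm x)\<^sup>2 \<le> (\<Sum>\<^sub>\<infinity>i. c\<^sup>2 * (cmod (coord y i))\<^sup>2)"
    unfolding norm_eq_infsum
  proof (rule infsum_mono[OF coord_summable summable_on_cmult_right[OF coord_summable]])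
    fix i show "(cmod (coord x i))\<^sup>2 \<le> c\<^sup>2 * (cmod (coord y i))\<^sup>2"
      using power_mono[OF assms(1)[of i], of 2] by (simp add: power_mult_distrib)
  qed
  then show "(norm x)\<^sup>2 \<le> (c * norm y)\<^sup>2" by (simp add: infsum_cmult_right' norm_eq_infsum power_mult_distrib)
qed (use assms(2) in auto)

lemma continuous_wt:
  assumes dom: "\<And>t. sq_dom (f t)" and c1: "continuous_on UNIV f"
    and c2: "continuous_on UNIV (\<lambda>t. op_app (num ^^ 2) (f t))" and r: "quad_growth r"
  shows "continuous_on UNIV (\<lambda>t. wt r (f t))"
proof -
  have e: "wt (\<lambda>n. 1 + (real n)\<^sup>2) (f t) = f t + op_app (num ^^ 2) (f t)" for t
  proof (rule ell2_eqI)
    fix n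
    have "(\<lambda>n. (cmod ((num ^^ 2) (coord (f t)) n))\<^sup>2) summable_on UNIV" using dom[of t] by (simp add: sq_dom_iff op_dom_def)
    then have "coord (op_app (num ^^ 2) (f t)) n = of_nat n ^ 2 * coord (f t) n"
      unfolding op_app_def by (subst coord_Abs) (auto simp: num_funpow)
    then show "coord (wt (\<lambda>n. 1 + (real n)\<^sup>2) (f t)) n = coord (f t + op_app (num ^^ 2) (f t)) n"
      by (simp add: coord_wt[OF dom quad_growth_sq] coord_add algebra_simps)
  qed
  obtain c where c: "c \<ge> 0" "\<And>n. \<bar>r n\<bar> \<le> c * (1 + (real n)\<^sup>2)" using r by (auto simp: quad_growth_def)
  have lip: "dist (wt r (f t)) (wt r (f s)) \<le> c * dist (wt (\<lambda>n. 1 + (real n)\<^sup>2) (f t)) (wt (\<lambda>n. 1 + (real n)\<^sup>2) (f s))" for t s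
    unfolding dist_norm
  proof (rule norm_le_coord[OF _ c(1)])
    fix n
    show "cmod (coord (wt r (f t) - wt r (f s)) n) \<le> c * cmod (coord (wt (\<lambda>n. 1 + (real n)\<^sup>2) (f t) - wt (\<lambda>n. 1 + (real n)\<^sup>2) (f s)) n)"
      using mult_right_mono[OF c(2)[of n], of "cmod (coord (f t) n - coord (f s) n)"]
      by (simp add: coord_diff coord_wt[OF dom r] coord_wt[OF dom quad_growth_sq] right_diff_distrib[symmetric] norm_mult
          cmod_one_plus_sq mult.assoc)
  qed
  have cont: "continuous_on UNIV (\<lambda>t. wt (\<lambda>n. 1 + (real n)\<^sup>2) (f t))"
    unfolding e by (intro continuous_intros c1 c2)
  show ?thesis
    unfolding continuous_on_def
  proof
    fix t :: 'a
    have "((\<lambda>s. wt (\<lambda>n. 1 + (real n)\<^sup>2) (f s)) \<longlongrightarrow> wt (\<lambda>n. 1 + (real n)\<^sup>2) (f t)) (at t)"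
      using cont by (simp add: continuous_on_def)
    then have "((\<lambda>s. c * dist (wt (\<lambda>n. 1 + (real n)\<^sup>2) (f s)) (wt (\<lambda>n. 1 + (real n)\<^sup>2) (f t))) \<longlongrightarrow> 0) (at t)"
      using tendsto_mult_right_zero tendsto_dist_iff by blast
    then have "((\<lambda>s. dist (wt r (f s)) (wt r (f t))) \<longlongrightarrow> 0) (at t)"
      by (rule Lim_null_comparison[rotated]) (use lip in auto)
    then show "((\<lambda>t. wt r (f t)) \<longlongrightarrow> wt r (f t)) (at t within UNIV)" using tendsto_dist_iff by blast
  qed
qed

text \<open>Only \<open>f\<close> is differentiable; \<open>g\<close>, an unbounded weight applied
  to the same path, is merely continuous. Symmetry writes the difference quotient of the form as
  that of \<open>f\<close> paired with \<open>g s + g t\<close>, whose limit is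
  \<open>2 g t\<close>.\<close>

lemma quadratic_form_derivative:
  fixes f g :: "real \<Rightarrow> 'a::real_inner"
  assumes f: "(f has_vector_derivative f') (at t)" and g: "continuous_on UNIV g"
    and sym: "\<And>s. inner (f s) (g t) = inner (g s) (f t)"
  shows "((\<lambda>s. inner (f s) (g s)) has_real_derivative 2 * inner f' (g t)) (at t)"
proof -
  have "((\<lambda>s. (f s - f t) /\<^sub>R (s - t)) \<longlongrightarrow> f') (at t)"
  proof (rule LIM_zero_cancel, rule tendsto_norm_zero_cancel, rule Lim_transform_eventually)
    show "((\<lambda>s. norm (f s - f t - (s - t) *\<^sub>R f') / norm (s - t)) \<longlongrightarrow> 0) (at t)"
      using f by (simp add: has_vector_derivative_def has_derivative_iff_norm)
    have "norm (f s - f t - (s - t) *\<^sub>R f') / norm (s - t) = norm ((f s - f t) /\<^sub>R (s - t) - f')" if "s \<noteq> t" for s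
    proof -
      have "(f s - f t) /\<^sub>R (s - t) - f' = (f s - f t - (s - t) *\<^sub>R f') /\<^sub>R (s - t)"
        using that by (simp add: scaleR_diff_right)
      then show ?thesis by (simp add: divide_inverse abs_inverse mult.commute)
    qed
    then show "eventually (\<lambda>s. norm (f s - f t - (s - t) *\<^sub>R f') / norm (s - t) = norm ((f s - f t) /\<^sub>R (s - t) - f')) (at t)"
      by (simp add: eventually_at_filter)
  qed
  moreover have "(g \<longlongrightarrow> g t) (at t)" using g by (simp add: continuous_on_def)
  ultimately have "((\<lambda>s. inner ((f s - f t) /\<^sub>R (s - t)) (g s + g t)) \<longlongrightarrow> inner f' (g t + g t)) (at t)"
    by (intro tendsto_intros)
  moreover have "inner ((f s - f t) /\<^sub>R (s - t)) (g s + g t) = (inner (f s) (g s) - inner (f t) (g t)) / (s - t)" for s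
    using sym[of s] by (simp add: inner_diff_left inner_add_right inner_commute[of "f t" "g s"] divide_inverse mult.commute right_diff_distrib)
  ultimately show ?thesis
    unfolding has_field_derivative_iff by (simp add: inner_add_right)
qed

lemma inner_eq_suminf:
  fixes x y :: "nat ell2"
  shows "(\<lambda>n. Re (cnj (coord x n) * coord y n)) sums inner x y"
  unfolding inner_ell2_def cinner_def infsum_Re[symmetric, OF cinner_summable]
  by (rule has_sum_imp_sums[OF has_sum_infsum[OF summable_on_Re[OF cinner_summable]]])

lemma square_growth:
  fixes x :: real
  shows "x + 1 \<le> 2 * (1 + x\<^sup>2)" and "1 + (x + 1)\<^sup>2 \<le> 3 * (1 + x\<^sup>2)"
proof -
  have "2 * (1 + x\<^sup>2) - (x + 1) = (1 + 3 * x\<^sup>2 + (x - 1)\<^sup>2) / 2" by (simp add: power2_eq_square field_simps)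
  moreover have "(1 + 3 * x\<^sup>2 + (x - 1)\<^sup>2) / 2 \<ge> 0" by (intro divide_nonneg_nonneg add_nonneg_nonneg) auto
  ultimately have "0 \<le> 2 * (1 + x\<^sup>2) - (x + 1)" by (simp only:)
  then show "x + 1 \<le> 2 * (1 + x\<^sup>2)" by (simp only: diff_ge_0_iff_ge)
  have "3 * (1 + x\<^sup>2) - (1 + (x + 1)\<^sup>2) = x\<^sup>2 + (x - 1)\<^sup>2" by (simp add: power2_eq_square algebra_simps)
  moreover have "x\<^sup>2 + (x - 1)\<^sup>2 \<ge> 0" by simp
  ultimately have "0 \<le> 3 * (1 + x\<^sup>2) - (1 + (x + 1)\<^sup>2)" by (simp only:)
  then show "1 + (x + 1)\<^sup>2 \<le> 3 * (1 + x\<^sup>2)" by (simp only: diff_ge_0_iff_ge)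
qed

section \<open>Coordinates, currents and moments along the mean-field path\<close>

locale mf_path =
  fixes J \<mu> U :: real and \<phi> :: "real \<Rightarrow> nat ell2"
  assumes sol: "mf_solution J \<mu> U \<phi>" and init: "norm (\<phi> 0) = 1"
begin

definition al :: "real \<Rightarrow> complex" where "al t = mf_alpha (\<phi> t)"
definition c :: "real \<Rightarrow> nat \<Rightarrow> complex" where "c t n = coord (\<phi> t) n"
definition dc :: "real \<Rightarrow> nat \<Rightarrow> complex" where
  "dc t n = - \<i> * (complex_of_real (site_energy J \<mu> U n) * c t n
     - complex_of_real J * (al t * (complex_of_real (sqrt (real n)) * c t (n - 1))
        + cnj (al t) * (complex_of_real (sqrt (real (n + 1))) * c t (n + 1))
        - complex_of_real ((cmod (al t))\<^sup>2) * c t n))"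

lemma dom: "sq_dom (\<phi> t)" using sol by (simp add: mf_solution_def sq_dom_iff)

lemma quad_growths: "quad_growth (\<lambda>n. 1)" "quad_growth (\<lambda>n. real n + 1)" "quad_growth (\<lambda>n. (real n + 1)\<^sup>2)"
  "quad_growth (\<lambda>n. sqrt (real n))" "quad_growth (\<lambda>n. sqrt (real n + 1))" "quad_growth (site_energy J \<mu> U)"
proof -
  have a: "real n \<le> 1 + (real n)\<^sup>2" for n
    using sum_squares_bound[of "real n" 1] zero_le_power2[of "real n - 1"] by (simp add: power2_diff)
  have s: "sqrt (real n + 1) \<le> real n + 1" for n
    by (rule real_le_lsqrt) (auto simp: power2_eq_square algebra_simps)
  have s': "sqrt (real n) \<le> sqrt (real n + 1)" for n by simp
  show "quad_growth (\<lambda>n. 1)" by (rule quad_growthI[of 1]) auto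
  show "quad_growth (\<lambda>n. real n + 1)"
  proof (rule quad_growthI[of 2])
    show "\<bar>real n + 1\<bar> \<le> 2 * (1 + (real n)\<^sup>2)" for n using square_growth(1)[of "real n"] by simp
  qed simp
  show "quad_growth (\<lambda>n. (real n + 1)\<^sup>2)"
  proof (rule quad_growthI[of 3])
    show "\<bar>(real n + 1)\<^sup>2\<bar> \<le> 3 * (1 + (real n)\<^sup>2)" for n using a[of n] by (simp add: power2_sum)
  qed simp
  show "quad_growth (\<lambda>n. sqrt (real n + 1))"
  proof (rule quad_growthI[of 2])
    show "\<bar>sqrt (real n + 1)\<bar> \<le> 2 * (1 + (real n)\<^sup>2)" for n
      using order_trans[OF s square_growth(1), of n] by simp
  qed simp
  show "quad_growth (\<lambda>n. sqrt (real n))"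
  proof (rule quad_growthI[of 2])
    show "\<bar>sqrt (real n)\<bar> \<le> 2 * (1 + (real n)\<^sup>2)" for n
      using order_trans[OF order_trans[OF s' s] square_growth(1), of n] by simp
  qed simp
  show "quad_growth (site_energy J \<mu> U)"
  proof (rule quad_growthI[of "\<bar>J - \<mu>\<bar> + \<bar>U / 2\<bar>"])
    fix n
    have "\<bar>site_energy J \<mu> U n\<bar> \<le> \<bar>J - \<mu>\<bar> * \<bar>real n\<bar> + \<bar>U / 2\<bar> * \<bar>real n * (real n - 1)\<bar>"
      unfolding site_energy_def abs_mult[symmetric] by (rule abs_triangle_ineq)
    also have "\<dots> \<le> \<bar>J - \<mu>\<bar> * (1 + (real n)\<^sup>2) + \<bar>U / 2\<bar> * (1 + (real n)\<^sup>2)"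
    proof (intro add_mono mult_left_mono)
      show "\<bar>real n\<bar> \<le> 1 + (real n)\<^sup>2" using a by simp
      have "real n * (real n - 1) \<ge> 0" by (cases n) auto
      then show "\<bar>real n * (real n - 1)\<bar> \<le> 1 + (real n)\<^sup>2" by (simp add: power2_eq_square algebra_simps)
    qed auto
    finally show "\<bar>site_energy J \<mu> U n\<bar> \<le> (\<bar>J - \<mu>\<bar> + \<bar>U / 2\<bar>) * (1 + (real n)\<^sup>2)" by (simp add: distrib_right)
  qed auto
qed

lemma wt_c: "quad_growth r \<Longrightarrow> coord (wt r (\<phi> t)) n = complex_of_real (r n) * c t n"
  by (simp add: coord_wt[OF dom] c_def)

lemma shift_summable:
  "(\<lambda>n. (cmod (complex_of_real (sqrt (real (n + 1))) * c t (n + 1)))\<^sup>2) summable_on UNIV"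
  "(\<lambda>n. (cmod (complex_of_real (sqrt (real n)) * c t (n - 1)))\<^sup>2) summable_on UNIV"
proof -
  have "(\<lambda>n. (cmod (complex_of_real (sqrt (real n)) * c t n))\<^sup>2) summable_on range Suc"
    using wt_summable[OF dom quad_growths(4)] by (auto intro: summable_on_subset simp: c_def)
  then show "(\<lambda>n. (cmod (complex_of_real (sqrt (real (n + 1))) * c t (n + 1)))\<^sup>2) summable_on UNIV"
    by (subst (asm) summable_on_reindex) (auto simp: o_def)
  have "(\<lambda>n. (cmod (complex_of_real (sqrt (real n + 1)) * c t n))\<^sup>2) summable_on UNIV"
    using wt_summable[OF dom quad_growths(5)] by (simp add: c_def)
  then have "(\<lambda>n. (cmod (complex_of_real (sqrt (real n)) * c t (n - 1)))\<^sup>2) summable_on range Suc"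
    by (subst summable_on_reindex) (auto simp: o_def add.commute)
  then show "(\<lambda>n. (cmod (complex_of_real (sqrt (real n)) * c t (n - 1)))\<^sup>2) summable_on UNIV"
    
  proof (rule summable_on_cong_neutral[THEN iffD1, rotated -1])
    fix n :: nat assume "n \<in> UNIV - range Suc"
    then have "n = 0" by (cases n) auto
    then show "(cmod (complex_of_real (sqrt (real n)) * c t (n - 1)))\<^sup>2 = 0" by simp
  qed auto
qed

lemma al_eq: "al t = (\<Sum>\<^sub>\<infinity>n. cnj (c t n) * (complex_of_real (sqrt (real (n + 1))) * c t (n + 1)))"
proof -
  have "coord (op_app ann (\<phi> t)) = (\<lambda>n. complex_of_real (sqrt (real (n + 1))) * c t (n + 1))"
    unfolding op_app_def using shift_summable(1)[of t] by (subst coord_Abs) (auto simp: ann_def c_def)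
  then show ?thesis by (simp add: al_def mf_alpha_def cinner_def c_def)
qed

definition d\<phi> :: "real \<Rightarrow> nat ell2" where "d\<phi> t = (SOME d. (\<phi> has_vector_derivative d) (at t) \<and> \<i> *\<^sub>C d = op_app (mf_op J \<mu> U (\<phi> t)) (\<phi> t))"

lemma d\<phi>: "(\<phi> has_vector_derivative d\<phi> t) (at t)" "\<i> *\<^sub>C d\<phi> t = op_app (mf_op J \<mu> U (\<phi> t)) (\<phi> t)"
proof -
  have "\<exists>d. (\<phi> has_vector_derivative d) (at t) \<and> \<i> *\<^sub>C d = op_app (mf_op J \<mu> U (\<phi> t)) (\<phi> t)"
    using sol unfolding mf_solution_def by blast
  from someI_ex[OF this] show "(\<phi> has_vector_derivative d\<phi> t) (at t)" "\<i> *\<^sub>C d\<phi> t = op_app (mf_op J \<mu> U (\<phi> t)) (\<phi> t)"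
    by (simp_all add: d\<phi>_def)
qed

lemma coord_d\<phi>: "coord (d\<phi> t) n = dc t n"
proof -
  let ?h = "\<lambda>n. complex_of_real (site_energy J \<mu> U n) * c t n
     - complex_of_real J * (al t * (complex_of_real (sqrt (real n)) * c t (n - 1))
        + cnj (al t) * (complex_of_real (sqrt (real (n + 1))) * c t (n + 1))
        - complex_of_real ((cmod (al t))\<^sup>2) * c t n)"
  have h: "mf_op J \<mu> U (\<phi> t) (coord (\<phi> t)) = ?h"
    by (simp add: fun_eq_iff mf_op_coord c_def al_def)
  have sub: "(\<lambda>i. (cmod (f i - g i))\<^sup>2) summable_on UNIV"
    if "(\<lambda>i. (cmod (f i))\<^sup>2) summable_on UNIV" "(\<lambda>i. (cmod (g i))\<^sup>2) summable_on UNIV" for f g :: "nat \<Rightarrow> complex"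
    using square_summable_add[of f "\<lambda>i. - g i"] that by simp
  have c0: "(\<lambda>n. (cmod (c t n))\<^sup>2) summable_on UNIV" unfolding c_def by (rule coord_summable)
  have "(\<lambda>n. (cmod (?h n))\<^sup>2) summable_on UNIV"
    using wt_summable[OF dom quad_growths(6), of t]
    by (intro sub square_summable_add square_summable_cmult shift_summable c0) (simp add: c_def)
  then have "coord (op_app (mf_op J \<mu> U (\<phi> t)) (\<phi> t)) n = ?h n"
    unfolding op_app_def h by (subst coord_Abs) auto
  then have "\<i> * coord (d\<phi> t) n = ?h n" by (simp add: d\<phi>(2)[symmetric] coord_simps)
  then have "- \<i> * (\<i> * coord (d\<phi> t) n) = - \<i> * ?h n" by simp
  then show ?thesis by (simp add: dc_def mult.assoc[symmetric])
qed

lemma c_deriv: "((\<lambda>t. c t n) has_vector_derivative dc t n) (at t)"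
  using bounded_linear.has_vector_derivative[OF bounded_linear_coord d\<phi>(1), of n t] by (simp add: c_def coord_d\<phi>)

text \<open>\<open>- 2 J cur t n\<close> is the probability current from level \<open>n\<close> to level \<open>n + 1\<close>.\<close>

definition cur :: "real \<Rightarrow> nat \<Rightarrow> real" where
  "cur t n = Im (al t * (complex_of_real (sqrt (real (n + 1))) * (cnj (c t (n + 1)) * c t n)))"

lemma cur_summable:
  assumes r: "quad_growth r"
  shows "summable (\<lambda>n. r n * cur t n)"
    and "summable (\<lambda>n. cmod (complex_of_real (r n) * c t n) * cmod (complex_of_real (sqrt (real (n + 1))) * c t (n + 1)))"
    and "\<bar>r n * cur t n\<bar> \<le> cmod (al t) * (cmod (complex_of_real (r n) * c t n) * cmod (complex_of_real (sqrt (real (n + 1))) * c t (n + 1)))"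
proof -
  let ?y = "\<lambda>n. complex_of_real (sqrt (real (n + 1))) * c t (n + 1)"
  let ?z = "\<lambda>n. complex_of_real (r n) * c t n"
  have "(\<lambda>n. (cmod (?z n))\<^sup>2 + (cmod (?y n))\<^sup>2) summable_on UNIV"
    using shift_summable(1)[of t] wt_summable[OF dom r, of t] by (intro summable_on_add) (auto simp: c_def)
  then have s: "summable (\<lambda>n. (cmod (?z n))\<^sup>2 + (cmod (?y n))\<^sup>2)" by (rule summable_on_imp_summable)
  have le: "cmod (?z n) * cmod (?y n) \<le> (cmod (?z n))\<^sup>2 + (cmod (?y n))\<^sup>2" for n
  proof -
    have "0 \<le> cmod (?z n) * cmod (?y n)" by (intro mult_nonneg_nonneg norm_ge_zero)
    then show ?thesis using sum_squares_bound[of "cmod (?z n)" "cmod (?y n)"] by linarith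
  qed
  show s1: "summable (\<lambda>n. cmod (?z n) * cmod (?y n))"
    by (rule summable_comparison_test'[OF s, of 0]) (use le in \<open>simp only: real_norm_def abs_mult abs_norm_cancel\<close>)
  show bd: "\<bar>r n * cur t n\<bar> \<le> cmod (al t) * (cmod (?z n) * cmod (?y n))" for n
  proof -
    have "r n * cur t n = Im (al t * (?z n * cnj (?y n)))"
      by (simp add: cur_def algebra_simps)
    also have "\<bar>\<dots>\<bar> \<le> cmod (al t * (?z n * cnj (?y n)))" by (rule abs_Im_le_cmod)
    also have "\<dots> = cmod (al t) * (cmod (?z n) * cmod (?y n))" by (simp only: norm_mult complex_mod_cnj)
    finally show ?thesis .
  qed
  show "summable (\<lambda>n. r n * cur t n)"
    by (rule summable_comparison_test'[OF summable_mult[OF s1, of "cmod (al t)"], of 0]) (use bd in \<open>simp only: real_norm_def\<close>)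
qed

lemma quad_growth_Suc:
  assumes "quad_growth r"
  shows "quad_growth (\<lambda>n. r (Suc n))"
proof -
  obtain c where c: "c \<ge> 0" "\<And>n. \<bar>r n\<bar> \<le> c * (1 + (real n)\<^sup>2)" using assms by (auto simp: quad_growth_def)
  show ?thesis
  proof (rule quad_growthI[of "3 * c"])
    fix n
    have "1 + (real (Suc n))\<^sup>2 \<le> 3 * (1 + (real n)\<^sup>2)"
      using square_growth(2)[of "real n"] by (simp add: add.commute)
    then have "c * (1 + (real (Suc n))\<^sup>2) \<le> c * (3 * (1 + (real n)\<^sup>2))" by (rule mult_left_mono[OF _ c(1)])
    then show "\<bar>r (Suc n)\<bar> \<le> 3 * c * (1 + (real n)\<^sup>2)" using c(2)[of "Suc n"] by (simp add: algebra_simps)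
  qed (use c in simp)
qed

text \<open>The probabilities of the levels obey a continuity equation with the currents
  \<open>cur\<close>; site energies and the \<open>\<alpha>\<close>-square term are real and drop
  out. Summation by parts moves the difference onto the weight \<open>r\<close>.\<close>

lemma moment_deriv:
  assumes r: "quad_growth r"
  shows "((\<lambda>t. inner (\<phi> t) (wt r (\<phi> t))) has_real_derivative 2 * (- J * (\<Sum>n. (r (Suc n) - r n) * cur t n))) (at t)"
proof -
  have sym: "inner (\<phi> s) (wt r (\<phi> t)) = inner (wt r (\<phi> s)) (\<phi> t)" for s t
    unfolding inner_ell2_def cinner_def by (simp add: wt_c[OF r] c_def[symmetric] mult_ac)
  have cont: "continuous_on UNIV (\<lambda>t. wt r (\<phi> t))"
    by (rule continuous_wt[OF dom _ _ r]) (use sol in \<open>simp_all add: mf_solution_def\<close>)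
  have der: "((\<lambda>t. inner (\<phi> t) (wt r (\<phi> t))) has_real_derivative 2 * inner (d\<phi> t) (wt r (\<phi> t))) (at t)"
    by (rule quadratic_form_derivative[OF d\<phi>(1) cont sym])
  have nsum: "(\<lambda>n. Re (cnj (dc t n) * (complex_of_real (r n) * c t n))) sums inner (d\<phi> t) (wt r (\<phi> t))"
    using inner_eq_suminf[of "d\<phi> t" "wt r (\<phi> t)"] by (simp add: coord_d\<phi> wt_c[OF r])
  \<comment> \<open>The current into level \<open>n\<close> from below; nothing enters level
    0.\<close>
  define j where "j n = (if n = 0 then 0 else cur t (n - 1))" for n
  have each: "Re (cnj (dc t n) * (complex_of_real (r n) * c t n)) = - J * (r n * j n - r n * cur t n)" for n
  proof -
    define z where "z = c t n"
    define x where "x = complex_of_real (sqrt (real n)) * c t (n - 1)"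
    define y where "y = complex_of_real (sqrt (real (n + 1))) * c t (n + 1)"
    have 1: "cur t n = Im (al t * (cnj y * z))"
      unfolding cur_def y_def z_def by (simp add: mult_ac)
    have 2: "j n = Im (al t * (cnj z * x))"
      by (cases n) (simp_all add: j_def cur_def x_def z_def mult_ac)
    have 3: "dc t n = - \<i> * (complex_of_real (site_energy J \<mu> U n) * z
       - complex_of_real J * (al t * x + cnj (al t) * y - complex_of_real ((cmod (al t))\<^sup>2) * z))"
      by (simp add: dc_def x_def y_def z_def)
    show ?thesis
      unfolding z_def[symmetric] 1 2 3 by (simp add: algebra_simps)
  qed
  define A where "A = (\<Sum>n. r n * cur t n)"
  define B where "B = (\<Sum>n. r (Suc n) * cur t n)"
  have sA: "(\<lambda>n. r n * cur t n) sums A" unfolding A_def by (rule summable_sums[OF cur_summable(1)[OF r]])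
  have sB: "(\<lambda>n. r (Suc n) * cur t n) sums B" unfolding B_def by (rule summable_sums[OF cur_summable(1)[OF quad_growth_Suc[OF r]]])
  have "(\<lambda>n. r n * j n) sums B"
    by (rule sums_Suc_iff[of "\<lambda>n. r n * j n" B, THEN iffD1, simplified j_def, simplified, folded j_def, rotated]) (use sB in simp_all)
  then have "(\<lambda>n. - J * (r n * j n - r n * cur t n)) sums (- J * (B - A))"
    by (intro sums_mult sums_diff sA)
  then have "inner (d\<phi> t) (wt r (\<phi> t)) = - J * (B - A)"
    using nsum unfolding each by (rule sums_unique2[symmetric])
  also have "B - A = (\<Sum>n. (r (Suc n) - r n) * cur t n)"
    using sums_diff[OF sB sA] by (simp add: left_diff_distrib[symmetric] sums_iff)
  finally show ?thesis using der by simp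
qed

lemma inner_wt_sums:
  assumes "quad_growth r"
  shows "(\<lambda>n. r n * (cmod (c t n))\<^sup>2) sums inner (\<phi> t) (wt r (\<phi> t))"
proof -
  have "Re (cnj (c t n) * (complex_of_real (r n) * c t n)) = r n * (cmod (c t n))\<^sup>2" for n
    by (simp add: cmod_power2) (simp add: power2_eq_square algebra_simps)
  then show ?thesis using inner_eq_suminf[of "\<phi> t" "wt r (\<phi> t)"] by (simp add: wt_c[OF assms] c_def[symmetric])
qed

definition mass :: "real \<Rightarrow> real" where "mass t = inner (\<phi> t) (wt (\<lambda>n. real n + 1) (\<phi> t))"
definition mom2 :: "real \<Rightarrow> real" where "mom2 t = inner (\<phi> t) (wt (\<lambda>n. (real n + 1)\<^sup>2) (\<phi> t))"

lemma mass_sums: "(\<lambda>n. (real n + 1) * (cmod (c t n))\<^sup>2) sums mass t"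
  unfolding mass_def by (rule inner_wt_sums[OF quad_growths(2)])
lemma mom2_sums: "(\<lambda>n. (real n + 1)\<^sup>2 * (cmod (c t n))\<^sup>2) sums mom2 t"
  unfolding mom2_def by (rule inner_wt_sums[OF quad_growths(3)])
lemma norm_sums: "(\<lambda>n. (cmod (c t n))\<^sup>2) sums (norm (\<phi> t))\<^sup>2"
  using has_sum_imp_sums[OF has_sum_infsum[OF coord_summable[of "\<phi> t"]]] by (simp add: norm_eq_infsum c_def)

lemma norm_phi: "norm (\<phi> t) = 1"
proof -
  have w1: "wt (\<lambda>n. 1) (\<phi> t) = \<phi> t" for t
    by (rule ell2_eqI) (simp only: wt_c[OF quad_growths(1)], simp add: c_def)
  have "((\<lambda>t. inner (\<phi> t) (\<phi> t)) has_real_derivative 0) (at t)" for t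
    using moment_deriv[OF quad_growths(1), of t] by (simp add: w1)
  then have "inner (\<phi> t) (\<phi> t) = inner (\<phi> 0) (\<phi> 0)" by (intro DERIV_isconst_all) auto
  then show ?thesis using init by (simp add: norm_eq_sqrt_inner)
qed

lemma al_sums: "(\<lambda>n. cnj (c t n) * (complex_of_real (sqrt (real (n + 1))) * c t (n + 1))) sums al t"
proof -
  have "(\<lambda>n. cnj (c t n) * (complex_of_real (sqrt (real (n + 1))) * c t (n + 1))) summable_on UNIV"
  proof (rule abs_summable_summable, rule summable_on_comparison_test)
    let ?y = "\<lambda>n. complex_of_real (sqrt (real (n + 1))) * c t (n + 1)"
    have "(\<lambda>n. (cmod (c t n))\<^sup>2) summable_on UNIV" unfolding c_def by (rule coord_summable)
    then show "(\<lambda>n. (cmod (c t n))\<^sup>2 + (cmod (?y n))\<^sup>2) summable_on UNIV"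
      using shift_summable(1)[of t] by (intro summable_on_add) auto
    fix n
    have "0 \<le> cmod (c t n) * cmod (?y n)" by (intro mult_nonneg_nonneg norm_ge_zero)
    then have "cmod (c t n) * cmod (?y n) \<le> (cmod (c t n))\<^sup>2 + (cmod (?y n))\<^sup>2"
      using sum_squares_bound[of "cmod (c t n)" "cmod (?y n)"] by linarith
    then show "norm (cnj (c t n) * ?y n) \<le> (cmod (c t n))\<^sup>2 + (cmod (?y n))\<^sup>2"
      by (simp only: norm_mult[of "cnj (c t n)"] complex_mod_cnj)
  qed auto
  then show ?thesis unfolding al_eq by (intro has_sum_imp_sums has_sum_infsum)
qed

text \<open>For the weight \<open>n + 1\<close> the derivative is the plain sum of the currents, and
  this is \<open>Im (al t * cnj (al t)) = 0\<close>. Self-consistency of \<alpha> is what closes the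
  identity, and the conserved value in turn bounds \<alpha> at all times.\<close>

lemma mass_const: "mass t = mass 0"
proof -
  have d0: "(\<Sum>n. (real (Suc n) + 1 - (real n + 1)) * cur t n) = 0" for t
  proof -
    have "(\<lambda>n. cnj (c t n) * (complex_of_real (sqrt (real (n + 1))) * c t (n + 1))) sums al t" by (rule al_sums)
    then have "(\<lambda>n. Im (al t * cnj (cnj (c t n) * (complex_of_real (sqrt (real (n + 1))) * c t (n + 1))))) sums Im (al t * cnj (al t))"
      by (intro sums_Im sums_mult) (simp only: sums_cnj)
    moreover have "Im (al t * cnj (cnj (c t n) * (complex_of_real (sqrt (real (n + 1))) * c t (n + 1)))) = cur t n" for n
      by (simp add: cur_def mult_ac)
    ultimately have "cur t sums 0" by (simp add: complex_mult_cnj)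
    then show ?thesis by (simp add: sums_iff)
  qed
  have "(mass has_real_derivative 0) (at t)" for t
    using moment_deriv[OF quad_growths(2), of t] unfolding d0 mass_def[abs_def] by simp
  then show ?thesis by (intro DERIV_isconst_all) auto
qed

lemma shift_mass: "(\<Sum>n. (cmod (complex_of_real (sqrt (real (n + 1))) * c t (n + 1)))\<^sup>2) \<le> mass t"
  "summable (\<lambda>n. (cmod (complex_of_real (sqrt (real (n + 1))) * c t (n + 1)))\<^sup>2)"
proof -
  have s: "(\<lambda>n. real n * (cmod (c t n))\<^sup>2) sums inner (\<phi> t) (wt real (\<phi> t))"
    by (rule inner_wt_sums, rule quad_growthI[of 1])
       (use zero_le_power2[of "real _ - 1"] in \<open>auto simp: power2_eq_square algebra_simps\<close>, smt (verit) mult_nonneg_nonneg of_nat_0_le_iff mult_le_cancel_left1)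
  have "(\<lambda>n. real (Suc n) * (cmod (c t (Suc n)))\<^sup>2) sums inner (\<phi> t) (wt real (\<phi> t))"
    using s sums_Suc_iff[of "\<lambda>n. real n * (cmod (c t n))\<^sup>2" "inner (\<phi> t) (wt real (\<phi> t))"] by simp
  moreover have e: "(cmod (complex_of_real (sqrt (real (n + 1))) * c t (n + 1)))\<^sup>2 = real (Suc n) * (cmod (c t (Suc n)))\<^sup>2" for n
    by (simp add: norm_mult power_mult_distrib)
  ultimately have s2: "(\<lambda>n. (cmod (complex_of_real (sqrt (real (n + 1))) * c t (n + 1)))\<^sup>2) sums inner (\<phi> t) (wt real (\<phi> t))"
    by (simp only: e)
  then show "summable (\<lambda>n. (cmod (complex_of_real (sqrt (real (n + 1))) * c t (n + 1)))\<^sup>2)" by (rule sums_summable)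
  have "inner (\<phi> t) (wt real (\<phi> t)) \<le> mass t"
    by (rule sums_le[OF _ s mass_sums]) (simp add: mult_right_mono)
  then show "(\<Sum>n. (cmod (complex_of_real (sqrt (real (n + 1))) * c t (n + 1)))\<^sup>2) \<le> mass t"
    using s2 by (simp only: sums_iff)
qed

lemma suminf_cauchy_schwarz:
  fixes a b :: "nat \<Rightarrow> real"
  assumes "\<And>n. a n \<ge> 0" "\<And>n. b n \<ge> 0" "(\<lambda>n. (a n)\<^sup>2) sums A" "summable (\<lambda>n. (b n)\<^sup>2)" "(\<Sum>n. (b n)\<^sup>2) \<le> B" "summable (\<lambda>n. a n * b n)"
  shows "(\<Sum>n. a n * b n) \<le> sqrt A * sqrt B"
proof (rule suminf_le_const[OF assms(6)])
  fix N
  have "(\<Sum>n<N. (a n)\<^sup>2) \<le> A" using sum_le_suminf[of "\<lambda>n. (a n)\<^sup>2" "{..<N}"] assms(3) by (simp add: sums_iff)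
  moreover have "(\<Sum>n<N. (b n)\<^sup>2) \<le> B" using sum_le_suminf[OF assms(4), of "{..<N}"] assms(5) by simp
  ultimately show "(\<Sum>n<N. a n * b n) \<le> sqrt A * sqrt B" by (rule sum_mult_le_sqrt[OF _ _ assms(1,2)])
qed

lemma al_le: "cmod (al t) \<le> sqrt (mass t)"
proof -
  have "cmod (al t) \<le> norm (\<phi> t) * norm (op_app ann (\<phi> t))" unfolding al_def mf_alpha_def by (rule cmod_cinner_le)
  also have "norm (op_app ann (\<phi> t)) \<le> sqrt (mass t)"
  proof (rule power2_le_imp_le)
    have e: "coord (op_app ann (\<phi> t)) = (\<lambda>n. complex_of_real (sqrt (real (n + 1))) * c t (n + 1))"
      unfolding op_app_def using shift_summable(1)[of t] by (subst coord_Abs) (auto simp: ann_def c_def)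
    have "(norm (op_app ann (\<phi> t)))\<^sup>2 = (\<Sum>n. (cmod (complex_of_real (sqrt (real (n + 1))) * c t (n + 1)))\<^sup>2)"
      unfolding norm_eq_infsum e by (rule sums_unique[OF has_sum_imp_sums[OF has_sum_infsum[OF shift_summable(1)]]])
    also have "\<dots> \<le> mass t" by (rule shift_mass)
    also have "\<dots> = (sqrt (mass t))\<^sup>2"
      using sums_le[OF _ sums_zero mass_sums[of t]] by simp
    finally show "(norm (op_app ann (\<phi> t)))\<^sup>2 \<le> (sqrt (mass t))\<^sup>2" .
  qed (use sums_le[OF _ sums_zero mass_sums[of t]] in simp)
  finally show ?thesis by (simp add: norm_phi)
qed

lemma mass_nonneg: "mass t \<ge> 0" using sums_le[OF _ sums_zero mass_sums[of t]] by simp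

lemma mom2_ge: "mom2 t \<ge> 1" "mass t \<le> mom2 t"
proof -
  have "(norm (\<phi> t))\<^sup>2 \<le> mom2 t"
    by (rule sums_le[OF _ norm_sums mom2_sums]) (simp add: mult_le_cancel_right1 one_le_power)
  then show "mom2 t \<ge> 1" by (simp add: norm_phi)
  show "mass t \<le> mom2 t"
    by (rule sums_le[OF _ mass_sums mom2_sums]) (simp add: power2_eq_square mult_le_cancel_right1 mult_right_mono)
qed

text \<open>The weights \<open>(n + 2)^2 - (n + 1)^2 = 2 n + 3 \<le> 3 (n + 1)\<close> leave
  \<open>sqrt (mom2 t)\<close> times the norm of the shifted vector. That norm and
  \<open>cmod (al t)\<close> are both at most the root of the conserved mass. So \<open>mom2\<close>
  grows at a rate proportional to its root, and the root grows linearly.\<close>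

lemma sqrt_mom2_le:
  assumes "t \<ge> 0"
  shows "sqrt (mom2 t) \<le> sqrt (mom2 0) + 3 * \<bar>J\<bar> * mass 0 * t"
proof -
  define D where "D t = 2 * (- J * (\<Sum>n. ((real (Suc n) + 1)\<^sup>2 - (real n + 1)\<^sup>2) * cur t n))" for t
  have der: "(mom2 has_real_derivative D t) (at t)" for t
    using moment_deriv[OF quad_growths(3), of t] unfolding D_def mom2_def[abs_def] .
  have Dle: "\<bar>D t\<bar> \<le> 6 * \<bar>J\<bar> * mass 0 * sqrt (mom2 t)" for t
  proof -
    let ?y = "\<lambda>n. complex_of_real (sqrt (real (n + 1))) * c t (n + 1)"
    let ?z = "\<lambda>n. complex_of_real (real n + 1) * c t n"
    let ?g = "\<lambda>n. cmod (?z n) * cmod (?y n)"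
    have sg: "summable ?g" by (rule cur_summable(2)[OF quad_growths(2)])
    have each: "\<bar>((real (Suc n) + 1)\<^sup>2 - (real n + 1)\<^sup>2) * cur t n\<bar> \<le> 3 * (cmod (al t) * ?g n)" for n
    proof -
      have "(real (Suc n) + 1)\<^sup>2 - (real n + 1)\<^sup>2 = 2 * real n + 3" by (simp add: power2_eq_square algebra_simps)
      then have "\<bar>((real (Suc n) + 1)\<^sup>2 - (real n + 1)\<^sup>2) * cur t n\<bar> = (2 * real n + 3) * \<bar>cur t n\<bar>"
        by (simp only: abs_mult)
      also have "\<dots> \<le> (3 * (real n + 1)) * \<bar>cur t n\<bar>" by (rule mult_right_mono) auto
      also have "\<dots> = 3 * \<bar>(real n + 1) * cur t n\<bar>" by (simp only: abs_mult mult.assoc abs_of_nonneg)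
      finally have "\<bar>((real (Suc n) + 1)\<^sup>2 - (real n + 1)\<^sup>2) * cur t n\<bar> \<le> 3 * \<bar>(real n + 1) * cur t n\<bar>" .
      then show ?thesis using cur_summable(3)[OF quad_growths(2), of n t] by linarith
    qed
    have s3: "summable (\<lambda>n. 3 * (cmod (al t) * ?g n))" by (intro summable_mult sg)
    have sa: "summable (\<lambda>n. \<bar>((real (Suc n) + 1)\<^sup>2 - (real n + 1)\<^sup>2) * cur t n\<bar>)"
      by (rule summable_comparison_test'[OF s3, of 0]) (use each in \<open>simp only: real_norm_def abs_idempotent\<close>)
    have "\<bar>\<Sum>n. ((real (Suc n) + 1)\<^sup>2 - (real n + 1)\<^sup>2) * cur t n\<bar> \<le> (\<Sum>n. \<bar>((real (Suc n) + 1)\<^sup>2 - (real n + 1)\<^sup>2) * cur t n\<bar>)"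
      by (rule summable_rabs[OF sa])
    also have "\<dots> \<le> (\<Sum>n. 3 * (cmod (al t) * ?g n))" by (rule suminf_le[OF each sa s3])
    also have "\<dots> = 3 * (cmod (al t) * suminf ?g)" using sg by (simp add: suminf_mult summable_mult)
    also have "\<dots> \<le> 3 * (sqrt (mass t) * (sqrt (mom2 t) * sqrt (mass t)))"
    proof (intro mult_left_mono mult_mono al_le)
      show "suminf ?g \<le> sqrt (mom2 t) * sqrt (mass t)"
      proof (rule suminf_cauchy_schwarz[OF _ _ _ shift_mass(2) shift_mass(1) sg])
        have "(cmod (?z n))\<^sup>2 = (real n + 1)\<^sup>2 * (cmod (c t n))\<^sup>2" for n
          by (simp only: norm_mult power_mult_distrib norm_of_real abs_power2 power2_abs)
        then show "(\<lambda>n. (cmod (?z n))\<^sup>2) sums mom2 t" using mom2_sums[of t] by (simp only:)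
      qed (rule norm_ge_zero)+
      show "0 \<le> suminf ?g" by (rule suminf_nonneg[OF sg]) (intro mult_nonneg_nonneg norm_ge_zero)
    qed (auto simp: mass_nonneg)
    also have "\<dots> = 3 * mass 0 * sqrt (mom2 t)" using mass_nonneg[of 0] by (simp add: mass_const[of t])
    finally have "\<bar>\<Sum>n. ((real (Suc n) + 1)\<^sup>2 - (real n + 1)\<^sup>2) * cur t n\<bar> \<le> 3 * mass 0 * sqrt (mom2 t)" .
    from mult_left_mono[OF this, of "2 * \<bar>J\<bar>"] show ?thesis unfolding D_def by (simp add: abs_mult mult_ac)
  qed
  have der2: "((\<lambda>t. sqrt (mom2 t) - 3 * \<bar>J\<bar> * mass 0 * t) has_real_derivative (D t / (2 * sqrt (mom2 t)) - 3 * \<bar>J\<bar> * mass 0)) (at t)" for t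
  proof -
    have "((\<lambda>t. sqrt (mom2 t)) has_real_derivative (inverse (sqrt (mom2 t)) / 2 * D t)) (at t)"
    proof -
      have "0 < mom2 t" using mom2_ge(1)[of t] by (rule less_le_trans[OF zero_less_one])
      from DERIV_chain2[OF DERIV_real_sqrt[OF this] der[of t]] show ?thesis .
    qed
    moreover have "inverse (sqrt (mom2 t)) / 2 * D t = D t / (2 * sqrt (mom2 t))" by (simp add: inverse_eq_divide)
    ultimately have "((\<lambda>t. sqrt (mom2 t)) has_real_derivative (D t / (2 * sqrt (mom2 t)))) (at t)" by (simp only:)
    from DERIV_diff[OF this DERIV_cmult_Id[of "3 * \<bar>J\<bar> * mass 0" t]] show ?thesis .
  qed
  have "sqrt (mom2 t) - 3 * \<bar>J\<bar> * mass 0 * t \<le> sqrt (mom2 0) - 3 * \<bar>J\<bar> * mass 0 * 0"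
  proof (rule DERIV_nonpos_imp_nonincreasing[OF assms])
    fix s
    have "D s \<le> 3 * \<bar>J\<bar> * mass 0 * (2 * sqrt (mom2 s))" using Dle[of s] by simp
    then have "D s / (2 * sqrt (mom2 s)) - 3 * \<bar>J\<bar> * mass 0 \<le> 0" using mom2_ge(1)[of s] by (simp add: pos_divide_le_eq)
    with der2[of s] show "\<exists>y. ((\<lambda>t. sqrt (mom2 t) - 3 * \<bar>J\<bar> * mass 0 * t) has_real_derivative y) (at s) \<and> y \<le> 0" by blast
  qed
  then show ?thesis by simp
qed

end

section \<open>The lattice evolution\<close>

definition nbs :: "nat \<Rightarrow> nat \<Rightarrow> site \<Rightarrow> site set" where
  "nbs d L x = {y \<in> lattice d L. x \<in> lattice d L \<and> neighbour d L x y}"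

lemma finite_lattice: "finite (lattice d L)"
  unfolding lattice_def by (intro finite_PiE) auto

lemma lattice_lt: "x \<in> lattice d L \<Longrightarrow> i < d \<Longrightarrow> x i < L"
  by (auto simp: lattice_def PiE_iff)

lemma lattice_undefined: "x \<in> lattice d L \<Longrightarrow> \<not> i < d \<Longrightarrow> x i = undefined"
  by (auto simp: lattice_def PiE_iff extensional_def)

lemma lattice_upd: "x \<in> lattice d L \<Longrightarrow> i < d \<Longrightarrow> a < L \<Longrightarrow> x(i := a) \<in> lattice d L"
  by (auto simp: lattice_def PiE_iff extensional_def)

lemma neighbour_sym: "neighbour d L x y \<Longrightarrow> neighbour d L y x"
  unfolding neighbour_def by metis

text \<open>For \<open>L \<ge> 3\<close> the two neighbours in a coordinate direction differ from
  the site and from each other, which makes the lattice loop-free and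
  \<open>2 d\<close>-regular.\<close>

lemma mod_step:
  fixes a L :: nat
  assumes "L \<ge> 3" "a < L"
  shows "(a + 1) mod L \<noteq> a" "(a + (L - 1)) mod L \<noteq> a" "(a + 1) mod L \<noteq> (a + (L - 1)) mod L"
    "((a + (L - 1)) mod L + 1) mod L = a"
proof -
  have 1: "(a + 1) mod L = (if a = L - 1 then 0 else a + 1)" using assms by auto
  have 2: "(a + (L - 1)) mod L = (if a = 0 then L - 1 else a - 1)"
  proof (cases "a = 0")
    case False
    then have "a + (L - 1) = (a - 1) + L" using assms by simp
    then have "(a + (L - 1)) mod L = (a - 1) mod L" by (simp only: mod_add_self2)
    then show ?thesis using False assms by simp
  qed (use assms in simp)
  show "(a + 1) mod L \<noteq> a" "(a + (L - 1)) mod L \<noteq> a" "(a + 1) mod L \<noteq> (a + (L - 1)) mod L"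
    "((a + (L - 1)) mod L + 1) mod L = a"
    unfolding 1 2 using assms by (auto split: if_splits)
qed

lemma mod_pred:
  fixes b L :: nat
  assumes "L \<ge> 3" "b < L"
  shows "((b + 1) mod L + (L - 1)) mod L = b"
proof -
  have "((b + 1) mod L + (L - 1)) mod L = (b + 1 + (L - 1)) mod L" by (rule mod_add_left_eq)
  also have "b + 1 + (L - 1) = b + L" using assms by simp
  finally show ?thesis using assms by simp
qed

lemma card_nbs:
  assumes L: "L \<ge> 3" and x: "x \<in> lattice d L"
  shows "card (nbs d L x) = 2 * d"
proof -
  \<comment> \<open>Neighbours are labelled by a direction and a sign; adding \<open>L - 1\<close>
    stands for subtracting 1 modulo \<open>L\<close>.\<close>
  define g where "g = (\<lambda>(i, b). x(i := (if b then (x i + 1) mod L else (x i + (L - 1)) mod L)))"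
  have L0: "L > 0" using L by simp
  have val: "(if b then (x i + 1) mod L else (x i + (L - 1)) mod L) \<noteq> x i" if "i < d" for i b
    using mod_step[OF L lattice_lt[OF x that]] by simp
  have "nbs d L x = g ` ({..<d} \<times> UNIV)"
  proof (intro equalityI subsetI)
    fix y assume "y \<in> nbs d L x"
    then have y: "y \<in> lattice d L" and "neighbour d L x y" by (auto simp: nbs_def)
    then obtain i where i: "i < d" "y i = (x i + 1) mod L \<or> x i = (y i + 1) mod L" "\<And>j. j < d \<Longrightarrow> j \<noteq> i \<Longrightarrow> x j = y j"
      by (auto simp: neighbour_def)
    have "y = x(i := y i)"
    proof
      fix j show "y j = (x(i := y i)) j"
        using i(3)[of j] lattice_undefined[OF x, of j] lattice_undefined[OF y, of j] by (cases "j < d") auto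
    qed
    moreover have "y i = (x i + 1) mod L \<or> y i = (x i + (L - 1)) mod L"
      using i(2) mod_pred[OF L lattice_lt[OF y i(1)]] by auto
    ultimately show "y \<in> g ` ({..<d} \<times> UNIV)"
    proof (elim disjE)
      assume e: "y = x(i := y i)" "y i = (x i + 1) mod L"
      then show ?thesis using i(1) by (intro image_eqI[of _ _ "(i, True)"]) (simp_all add: g_def)
    next
      assume e: "y = x(i := y i)" "y i = (x i + (L - 1)) mod L"
      then show ?thesis using i(1) by (intro image_eqI[of _ _ "(i, False)"]) (simp_all add: g_def)
    qed
  next
    fix y assume "y \<in> g ` ({..<d} \<times> UNIV)"
    then obtain i b where i: "i < d" and y: "y = x(i := (if b then (x i + 1) mod L else (x i + (L - 1)) mod L))"
      by (auto simp: g_def)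
    have "y \<in> lattice d L" unfolding y using L0 by (intro lattice_upd[OF x i]) auto
    moreover have "neighbour d L x y"
      unfolding neighbour_def using i mod_step(4)[OF L lattice_lt[OF x i]] by (intro exI[of _ i]) (auto simp: y)
    ultimately show "y \<in> nbs d L x" using x by (simp add: nbs_def)
  qed
  moreover have "inj_on g ({..<d} \<times> UNIV)"
  proof (rule inj_onI)
    fix p p' assume pp: "p \<in> {..<d} \<times> UNIV" "p' \<in> {..<d} \<times> UNIV" "g p = g p'"
    obtain i b j b' where p: "p = (i, b)" "p' = (j, b')" by (cases p, cases p')
    have ij: "i \<in> {..<d}" "j \<in> {..<d}" and eq: "g (i, b) = g (j, b')" using pp by (simp_all add: p)
    have "i = j"
    proof (rule ccontr)
      assume "i \<noteq> j"
      then have "g (j, b') i = x i" by (simp add: g_def)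
      moreover have "g (i, b) i \<noteq> x i" using val[of i b] ij by (simp add: g_def)
      ultimately show False using eq by simp
    qed
    moreover have "b = b'"
    proof (rule ccontr)
      assume "b \<noteq> b'"
      moreover have "g (i, b) i = g (i, b') i" using eq \<open>i = j\<close> by simp
      ultimately show False using mod_step(3)[OF L lattice_lt[OF x, of i]] ij by (cases b; cases b') (auto simp: g_def)
    qed
    ultimately show "p = p'" by (simp add: p)
  qed
  ultimately show ?thesis by (simp add: card_image card_cartesian_product)
qed

lemma nbs_irrefl:
  assumes "L \<ge> 3"
  shows "x \<notin> nbs d L x"
proof
  assume "x \<in> nbs d L x"
  then obtain i where "i < d" "x i = (x i + 1) mod L" "x \<in> lattice d L" by (auto simp: nbs_def neighbour_def)
  then show False using mod_step(1)[OF assms lattice_lt, of x d i] by simp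
qed

section \<open>The Hamiltonian in occupation coordinates\<close>

definition hop :: "site \<times> site \<Rightarrow> config formal_op" where
  "hop p \<Psi> c = complex_of_real (sqrt (real (c (fst p)))) *
     (complex_of_real (sqrt (real ((c(fst p := c (fst p) - 1)) (snd p) + 1))) *
       \<Psi> (c(fst p := c (fst p) - 1, snd p := (c(fst p := c (fst p) - 1)) (snd p) + 1)))"

locale bose_hubbard =
  fixes J \<mu> U :: real and d L :: nat
  assumes d: "d \<ge> 1" and L: "L \<ge> 3"
begin

abbreviation \<Lambda> :: "site set" where "\<Lambda> \<equiv> lattice d L"
abbreviation Hm :: "config formal_op" where "Hm \<equiv> hamiltonian J \<mu> U d L"
abbreviation v :: "nat \<Rightarrow> real" where "v \<equiv> site_energy J \<mu> U"
abbreviation HF :: "config fs \<Rightarrow> config fs" where "HF \<equiv> lattice_ham v J \<Lambda> (nbs d L) (2 * d)"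

definition bonds :: "(site \<times> site) set" where "bonds = Sigma \<Lambda> (nbs d L)"
definition tot :: "config \<Rightarrow> nat" where "tot c = (\<Sum>x\<in>\<Lambda>. c x)"

lemma bonds_D: "p \<in> bonds \<Longrightarrow> fst p \<in> \<Lambda>" "p \<in> bonds \<Longrightarrow> snd p \<in> \<Lambda>" "p \<in> bonds \<Longrightarrow> fst p \<noteq> snd p"
  using nbs_irrefl[OF L] by (auto simp: bonds_def nbs_def)

lemma bonds_swap: "prod.swap ` bonds = bonds"
  unfolding bonds_def nbs_def using neighbour_sym by (auto simp: image_iff)

text \<open>Reversing bonds shows that the two hopping sums agree, which cancels the factor 1/2 of
  the ordered-pair convention and leaves the shape of \<open>lattice_ham\<close>.\<close>

lemma Hm_eq: "Hm \<Psi> c = (\<Sum>x\<in>\<Lambda>. complex_of_real (v (c x))) * \<Psi> c - complex_of_real (J / (2 * real d)) * (\<Sum>p\<in>bonds. hop p \<Psi> c)"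
proof -
  have P: "{(x, y) \<in> \<Lambda> \<times> \<Lambda>. neighbour d L x y} = bonds" by (auto simp: bonds_def nbs_def)
  have h: "at_site x cre (at_site y ann \<Psi>) c = hop (x, y) \<Psi> c" for x y
    by (simp add: at_site_def cre_def ann_def hop_def)
  have "(\<Sum>(x, y)\<in>bonds. at_site x cre (at_site y ann \<Psi>) c + at_site y cre (at_site x ann \<Psi>) c)
      = (\<Sum>p\<in>bonds. hop p \<Psi> c) + (\<Sum>p\<in>bonds. hop (prod.swap p) \<Psi> c)"
    by (simp add: h case_prod_unfold sum.distrib[symmetric] prod.swap_def)
  also have "(\<Sum>p\<in>bonds. hop (prod.swap p) \<Psi> c) = (\<Sum>p\<in>prod.swap ` bonds. hop p \<Psi> c)"
    by (subst sum.reindex) auto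
  also have "\<dots> = (\<Sum>p\<in>bonds. hop p \<Psi> c)" by (simp only: bonds_swap)
  finally have hopsum: "(\<Sum>(x, y)\<in>bonds. at_site x cre (at_site y ann \<Psi>) c + at_site y cre (at_site x ann \<Psi>) c) = 2 * (\<Sum>p\<in>bonds. hop p \<Psi> c)" by simp
  have pot: "complex_of_real (J - \<mu>) * (\<Sum>x\<in>\<Lambda>. at_site x num \<Psi> c) + complex_of_real (U / 2) * (\<Sum>x\<in>\<Lambda>. at_site x num_pair \<Psi> c)
      = (\<Sum>x\<in>\<Lambda>. complex_of_real (v (c x))) * \<Psi> c"
    by (simp add: at_site_def num_pair_def num_eq site_energy_def sum_distrib_left sum_distrib_right sum.distrib[symmetric] algebra_simps)
  show ?thesis unfolding hamiltonian_def P hopsum by (simp only: pot[symmetric]) simp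
qed

lemma tot_hop:
  assumes p: "p \<in> bonds" and c: "c (fst p) > 0"
  shows "tot (c(fst p := c (fst p) - 1, snd p := (c(fst p := c (fst p) - 1)) (snd p) + 1)) = tot c"
proof -
  define x y where "x = fst p" and "y = snd p"
  have xy: "x \<in> \<Lambda>" "y \<in> \<Lambda>" "x \<noteq> y" using bonds_D[OF p] by (auto simp: x_def y_def)
  have 1: "tot f = f x + (f y + (\<Sum>z\<in>\<Lambda> - {x} - {y}. f z))" for f
    unfolding tot_def using xy finite_lattice
    by (subst sum.remove[of _ x]) (auto intro!: sum.remove)
  have "tot (c(x := c x - 1, y := (c(x := c x - 1)) y + 1)) = tot c"
    unfolding 1 using xy c by (simp add: x_def[symmetric])
  then show ?thesis by (simp add: x_def y_def)
qed

text \<open>A class containing every configuration that \<open>Hm\<close> can couple to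
  \<open>c\<close>. Demanding agreement outside \<Lambda> as well makes locality hold for arbitrary
  families of coordinates.\<close>

definition cls :: "config \<Rightarrow> config \<Rightarrow> bool" where
  "cls c c' \<longleftrightarrow> tot c' = tot c \<and> (\<forall>x. x \<notin> \<Lambda> \<longrightarrow> c' x = c x)"

lemma hop_local:
  assumes p: "p \<in> bonds" and eq: "\<And>c'. cls c c' \<Longrightarrow> \<Psi> c' = \<Phi> c'"
  shows "hop p \<Psi> c = hop p \<Phi> c"
proof (cases "c (fst p) = 0")
  \<comment> \<open>If the site \<open>fst p\<close> is empty, truncated subtraction names a
    configuration with a different total; it is never read, because the first square root
    vanishes.\<close>
  case False
  then have "cls c (c(fst p := c (fst p) - 1, snd p := (c(fst p := c (fst p) - 1)) (snd p) + 1))"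
    unfolding cls_def using tot_hop[OF p] bonds_D[OF p] by auto
  then show ?thesis by (simp add: hop_def eq)
qed (simp add: hop_def)

lemma Hm_local:
  assumes eq: "\<And>c'. cls c c' \<Longrightarrow> \<Psi> c' = \<Phi> c'"
  shows "Hm \<Psi> c = Hm \<Phi> c"
proof -
  have "\<Psi> c = \<Phi> c" by (rule eq) (simp add: cls_def)
  then show ?thesis unfolding Hm_eq using hop_local[OF _ eq] by simp
qed

lemma Hm_pow_local:
  assumes eq: "\<And>c'. cls c c' \<Longrightarrow> \<Psi> c' = \<Phi> c'"
  shows "(Hm ^^ k) \<Psi> c = (Hm ^^ k) \<Phi> c"
proof -
  have "\<forall>c'. cls c c' \<longrightarrow> (Hm ^^ k) \<Psi> c' = (Hm ^^ k) \<Phi> c'"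
  proof (induction k)
    case (Suc k)
    show ?case
    proof (intro allI impI)
      fix c' assume c': "cls c c'"
      have "Hm ((Hm ^^ k) \<Psi>) c' = Hm ((Hm ^^ k) \<Phi>) c'"
        by (rule Hm_local) (use c' Suc in \<open>auto simp: cls_def\<close>)
      then show "(Hm ^^ Suc k) \<Psi> c' = (Hm ^^ Suc k) \<Phi> c'" by simp
    qed
  qed (use eq in simp)
  then show ?thesis by (simp add: cls_def)
qed

lemma Hm_sums:
  assumes "\<And>c'. (\<lambda>k. F k c') sums G c'"
  shows "(\<lambda>k. Hm (F k) c) sums Hm G c"
  unfolding Hm_eq hop_def by (intro sums_diff sums_mult sums_sum assms)

lemma Hm_scale: "Hm (\<lambda>c. a * \<Psi> c) c = a * Hm \<Psi> c"
  by (simp add: Hm_eq hop_def sum_distrib_left algebra_simps)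

text \<open>A bound for \<open>Hm\<close> in the supremum norm of the sector with \<open>N\<close>
  particles: every site energy is among \<open>v 0, ..., v N\<close>, and both square roots of a hop
  are at most \<open>sqrt (N + 1)\<close>.\<close>

definition HK :: "nat \<Rightarrow> real" where
  "HK N = (\<Sum>n\<le>N. \<bar>v n\<bar>) * card \<Lambda> + \<bar>J / (2 * real d)\<bar> * (card bonds * (real N + 1))"

lemma le_tot: "x \<in> \<Lambda> \<Longrightarrow> c x \<le> tot c"
  unfolding tot_def using finite_lattice by (intro member_le_sum) auto

lemma Hm_bound:
  assumes b: "\<And>c. tot c = N \<Longrightarrow> cmod (\<Psi> c) \<le> B" and c: "tot c = N"
  shows "cmod (Hm \<Psi> c) \<le> HK N * B"
proof -
  have B: "B \<ge> 0" using order_trans[OF norm_ge_zero b[OF c]] .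
  have v: "\<bar>v (c x)\<bar> \<le> (\<Sum>n\<le>N. \<bar>v n\<bar>)" if "x \<in> \<Lambda>" for x
    using le_tot[OF that, of c] c by (intro member_le_sum) auto
  have "cmod (\<Sum>x\<in>\<Lambda>. complex_of_real (v (c x))) \<le> (\<Sum>x\<in>\<Lambda>. \<Sum>n\<le>N. \<bar>v n\<bar>)"
    by (intro order_trans[OF norm_sum] sum_mono) (use v in simp)
  then have 1: "cmod ((\<Sum>x\<in>\<Lambda>. complex_of_real (v (c x))) * \<Psi> c) \<le> (\<Sum>n\<le>N. \<bar>v n\<bar>) * card \<Lambda> * B"
    unfolding norm_mult using B by (intro mult_mono b c) (auto simp: mult.commute sum_nonneg)
  have h: "cmod (hop p \<Psi> c) \<le> (real N + 1) * B" if p: "p \<in> bonds" for p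
  proof (cases "c (fst p) = 0")
    case False
    define c' where "c' = c(fst p := c (fst p) - 1, snd p := (c(fst p := c (fst p) - 1)) (snd p) + 1)"
    have t: "tot c' = N" unfolding c'_def using tot_hop[OF p] False c by simp
    have "sqrt (real (c (fst p))) \<le> sqrt (real N + 1)"
      using le_tot[OF bonds_D(1)[OF p], of c] c by simp
    moreover have "sqrt (real ((c(fst p := c (fst p) - 1)) (snd p) + 1)) \<le> sqrt (real N + 1)"
      using le_tot[OF bonds_D(2)[OF p], of c] c bonds_D(3)[OF p] by simp
    ultimately have "sqrt (real (c (fst p))) * (sqrt (real ((c(fst p := c (fst p) - 1)) (snd p) + 1)) * cmod (\<Psi> c'))
        \<le> sqrt (real N + 1) * (sqrt (real N + 1) * B)"
      using B by (intro mult_mono b t) auto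
    then show ?thesis unfolding hop_def c'_def[symmetric] norm_mult norm_of_real
      by (simp add: mult.assoc[symmetric] del: of_nat_add of_nat_Suc)
  qed (use B in \<open>simp add: hop_def\<close>)
  have 2: "cmod (complex_of_real (J / (2 * real d)) * (\<Sum>p\<in>bonds. hop p \<Psi> c)) \<le> \<bar>J / (2 * real d)\<bar> * (card bonds * ((real N + 1) * B))"
    unfolding norm_mult norm_of_real
    by (intro mult_left_mono order_trans[OF norm_sum] order_trans[OF sum_bounded_above[where K="(real N + 1) * B"]] h) auto
  have "cmod (Hm \<Psi> c) \<le> (\<Sum>n\<le>N. \<bar>v n\<bar>) * card \<Lambda> * B + \<bar>J / (2 * real d)\<bar> * (card bonds * ((real N + 1) * B))"
    unfolding Hm_eq by (intro order_trans[OF norm_triangle_ineq4] add_mono 1 2)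
  then show ?thesis by (simp add: HK_def algebra_simps)
qed

lemma Hm_pow_bound:
  assumes b: "\<And>c. tot c = N \<Longrightarrow> cmod (\<Psi> c) \<le> B"
  shows "tot c = N \<Longrightarrow> cmod ((Hm ^^ k) \<Psi> c) \<le> HK N ^ k * B"
proof (induction k arbitrary: c)
  case (Suc k)
  have "cmod (Hm ((Hm ^^ k) \<Psi>) c) \<le> HK N * (HK N ^ k * B)" by (rule Hm_bound[OF Suc.IH Suc.prems])
  then show ?case by (simp add: mult.assoc)
qed (use b in simp)

section \<open>The exponential series and conservation of the norm\<close>

definition ev :: "real \<Rightarrow> config formal_op" where "ev t = evolution J \<mu> U d L t"

definition bdd_cf :: "(config \<Rightarrow> complex) \<Rightarrow> bool" where
  "bdd_cf \<Psi> \<longleftrightarrow> (\<exists>B. \<forall>c. cmod (\<Psi> c) \<le> B)"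

text \<open>The sector cut in \<open>evolution\<close> is invisible at \<open>c\<close>, because
  powers of \<open>Hm\<close> read only configurations in the class of \<open>c\<close>, all with
  the same particle number.\<close>

lemma sector_pow: "(Hm ^^ k) (sector \<Lambda> (\<Sum>x\<in>\<Lambda>. c x) \<Psi>) c = (Hm ^^ k) \<Psi> c"
  by (rule Hm_pow_local) (auto simp: sector_def cls_def tot_def)

lemma exp_series_summable:
  fixes z :: complex
  assumes b: "\<And>c. tot c = tot c0 \<Longrightarrow> cmod (\<Psi> c) \<le> B"
  shows "summable (\<lambda>k. (Hm ^^ k) \<Psi> c0 / fact k * z ^ k)"
proof (rule summable_comparison_test')
  have "summable (\<lambda>k. B * (inverse (fact k) * (HK (tot c0) * cmod z) ^ k))"
    by (intro summable_mult summable_exp)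
  then show "summable (\<lambda>k. (HK (tot c0) ^ k * B) / fact k * cmod z ^ k)"
    by (simp add: power_mult_distrib divide_inverse mult_ac)
  fix k
  show "norm ((Hm ^^ k) \<Psi> c0 / fact k * z ^ k) \<le> (HK (tot c0) ^ k * B) / fact k * cmod z ^ k"
    unfolding norm_mult norm_divide norm_power norm_fact
    by (intro mult_right_mono divide_right_mono Hm_pow_bound[OF b refl]) auto
qed

lemma ev_sums:
  assumes "bdd_cf \<Psi>"
  shows "(\<lambda>k. (- \<i> * complex_of_real t) ^ k / fact k * (Hm ^^ k) \<Psi> c) sums ev t \<Psi> c"
proof -
  obtain B where B: "\<And>c. cmod (\<Psi> c) \<le> B" using assms by (auto simp: bdd_cf_def)
  have "summable (\<lambda>k. (- \<i> * complex_of_real t) ^ k / fact k * (Hm ^^ k) \<Psi> c)"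
    using exp_series_summable[of c _ B "- \<i> * complex_of_real t"] B by (simp add: divide_inverse mult_ac)
  then show ?thesis unfolding ev_def evolution_def sector_pow by (rule summable_sums)
qed

text \<open>As a function of a complex variable the coordinate is an everywhere convergent power
  series. Its formal derivative is \<open>Hm\<close> applied termwise, and the path
  \<open>- \<i> t\<close> is inserted by the chain rule.\<close>

lemma ev_deriv:
  assumes bd: "bdd_cf \<Psi>"
  shows "((\<lambda>t. ev t \<Psi> c) has_vector_derivative - \<i> * Hm (ev t \<Psi>) c) (at t)"
proof -
  obtain B where B: "\<And>c. cmod (\<Psi> c) \<le> B" using bd by (auto simp: bdd_cf_def)
  define a where "a k = (Hm ^^ k) \<Psi> c / fact k" for k
  define g where "g z = (\<Sum>k. a k * z ^ k)" for z :: complex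
  have sm: "summable (\<lambda>k. a k * z ^ k)" for z
    unfolding a_def by (rule exp_series_summable[OF B])
  have der: "(g has_field_derivative (\<Sum>k. diffs a k * z ^ k)) (at z)" for z
    unfolding g_def[abs_def] by (rule termdiffs_strong_converges_everywhere[OF sm])
  have ev_g: "ev s \<Psi> c = g (- \<i> * complex_of_real s)" for s
    using ev_sums[OF bd, of s c] by (simp add: g_def a_def sums_iff divide_inverse mult_ac)
  let ?z = "- \<i> * complex_of_real t"
  have "diffs a k * ?z ^ k = Hm (\<lambda>c. ?z ^ k / fact k * (Hm ^^ k) \<Psi> c) c" for k
  proof -
    have "diffs a k = (Hm ^^ Suc k) \<Psi> c / fact k"
      by (simp add: diffs_def a_def field_simps del: of_nat_Suc)
    then show ?thesis unfolding Hm_scale by simp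
  qed
  then have d2: "(\<Sum>k. diffs a k * ?z ^ k) = Hm (ev t \<Psi>) c"
    using Hm_sums[where c=c, OF ev_sums[OF bd, of t]] by (simp add: sums_iff)
  have lin: "((\<lambda>s. - \<i> * complex_of_real s) has_vector_derivative - \<i>) (at t)"
    by (auto intro!: derivative_eq_intros)
  have "((g \<circ> (\<lambda>s. - \<i> * complex_of_real s)) has_vector_derivative (- \<i> * (\<Sum>k. diffs a k * ?z ^ k))) (at t)"
    by (rule field_vector_diff_chain_at[OF lin der])
  moreover have "g \<circ> (\<lambda>s. - \<i> * complex_of_real s) = (\<lambda>s. ev s \<Psi> c)" by (simp add: fun_eq_iff ev_g)
  ultimately show ?thesis by (simp only: d2)
qed

lemma ev_0: "ev 0 \<Psi> c = \<Psi> c"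
proof -
  have "(\<lambda>k. (- \<i> * complex_of_real 0) ^ k / fact k * (Hm ^^ k) \<Psi> c) = (\<lambda>k. if k = 0 then \<Psi> c else 0)"
    by (auto simp: fun_eq_iff)
  then have "(\<lambda>k. (- \<i> * complex_of_real 0) ^ k / fact k * (Hm ^^ k) \<Psi> c) sums \<Psi> c"
    using sums_single[of 0 "\<lambda>_. \<Psi> c"] by simp
  then show ?thesis unfolding ev_def evolution_def sector_pow by (simp add: sums_iff)
qed

lemma ev_local:
  assumes "\<And>c'. cls c c' \<Longrightarrow> \<Psi> c' = \<Phi> c'"
  shows "ev t \<Psi> c = ev t \<Phi> c"
  unfolding ev_def evolution_def sector_pow using Hm_pow_local[OF assms] by simp

text \<open>Finite and closed under \<open>cls\<close>: the coordinates in this set evolve among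
  themselves.\<close>

definition SM :: "nat \<Rightarrow> config set" where "SM M = {c \<in> configs \<Lambda>. tot c \<le> M}"

lemma finite_SM: "finite (SM M)"
proof -
  have "SM M \<subseteq> (\<lambda>f x. if x \<in> \<Lambda> then f x else 0) ` (\<Lambda> \<rightarrow>\<^sub>E {..M})"
  proof
    fix c assume c: "c \<in> SM M"
    then have "c = (\<lambda>x. if x \<in> \<Lambda> then restrict c \<Lambda> x else 0)" by (auto simp: SM_def configs_def fun_eq_iff)
    moreover have "restrict c \<Lambda> \<in> \<Lambda> \<rightarrow>\<^sub>E {..M}" using c le_tot[of _ c] by (force simp: SM_def)
    ultimately show "c \<in> (\<lambda>f x. if x \<in> \<Lambda> then f x else 0) ` (\<Lambda> \<rightarrow>\<^sub>E {..M})" by (rule image_eqI)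
  qed
  then show ?thesis by (rule finite_subset) (intro finite_imageI finite_PiE finite_lattice, auto)
qed

lemma SM_cls: "c \<in> SM M \<Longrightarrow> cls c c' \<Longrightarrow> c' \<in> SM M"
  by (auto simp: SM_def cls_def configs_def)

lemma cls_sym: "cls c c' \<Longrightarrow> cls c' c" by (auto simp: cls_def)

lift_definition restr :: "config set \<Rightarrow> (config \<Rightarrow> complex) \<Rightarrow> config fs" is
  "\<lambda>S \<Psi> c. if finite S \<and> c \<in> S then \<Psi> c else 0" by auto

lemma fc_restr: "fc (restr (SM M) \<Psi>) c = (if c \<in> SM M then \<Psi> c else 0)"
  by (simp add: restr.rep_eq finite_SM)

lemma fc_sum: "fc (\<Sum>x\<in>A. f x) c = (\<Sum>x\<in>A. fc (f x) c)"
  by (induction A rule: infinite_finite_induct) (auto simp: fc_simps)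

lemma fc_HF: "fc (HF f) c = Hm (fc f) c"
  by (simp add: lattice_ham_def fc_sum fc_simps op_rep Hm_eq hop_def bonds_def[symmetric] sum_distrib_right)

text \<open>Cutting at \<open>M\<close> particles commutes with the Hamiltonian exactly. This hands
  arbitrary families to the finitely supported calculus without an error term.\<close>

lemma HF_restr: "HF (restr (SM M) \<Psi>) = restr (SM M) (Hm \<Psi>)"
proof (rule fs_eqI)
  fix c
  show "fc (HF (restr (SM M) \<Psi>)) c = fc (restr (SM M) (Hm \<Psi>)) c"
  proof (cases "c \<in> SM M")
    case True
    then have "Hm (fc (restr (SM M) \<Psi>)) c = Hm \<Psi> c" by (intro Hm_local) (simp add: fc_restr SM_cls)
    then show ?thesis using True by (simp add: fc_HF fc_restr)
  next
    case False
    have "Hm (fc (restr (SM M) \<Psi>)) c = Hm (\<lambda>c. 0) c"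
    proof (rule Hm_local)
      fix c' assume "cls c c'"
      then have "c' \<notin> SM M" using False SM_cls[OF _ cls_sym] by blast
      then show "fc (restr (SM M) \<Psi>) c' = 0" by (simp add: fc_restr)
    qed
    also have "Hm (\<lambda>c. 0) c = 0" by (simp add: Hm_eq hop_def)
    finally show ?thesis using False by (simp add: fc_HF fc_restr)
  qed
qed

lemma adjp_HF: "adjp HF HF"
  unfolding adjp_def
proof (intro allI)
  fix f g
  have "(\<Sum>p\<in>bonds. cip f (crf (fst p) (anf (snd p) g))) = (\<Sum>p\<in>bonds. cip (crf (snd p) (anf (fst p) f)) g)"
    by (rule sum.cong[OF refl]) (simp add: adjpD[OF adjp_crf] adjpD[OF adjp_anf])
  also have "\<dots> = (\<Sum>p\<in>prod.swap ` bonds. cip (crf (fst p) (anf (snd p) f)) g)"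
    by (subst sum.reindex) auto
  finally have "(\<Sum>p\<in>bonds. cip f (crf (fst p) (anf (snd p) g))) = (\<Sum>p\<in>bonds. cip (crf (fst p) (anf (snd p) f)) g)"
    by (simp only: bonds_swap)
  then show "cip f (HF g) = cip (HF f) g"
    by (simp add: lattice_ham_def bonds_def[symmetric] cip_simps cip_sum_left cip_sum_right adjpD[OF adjp_dgf])
qed

lemma cip_restr: "cip (restr (SM M) \<Phi>) (restr (SM M) \<Psi>) = (\<Sum>c\<in>SM M. cnj (\<Phi> c) * \<Psi> c)"
  by (subst cip_sum[OF finite_SM[of M]]) (auto simp: fc_restr)

lemma Hm_hermitian: "(\<Sum>c\<in>SM M. cnj (\<Phi> c) * Hm \<Psi> c) = (\<Sum>c\<in>SM M. cnj (Hm \<Phi> c) * \<Psi> c)"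
  using adjpD[OF adjp_HF, of "restr (SM M) \<Phi>" "restr (SM M) \<Psi>"] by (simp add: HF_restr cip_restr)

lemma Hm_pow_hermitian: "(\<Sum>c\<in>SM M. cnj (\<Phi> c) * (Hm ^^ k) \<Psi> c) = (\<Sum>c\<in>SM M. cnj ((Hm ^^ k) \<Phi> c) * \<Psi> c)"
proof (induction k arbitrary: \<Phi>)
  case (Suc k)
  have "(\<Sum>c\<in>SM M. cnj (\<Phi> c) * (Hm ^^ Suc k) \<Psi> c) = (\<Sum>c\<in>SM M. cnj (Hm \<Phi> c) * (Hm ^^ k) \<Psi> c)"
    by (simp add: Hm_hermitian)
  also have "\<dots> = (\<Sum>c\<in>SM M. cnj ((Hm ^^ k) (Hm \<Phi>) c) * \<Psi> c)" by (rule Suc.IH)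
  finally show ?case by (simp add: funpow_swap1)
qed simp

text \<open>Compared term by term in the series: powers of \<open>Hm\<close> are hermitian on
  \<open>SM M\<close>, and conjugating the coefficient reverses the sign of
  \<open>t\<close>.\<close>

lemma ev_adjoint:
  assumes "bdd_cf \<Phi>" "bdd_cf \<Psi>"
  shows "(\<Sum>c\<in>SM M. cnj (\<Phi> c) * ev (- t) \<Psi> c) = (\<Sum>c\<in>SM M. cnj (ev t \<Phi> c) * \<Psi> c)"
proof -
  have 1: "(\<lambda>k. \<Sum>c\<in>SM M. cnj (\<Phi> c) * ((- \<i> * complex_of_real (- t)) ^ k / fact k * (Hm ^^ k) \<Psi> c)) sums
     (\<Sum>c\<in>SM M. cnj (\<Phi> c) * ev (- t) \<Psi> c)"
    by (intro sums_sum sums_mult ev_sums assms)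
  have 2: "(\<lambda>k. \<Sum>c\<in>SM M. cnj ((- \<i> * complex_of_real t) ^ k / fact k * (Hm ^^ k) \<Phi> c) * \<Psi> c) sums
     (\<Sum>c\<in>SM M. cnj (ev t \<Phi> c) * \<Psi> c)"
    by (intro sums_sum sums_mult2 sums_cnj[THEN iffD2] ev_sums assms)
  have "(\<Sum>c\<in>SM M. cnj (\<Phi> c) * ((- \<i> * complex_of_real (- t)) ^ k / fact k * (Hm ^^ k) \<Psi> c))
    = (\<Sum>c\<in>SM M. cnj ((- \<i> * complex_of_real t) ^ k / fact k * (Hm ^^ k) \<Phi> c) * \<Psi> c)" for k
  proof -
    have "(\<Sum>c\<in>SM M. cnj (\<Phi> c) * ((- \<i> * complex_of_real (- t)) ^ k / fact k * (Hm ^^ k) \<Psi> c))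
      = (\<i> * complex_of_real t) ^ k / fact k * (\<Sum>c\<in>SM M. cnj (\<Phi> c) * (Hm ^^ k) \<Psi> c)"
      by (simp add: sum_distrib_left mult_ac)
    also have "\<dots> = (\<Sum>c\<in>SM M. cnj ((- \<i> * complex_of_real t) ^ k / fact k * (Hm ^^ k) \<Phi> c) * \<Psi> c)"
      unfolding Hm_pow_hermitian by (simp add: sum_distrib_left mult_ac)
    finally show ?thesis .
  qed
  with 1 2 show ?thesis by (simp add: sums_unique2)
qed

lemma ev_norm:
  assumes bd: "bdd_cf \<Psi>"
  shows "(\<Sum>c\<in>SM M. (cmod (ev t \<Psi> c))\<^sup>2) = (\<Sum>c\<in>SM M. (cmod (\<Psi> c))\<^sup>2)"
proof -
  define h where "h t = (\<Sum>c\<in>SM M. cnj (ev t \<Psi> c) * ev t \<Psi> c)" for t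
  have "(h has_vector_derivative (\<Sum>c\<in>SM M. cnj (ev t \<Psi> c) * (- \<i> * Hm (ev t \<Psi>) c) + cnj (- \<i> * Hm (ev t \<Psi>) c) * ev t \<Psi> c)) (at t)" for t
    unfolding h_def[abs_def]
    by (intro has_vector_derivative_sum has_vector_derivative_mult has_vector_derivative_cnj ev_deriv bd)
  moreover have "(\<Sum>c\<in>SM M. cnj (ev t \<Psi> c) * (- \<i> * Hm (ev t \<Psi>) c) + cnj (- \<i> * Hm (ev t \<Psi>) c) * ev t \<Psi> c) = 0" for t
  proof -
    have "(\<Sum>c\<in>SM M. cnj (ev t \<Psi> c) * (- \<i> * Hm (ev t \<Psi>) c) + cnj (- \<i> * Hm (ev t \<Psi>) c) * ev t \<Psi> c)
      = - \<i> * (\<Sum>c\<in>SM M. cnj (ev t \<Psi> c) * Hm (ev t \<Psi>) c) + \<i> * (\<Sum>c\<in>SM M. cnj (Hm (ev t \<Psi>) c) * ev t \<Psi> c)"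
      by (simp add: sum.distrib sum_distrib_left mult_ac sum_negf sum_subtractf)
    then show ?thesis unfolding Hm_hermitian by simp
  qed
  ultimately have hd: "(h has_vector_derivative 0) (at t)" for t by (simp only:)
  have "h t = h 0"
  proof (rule has_vector_derivative_zero_constant[OF convex_UNIV hd])
    fix k assume "\<And>t. t \<in> UNIV \<Longrightarrow> h t = k"
    then show "h t = h 0" by simp
  qed
  moreover have "h t = complex_of_real (\<Sum>c\<in>SM M. (cmod (ev t \<Psi> c))\<^sup>2)" for t
    unfolding h_def of_real_sum by (rule sum.cong[OF refl]) (simp only: complex_norm_square mult.commute)
  ultimately show ?thesis by (simp only: of_real_eq_iff ev_0)
qed

end

section \<open>Differential inequality and Gronwall argument\<close>

context bose_hubbard
begin

definition slices :: "nat \<Rightarrow> site \<Rightarrow> config set" where "slices M x = {r \<in> SM M. r x = 0}"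

lemma finite_slices: "finite (slices M x)" using finite_SM by (simp add: slices_def)

lemma SM_le: "s \<in> SM M \<Longrightarrow> s x \<le> M"
  using le_tot[of x s] by (cases "x \<in> \<Lambda>") (auto simp: SM_def configs_def)

lemma SM_reset:
  assumes "s \<in> SM M"
  shows "s(x := 0) \<in> slices M x"
proof -
  have "tot (s(x := 0)) \<le> tot s" unfolding tot_def by (intro sum_mono) simp
  then show ?thesis using assms by (auto simp: slices_def SM_def configs_def)
qed

text \<open>When \<open>r\<close> is close to the particle limit, \<open>r(x := n)\<close> may leave
  \<open>SM M\<close>. The vanishing of \<open>T\<close> there lets the occupation at
  \<open>x\<close> run over all \<open>n \<le> M\<close> independently of \<open>r\<close>.\<close>

lemma sum_slices:
  assumes T: "\<And>s. s \<notin> SM M \<Longrightarrow> T s = 0"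
  shows "(\<Sum>s\<in>SM M. T s) = (\<Sum>r\<in>slices M x. \<Sum>n\<le>M. T (r(x := n)))"
proof -
  let ?g = "\<lambda>(r, n). r(x := n)"
  have inj: "inj_on ?g (slices M x \<times> {..M})"
  proof (rule inj_onI)
    fix p p' assume p: "p \<in> slices M x \<times> {..M}" "p' \<in> slices M x \<times> {..M}" and eq: "?g p = ?g p'"
    obtain r n r' n' where pp: "p = (r, n)" "p' = (r', n')" by (cases p, cases p')
    have e: "r(x := n) = r'(x := n')" using eq by (simp add: pp)
    have "n = n'" using fun_cong[OF e, of x] by simp
    moreover have "r y = r' y" for y
      using fun_cong[OF e, of y] p by (cases "y = x") (auto simp: pp slices_def)
    ultimately show "p = p'" by (auto simp: pp)
  qed
  have "SM M \<subseteq> ?g ` (slices M x \<times> {..M})"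
  proof
    fix s assume s: "s \<in> SM M"
    then show "s \<in> ?g ` (slices M x \<times> {..M})"
      using SM_reset[OF s, of x] SM_le[OF s, of x] by (intro image_eqI[of _ _ "(s(x := 0), s x)"]) auto
  qed
  then have "(\<Sum>s\<in>SM M. T s) = (\<Sum>s\<in>?g ` (slices M x \<times> {..M}). T s)"
    using T finite_slices by (intro sum.mono_neutral_left) auto
  also have "\<dots> = (\<Sum>p\<in>slices M x \<times> {..M}. T (?g p))" by (subst sum.reindex[OF inj]) simp
  also have "\<dots> = (\<Sum>r\<in>slices M x. \<Sum>n\<le>M. T (r(x := n)))"
    by (simp add: sum.cartesian_product case_prod_unfold)
  finally show ?thesis .
qed

text \<open>The partial inner product of \<open>z\<close> with \<Phi> at the site \<open>x\<close>,
  the other occupations being those of \<open>r\<close>. The sum stops at \<open>M\<close> because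
  \<Phi> will be supported on at most \<open>M\<close> particles.\<close>

definition KK :: "nat \<Rightarrow> site \<Rightarrow> (nat \<Rightarrow> complex) \<Rightarrow> (config \<Rightarrow> complex) \<Rightarrow> config \<Rightarrow> complex" where
  "KK M x z \<Phi> r = (\<Sum>n\<le>M. cnj (z n) * \<Phi> (r(x := n)))"

text \<open>The matrix element of the rank-one operator \<open>kbf x w z\<close> between \<Phi> and
  \<Phi>', written through slices so that \<open>w\<close> and \<open>z\<close> may have infinite
  support.\<close>

definition BB :: "nat \<Rightarrow> site \<Rightarrow> (nat \<Rightarrow> complex) \<Rightarrow> (nat \<Rightarrow> complex) \<Rightarrow> (config \<Rightarrow> complex) \<Rightarrow> (config \<Rightarrow> complex) \<Rightarrow> complex" where
  "BB M x w z \<Phi> \<Phi>' = (\<Sum>r\<in>slices M x. cnj (KK M x w \<Phi> r) * KK M x z \<Phi>' r)"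

definition DD :: "nat \<Rightarrow> site \<Rightarrow> (config \<Rightarrow> complex) \<Rightarrow> (config \<Rightarrow> complex) \<Rightarrow> complex" where
  "DD M x \<Phi> \<Phi>' = (\<Sum>s\<in>SM M. of_nat (s x + 1) * (cnj (\<Phi> s) * \<Phi>' s))"

definition nw :: "(nat \<Rightarrow> complex) \<Rightarrow> nat \<Rightarrow> complex" where "nw z n = of_nat (n + 1) * z n"

text \<open>\<open>\<langle>\<Phi>, q\<^sub>x (1 + N\<^sub>x) q\<^sub>x \<Phi>\<rangle>\<close> for \<open>q = 1 - |w\<rangle>\<langle>w|\<close>, expanded with \<open>m = \<langle>w, (1 + N) w\<rangle>\<close>. In this form it depends
  on finitely many coordinates of \<open>w\<close> and \<open>\<Phi>\<close> only and makes sense for \<open>w\<close> of infinite support.\<close>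

definition FF :: "nat \<Rightarrow> site \<Rightarrow> (nat \<Rightarrow> complex) \<Rightarrow> real \<Rightarrow> (config \<Rightarrow> complex) \<Rightarrow> real" where
  "FF M x w m \<Phi> = Re (DD M x \<Phi> \<Phi> - 2 * BB M x w (nw w) \<Phi> \<Phi> + of_real m * BB M x w w \<Phi> \<Phi>)"

text \<open>The product rule for \<open>FF\<close> with \<open>m\<close> held fixed, as is correct
  along the mean-field flow, which conserves it.\<close>

definition dFF :: "nat \<Rightarrow> site \<Rightarrow> (nat \<Rightarrow> complex) \<Rightarrow> (nat \<Rightarrow> complex) \<Rightarrow> real \<Rightarrow> (config \<Rightarrow> complex) \<Rightarrow> (config \<Rightarrow> complex) \<Rightarrow> real" where
  "dFF M x w w' m \<Phi> \<Phi>' = Re (DD M x \<Phi> \<Phi>' + DD M x \<Phi>' \<Phi>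
     - 2 * (BB M x w' (nw w) \<Phi> \<Phi> + BB M x w (nw w') \<Phi> \<Phi> + BB M x w (nw w) \<Phi>' \<Phi> + BB M x w (nw w) \<Phi> \<Phi>')
     + of_real m * (BB M x w' w \<Phi> \<Phi> + BB M x w w' \<Phi> \<Phi> + BB M x w w \<Phi>' \<Phi> + BB M x w w \<Phi> \<Phi>'))"

lemma FF_deriv:
  assumes w: "\<And>n. ((\<lambda>t. w t n) has_vector_derivative w' n) (at t)"
    and P: "\<And>s. ((\<lambda>t. \<Phi> t s) has_vector_derivative \<Phi>' s) (at t)"
  shows "((\<lambda>t. FF M x (w t) m (\<Phi> t)) has_real_derivative dFF M x (w t) w' m (\<Phi> t) \<Phi>') (at t)"
proof -
  have K: "((\<lambda>t. KK M x (z t) (\<Phi> t) r) has_vector_derivative (KK M x z' (\<Phi> t) r + KK M x (z t) \<Phi>' r)) (at t)"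
    if "\<And>n. ((\<lambda>t. z t n) has_vector_derivative z' n) (at t)" for z z' r
    unfolding KK_def sum.distrib[symmetric]
    by (rule has_vector_derivative_sum, rule has_vector_derivative_eq_rhs,
        rule has_vector_derivative_mult[OF has_vector_derivative_cnj[OF that] P]) simp
  have n: "((\<lambda>t. nw (w t) n) has_vector_derivative nw w' n) (at t)" for n
    unfolding nw_def by (rule has_vector_derivative_mult_right[OF w])
  have B: "((\<lambda>t. BB M x (w t) (z t) (\<Phi> t) (\<Phi> t)) has_vector_derivative
      (BB M x w' (z t) (\<Phi> t) (\<Phi> t) + BB M x (w t) z' (\<Phi> t) (\<Phi> t) + BB M x (w t) (z t) \<Phi>' (\<Phi> t) + BB M x (w t) (z t) (\<Phi> t) \<Phi>')) (at t)"
    if z: "\<And>n. ((\<lambda>t. z t n) has_vector_derivative z' n) (at t)" for z z'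
    unfolding BB_def sum.distrib[symmetric]
    by (rule has_vector_derivative_sum, rule has_vector_derivative_eq_rhs,
        rule has_vector_derivative_mult[OF has_vector_derivative_cnj[OF K[OF w]] K[OF z]]) (simp add: algebra_simps)
  have D: "((\<lambda>t. DD M x (\<Phi> t) (\<Phi> t)) has_vector_derivative (DD M x (\<Phi> t) \<Phi>' + DD M x \<Phi>' (\<Phi> t))) (at t)"
    unfolding DD_def sum.distrib[symmetric]
    by (rule has_vector_derivative_sum, rule has_vector_derivative_eq_rhs,
        rule has_vector_derivative_mult_right[OF has_vector_derivative_mult[OF has_vector_derivative_cnj[OF P] P]]) (simp add: algebra_simps)
  have "((\<lambda>t. DD M x (\<Phi> t) (\<Phi> t) - 2 * BB M x (w t) (nw (w t)) (\<Phi> t) (\<Phi> t) + of_real m * BB M x (w t) (w t) (\<Phi> t) (\<Phi> t)) has_vector_derivative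
     (DD M x (\<Phi> t) \<Phi>' + DD M x \<Phi>' (\<Phi> t)
     - 2 * (BB M x w' (nw (w t)) (\<Phi> t) (\<Phi> t) + BB M x (w t) (nw w') (\<Phi> t) (\<Phi> t) + BB M x (w t) (nw (w t)) \<Phi>' (\<Phi> t) + BB M x (w t) (nw (w t)) (\<Phi> t) \<Phi>')
     + of_real m * (BB M x w' (w t) (\<Phi> t) (\<Phi> t) + BB M x (w t) w' (\<Phi> t) (\<Phi> t) + BB M x (w t) (w t) \<Phi>' (\<Phi> t) + BB M x (w t) (w t) (\<Phi> t) \<Phi>'))) (at t)"
    by (intro has_vector_derivative_add has_vector_derivative_diff has_vector_derivative_mult_right D B n w)
  from bounded_linear.has_vector_derivative[OF bounded_linear_Re this]
  show ?thesis unfolding FF_def dFF_def has_real_derivative_iff_has_vector_derivative .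
qed

lemma BB_cip:
  assumes "\<And>s. s \<notin> SM M \<Longrightarrow> fc \<Phi> s = 0" "\<And>s. s \<notin> SM M \<Longrightarrow> fc \<Phi>' s = 0"
  shows "cip \<Phi> (kbf x w z \<Phi>') = BB M x (fc w) (fc z) (fc \<Phi>) (fc \<Phi>')"
proof -
  have k: "fc (kbf x w z \<Phi>') s = fc w (s x) * KK M x (fc z) (fc \<Phi>') s" if "s(x := 0) \<in> slices M x \<or> True" for s
  proof -
    have "(\<Sum>\<^sub>\<infinity>n. cnj (fc z n) * fc \<Phi>' (s(x := n))) = (\<Sum>\<^sub>\<infinity>n\<in>{..M}. cnj (fc z n) * fc \<Phi>' (s(x := n)))"
    proof (rule infsum_cong_neutral)
      fix n assume "n \<in> UNIV - {..M}"
      then have "s(x := n) \<notin> SM M" using SM_le[of "s(x := n)" M x] by auto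
      then show "cnj (fc z n) * fc \<Phi>' (s(x := n)) = 0" by (simp add: assms(2))
    qed auto
    then show ?thesis by (simp add: kbf.rep_eq KK_def)
  qed
  have "cip \<Phi> (kbf x w z \<Phi>') = (\<Sum>s\<in>SM M. cnj (fc \<Phi> s) * (fc w (s x) * KK M x (fc z) (fc \<Phi>') s))"
    using assms(1) by (subst cip_sum[OF finite_SM[of M]]) (auto simp: k)
  also have "\<dots> = (\<Sum>r\<in>slices M x. \<Sum>n\<le>M. cnj (fc \<Phi> (r(x := n))) * (fc w n * KK M x (fc z) (fc \<Phi>') r))"
    by (subst sum_slices[of M _ x]) (auto simp: assms(1) KK_def)
  also have "\<dots> = BB M x (fc w) (fc z) (fc \<Phi>) (fc \<Phi>')"
    unfolding BB_def by (intro sum.cong refl) (simp add: KK_def[of M x "fc w"] sum_distrib_right sum_distrib_left mult_ac)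
  finally show ?thesis .
qed

lemma DD_cip:
  assumes "\<And>s. s \<notin> SM M \<Longrightarrow> fc \<Phi> s = 0"
  shows "cip \<Phi> (dgf nh x \<Phi>') = DD M x (fc \<Phi>) (fc \<Phi>')"
  unfolding DD_def using assms by (subst cip_sum[OF finite_SM[of M]]) (auto simp: op_rep algebra_simps)

lemma nw_dg1: "fc (dg1 nh w) = nw (fc w)"
  by (auto simp: fun_eq_iff nw_def op_rep add.commute)

end

locale finite_path_estimate = bose_hubbard J \<mu> U d L for J \<mu> U d L +
  fixes M :: nat and w :: "nat fs" and \<Phi> :: "config fs"
  assumes norm_w: "norm w = 1" and supp: "\<And>s. s \<notin> SM M \<Longrightarrow> fc \<Phi> s = 0"
begin

sublocale mf: mean_field_lattice w J "site_energy J \<mu> U" "norm (dg1 nh w)" "lattice d L" "nbs d L" "2 * d"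
proof
  show "norm w = 1" "norm (dg1 nh w) \<le> norm (dg1 nh w)" using norm_w by auto
  show "finite (lattice d L)" by (rule finite_lattice)
  show "nbs d L x \<subseteq> lattice d L" for x by (auto simp: nbs_def)
  show "x \<in> nbs d L y" if "y \<in> nbs d L x" for x y
    using that neighbour_sym by (auto simp: nbs_def)
  show "x \<notin> nbs d L x" for x by (rule nbs_irrefl[OF L])
  show "card (nbs d L x) = 2 * d" if "x \<in> lattice d L" for x by (rule card_nbs[OF L that])
  show "0 < 2 * d" using d by simp
qed


lemma FF_eq: "FF M x (fc w) (Re (cip w (dg1 nh w))) (fc \<Phi>) = (mf.e \<Phi> x)\<^sup>2"
proof -
  have m: "cip w (dg1 nh w) = complex_of_real (Re (cip w (dg1 nh w)))"
  proof -
    have "cip w (dg1 nh w) = cnj (cip w (dg1 nh w))"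
      using cip_cnj[of w "dg1 nh w"] adjpD[OF adjp_dg1, of w nh w] by simp
    from arg_cong[OF this, of Im] show ?thesis by (simp add: complex_eq_iff)
  qed
  have b: "cip \<Phi> (kbf x w (dg1 nh w) \<Phi>) = cnj (cip \<Phi> (kbf x (dg1 nh w) w \<Phi>))"
    using adjpD[OF adjp_kbf, of \<Phi> x w "dg1 nh w" \<Phi>] cip_cnj[of "kbf x (dg1 nh w) w \<Phi>" \<Phi>] by simp
  have "complex_of_real ((mf.e \<Phi> x)\<^sup>2) = cip (mf.q x \<Phi>) (dgf nh x (mf.q x \<Phi>))"
    unfolding mf.e_def using adjpD[OF adjp_anf, of "mf.q x \<Phi>" x "crf x (mf.q x \<Phi>)"] by (simp add: cip_self anf_crf)
  also have "\<dots> = cip \<Phi> (dgf nh x \<Phi>) - cip \<Phi> (kbf x (dg1 nh w) w \<Phi>) - cip \<Phi> (kbf x w (dg1 nh w) \<Phi>)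
      + cip w (dg1 nh w) * cip \<Phi> (kbf x w w \<Phi>)"
    by (simp add: mf.q_def adjp_diff[OF adjp_dgf] dgf_kbf cip_simps adjpD[OF adjp_kbf, symmetric] kbf_dgf kbf_kbf)
  finally have "(mf.e \<Phi> x)\<^sup>2 = Re (cip \<Phi> (dgf nh x \<Phi>) - 2 * cip \<Phi> (kbf x w (dg1 nh w) \<Phi>)
      + complex_of_real (Re (cip w (dg1 nh w))) * cip \<Phi> (kbf x w w \<Phi>))"
    using b m by (simp add: complex_eq_iff)
  then show ?thesis
    by (simp add: FF_def BB_cip[OF supp supp] DD_cip[OF supp] nw_dg1)
qed

lemma HF_supp: "s \<notin> SM M \<Longrightarrow> fc (HF \<Phi>) s = 0"
proof -
  assume s: "s \<notin> SM M"
  have "\<Phi> = restr (SM M) (fc \<Phi>)" by (rule fs_eqI) (simp add: fc_restr supp)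
  then have "HF \<Phi> = restr (SM M) (Hm (fc \<Phi>))" using HF_restr by metis
  then show "fc (HF \<Phi>) s = 0" using s by (simp add: fc_restr)
qed

lemma dFF_eq:
  "dFF M x (fc w) (fc (- \<i> *\<^sub>F mf.h1 w)) (Re (cip w (dg1 nh w))) (fc \<Phi>) (fc (- \<i> *\<^sub>F HF \<Phi>)) = mf.deriv_e \<Phi> x"
proof -
  define w' where "w' = - \<i> *\<^sub>F mf.h1 w"
  define \<Phi>' where "\<Phi>' = - \<i> *\<^sub>F HF \<Phi>"
  have supp': "fc \<Phi>' s = 0" if "s \<notin> SM M" for s using HF_supp[OF that] by (simp add: \<Phi>'_def fc_simps)
  have B: "cip \<Phi> (kbf x a b \<Phi>) = BB M x (fc a) (fc b) (fc \<Phi>) (fc \<Phi>)"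
    "cip \<Phi>' (kbf x a b \<Phi>) = BB M x (fc a) (fc b) (fc \<Phi>') (fc \<Phi>)"
    "cip \<Phi> (kbf x a b \<Phi>') = BB M x (fc a) (fc b) (fc \<Phi>) (fc \<Phi>')" for a b
    by (rule BB_cip; simp add: supp supp')+
  have D: "cip \<Phi> (dgf nh x \<Phi>') = DD M x (fc \<Phi>) (fc \<Phi>')" "cip \<Phi>' (dgf nh x \<Phi>) = DD M x (fc \<Phi>') (fc \<Phi>)"
    by (rule DD_cip; simp add: supp supp')+
  have eq: "dFF M x (fc w) (fc w') (Re (cip w (dg1 nh w))) (fc \<Phi>) (fc \<Phi>') =
    Re (cip \<Phi> (dgf nh x \<Phi>') + cip \<Phi>' (dgf nh x \<Phi>)
     - 2 * (cip \<Phi> (kbf x w' (dg1 nh w) \<Phi>) + cip \<Phi> (kbf x w (dg1 nh w') \<Phi>) + cip \<Phi>' (kbf x w (dg1 nh w) \<Phi>) + cip \<Phi> (kbf x w (dg1 nh w) \<Phi>'))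
     + complex_of_real (Re (cip w (dg1 nh w))) * (cip \<Phi> (kbf x w' w \<Phi>) + cip \<Phi> (kbf x w w' \<Phi>) + cip \<Phi>' (kbf x w w \<Phi>) + cip \<Phi> (kbf x w w \<Phi>')))"
    by (simp only: dFF_def D B nw_dg1)
  have m: "cip w (dg1 nh w) = complex_of_real (Re (cip w (dg1 nh w)))"
  proof -
    have "cip w (dg1 nh w) = cnj (cip w (dg1 nh w))"
      using cip_cnj[of w "dg1 nh w"] adjpD[OF adjp_dg1, of w nh w] by simp
    from arg_cong[OF this, of Im] show ?thesis by (simp add: complex_eq_iff)
  qed
  have adj1: "cip a (kbf x z z' b) = cnj (cip b (kbf x z' z a))" for a b z z'
    using adjpD[OF adjp_kbf, of a x z z' b] cip_cnj[of "kbf x z' z a" b] by simp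
  have adj2: "cip a (dgf nh x b) = cnj (cip b (dgf nh x a))" for a b
    using adjpD[OF adjp_dgf, of a nh x b] cip_cnj[of "dgf nh x a" b] by simp
  \<comment> \<open>Conservation of the expectation of \<open>1 + N\<close>, in infinitesimal form;
    it holds for the finitely supported \<open>w\<close> because \<alpha> is computed from
    \<open>w\<close> itself. Differentiating \<open>q\<close> produces this term, while
    \<open>dFF\<close> with its frozen \<open>m\<close> has no counterpart.\<close>
  have cons: "Re (cip w' (dg1 nh w)) = 0"
  proof -
    have r: "Im (cip (dg1 nh w) (dg1 r w)) = 0" for r :: "nat \<Rightarrow> real"
    proof -
      have "cip (dg1 nh w) (dg1 r w) = cnj (cip (dg1 nh w) (dg1 r w))"
        using adjpD[OF adjp_dg1, of "dg1 nh w" r w] adjpD[OF adjp_dg1, of "dg1 r w" nh w]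
          cip_cnj[of "dg1 nh w" "dg1 r w"] adjpD[OF adjp_dg1, of w "\<lambda>n. nh n * r n" w]
        by (simp add: dg1_dg1 mult.commute)
      from arg_cong[OF this, of Im] show ?thesis by simp
    qed
    have a1: "cip (dg1 nh w) (cr1 w) = cip (an1 w) (dg1 nh w) + cip (an1 w) w"
    proof -
      have "an1 (dg1 nh w) = dg1 nh (an1 w) + an1 w" by (rule fs_eqI) (simp add: op_rep algebra_simps)
      then show ?thesis by (simp add: adjpD[OF adjp_cr1] cip_add_left) (rule adjpD[OF adjp_dg1, symmetric])
    qed
    have a2: "cip (dg1 nh w) (an1 w) = cnj (cip (an1 w) (dg1 nh w))" by (rule cip_cnj)
    have al: "cip (an1 w) w = cnj mf.\<alpha>" unfolding mf.\<alpha>_def by (rule cip_cnj)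
    define a where "a = cip (an1 w) (dg1 nh w)"
    have "cip (dg1 nh w) (mf.h1 w) = cip (dg1 nh w) (dg1 (site_energy J \<mu> U) w)
        - complex_of_real J * (mf.\<alpha> * (a + cnj mf.\<alpha>) + cnj mf.\<alpha> * cnj a - complex_of_real ((cmod mf.\<alpha>)\<^sup>2) * cip (dg1 nh w) w)"
      by (simp only: mf.h1_def cip_simps a1 a2 al a_def)
    moreover have "Im (cip (dg1 nh w) w) = 0"
      using arg_cong[OF m, of Im] cip_cnj[of "dg1 nh w" w] by simp
    moreover have "Im (mf.\<alpha> * (a + cnj mf.\<alpha>) + cnj mf.\<alpha> * cnj a) = 0" by (simp add: algebra_simps)
    ultimately have "Im (cip (dg1 nh w) (mf.h1 w)) = 0" using r by simp
    then show ?thesis using cip_cnj[of "mf.h1 w" "dg1 nh w"] by (simp add: w'_def cip_scale_left)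
  qed
  have dq: "mf.dq x \<Phi> = - (kbf x w' w \<Phi> + kbf x w w' \<Phi>)"
    unfolding mf.dq_def w'_def kbf_scale1 kbf_scale2 by (rule fs_eqI) (simp add: fc_simps algebra_simps)
  have t1: "2 * Re (cip (mf.dq x \<Phi>) (dgf nh x (mf.q x \<Phi>))) =
      Re (- 2 * (cip \<Phi> (kbf x w' (dg1 nh w) \<Phi>) + cip \<Phi> (kbf x w (dg1 nh w') \<Phi>))
         + complex_of_real (Re (cip w (dg1 nh w))) * (cip \<Phi> (kbf x w' w \<Phi>) + cip \<Phi> (kbf x w w' \<Phi>)))"
  proof -
    have nX: "dgf nh x (mf.q x \<Phi>) = dgf nh x \<Phi> - kbf x (dg1 nh w) w \<Phi>"
      by (simp add: mf.q_def adjp_diff[OF adjp_dgf] dgf_kbf)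
    have "cip (kbf x w' w \<Phi>) (dgf nh x (mf.q x \<Phi>)) = cip \<Phi> (kbf x w (dg1 nh w') \<Phi>) - cip w' (dg1 nh w) * cip \<Phi> (kbf x w w \<Phi>)"
      by (simp add: nX cip_simps adjpD[OF adjp_kbf, symmetric] kbf_dgf kbf_kbf)
    moreover have "cip (kbf x w w' \<Phi>) (dgf nh x (mf.q x \<Phi>)) = cip \<Phi> (kbf x w' (dg1 nh w) \<Phi>) - cip w (dg1 nh w) * cip \<Phi> (kbf x w' w \<Phi>)"
      by (simp add: nX cip_simps adjpD[OF adjp_kbf, symmetric] kbf_dgf kbf_kbf)
    ultimately have dqe: "cip (mf.dq x \<Phi>) (dgf nh x (mf.q x \<Phi>)) =
      - (cip \<Phi> (kbf x w (dg1 nh w') \<Phi>) - cip w' (dg1 nh w) * cip \<Phi> (kbf x w w \<Phi>)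
        + (cip \<Phi> (kbf x w' (dg1 nh w) \<Phi>) - cip w (dg1 nh w) * cip \<Phi> (kbf x w' w \<Phi>)))"
      by (simp add: dq cip_uminus_left cip_add_left cip_diff_left)
    have i1: "Im (cip \<Phi> (kbf x w w \<Phi>)) = 0"
      using arg_cong[OF adj1[of \<Phi> w w \<Phi>], of Im] by simp
    have i2: "Re (cip \<Phi> (kbf x w' w \<Phi>)) = Re (cip \<Phi> (kbf x w w' \<Phi>))"
      using arg_cong[OF adj1[of \<Phi> w' w \<Phi>], of Re] by simp
    have i3: "Im (cip w (dg1 nh w)) = 0" using arg_cong[OF m, of Im] by simp
    show ?thesis unfolding dqe using cons i1 i2 i3 by simp
  qed
  have t2: "2 * Im (cip (mf.W x \<Phi>) (HF \<Phi>)) = 2 * Re (cip (mf.W x \<Phi>) \<Phi>')"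
    by (simp add: \<Phi>'_def cip_scale_right)
  have W: "mf.W x \<Phi> = dgf nh x \<Phi> - kbf x (dg1 nh w) w \<Phi> - kbf x w (dg1 nh w) \<Phi> + cip w (dg1 nh w) *\<^sub>F kbf x w w \<Phi>"
    by (simp add: mf.W_def mf.q_def adjp_diff[OF adjp_dgf] dgf_kbf kbf_dgf kbf_kbf adjp_diff[OF adjp_kbf])
  have "cip (mf.W x \<Phi>) \<Phi>' = cip \<Phi> (dgf nh x \<Phi>') - cip \<Phi> (kbf x w (dg1 nh w) \<Phi>') - cip \<Phi> (kbf x (dg1 nh w) w \<Phi>')
      + cnj (cip w (dg1 nh w)) * cip \<Phi> (kbf x w w \<Phi>')"
    by (simp add: W cip_simps adjpD[OF adjp_kbf, symmetric] adjpD[OF adjp_dgf, symmetric])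
  then have t3: "2 * Re (cip (mf.W x \<Phi>) \<Phi>') = Re (cip \<Phi> (dgf nh x \<Phi>') + cip \<Phi>' (dgf nh x \<Phi>)
     - 2 * (cip \<Phi>' (kbf x w (dg1 nh w) \<Phi>) + cip \<Phi> (kbf x w (dg1 nh w) \<Phi>'))
     + complex_of_real (Re (cip w (dg1 nh w))) * (cip \<Phi>' (kbf x w w \<Phi>) + cip \<Phi> (kbf x w w \<Phi>')))"
    using adj2[of \<Phi>' \<Phi>] adj1[of \<Phi>' w "dg1 nh w" \<Phi>] adj1[of \<Phi>' w w \<Phi>] arg_cong[OF m, of Im] by simp
  have "dFF M x (fc w) (fc w') (Re (cip w (dg1 nh w))) (fc \<Phi>) (fc \<Phi>') =
     2 * Re (cip (mf.W x \<Phi>) \<Phi>') + 2 * Re (cip (mf.dq x \<Phi>) (dgf nh x (mf.q x \<Phi>)))"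
    unfolding eq t3 t1 by (simp add: algebra_simps)
  then show ?thesis unfolding mf.deriv_e_def t2 by (simp add: w'_def \<Phi>'_def)
qed

lemma dFF_sum_le:
  "(\<Sum>x\<in>lattice d L. dFF M x (fc w) (fc (- \<i> *\<^sub>F mf.h1 w)) (Re (cip w (dg1 nh w))) (fc \<Phi>) (fc (- \<i> *\<^sub>F HF \<Phi>)))
   \<le> \<bar>J\<bar> * norm (dg1 nh w) ^ 3 * (106 * (\<Sum>x\<in>lattice d L. FF M x (fc w) (Re (cip w (dg1 nh w))) (fc \<Phi>))
      + 16 * card (lattice d L) * (norm \<Phi>)\<^sup>2 / (2 * d))"
  using mf.deriv_e_sum_le[of \<Phi>] by (simp only: dFF_eq FF_eq)

end

section \<open>Cutting off the mean-field vector at a fixed time\<close>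

definition mf_dot :: "real \<Rightarrow> (nat \<Rightarrow> real) \<Rightarrow> complex \<Rightarrow> (nat \<Rightarrow> complex) \<Rightarrow> nat \<Rightarrow> complex" where
  "mf_dot J v a w n = - \<i> * (complex_of_real (v n) * w n
     - complex_of_real J * (a * (complex_of_real (sqrt (real n)) * w (n - 1))
        + cnj a * (complex_of_real (sqrt (real (n + 1))) * w (n + 1))
        - complex_of_real ((cmod a)\<^sup>2) * w n))"

text \<open>One formula, with \<alpha> as a separate argument, describes the velocity both in the
  finite calculus and on the true path. Convergence of the coordinates and of \<alpha> then gives
  convergence of the velocities.\<close>

lemma (in finite_path_estimate) h1_mf_dot:
  "fc (- \<i> *\<^sub>F mf.h1 w) = mf_dot J (site_energy J \<mu> U) (cip w (an1 w)) (fc w)"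
  by (rule ext) (simp add: mf_dot_def mf.h1_def mf.\<alpha>_def op_rep)

lemma (in mf_path) dc_mf_dot: "dc t = mf_dot J (site_energy J \<mu> U) (al t) (c t)"
  by (rule ext) (simp add: mf_dot_def dc_def)

lift_definition trunc :: "nat \<Rightarrow> (nat \<Rightarrow> complex) \<Rightarrow> nat fs" is "\<lambda>D f n. if n \<le> D then f n else 0"
  by (rule finite_subset[of _ "{..D}" for D]) auto

context bose_hubbard
begin

text \<open>For fixed \<open>M\<close> the functional is a polynomial in finitely many coordinates
  of the one-site vector, so coordinatewise convergence is enough. The mean \<open>m\<close>, which
  depends on all coordinates, is passed to the limit separately.\<close>

lemma FF_tendsto:
  assumes "\<And>n. (\<lambda>D. w D n) \<longlonglongrightarrow> w0 n" "m \<longlonglongrightarrow> m0"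
  shows "(\<lambda>D. FF M x (w D) (m D) \<Phi>) \<longlonglongrightarrow> FF M x w0 m0 \<Phi>"
  unfolding FF_def BB_def KK_def nw_def DD_def by (intro tendsto_intros assms)

lemma dFF_tendsto:
  assumes "\<And>n. (\<lambda>D. w D n) \<longlonglongrightarrow> w0 n" "\<And>n. (\<lambda>D. w' D n) \<longlonglongrightarrow> w0' n" "m \<longlonglongrightarrow> m0"
  shows "(\<lambda>D. dFF M x (w D) (w' D) (m D) \<Phi> \<Phi>') \<longlonglongrightarrow> dFF M x w0 w0' m0 \<Phi> \<Phi>'"
  unfolding dFF_def BB_def KK_def nw_def DD_def by (intro tendsto_intros assms)

lemma FF_slices:
  assumes supp: "\<And>s. s \<notin> SM M \<Longrightarrow> \<Phi> s = 0"
  shows "FF M x w m \<Phi> = (\<Sum>r\<in>slices M x. (\<Sum>n\<le>M. (real n + 1) * (cmod (\<Phi> (r(x := n))))\<^sup>2)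
     - 2 * Re (cnj (KK M x w \<Phi> r) * KK M x (nw w) \<Phi> r) + m * (cmod (KK M x w \<Phi> r))\<^sup>2)"
proof -
  have "Re (DD M x \<Phi> \<Phi>) = (\<Sum>s\<in>SM M. (real (s x) + 1) * (cmod (\<Phi> s))\<^sup>2)"
    unfolding DD_def Re_sum
  proof (rule sum.cong[OF refl])
    fix s
    have "of_nat (s x + 1) * (cnj (\<Phi> s) * \<Phi> s) = complex_of_real ((real (s x) + 1) * (cmod (\<Phi> s))\<^sup>2)"
      by (simp only: of_real_mult complex_norm_square) (simp add: mult_ac)
    then show "Re (of_nat (s x + 1) * (cnj (\<Phi> s) * \<Phi> s)) = (real (s x) + 1) * (cmod (\<Phi> s))\<^sup>2"
      by (simp only: Re_complex_of_real)
  qed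
  also have "\<dots> = (\<Sum>r\<in>slices M x. \<Sum>n\<le>M. (real n + 1) * (cmod (\<Phi> (r(x := n))))\<^sup>2)"
    by (subst sum_slices[of M _ x]) (auto simp: supp)
  finally have D: "Re (DD M x \<Phi> \<Phi>) = (\<Sum>r\<in>slices M x. \<Sum>n\<le>M. (real n + 1) * (cmod (\<Phi> (r(x := n))))\<^sup>2)" .
  have B: "Re (BB M x w w \<Phi> \<Phi>) = (\<Sum>r\<in>slices M x. (cmod (KK M x w \<Phi> r))\<^sup>2)"
    unfolding BB_def Re_sum
  proof (rule sum.cong[OF refl])
    fix r
    have "cnj (KK M x w \<Phi> r) * KK M x w \<Phi> r = complex_of_real ((cmod (KK M x w \<Phi> r))\<^sup>2)"
      by (simp only: complex_norm_square mult.commute)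
    then show "Re (cnj (KK M x w \<Phi> r) * KK M x w \<Phi> r) = (cmod (KK M x w \<Phi> r))\<^sup>2"
      by (simp only: Re_complex_of_real)
  qed
  have C: "Re (BB M x w (nw w) \<Phi> \<Phi>) = (\<Sum>r\<in>slices M x. Re (cnj (KK M x w \<Phi> r) * KK M x (nw w) \<Phi> r))"
    unfolding BB_def Re_sum ..
  show ?thesis
    by (simp add: FF_def D B C sum.distrib sum_subtractf sum_distrib_left)
qed

end

section \<open>Gronwall's inequality for a truncated pure state\<close>

locale full_path = bose_hubbard J \<mu> U d L + mf_path J \<mu> U \<phi> for J \<mu> U d L \<phi> +
  fixes \<psi>0 :: "config \<Rightarrow> complex" and M :: nat
  assumes bdd: "bdd_cf \<psi>0"
begin

definition Ps :: "real \<Rightarrow> config fs" where "Ps t = restr (SM M) (ev t \<psi>0)"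
definition P0 :: real where "P0 = (\<Sum>s\<in>SM M. (cmod (\<psi>0 s))\<^sup>2)"
definition G :: "real \<Rightarrow> real" where "G t = (\<Sum>x\<in>\<Lambda>. FF M x (c t) (mass 0) (fc (Ps t)))"

lemma Ps_supp: "s \<notin> SM M \<Longrightarrow> fc (Ps t) s = 0" by (simp add: Ps_def fc_restr)

lemma norm_Ps: "(norm (Ps t))\<^sup>2 = P0"
proof -
  have "complex_of_real ((norm (Ps t))\<^sup>2) = (\<Sum>s\<in>SM M. cnj (ev t \<psi>0 s) * ev t \<psi>0 s)"
    by (simp only: cip_self[symmetric] Ps_def cip_restr)
  also have "\<dots> = complex_of_real (\<Sum>s\<in>SM M. (cmod (ev t \<psi>0 s))\<^sup>2)"
    unfolding of_real_sum by (rule sum.cong[OF refl]) (simp only: complex_norm_square mult.commute)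
  finally show ?thesis by (simp only: of_real_eq_iff ev_norm[OF bdd] P0_def)
qed

lemma Ps_deriv: "((\<lambda>t. fc (Ps t) s) has_vector_derivative fc (- \<i> *\<^sub>F HF (Ps t)) s) (at t)"
proof (cases "s \<in> SM M")
  case True
  then show ?thesis using ev_deriv[OF bdd, of s t] by (simp add: Ps_def HF_restr fc_restr fc_simps)
next
  case False
  then show ?thesis by (simp add: Ps_def HF_restr fc_restr fc_simps)
qed

definition rho :: "real \<Rightarrow> nat \<Rightarrow> real" where "rho t D = (\<Sum>n\<le>D. (cmod (c t n))\<^sup>2)"
text \<open>The cut-off path renormalised at each time by itself. It follows no flow;
  \<open>finite_path_estimate\<close> asks for a unit vector of finite support and supplies the
  velocity.\<close>

definition tr :: "real \<Rightarrow> nat \<Rightarrow> nat fs" where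
  "tr t D = complex_of_real (1 / sqrt (rho t D)) *\<^sub>F trunc D (c t)"

lemma rho_lim: "(\<lambda>D. rho t D) \<longlonglongrightarrow> 1"
  using norm_sums[of t] unfolding sums_def_le rho_def by (simp add: norm_phi)

lemma rho_nonneg: "rho t D \<ge> 0" by (simp add: rho_def sum_nonneg)

lemma rho_pos: "eventually (\<lambda>D. rho t D > 0) sequentially"
  using order_tendstoD(1)[OF rho_lim, of 0] by simp

lemma scale_sq: "complex_of_real (1 / sqrt (rho t D)) * (cnj (complex_of_real (1 / sqrt (rho t D))) * z) = complex_of_real (1 / rho t D) * z"
proof -
  have "(1 / sqrt (rho t D)) * (1 / sqrt (rho t D)) = 1 / rho t D" using rho_nonneg[of t D] by simp
  then show ?thesis by (simp only: complex_cnj_complex_of_real mult.assoc[symmetric] of_real_mult[symmetric])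
qed

lemma cip_trunc: "cip (trunc D f) g = (\<Sum>n\<le>D. cnj (f n) * fc g n)"
  by (subst cip_sum[of "{..D}"]) (auto simp: trunc.rep_eq)

lemma tr_dg: "cip (tr t D) (dg1 r (tr t D)) = complex_of_real ((1 / rho t D) * (\<Sum>n\<le>D. r n * (cmod (c t n))\<^sup>2))"
proof -
  have "cip (tr t D) (dg1 r (tr t D)) = complex_of_real (1 / rho t D) * cip (trunc D (c t)) (dg1 r (trunc D (c t)))"
    unfolding tr_def adjp_scale[OF adjp_dg1] cip_scale_left cip_scale_right by (rule scale_sq)
  also have "cip (trunc D (c t)) (dg1 r (trunc D (c t))) = complex_of_real (\<Sum>n\<le>D. r n * (cmod (c t n))\<^sup>2)"
    unfolding cip_trunc of_real_sum
  proof (rule sum.cong[OF refl])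
    fix n assume "n \<in> {..D}"
    then show "cnj (c t n) * fc (dg1 r (trunc D (c t))) n = complex_of_real (r n * (cmod (c t n))\<^sup>2)"
      by (simp only: of_real_mult complex_norm_square) (simp add: op_rep trunc.rep_eq)
  qed
  finally show ?thesis by simp
qed

lemma norm_tr: "rho t D > 0 \<Longrightarrow> norm (tr t D) = 1"
proof -
  assume "rho t D > 0"
  then have "(norm (tr t D))\<^sup>2 = 1"
    using tr_dg[of t D "\<lambda>_. 1"] by (simp add: dg1_one cip_self rho_def[symmetric] del: of_real_power)
  then show ?thesis using norm_ge_zero[of "tr t D"] by (auto simp: power2_eq_1_iff)
qed

lemma tr_lim: "(\<lambda>D. fc (tr t D) n) \<longlonglongrightarrow> c t n"
proof -
  have "(\<lambda>D. complex_of_real (1 / sqrt (rho t D)) * c t n) \<longlonglongrightarrow> complex_of_real (1 / sqrt 1) * c t n"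
    by (intro tendsto_intros rho_lim) auto
  moreover have "eventually (\<lambda>D. complex_of_real (1 / sqrt (rho t D)) * c t n = fc (tr t D) n) sequentially"
    using eventually_ge_at_top[of n] by eventually_elim (simp add: tr_def fc_simps trunc.rep_eq)
  ultimately show ?thesis by (simp add: Lim_transform_eventually)
qed

lemma tr_an: "cip (tr t D) (an1 (tr t D)) = complex_of_real (1 / rho t D) * (\<Sum>n<D. cnj (c t n) * (complex_of_real (sqrt (real (n + 1))) * c t (n + 1)))"
proof -
  have "cip (tr t D) (an1 (tr t D)) = complex_of_real (1 / rho t D) * cip (trunc D (c t)) (an1 (trunc D (c t)))"
    unfolding tr_def adjp_scale[OF adjp_an1] cip_scale_left cip_scale_right by (rule scale_sq)
  also have "cip (trunc D (c t)) (an1 (trunc D (c t))) = (\<Sum>n<D. cnj (c t n) * (complex_of_real (sqrt (real (n + 1))) * c t (n + 1)))"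
    unfolding cip_trunc lessThan_Suc_atMost[symmetric] by (simp add: op_rep trunc.rep_eq)
  finally show ?thesis .
qed

lemma one_over_rho: "(\<lambda>D. 1 / rho t D) \<longlonglongrightarrow> 1"
  using tendsto_divide[OF tendsto_const[of 1] rho_lim] by simp

lemma tr_an_lim: "(\<lambda>D. cip (tr t D) (an1 (tr t D))) \<longlonglongrightarrow> al t"
proof -
  have "(\<lambda>D. complex_of_real (1 / rho t D) * (\<Sum>n<D. cnj (c t n) * (complex_of_real (sqrt (real (n + 1))) * c t (n + 1)))) \<longlonglongrightarrow> complex_of_real 1 * al t"
    using al_sums[of t] unfolding sums_def by (intro tendsto_mult tendsto_of_real one_over_rho)
  then show ?thesis by (simp only: tr_an) simp
qed

lemma tr_mass_lim: "(\<lambda>D. Re (cip (tr t D) (dg1 nh (tr t D)))) \<longlonglongrightarrow> mass 0"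
proof -
  have "(\<lambda>D. (1 / rho t D) * (\<Sum>n\<le>D. nh n * (cmod (c t n))\<^sup>2)) \<longlonglongrightarrow> 1 * mass t"
    using mass_sums[of t] unfolding sums_def_le by (intro tendsto_mult one_over_rho)
  then show ?thesis by (simp only: tr_dg Re_complex_of_real mass_const[of t, symmetric]) simp
qed

lemma tr_mom2_lim: "(\<lambda>D. norm (dg1 nh (tr t D))) \<longlonglongrightarrow> sqrt (mom2 t)"
proof -
  have e: "norm (dg1 nh (tr t D)) = sqrt ((1 / rho t D) * (\<Sum>n\<le>D. (real n + 1)\<^sup>2 * (cmod (c t n))\<^sup>2))" for D
  proof -
    have "complex_of_real ((norm (dg1 nh (tr t D)))\<^sup>2) = cip (tr t D) (dg1 (\<lambda>n. (real n + 1)\<^sup>2) (tr t D))"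
      using adjpD[OF adjp_dg1, of "tr t D" nh "dg1 nh (tr t D)"] by (simp only: cip_self dg1_dg1 power2_eq_square)
    then have "(norm (dg1 nh (tr t D)))\<^sup>2 = (1 / rho t D) * (\<Sum>n\<le>D. (real n + 1)\<^sup>2 * (cmod (c t n))\<^sup>2)"
      by (simp only: tr_dg of_real_eq_iff)
    from arg_cong[OF this, of sqrt] show ?thesis by simp
  qed
  have "(\<lambda>D. sqrt ((1 / rho t D) * (\<Sum>n\<le>D. (real n + 1)\<^sup>2 * (cmod (c t n))\<^sup>2))) \<longlonglongrightarrow> sqrt (1 * mom2 t)"
    using mom2_sums[of t] unfolding sums_def_le by (intro tendsto_real_sqrt tendsto_mult one_over_rho)
  then show ?thesis by (simp only: e) simp
qed

definition dG :: "real \<Rightarrow> real" where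
  "dG t = (\<Sum>x\<in>\<Lambda>. dFF M x (c t) (dc t) (mass 0) (fc (Ps t)) (fc (- \<i> *\<^sub>F HF (Ps t))))"

lemma G_deriv: "(G has_real_derivative dG t) (at t)"
  unfolding G_def[abs_def] dG_def by (intro DERIV_sum FF_deriv c_deriv Ps_deriv)

text \<open>At fixed \<open>t\<close> the inequality is applied to the cut-off vector with its own
  mean-field velocity, and then \<open>D\<close> tends to infinity. Normalisation requires a nonzero
  cut-off vector, hence the eventual statement.\<close>

lemma dG_le: "dG t \<le> \<bar>J\<bar> * sqrt (mom2 t) ^ 3 * (106 * G t + 16 * card \<Lambda> * P0 / (2 * d))"
proof (rule tendsto_le[OF sequentially_bot])
  let ?a = "\<lambda>D. cip (tr t D) (an1 (tr t D))" and ?m = "\<lambda>D. Re (cip (tr t D) (dg1 nh (tr t D)))"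
  let ?w' = "\<lambda>D. mf_dot J v (?a D) (fc (tr t D))"
  have w': "(\<lambda>D. ?w' D n) \<longlonglongrightarrow> dc t n" for n
    unfolding mf_dot_def dc_mf_dot by (intro tendsto_intros tr_lim tr_an_lim)
  show "(\<lambda>D. \<Sum>x\<in>\<Lambda>. dFF M x (fc (tr t D)) (?w' D) (?m D) (fc (Ps t)) (fc (- \<i> *\<^sub>F HF (Ps t)))) \<longlonglongrightarrow> dG t"
    unfolding dG_def by (intro tendsto_sum dFF_tendsto tr_lim w' tr_mass_lim)
  show "(\<lambda>D. \<bar>J\<bar> * norm (dg1 nh (tr t D)) ^ 3 * (106 * (\<Sum>x\<in>\<Lambda>. FF M x (fc (tr t D)) (?m D) (fc (Ps t))) + 16 * card \<Lambda> * P0 / (2 * d)))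
      \<longlonglongrightarrow> \<bar>J\<bar> * sqrt (mom2 t) ^ 3 * (106 * G t + 16 * card \<Lambda> * P0 / (2 * d))"
    unfolding G_def by (intro tendsto_intros tendsto_sum FF_tendsto tr_lim tr_mass_lim tr_mom2_lim)
  show "eventually (\<lambda>D. (\<Sum>x\<in>\<Lambda>. dFF M x (fc (tr t D)) (?w' D) (?m D) (fc (Ps t)) (fc (- \<i> *\<^sub>F HF (Ps t))))
     \<le> \<bar>J\<bar> * norm (dg1 nh (tr t D)) ^ 3 * (106 * (\<Sum>x\<in>\<Lambda>. FF M x (fc (tr t D)) (?m D) (fc (Ps t))) + 16 * card \<Lambda> * P0 / (2 * d))) sequentially"
    using rho_pos[of t]
  proof eventually_elim
    case (elim D)
    interpret fpe: finite_path_estimate J \<mu> U d L M "tr t D" "Ps t"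
      by unfold_locales (use norm_tr[OF elim] Ps_supp in auto)
    show ?case using fpe.dFF_sum_le by (simp only: fpe.h1_mf_dot norm_Ps)
  qed
qed

text \<open>Completing the square: the three terms are the weighted square norm of a slice minus its
  component along \<phi>. In this form nonnegativity is visible although \<phi> may have infinite
  support.\<close>

lemma FF_sums:
  assumes supp: "\<And>s. s \<notin> SM M \<Longrightarrow> \<Phi> s = 0"
  shows "(\<lambda>n. (real n + 1) * (cmod (\<Phi> (r(x := n)) - KK M x (c t) \<Phi> r * c t n))\<^sup>2) sums
    ((\<Sum>n\<le>M. (real n + 1) * (cmod (\<Phi> (r(x := n))))\<^sup>2)
     - 2 * Re (cnj (KK M x (c t) \<Phi> r) * KK M x (nw (c t)) \<Phi> r) + mass 0 * (cmod (KK M x (c t) \<Phi> r))\<^sup>2)"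
proof -
  define f where "f = KK M x (c t) \<Phi> r"
  define \<xi> where "\<xi> n = \<Phi> (r(x := n))" for n
  have z: "\<xi> n = 0" if "n > M" for n
    unfolding \<xi>_def by (rule supp) (use SM_le[of "r(x := n)" M x] that in auto)
  have e: "(real n + 1) * (cmod (\<xi> n - f * c t n))\<^sup>2 =
     ((real n + 1) * (cmod (\<xi> n))\<^sup>2 - 2 * Re (cnj f * (cnj (nw (c t) n) * \<xi> n))) + (cmod f)\<^sup>2 * ((real n + 1) * (cmod (c t n))\<^sup>2)" for n
  proof -
    have "(cmod (\<xi> n - f * c t n))\<^sup>2 = (cmod (\<xi> n))\<^sup>2 - 2 * Re (cnj (f * c t n) * \<xi> n) + (cmod (f * c t n))\<^sup>2"
      unfolding cmod_power2 by (simp add: power2_eq_square algebra_simps)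
    moreover have "cnj f * (cnj (nw (c t) n) * \<xi> n) = complex_of_real (real n + 1) * (cnj (f * c t n) * \<xi> n)"
      by (simp add: nw_def algebra_simps)
    then have "Re (cnj f * (cnj (nw (c t) n) * \<xi> n)) = (real n + 1) * Re (cnj (f * c t n) * \<xi> n)"
      by (simp only: mult.assoc times_complex.sel Re_complex_of_real Im_complex_of_real mult_zero_left diff_zero)
    ultimately show ?thesis by (simp only: norm_mult power_mult_distrib) (simp only: algebra_simps)
  qed
  have 1: "(\<lambda>n. (real n + 1) * (cmod (\<xi> n))\<^sup>2) sums (\<Sum>n\<le>M. (real n + 1) * (cmod (\<xi> n))\<^sup>2)"
    by (rule sums_finite) (use z in auto)
  have "(\<lambda>n. 2 * Re (cnj f * (cnj (nw (c t) n) * \<xi> n))) sums (\<Sum>n\<le>M. 2 * Re (cnj f * (cnj (nw (c t) n) * \<xi> n)))"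
    by (rule sums_finite) (use z in auto)
  also have "(\<Sum>n\<le>M. 2 * Re (cnj f * (cnj (nw (c t) n) * \<xi> n))) = 2 * Re (cnj f * KK M x (nw (c t)) \<Phi> r)"
    by (simp only: KK_def \<xi>_def sum_distrib_left Re_sum)
  finally have 2: "(\<lambda>n. 2 * Re (cnj f * (cnj (nw (c t) n) * \<xi> n))) sums (2 * Re (cnj f * KK M x (nw (c t)) \<Phi> r))" .
  have 3: "(\<lambda>n. (cmod f)\<^sup>2 * ((real n + 1) * (cmod (c t n))\<^sup>2)) sums ((cmod f)\<^sup>2 * mass 0)"
    unfolding mass_const[of t, symmetric] by (rule sums_mult[OF mass_sums])
  show ?thesis
    using sums_add[OF sums_diff[OF 1 2] 3] unfolding e[symmetric] by (simp add: f_def \<xi>_def mult.commute)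
qed

lemma FF_nonneg: "(\<And>s. s \<notin> SM M \<Longrightarrow> \<Phi> s = 0) \<Longrightarrow> FF M x (c t) (mass 0) \<Phi> \<ge> 0"
proof -
  assume supp: "\<And>s. s \<notin> SM M \<Longrightarrow> \<Phi> s = 0"
  show ?thesis
  proof (subst FF_slices)
    show "\<Phi> s = 0" if "s \<notin> SM M" for s using supp[OF that] .
    show "0 \<le> (\<Sum>r\<in>slices M x. (\<Sum>n\<le>M. (real n + 1) * (cmod (\<Phi> (r(x := n))))\<^sup>2)
     - 2 * Re (cnj (KK M x (c t) \<Phi> r) * KK M x (nw (c t)) \<Phi> r) + mass 0 * (cmod (KK M x (c t) \<Phi> r))\<^sup>2)"
    proof (rule sum_nonneg)
      fix r
      show "0 \<le> (\<Sum>n\<le>M. (real n + 1) * (cmod (\<Phi> (r(x := n))))\<^sup>2)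
     - 2 * Re (cnj (KK M x (c t) \<Phi> r) * KK M x (nw (c t)) \<Phi> r) + mass 0 * (cmod (KK M x (c t) \<Phi> r))\<^sup>2"
        by (rule sums_le[OF _ sums_zero FF_sums]) (auto intro: supp)
    qed
  qed
qed

theorem gronwall:
  assumes t: "t \<ge> 0" and A: "A \<ge> 0" "\<And>s. s \<ge> 0 \<Longrightarrow> sqrt (mom2 s) \<le> A * (1 + s)"
  shows "G t + card \<Lambda> * P0 / d \<le> (G 0 + card \<Lambda> * P0 / d) * exp (27 * \<bar>J\<bar> * A ^ 3 * (1 + t) ^ 4)"
proof -
  define \<kappa> where "\<kappa> = card \<Lambda> * P0 / d"
  have P0: "P0 \<ge> 0" by (simp add: P0_def sum_nonneg)
  have k: "\<kappa> \<ge> 0" unfolding \<kappa>_def using P0 by simp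
  \<comment> \<open>The inhomogeneous term is \<open>8 \<kappa>\<close>, so 108 serves for
    \<open>G + \<kappa>\<close> and makes the inequality homogeneous; rounding 106 up to 108 gives
    the primitive \<open>27 (1 + s)^4\<close>.\<close>
  define a where "a s = 108 * \<bar>J\<bar> * A ^ 3 * (1 + s) ^ 3" for s
  define b where "b s = 27 * \<bar>J\<bar> * A ^ 3 * (1 + s) ^ 4" for s :: real
  have G0: "G s \<ge> 0" for s unfolding G_def by (intro sum_nonneg FF_nonneg Ps_supp)
  have le: "dG s \<le> a s * (G s + \<kappa>)" if "s \<ge> 0" for s
  proof -
    have m: "0 \<le> mom2 s" by (rule order_trans[OF zero_le_one mom2_ge(1)])
    have "dG s \<le> \<bar>J\<bar> * sqrt (mom2 s) ^ 3 * (106 * G s + 16 * card \<Lambda> * P0 / (2 * d))" by (rule dG_le)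
    also have "\<dots> \<le> \<bar>J\<bar> * (A * (1 + s)) ^ 3 * (108 * (G s + \<kappa>))"
    proof (intro mult_mono mult_left_mono power_mono A that)
      have "16 * card \<Lambda> * P0 / (2 * d) = 8 * \<kappa>" unfolding \<kappa>_def by simp
      then show "106 * G s + 16 * card \<Lambda> * P0 / (2 * d) \<le> 108 * (G s + \<kappa>)" using G0[of s] k by simp
      show "0 \<le> 106 * G s + 16 * card \<Lambda> * P0 / (2 * d)" using G0[of s] P0 by simp
      show "0 \<le> sqrt (mom2 s)" by (rule real_sqrt_ge_zero[OF order_trans[OF zero_le_one mom2_ge(1)]])
    qed (use A that m in auto)
    also have "\<dots> = a s * (G s + \<kappa>)" by (simp add: a_def power_mult_distrib)
    finally show ?thesis .
  qed
  have bder: "(b has_real_derivative a s) (at s)" for s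
    unfolding b_def[abs_def] a_def by (auto intro!: derivative_eq_intros)
  define h where "h s = (G s + \<kappa>) * exp (- b s)" for s
  have hder: "(h has_real_derivative (dG s - a s * (G s + \<kappa>)) * exp (- b s)) (at s)" for s
    unfolding h_def[abs_def] by (auto intro!: derivative_eq_intros G_deriv bder simp: algebra_simps)
  have "h t \<le> h 0"
  proof (rule DERIV_nonpos_imp_nonincreasing[OF t])
    fix s assume "0 \<le> s" "s \<le> t"
    then have "(dG s - a s * (G s + \<kappa>)) * exp (- b s) \<le> 0"
      using le[of s] by (intro mult_nonpos_nonneg) auto
    with hder[of s] show "\<exists>y. (h has_real_derivative y) (at s) \<and> y \<le> 0" by blast
  qed
  then have "(G t + \<kappa>) * exp (- b t) \<le> (G 0 + \<kappa>) * exp (- b 0)" by (simp add: h_def)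
  also have "\<dots> \<le> (G 0 + \<kappa>) * 1"
    using A G0[of 0] k by (intro mult_left_mono) (auto simp: b_def)
  finally have "(G t + \<kappa>) * exp (- b t) * exp (b t) \<le> (G 0 + \<kappa>) * exp (b t)" by (intro mult_right_mono) auto
  then show ?thesis by (simp add: mult.assoc exp_minus b_def \<kappa>_def)
qed

end

section \<open>Reduced density matrices as sums of rank-one operators\<close>

lemma infsum_Sigma_ennreal:
  fixes f :: "'a \<Rightarrow> 'b \<Rightarrow> ennreal"
  shows "infsum (\<lambda>x. infsum (f x) (B x)) A = infsum (\<lambda>(x, y). f x y) (Sigma A B)"
proof -
  have "infsum (\<lambda>x. infsum (f x) (B x)) A = infsum (\<lambda>x. infsum (\<lambda>y. if y \<in> B x then f x y else 0) UNIV) A"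
    by (intro infsum_cong infsum_cong_neutral) auto
  also have "\<dots> = infsum (\<lambda>(x, y). f x y) (Sigma A B)"
    unfolding infsum_Times_ennreal by (rule infsum_cong_neutral) (auto split: if_splits)
  finally show ?thesis .
qed

text \<open>The sum of the rank-one operators of the vectors \<open>\<xi> k\<close>. For
  square-summable norms it converges absolutely at every \<open>z\<close> and is positive.\<close>

definition gram :: "'k set \<Rightarrow> ('k \<Rightarrow> 'i ell2) \<Rightarrow> 'i ell2 \<Rightarrow> 'i ell2" where
  "gram K \<xi> z = (\<Sum>\<^sub>\<infinity>k\<in>K. cinner (\<xi> k) z *\<^sub>C \<xi> k)"

lemma bounded_linear_cscale: "bounded_linear (\<lambda>\<psi> :: 'i ell2. a *\<^sub>C \<psi>)"
  by (rule bounded_linear_intro[of _ "cmod a"])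
     (auto intro!: ell2_eqI simp: coord_simps algebra_simps norm_cscale)

context
  fixes K :: "'k set" and \<xi> :: "'k \<Rightarrow> 'i ell2"
  assumes s: "(\<lambda>k. (norm (\<xi> k))\<^sup>2) summable_on K"
begin

lemma gram_term_le: "norm (cinner (\<xi> k) z *\<^sub>C \<xi> k) \<le> norm z * (norm (\<xi> k))\<^sup>2"
proof -
  have "norm (cinner (\<xi> k) z *\<^sub>C \<xi> k) \<le> (norm (\<xi> k) * norm z) * norm (\<xi> k)"
    unfolding norm_cscale by (intro mult_right_mono cmod_cinner_le) auto
  then show ?thesis by (simp add: power2_eq_square mult_ac)
qed

lemma gram_abs_summable: "(\<lambda>k. norm (cinner (\<xi> k) z *\<^sub>C \<xi> k)) summable_on K"
  by (rule summable_on_comparison_test[OF summable_on_cmult_right[OF s, of "norm z"]]) (auto intro: gram_term_le)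

lemma gram_summable: "(\<lambda>k. cinner (\<xi> k) z *\<^sub>C \<xi> k) summable_on K"
  by (rule abs_summable_summable[OF gram_abs_summable])

lemma bounded_clinear_gram: "bounded_clinear (gram K \<xi>)"
proof (rule bounded_clinearI)
  fix z y :: "'i ell2" and a
  have "cinner (\<xi> k) (z + y) *\<^sub>C \<xi> k = cinner (\<xi> k) z *\<^sub>C \<xi> k + cinner (\<xi> k) y *\<^sub>C \<xi> k" for k
    by (rule ell2_eqI) (simp add: coord_simps cinner_add_right algebra_simps)
  then show "gram K \<xi> (z + y) = gram K \<xi> z + gram K \<xi> y"
    unfolding gram_def by (simp add: infsum_add gram_summable)
  have "cinner (\<xi> k) (a *\<^sub>C z) *\<^sub>C \<xi> k = a *\<^sub>C (cinner (\<xi> k) z *\<^sub>C \<xi> k)" for k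
    by (rule ell2_eqI) (simp add: coord_simps cinner_scale_right)
  then show "gram K \<xi> (a *\<^sub>C z) = a *\<^sub>C gram K \<xi> z"
    unfolding gram_def by (simp add: infsum_bounded_linear'[OF bounded_linear_cscale gram_summable])
  have "norm (gram K \<xi> z) \<le> (\<Sum>\<^sub>\<infinity>k\<in>K. norm (cinner (\<xi> k) z *\<^sub>C \<xi> k))"
    unfolding gram_def by (rule norm_infsum_bound[OF gram_abs_summable])
  also have "\<dots> \<le> (\<Sum>\<^sub>\<infinity>k\<in>K. norm z * (norm (\<xi> k))\<^sup>2)"
    by (rule infsum_mono[OF gram_abs_summable summable_on_cmult_right[OF s] gram_term_le])
  also have "\<dots> = (\<Sum>\<^sub>\<infinity>k\<in>K. (norm (\<xi> k))\<^sup>2) * norm z" by (simp add: infsum_cmult_right' mult.commute)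
  finally show "norm (gram K \<xi> z) \<le> (\<Sum>\<^sub>\<infinity>k\<in>K. (norm (\<xi> k))\<^sup>2) * norm z" .
qed

lemma cinner_gram: "cinner y (gram K \<xi> z) = (\<Sum>\<^sub>\<infinity>k\<in>K. cinner (\<xi> k) z * cinner y (\<xi> k))"
  unfolding gram_def using infsum_bounded_linear'[OF bounded_linear_cinner gram_summable, of y z]
  by (simp add: cinner_scale_right)

lemma gram_form:
  "(\<lambda>k. (cmod (cinner (\<xi> k) z))\<^sup>2) summable_on K"
  "cinner z (gram K \<xi> z) = complex_of_real (\<Sum>\<^sub>\<infinity>k\<in>K. (cmod (cinner (\<xi> k) z))\<^sup>2)"
proof -
  have le: "(cmod (cinner (\<xi> k) z))\<^sup>2 \<le> (norm z)\<^sup>2 * (norm (\<xi> k))\<^sup>2" for k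
    using power_mono[OF cmod_cinner_le[of "\<xi> k" z], of 2] by (simp add: power_mult_distrib mult.commute)
  show sm: "(\<lambda>k. (cmod (cinner (\<xi> k) z))\<^sup>2) summable_on K"
    by (rule summable_on_comparison_test[OF summable_on_cmult_right[OF s, of "(norm z)\<^sup>2"]]) (auto intro: le)
  have "cinner (\<xi> k) z * cinner z (\<xi> k) = complex_of_real ((cmod (cinner (\<xi> k) z))\<^sup>2)" for k
    using cinner_cnj[of z "\<xi> k"] by (simp only: complex_norm_square)
  then show "cinner z (gram K \<xi> z) = complex_of_real (\<Sum>\<^sub>\<infinity>k\<in>K. (cmod (cinner (\<xi> k) z))\<^sup>2)"
    unfolding cinner_gram by (simp only: infsum_bounded_linear'[OF bounded_linear_of_real sm])
qed

lemma ennreal_gram_form: "ennreal (Re (cinner z (gram K \<xi> z))) = (\<Sum>\<^sub>\<infinity>k\<in>K. ennreal ((cmod (cinner (\<xi> k) z))\<^sup>2))"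
  by (simp add: gram_form(2) ennreal_infsum[OF gram_form(1)])

lemma positive_op_gram: "positive_op (gram K \<xi>)"
  by (rule positive_opI[OF bounded_clinear_gram gram_form(2)]) (simp add: infsum_nonneg)

text \<open>Interchanging the basis sum with the sum over \<open>k\<close> turns a trace of
  \<open>Q G Q\<close> against a diagonal weight into a sum of quadratic forms of the single
  vectors.\<close>

lemma gram_weighted:
  fixes w :: "'i \<Rightarrow> ennreal"
  assumes Q: "\<And>x y. cinner x (Q y) = cinner (Q x) y"
  shows "(\<Sum>\<^sub>\<infinity>n. w n * ennreal (Re (cinner (Q (ket n)) (gram K \<xi> (Q (ket n)))))) =
    (\<Sum>\<^sub>\<infinity>k\<in>K. \<Sum>\<^sub>\<infinity>n. w n * ennreal ((cmod (coord (Q (\<xi> k)) n))\<^sup>2))"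
proof -
  have "cmod (cinner (\<xi> k) (Q (ket n))) = cmod (coord (Q (\<xi> k)) n)" for k n
    by (simp add: Q cinner_ket_right)
  then show ?thesis
    unfolding ennreal_gram_form infsum_cmult_ennreal[symmetric] by (subst infsum_swap_ennreal) simp
qed

end

text \<open>The root in \<open>trace_form\<close> is symmetric, so it can be moved to the basis
  vectors and squared there. Together with \<open>gram_weighted\<close> this expresses the initial
  quantity through pure states.\<close>

lemma trace_form_weighted:
  fixes w :: "'i \<Rightarrow> ennreal"
  assumes G: "positive_op G" and Q: "\<And>x y. cinner x (Q y) = cinner (Q x) y"
  shows "trace_form G (\<lambda>\<psi>. \<Sum>\<^sub>\<infinity>n. w n * ennreal ((cmod (coord (Q \<psi>) n))\<^sup>2)) =
    (\<Sum>\<^sub>\<infinity>n. w n * ennreal (Re (cinner (Q (ket n)) (G (Q (ket n))))))"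
proof -
  have "coord (Q (sqrt_op G (ket i))) n = cinner (sqrt_op G (Q (ket n))) (ket i)" for i n
    by (simp only: cinner_ket_left[symmetric] Q symmetric_opD[OF positive_op_symmetric[OF positive_sqrt_op[OF G]]])
  then have "trace_form G (\<lambda>\<psi>. \<Sum>\<^sub>\<infinity>n. w n * ennreal ((cmod (coord (Q \<psi>) n))\<^sup>2)) =
     (\<Sum>\<^sub>\<infinity>n. \<Sum>\<^sub>\<infinity>i. w n * ennreal ((cmod (cinner (sqrt_op G (Q (ket n))) (ket i)))\<^sup>2))"
    unfolding trace_form_def by (subst infsum_swap_ennreal) simp
  then show ?thesis
    by (simp only: infsum_cmult_ennreal infsum_coord_cnj norm_sqrt_op[OF G])
qed

lemma num_form_eq: "num_form k \<psi> = (\<Sum>\<^sub>\<infinity>n. ennreal (real n ^ k * (cmod (coord \<psi> n))\<^sup>2))"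
proof -
  have "cnj (coord \<psi> n) * (num ^^ k) (coord \<psi>) n = complex_of_real (real n ^ k * (cmod (coord \<psi> n))\<^sup>2)" for n
    by (simp only: num_funpow of_real_mult complex_norm_square) simp
  then show ?thesis by (simp only: num_form_def Re_complex_of_real)
qed

lemma qNNq_form_eq:
  assumes "norm \<phi> = 1"
  shows "qNNq_plus_q_form \<phi> = (\<lambda>\<psi>. \<Sum>\<^sub>\<infinity>n. ennreal ((real n)\<^sup>2 + 1) * ennreal ((cmod (coord (coproj \<phi> \<psi>) n))\<^sup>2))"
proof
  fix \<psi>
  have "ennreal (Re (cinner \<psi> (coproj \<phi> \<psi>))) = (\<Sum>\<^sub>\<infinity>n. ennreal ((cmod (coord (coproj \<phi> \<psi>) n))\<^sup>2))"
    by (simp add: coproj_form[OF assms] ennreal_norm_eq del: of_real_power)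
  then show "qNNq_plus_q_form \<phi> \<psi> = (\<Sum>\<^sub>\<infinity>n. ennreal ((real n)\<^sup>2 + 1) * ennreal ((cmod (coord (coproj \<phi> \<psi>) n))\<^sup>2))"
    unfolding qNNq_plus_q_form_def num_form_eq
    by (simp add: infsum_add_ennreal[symmetric] ennreal_mult' distrib_right)
qed

section \<open>Slices of a Fock vector and the partial trace\<close>

lemma coord_extract: "coord (extract_site x r \<psi>) n = coord \<psi> (r(x := n))"
  by (simp add: extract_site.rep_eq)

lemma slice_infsum:
  fixes f :: "config \<Rightarrow> ennreal"
  assumes x: "x \<in> S"
  shows "(\<Sum>\<^sub>\<infinity>s\<in>configs S. f s) = (\<Sum>\<^sub>\<infinity>r\<in>configs (S - {x}). \<Sum>\<^sub>\<infinity>n. f (r(x := n)))"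
proof -
  have "bij_betw (\<lambda>(r, n). r(x := n)) (configs (S - {x}) \<times> UNIV) (configs S)"
    by (rule bij_betw_byWitness[where f' = "\<lambda>s. (s(x := 0), s x)"]) (use x in \<open>auto simp: configs_def fun_upd_idem_iff\<close>)
  from infsum_reindex_bij_betw[OF this, of f] show ?thesis
    unfolding infsum_Times_ennreal by (simp add: case_prod_unfold)
qed

lemma norm_fock_infsum: "\<psi> \<in> fock S \<Longrightarrow> ennreal ((norm \<psi>)\<^sup>2) = (\<Sum>\<^sub>\<infinity>s\<in>configs S. ennreal ((cmod (coord \<psi> s))\<^sup>2))"
  unfolding ennreal_norm_eq by (rule infsum_cong_neutral) (auto simp: fock_def)

lemma extract_norm_sum:
  assumes "x \<in> S" "\<psi> \<in> fock S"
  shows "(\<Sum>\<^sub>\<infinity>r\<in>configs (S - {x}). ennreal ((norm (extract_site x r \<psi>))\<^sup>2)) = ennreal ((norm \<psi>)\<^sup>2)"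
  unfolding norm_fock_infsum[OF assms(2)] slice_infsum[OF assms(1)] by (simp add: ennreal_norm_eq coord_extract)

lemma bounded_linear_extract: "bounded_linear (extract_site x r)"
proof (rule bounded_linear_intro[of _ 1])
  fix \<psi>
  have inj: "inj (\<lambda>n. r(x := n))" by (rule injI) (metis fun_upd_same)
  have "ennreal ((norm (extract_site x r \<psi>))\<^sup>2) = (\<Sum>\<^sub>\<infinity>s\<in>range (\<lambda>n. r(x := n)). ennreal ((cmod (coord \<psi> s))\<^sup>2))"
    unfolding ennreal_norm_eq coord_extract by (subst infsum_reindex[OF inj]) (simp add: o_def)
  also have "\<dots> \<le> ennreal ((norm \<psi>)\<^sup>2)"
    unfolding ennreal_norm_eq by (rule infsum_mono_neutral) (auto intro: summable_on_ennreal_UNIV)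
  finally have "(norm (extract_site x r \<psi>))\<^sup>2 \<le> (norm \<psi>)\<^sup>2" by simp
  then show "norm (extract_site x r \<psi>) \<le> norm \<psi> * 1" by (simp add: power2_le_iff_abs_le)
qed (auto intro!: ell2_eqI simp: coord_extract coord_add coord_simps)

lemma cinner_insert: "cinner (insert_site x r z) \<psi> = cinner z (extract_site x r \<psi>)"
proof -
  have inj: "inj (\<lambda>n. r(x := n))" by (rule injI) (metis fun_upd_same)
  have "cinner (insert_site x r z) \<psi> = (\<Sum>\<^sub>\<infinity>s\<in>range (\<lambda>n. r(x := n)). cnj (coord z (s x)) * coord \<psi> s)"
    unfolding cinner_def
  proof (rule infsum_cong_neutral)
    fix s assume "s \<in> UNIV - range (\<lambda>n. r(x := n))"
    then have "s \<noteq> r(x := s x)" by blast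
    then show "cnj (coord (insert_site x r z) s) * coord \<psi> s = 0" by (simp add: insert_site.rep_eq)
  next
    fix s assume "s \<in> UNIV \<inter> range (\<lambda>n. r(x := n))"
    then have "s = r(x := s x)" by auto
    then show "cnj (coord (insert_site x r z) s) * coord \<psi> s = cnj (coord z (s x)) * coord \<psi> s"
      by (simp add: insert_site.rep_eq)
  qed auto
  also have "\<dots> = cinner z (extract_site x r \<psi>)"
    unfolding cinner_def coord_extract by (subst infsum_reindex[OF inj]) (simp add: o_def)
  finally show ?thesis .
qed

lemma insert_fock: "x \<in> S \<Longrightarrow> r \<in> configs (S - {x}) \<Longrightarrow> insert_site x r z \<in> fock S"
proof -
  assume x: "x \<in> S" and r: "r \<in> configs (S - {x})"
  have "coord (insert_site x r z) c = 0" if "c \<notin> configs S" for c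
  proof -
    have "r(x := n) \<in> configs S" for n using x r by (simp add: configs_def)
    with that have "c \<noteq> r(x := c x)" by metis
    then show ?thesis by (simp add: insert_site.rep_eq)
  qed
  then show ?thesis by (simp add: fock_def)
qed

text \<open>Labels made of a site, the occupations of the other sites and a member of the family.
  The rank-one operators with these labels add up to the number of sites times the reduced density
  matrix.\<close>

definition cells :: "site set \<Rightarrow> (site \<times> config \<times> 'k) set" where
  "cells S = (SIGMA x:S. configs (S - {x}) \<times> UNIV)"

lemma infsum_cells:
  fixes f :: "site \<times> config \<times> 'k \<Rightarrow> ennreal"
  assumes "finite S"
  shows "(\<Sum>\<^sub>\<infinity>k\<in>cells S. f k) = (\<Sum>x\<in>S. \<Sum>\<^sub>\<infinity>i. \<Sum>\<^sub>\<infinity>r\<in>configs (S - {x}). f (x, r, i))"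
proof -
  have "(\<Sum>\<^sub>\<infinity>k\<in>cells S. f k) = (\<Sum>\<^sub>\<infinity>x\<in>S. \<Sum>\<^sub>\<infinity>(r, i)\<in>configs (S - {x}) \<times> UNIV. f (x, r, i))"
    unfolding cells_def infsum_Sigma_ennreal by (simp add: case_prod_unfold)
  also have "\<dots> = (\<Sum>x\<in>S. \<Sum>\<^sub>\<infinity>(r, i)\<in>configs (S - {x}) \<times> UNIV. f (x, r, i))" using assms by simp
  also have "(\<lambda>x. \<Sum>\<^sub>\<infinity>(r, i)\<in>configs (S - {x}) \<times> UNIV. f (x, r, i)) = (\<lambda>x. \<Sum>\<^sub>\<infinity>i. \<Sum>\<^sub>\<infinity>r\<in>configs (S - {x}). f (x, r, i))"
    unfolding infsum_Times_ennreal[symmetric] by (subst infsum_swap_ennreal) (rule refl)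
  finally show ?thesis .
qed

abbreviation slice :: "('k \<Rightarrow> config ell2) \<Rightarrow> site \<times> config \<times> 'k \<Rightarrow> nat ell2" where
  "slice \<eta> \<equiv> \<lambda>(x, r, i). extract_site x r (\<eta> i)"

lemma slice_norm_sum:
  assumes "finite S" "\<And>i. \<eta> i \<in> fock S"
  shows "(\<Sum>\<^sub>\<infinity>k\<in>cells S. ennreal ((norm (slice \<eta> k))\<^sup>2)) = of_nat (card S) * (\<Sum>\<^sub>\<infinity>i. ennreal ((norm (\<eta> i))\<^sup>2))"
  unfolding infsum_cells[OF assms(1)] by (simp add: extract_norm_sum assms(2))

lemma slice_summable:
  assumes "finite S" "\<And>i. \<eta> i \<in> fock S" "(\<Sum>\<^sub>\<infinity>i. ennreal ((norm (\<eta> i))\<^sup>2)) < \<infinity>"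
  shows "(\<lambda>k. (norm (slice \<eta> k))\<^sup>2) summable_on cells S"
  unfolding summable_on_iff_ennreal[OF zero_le_power2] slice_norm_sum[OF assms(1,2)]
  using assms(3) by (simp add: ennreal_mult_less_top of_nat_less_top)

text \<open>Since \<open>extract_site\<close> is adjoint to \<open>insert_site\<close>, each partial
  trace of a rank-one operator is the sum of the rank-one operators of its slices. Knowing
  \<open>A\<close> on \<open>fock\<close> suffices, because inserted vectors lie there.\<close>

lemma reduced_density_gram:
  fixes \<eta> :: "'k \<Rightarrow> config ell2"
  assumes fock: "\<And>i. \<eta> i \<in> fock (lattice d L)"
    and fin: "(\<Sum>\<^sub>\<infinity>i. ennreal ((norm (\<eta> i))\<^sup>2)) < \<infinity>"
    and A: "\<And>Y. Y \<in> fock (lattice d L) \<Longrightarrow> A Y = gram UNIV \<eta> Y"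
  shows "reduced_density d L A = (\<lambda>z. (1 / real (card (lattice d L))) *\<^sub>R gram (cells (lattice d L)) (slice \<eta>) z)"
proof
  fix z
  let ?S = "lattice d L"
  have s: "(\<lambda>i. (norm (\<eta> i))\<^sup>2) summable_on UNIV"
    unfolding summable_on_iff_ennreal[OF zero_le_power2] by (rule fin)
  define f where "f k = cinner (slice \<eta> k) z *\<^sub>C slice \<eta> k" for k
  have sm: "f summable_on cells ?S"
    unfolding f_def[abs_def] by (rule gram_summable[OF slice_summable[OF finite_lattice fock fin]])
  have smx: "(\<lambda>p. f (x, p)) summable_on (configs (?S - {x}) \<times> UNIV)" if "x \<in> ?S" for x
  proof -
    have "f summable_on Pair x ` (configs (?S - {x}) \<times> UNIV)"
      by (rule summable_on_subset_banach[OF sm]) (use that in \<open>auto simp: cells_def\<close>)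
    then show ?thesis by (subst (asm) summable_on_reindex) (auto simp: inj_on_def o_def)
  qed
  have "gram (cells ?S) (slice \<eta>) z = infsum f (cells ?S)" unfolding gram_def f_def[abs_def] ..
  also have "\<dots> = (\<Sum>\<^sub>\<infinity>x\<in>?S. infsum (\<lambda>p. f (x, p)) (configs (?S - {x}) \<times> UNIV))"
    unfolding cells_def using sm by (intro infsum_Sigma_banach[symmetric]) (simp add: cells_def)
  also have "\<dots> = (\<Sum>x\<in>?S. infsum (\<lambda>p. f (x, p)) (configs (?S - {x}) \<times> UNIV))"
    by (simp add: finite_lattice)
  also have "\<dots> = (\<Sum>x\<in>?S. partial_trace ?S x A z)"
  proof (rule sum.cong[OF refl])
    fix x assume x: "x \<in> ?S"
    have "infsum (\<lambda>p. f (x, p)) (configs (?S - {x}) \<times> UNIV) = (\<Sum>\<^sub>\<infinity>r\<in>configs (?S - {x}). \<Sum>\<^sub>\<infinity>i. f (x, r, i))"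
      using infsum_Sigma_banach[OF smx[OF x]] by simp
    also have "\<dots> = partial_trace ?S x A z"
      unfolding partial_trace_def
    proof (rule infsum_cong)
      fix r assume r: "r \<in> configs (?S - {x})"
      have "extract_site x r (A (insert_site x r z)) = extract_site x r (gram UNIV \<eta> (insert_site x r z))"
        by (simp add: A insert_fock[OF x r])
      also have "\<dots> = (\<Sum>\<^sub>\<infinity>i. extract_site x r (cinner (\<eta> i) (insert_site x r z) *\<^sub>C \<eta> i))"
        unfolding gram_def by (rule infsum_bounded_linear'[OF bounded_linear_extract gram_summable[OF s], symmetric])
      also have "\<dots> = (\<Sum>\<^sub>\<infinity>i. f (x, r, i))"
      proof (rule infsum_cong)
        fix i
        have "cinner (\<eta> i) (insert_site x r z) = cinner (extract_site x r (\<eta> i)) z"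
          using cinner_insert[of x r z "\<eta> i"] cinner_cnj[of "\<eta> i"] cinner_cnj[of "extract_site x r (\<eta> i)" z] by simp
        then show "extract_site x r (cinner (\<eta> i) (insert_site x r z) *\<^sub>C \<eta> i) = f (x, r, i)"
          by (auto intro!: ell2_eqI simp: f_def coord_extract coord_simps)
      qed
      finally show "(\<Sum>\<^sub>\<infinity>i. f (x, r, i)) = extract_site x r (A (insert_site x r z))" by simp
    qed
    finally show "infsum (\<lambda>p. f (x, p)) (configs (?S - {x}) \<times> UNIV) = partial_trace ?S x A z" .
  qed
  finally show "reduced_density d L A z = (1 / real (card ?S)) *\<^sub>R gram (cells ?S) (slice \<eta>) z"
    by (simp add: reduced_density_def)
qed

section \<open>Evolution of mixed states and comparison with the mean-field state\<close>

text \<open>A substitute for the spectral decomposition: inserting the resolution of the identity by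
  kets between the two roots of \<gamma> gives a sum of rank-one operators, whose vectors are in
  general not orthogonal.\<close>

lemma sqrt_op_gram:
  assumes pos: "positive_op \<gamma>" and tr: "trace_pos \<gamma> < \<infinity>"
  shows "(\<Sum>\<^sub>\<infinity>i. ennreal ((norm (sqrt_op \<gamma> (ket i)))\<^sup>2)) = trace_pos \<gamma>"
    and "\<gamma> = gram UNIV (\<lambda>i. sqrt_op \<gamma> (ket i))"
proof -
  show 1: "(\<Sum>\<^sub>\<infinity>i. ennreal ((norm (sqrt_op \<gamma> (ket i)))\<^sup>2)) = trace_pos \<gamma>"
    by (simp add: norm_sqrt_op[OF pos] trace_pos_def)
  have s: "(\<lambda>i. (norm (sqrt_op \<gamma> (ket i)))\<^sup>2) summable_on UNIV"
    unfolding summable_on_iff_ennreal[OF zero_le_power2] 1 by (rule tr)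
  note sym = symmetric_opD[OF positive_op_symmetric[OF positive_sqrt_op[OF pos]]]
  show "\<gamma> = gram UNIV (\<lambda>i. sqrt_op \<gamma> (ket i))"
  proof
    fix z show "\<gamma> z = gram UNIV (\<lambda>i. sqrt_op \<gamma> (ket i)) z"
    proof (rule cinner_eqI)
      fix y
      have "cinner y (\<gamma> z) = cinner (sqrt_op \<gamma> y) (sqrt_op \<gamma> z)"
        by (simp only: sqrt_op_square[OF pos, of z, symmetric] sym)
      also have "\<dots> = (\<Sum>\<^sub>\<infinity>i. cinner (sqrt_op \<gamma> (ket i)) z * cinner y (sqrt_op \<gamma> (ket i)))"
        unfolding cinner_def[of "sqrt_op \<gamma> y"]
      proof (rule infsum_cong)
        fix i
        have "cinner (sqrt_op \<gamma> (ket i)) z = coord (sqrt_op \<gamma> z) i" by (simp only: sym[symmetric] cinner_ket_left)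
        moreover have "cinner y (sqrt_op \<gamma> (ket i)) = cnj (coord (sqrt_op \<gamma> y) i)" by (simp only: sym cinner_ket_right)
        ultimately show "cnj (coord (sqrt_op \<gamma> y) i) * coord (sqrt_op \<gamma> z) i
            = cinner (sqrt_op \<gamma> (ket i)) z * cinner y (sqrt_op \<gamma> (ket i))" by simp
      qed
      finally show "cinner y (\<gamma> z) = cinner y (gram UNIV (\<lambda>i. sqrt_op \<gamma> (ket i)) z)"
        by (simp only: cinner_gram[OF s])
    qed
  qed
qed

text \<open>A ket outside the configurations has vanishing expectation in \<gamma>, so the root
  annihilates it; symmetry of the root turns this into vanishing coordinates.\<close>

lemma sqrt_op_fock:
  assumes "op_on_fock S \<gamma>" "positive_op \<gamma>"
  shows "sqrt_op \<gamma> (ket i) \<in> fock S"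
proof -
  note sym = symmetric_opD[OF positive_op_symmetric[OF positive_sqrt_op[OF assms(2)]]]
  have "coord (sqrt_op \<gamma> (ket i)) c = 0" if c: "c \<notin> configs S" for c
  proof -
    have "\<gamma> (ket c) \<in> fock S" using assms(1) by (simp add: op_on_fock_def)
    then have "cinner (ket c) (\<gamma> (ket c)) = 0" using c by (simp add: cinner_ket_left fock_def)
    then have "sqrt_op \<gamma> (ket c) = 0" using norm_sqrt_op[OF assms(2), of "ket c"] by simp
    moreover have "coord (sqrt_op \<gamma> (ket i)) c = cinner (sqrt_op \<gamma> (ket c)) (ket i)"
      by (simp only: cinner_ket_left[symmetric] sym)
    ultimately show ?thesis by simp
  qed
  then show ?thesis by (simp add: fock_def)
qed

context bose_hubbard
begin

definition Ut :: "real \<Rightarrow> config ell2 \<Rightarrow> config ell2" where "Ut t = op_app (evolution J \<mu> U d L t)"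

lemma bdd_coord: "bdd_cf (coord \<Psi>)"
  unfolding bdd_cf_def using coord_le_norm[of \<Psi>] by blast

lemma SM_covers:
  assumes "finite F" "F \<subseteq> configs \<Lambda>"
  shows "eventually (\<lambda>M. F \<subseteq> SM M) sequentially"
  using eventually_ge_at_top[of "\<Sum>c\<in>F. tot c"]
proof eventually_elim
  case (elim M)
  show ?case
  proof
    fix c assume c: "c \<in> F"
    have "tot c \<le> (\<Sum>c\<in>F. tot c)" by (rule member_le_sum[OF c]) (use assms in auto)
    then show "c \<in> SM M" using c assms elim by (auto simp: SM_def)
  qed
qed

lemma cinner_SM_lim:
  assumes "X \<in> fock \<Lambda>"
  shows "(\<lambda>M. \<Sum>c\<in>SM M. cnj (coord X c) * coord Y c) \<longlonglongrightarrow> cinner X Y"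
proof -
  have "((\<lambda>c. cnj (coord X c) * coord Y c) has_sum cinner X Y) UNIV"
    unfolding cinner_def by (rule has_sum_infsum[OF cinner_summable])
  then have "((\<lambda>c. cnj (coord X c) * coord Y c) has_sum cinner X Y) (configs \<Lambda>)"
    by (rule has_sum_cong_neutral[THEN iffD1, rotated -1]) (use assms in \<open>auto simp: fock_def\<close>)
  then have "(sum (\<lambda>c. cnj (coord X c) * coord Y c) \<longlongrightarrow> cinner X Y) (finite_subsets_at_top (configs \<Lambda>))"
    by (simp add: has_sum_def)
  moreover have "filterlim SM (finite_subsets_at_top (configs \<Lambda>)) sequentially"
    unfolding filterlim_finite_subsets_at_top
  proof (intro allI impI)
    fix F assume F: "finite F \<and> F \<subseteq> configs \<Lambda>"
    have "eventually (\<lambda>M. F \<subseteq> SM M) sequentially" by (rule SM_covers) (use F in auto)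
    then show "eventually (\<lambda>M. finite (SM M) \<and> F \<subseteq> SM M \<and> SM M \<subseteq> configs \<Lambda>) sequentially"
      by eventually_elim (intro conjI finite_SM, assumption, auto simp: SM_def)
  qed
  ultimately show ?thesis by (rule filterlim_compose)
qed

lemma ev_outside:
  assumes "\<Psi> \<in> fock \<Lambda>" "c \<notin> configs \<Lambda>"
  shows "ev t (coord \<Psi>) c = 0"
proof -
  have "ev t (coord \<Psi>) c = ev t (\<lambda>_. 0) c"
  proof (rule ev_local)
    fix c' assume "cls c c'"
    then have "c' \<notin> configs \<Lambda>" using assms(2) by (auto simp: cls_def configs_def)
    then show "coord \<Psi> c' = 0" using assms(1) by (simp add: fock_def)
  qed
  also have "(Hm ^^ k) (\<lambda>_. 0) = (\<lambda>_. 0)" for k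
    by (induction k) (auto simp: fun_eq_iff Hm_eq hop_def)
  then have "ev t (\<lambda>_. 0) c = 0" using ev_sums[of "\<lambda>_. 0" t c] sums_unique2[OF _ sums_zero] by (auto simp: bdd_cf_def)
  finally show ?thesis .
qed

text \<open>\<open>op_app\<close> has a definite value only if the evolved coordinates are
  square-summable. Every finite set of configurations fits into some \<open>SM M\<close>, where the
  norm is conserved.\<close>

lemma coord_Ut:
  assumes "\<Psi> \<in> fock \<Lambda>"
  shows "coord (Ut t \<Psi>) = ev t (coord \<Psi>)"
proof -
  have "coord (Abs_ell2 (ev t (coord \<Psi>))) = ev t (coord \<Psi>)"
  proof (rule ell2_from_bound(1))
    fix F :: "config set" assume F: "finite F"
    have "eventually (\<lambda>M. F \<inter> configs \<Lambda> \<subseteq> SM M) sequentially" by (rule SM_covers) (use F in auto)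
    then obtain M where M: "F \<inter> configs \<Lambda> \<subseteq> SM M" by (auto simp: eventually_sequentially)
    have "(\<Sum>i\<in>F. (cmod (ev t (coord \<Psi>) i))\<^sup>2) = (\<Sum>i\<in>F \<inter> configs \<Lambda>. (cmod (ev t (coord \<Psi>) i))\<^sup>2)"
      using F by (intro sum.mono_neutral_right) (auto simp: ev_outside[OF assms])
    also have "\<dots> \<le> (\<Sum>i\<in>SM M. (cmod (ev t (coord \<Psi>) i))\<^sup>2)" by (rule sum_mono2[OF finite_SM M]) simp
    also have "\<dots> \<le> (norm \<Psi>)\<^sup>2" unfolding ev_norm[OF bdd_coord] by (rule sum_coord_le[OF finite_SM])
    finally show "(\<Sum>i\<in>F. (cmod (ev t (coord \<Psi>) i))\<^sup>2) \<le> (norm \<Psi>)\<^sup>2" .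
  qed simp
  then show ?thesis by (simp add: Ut_def op_app_def ev_def)
qed

lemma Ut_fock: "\<Psi> \<in> fock \<Lambda> \<Longrightarrow> Ut t \<Psi> \<in> fock \<Lambda>"
  by (subst fock_def) (simp add: coord_Ut ev_outside)

lemma Ut_adjoint:
  assumes "X \<in> fock \<Lambda>" "Y \<in> fock \<Lambda>"
  shows "cinner X (Ut (- t) Y) = cinner (Ut t X) Y"
proof (rule LIMSEQ_unique)
  show "(\<lambda>M. \<Sum>c\<in>SM M. cnj (coord X c) * coord (Ut (- t) Y) c) \<longlonglongrightarrow> cinner X (Ut (- t) Y)"
    by (rule cinner_SM_lim[OF assms(1)])
  show "(\<lambda>M. \<Sum>c\<in>SM M. cnj (coord X c) * coord (Ut (- t) Y) c) \<longlonglongrightarrow> cinner (Ut t X) Y"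
    unfolding coord_Ut[OF assms(2)] ev_adjoint[OF bdd_coord bdd_coord] coord_Ut[OF assms(1), symmetric]
    by (rule cinner_SM_lim[OF Ut_fock[OF assms(1)]])
qed

lemma norm_SM_lim:
  assumes "X \<in> fock \<Lambda>"
  shows "(\<lambda>M. \<Sum>c\<in>SM M. (cmod (coord X c))\<^sup>2) \<longlonglongrightarrow> (norm X)\<^sup>2"
proof -
  have "(\<Sum>c\<in>SM M. cnj (coord X c) * coord X c) = complex_of_real (\<Sum>c\<in>SM M. (cmod (coord X c))\<^sup>2)" for M
    unfolding of_real_sum by (rule sum.cong[OF refl]) (simp only: complex_norm_square mult.commute)
  then show ?thesis using cinner_SM_lim[OF assms, of X] by (simp only: cinner_self tendsto_of_real_iff)
qed

lemma norm_Ut: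
  assumes "X \<in> fock \<Lambda>"
  shows "norm (Ut t X) = norm X"
proof -
  have "(norm (Ut t X))\<^sup>2 = (norm X)\<^sup>2"
    using LIMSEQ_unique[OF norm_SM_lim[OF Ut_fock[OF assms, of t]]] norm_SM_lim[OF assms]
    by (simp only: coord_Ut[OF assms] ev_norm[OF bdd_coord])
  then show ?thesis by simp
qed

text \<open>Checked coordinate by coordinate: both factors of the evolution are moved across inner
  products onto the members of the family. This is available on \<open>fock\<close>, which is why
  \<open>Y\<close> is taken there.\<close>

lemma von_neumann_gram:
  assumes fock: "\<And>i. \<eta> i \<in> fock \<Lambda>" and fin: "(\<Sum>\<^sub>\<infinity>i. ennreal ((norm (\<eta> i))\<^sup>2)) < \<infinity>"
    and g: "\<And>Y. Y \<in> fock \<Lambda> \<Longrightarrow> \<gamma> Y = gram UNIV \<eta> Y" and gf: "\<And>Y. \<gamma> Y \<in> fock \<Lambda>"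
    and Y: "Y \<in> fock \<Lambda>"
  shows "von_neumann J \<mu> U d L \<gamma> t Y = gram UNIV (\<lambda>i. Ut t (\<eta> i)) Y"
proof -
  have s: "(\<lambda>i. (norm (\<eta> i))\<^sup>2) summable_on UNIV"
    unfolding summable_on_iff_ennreal[OF zero_le_power2] by (rule fin)
  have s': "(\<lambda>i. (norm (Ut t (\<eta> i)))\<^sup>2) summable_on UNIV" using s by (simp add: norm_Ut[OF fock])
  let ?Z = "\<gamma> (Ut (- t) Y)"
  have "coord (Ut t ?Z) c = coord (gram UNIV (\<lambda>i. Ut t (\<eta> i)) Y) c" for c
  proof (cases "c \<in> configs \<Lambda>")
    case False
    have "coord (Ut t (\<eta> i)) c = 0" for i using Ut_fock[OF fock[of i], of t] False by (simp add: fock_def)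
    then have "coord (gram UNIV (\<lambda>i. Ut t (\<eta> i)) Y) c = 0"
      unfolding cinner_ket_left[symmetric] cinner_gram[OF s'] by simp
    moreover have "coord (Ut t ?Z) c = 0" using Ut_fock[OF gf, of t] False by (simp add: fock_def)
    ultimately show ?thesis by simp
  next
    case True
    then have k: "ket c \<in> fock \<Lambda>" by (auto simp: fock_def coord_ket)
    have adj: "cinner (ket c) (Ut t X) = cinner (Ut (- t) (ket c)) X" if "X \<in> fock \<Lambda>" for X
      using Ut_adjoint[OF k that, of "- t"] by simp
    have "coord (Ut t ?Z) c = cinner (Ut (- t) (ket c)) ?Z"
      by (simp only: cinner_ket_left[symmetric] adj[OF gf])
    also have "\<dots> = (\<Sum>\<^sub>\<infinity>i. cinner (\<eta> i) (Ut (- t) Y) * cinner (Ut (- t) (ket c)) (\<eta> i))"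
      by (simp only: g[OF Ut_fock[OF Y]] cinner_gram[OF s])
    also have "\<dots> = (\<Sum>\<^sub>\<infinity>i. cinner (Ut t (\<eta> i)) Y * cinner (ket c) (Ut t (\<eta> i)))"
      by (simp only: Ut_adjoint[OF fock Y] adj[OF fock])
    finally show ?thesis unfolding cinner_ket_left[symmetric] cinner_gram[OF s'] .
  qed
  then show ?thesis by (simp add: von_neumann_def Ut_def ell2_eqI)
qed

definition Pi :: "nat \<Rightarrow> config ell2 \<Rightarrow> config ell2" where "Pi M \<Psi> = emb (restr (SM M) (coord \<Psi>))"

lemma coord_Pi: "coord (Pi M \<Psi>) s = (if s \<in> SM M then coord \<Psi> s else 0)"
  by (simp add: Pi_def coord_emb fc_restr)

lemma Pi_fock: "Pi M \<Psi> \<in> fock \<Lambda>" by (auto simp: fock_def coord_Pi SM_def)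

lemma norm_Pi: "(norm (\<Psi> - Pi M \<Psi>))\<^sup>2 = (norm \<Psi>)\<^sup>2 - (\<Sum>s\<in>SM M. (cmod (coord \<Psi> s))\<^sup>2)"
proof -
  have "(norm \<Psi>)\<^sup>2 = (\<Sum>\<^sub>\<infinity>s. (if s \<in> SM M then (cmod (coord \<Psi> s))\<^sup>2 else 0) + (cmod (coord (\<Psi> - Pi M \<Psi>) s))\<^sup>2)"
    unfolding norm_eq_infsum by (rule infsum_cong) (simp add: coord_diff coord_Pi)
  also have "\<dots> = (\<Sum>\<^sub>\<infinity>s. if s \<in> SM M then (cmod (coord \<Psi> s))\<^sup>2 else 0) + (norm (\<Psi> - Pi M \<Psi>))\<^sup>2"
    unfolding norm_eq_infsum
    by (rule infsum_add[OF summable_on_cong_neutral[THEN iffD1, OF _ _ _ summable_on_finite[OF finite_SM[of M], of "\<lambda>s. (cmod (coord \<Psi> s))\<^sup>2"]] coord_summable]) auto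
  also have "(\<Sum>\<^sub>\<infinity>s. if s \<in> SM M then (cmod (coord \<Psi> s))\<^sup>2 else 0) = (\<Sum>\<^sub>\<infinity>s\<in>SM M. (cmod (coord \<Psi> s))\<^sup>2)"
    by (rule infsum_cong_neutral) auto
  also have "\<dots> = (\<Sum>s\<in>SM M. (cmod (coord \<Psi> s))\<^sup>2)" by (rule infsum_finite[OF finite_SM])
  finally show ?thesis by simp
qed

text \<open>The full norm and the part with at most \<open>M\<close> particles are both conserved,
  so the tail is independent of time.\<close>

lemma norm_Pi_Ut:
  assumes "\<Psi> \<in> fock \<Lambda>"
  shows "norm (Ut t \<Psi> - Pi M (Ut t \<Psi>)) = norm (\<Psi> - Pi M \<Psi>)"
proof -
  have "(norm (Ut t \<Psi> - Pi M (Ut t \<Psi>)))\<^sup>2 = (norm (\<Psi> - Pi M \<Psi>))\<^sup>2"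
    by (simp only: norm_Pi norm_Ut[OF assms] coord_Ut[OF assms] ev_norm[OF bdd_coord])
  then show ?thesis by simp
qed

end

section \<open>The forms of \<open>1 + N\<close> and \<open>1 + N^2\<close>, and uniform
  tails\<close>

definition nform :: "nat ell2 \<Rightarrow> ennreal" where
  "nform \<xi> = (\<Sum>\<^sub>\<infinity>n. ennreal (real n + 1) * ennreal ((cmod (coord \<xi> n))\<^sup>2))"

definition wform :: "nat ell2 \<Rightarrow> ennreal" where
  "wform \<xi> = (\<Sum>\<^sub>\<infinity>n. ennreal ((real n)\<^sup>2 + 1) * ennreal ((cmod (coord \<xi> n))\<^sup>2))"

lemma square_add_le: "(x::real) \<le> a + b \<Longrightarrow> 0 \<le> x \<Longrightarrow> x\<^sup>2 \<le> 2 * a\<^sup>2 + 2 * b\<^sup>2"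
proof -
  assume "x \<le> a + b" "0 \<le> x"
  then have "x\<^sup>2 \<le> (a + b)\<^sup>2" by (intro power_mono)
  also have "\<dots> \<le> 2 * a\<^sup>2 + 2 * b\<^sup>2" using sum_squares_bound[of a b] by (simp add: power2_sum)
  finally show ?thesis .
qed

lemma ennreal_square_add_le:
  assumes "(x::real) \<le> a + b" "0 \<le> x"
  shows "ennreal (x\<^sup>2) \<le> 2 * ennreal (a\<^sup>2) + 2 * ennreal (b\<^sup>2)"
proof -
  have "ennreal (x\<^sup>2) \<le> ennreal (2 * a\<^sup>2 + 2 * b\<^sup>2)" by (rule ennreal_leI[OF square_add_le[OF assms]])
  also have "\<dots> = 2 * ennreal (a\<^sup>2) + 2 * ennreal (b\<^sup>2)" by (simp add: ennreal_mult)
  finally show ?thesis .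
qed

text \<open>Stated through moduli of coordinates, it covers sums and differences alike. The factor 2
  replaces the triangle inequality, as the forms are squares with values in
  \<open>[0, \<infinity>]\<close>.\<close>

lemma nform_quasi_add:
  assumes "\<And>n. cmod (coord \<xi> n) \<le> cmod (coord a n) + cmod (coord b n)"
  shows "nform \<xi> \<le> 2 * nform a + 2 * nform b"
  unfolding nform_def infsum_cmult_ennreal[symmetric] infsum_add_ennreal[symmetric]
proof (rule infsum_mono_ennreal)
  fix n
  have "ennreal (real n + 1) * ennreal ((cmod (coord \<xi> n))\<^sup>2)
      \<le> ennreal (real n + 1) * (2 * ennreal ((cmod (coord a n))\<^sup>2) + 2 * ennreal ((cmod (coord b n))\<^sup>2))"
    by (intro mult_left_mono ennreal_square_add_le assms) auto
  then show "ennreal (real n + 1) * ennreal ((cmod (coord \<xi> n))\<^sup>2)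
      \<le> 2 * (ennreal (real n + 1) * ennreal ((cmod (coord a n))\<^sup>2)) + 2 * (ennreal (real n + 1) * ennreal ((cmod (coord b n))\<^sup>2))"
    by (simp only: distrib_left mult.left_commute)
qed

lemma norm_le_nform: "ennreal ((norm \<xi>)\<^sup>2) \<le> nform \<xi>"
  unfolding nform_def ennreal_norm_eq
proof (rule infsum_mono_ennreal)
  fix n
  have "1 * ennreal ((cmod (coord \<xi> n))\<^sup>2) \<le> ennreal (real n + 1) * ennreal ((cmod (coord \<xi> n))\<^sup>2)"
    by (intro mult_right_mono) auto
  then show "ennreal ((cmod (coord \<xi> n))\<^sup>2) \<le> ennreal (real n + 1) * ennreal ((cmod (coord \<xi> n))\<^sup>2)" by simp
qed

lemma nform_le_wform: "nform \<xi> \<le> 2 * wform \<xi>"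
  unfolding nform_def wform_def infsum_cmult_ennreal[symmetric]
proof (rule infsum_mono_ennreal)
  fix n
  have "2 * real n \<le> (real n)\<^sup>2 + 1" using sum_squares_bound[of "real n" 1] by simp
  moreover have "0 \<le> (real n)\<^sup>2" by simp
  ultimately have "real n + 1 \<le> 2 * ((real n)\<^sup>2 + 1)" unfolding distrib_left by linarith
  then have "ennreal (real n + 1) \<le> 2 * ennreal ((real n)\<^sup>2 + 1)"
    using ennreal_leI[of "real n + 1" "2 * ((real n)\<^sup>2 + 1)"] by (simp add: ennreal_mult)
  then show "ennreal (real n + 1) * ennreal ((cmod (coord \<xi> n))\<^sup>2) \<le> 2 * (ennreal ((real n)\<^sup>2 + 1) * ennreal ((cmod (coord \<xi> n))\<^sup>2))"
    unfolding mult.assoc[symmetric] by (intro mult_right_mono) auto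
qed

lemma nform_proj:
  assumes "norm \<phi> = 1"
  shows "nform (proj \<phi> \<xi>) \<le> ennreal ((norm \<xi>)\<^sup>2) * nform \<phi>"
  unfolding nform_def infsum_cmult_ennreal[symmetric]
proof (rule infsum_mono_ennreal)
  fix n
  have "cmod (cinner \<phi> \<xi>) \<le> norm \<xi>" using cmod_cinner_le[of \<phi> \<xi>] assms by simp
  then have "(cmod (coord (proj \<phi> \<xi>) n))\<^sup>2 \<le> (norm \<xi>)\<^sup>2 * (cmod (coord \<phi> n))\<^sup>2"
    by (simp add: proj_def coord_simps norm_mult power_mult_distrib mult_right_mono power_mono)
  then have "ennreal ((cmod (coord (proj \<phi> \<xi>) n))\<^sup>2) \<le> ennreal ((norm \<xi>)\<^sup>2) * ennreal ((cmod (coord \<phi> n))\<^sup>2)"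
    by (simp add: ennreal_mult[symmetric] ennreal_leI)
  then show "ennreal (real n + 1) * ennreal ((cmod (coord (proj \<phi> \<xi>) n))\<^sup>2)
      \<le> ennreal ((norm \<xi>)\<^sup>2) * (ennreal (real n + 1) * ennreal ((cmod (coord \<phi> n))\<^sup>2))"
    by (simp only: mult.left_commute[of "ennreal ((norm \<xi>)\<^sup>2)"]) (intro mult_left_mono, auto)
qed

lemma nform_coproj:
  assumes "norm \<phi> = 1"
  shows "nform (coproj \<phi> \<xi>) \<le> (2 + 2 * nform \<phi>) * nform \<xi>"
proof -
  have "nform (coproj \<phi> \<xi>) \<le> 2 * nform \<xi> + 2 * nform (proj \<phi> \<xi>)"
    by (rule nform_quasi_add) (simp add: coproj_def coord_diff norm_triangle_ineq4)
  also have "\<dots> \<le> 2 * nform \<xi> + 2 * (nform \<xi> * nform \<phi>)"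
    by (intro add_left_mono mult_left_mono order_trans[OF nform_proj[OF assms]] mult_right_mono norm_le_nform) auto
  finally show ?thesis by (simp add: distrib_left distrib_right mult_ac)
qed

text \<open>The initial quantity sees only the \<open>q\<close> part of a slice; the missing
  component along \<phi> has a known form. This is how a finite initial quantity yields a finite
  particle number.\<close>

lemma nform_le_coproj:
  assumes "norm \<phi> = 1"
  shows "nform \<xi> \<le> 4 * wform (coproj \<phi> \<xi>) + (2 * nform \<phi>) * ennreal ((norm \<xi>)\<^sup>2)"
proof -
  have "cmod (coord \<xi> n) \<le> cmod (coord (coproj \<phi> \<xi>) n) + cmod (coord (proj \<phi> \<xi>) n)" for n
    using norm_triangle_ineq[of "coord (coproj \<phi> \<xi>) n" "coord (proj \<phi> \<xi>) n"] by (simp add: coproj_def coord_diff)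
  then have "nform \<xi> \<le> 2 * nform (coproj \<phi> \<xi>) + 2 * nform (proj \<phi> \<xi>)" by (rule nform_quasi_add)
  also have "\<dots> \<le> 2 * (2 * wform (coproj \<phi> \<xi>)) + 2 * (ennreal ((norm \<xi>)\<^sup>2) * nform \<phi>)"
    by (intro add_mono mult_left_mono nform_le_wform nform_proj assms) auto
  finally show ?thesis by (simp add: mult_ac)
qed

lemma coproj_diff: "coproj \<phi> (a - b) = coproj \<phi> a - coproj \<phi> b"
  by (rule ell2_eqI) (simp add: coproj_def proj_def coord_simps cinner_diff_right algebra_simps)

lemma ennreal_infsum_sums:
  assumes "f sums S" "\<And>n. 0 \<le> f n"
  shows "(\<Sum>\<^sub>\<infinity>n. ennreal (f n)) = ennreal S"
proof -
  have "summable (\<lambda>n. norm (f n))" using assms by (simp add: sums_iff)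
  then have "(f has_sum S) UNIV" using assms(1) by (rule norm_summable_imp_has_sum)
  then show ?thesis using ennreal_infsum[of f UNIV] assms(2) by (auto simp: has_sum_iff)
qed

lemma infsum_tail_ennreal:
  fixes g :: "'a \<Rightarrow> ennreal" and \<delta> :: real
  assumes "infsum g A < \<infinity>" "\<delta> > 0"
  obtains F where "finite F" "F \<subseteq> A" "\<And>F'. finite F' \<Longrightarrow> F \<subseteq> F' \<Longrightarrow> F' \<subseteq> A \<Longrightarrow> infsum g (A - F') \<le> ennreal \<delta>"
proof -
  have "\<exists>F\<in>{F. finite F \<and> F \<subseteq> A}. infsum g A < sum g F + ennreal \<delta>"
    by (rule SUP_approx_ennreal[OF assms(2) _ infsum_ennreal_eq_SUP]) (use assms(1) in auto)
  then obtain F where F: "finite F" "F \<subseteq> A" "infsum g A < sum g F + ennreal \<delta>" by blast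
  have "infsum g (A - F') \<le> ennreal \<delta>" if F': "finite F'" "F \<subseteq> F'" "F' \<subseteq> A" for F'
  proof -
    have "infsum g (F' \<union> (A - F')) = infsum g F' + infsum g (A - F')"
      by (rule infsum_Un_disjoint) (auto intro: summable_on_ennreal_UNIV)
    moreover have "F' \<union> (A - F') = A" using F' by auto
    ultimately have eq: "infsum g A = sum g F' + infsum g (A - F')" using F' by simp
    have "sum g F \<le> sum g F'" by (rule sum_mono2[OF F'(1,2)]) simp
    then have "sum g F' + infsum g (A - F') \<le> sum g F' + ennreal \<delta>"
      using F(3) unfolding eq by (meson add_right_mono less_imp_le order_trans)
    moreover have "sum g F' \<noteq> \<infinity>" using eq assms(1) by auto
    ultimately show ?thesis by (simp add: ennreal_add_left_cancel_le)
  qed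
  with F that show ?thesis by blast
qed

lemma (in mf_path) nform_phi: "nform (\<phi> t) = ennreal (mass 0)"
proof -
  have "nform (\<phi> t) = (\<Sum>\<^sub>\<infinity>n. ennreal ((real n + 1) * (cmod (c t n))\<^sup>2))"
    by (simp add: nform_def c_def ennreal_mult)
  also have "\<dots> = ennreal (mass t)" by (rule ennreal_infsum_sums[OF mass_sums]) simp
  finally show ?thesis by (simp add: mass_const[of t])
qed

context bose_hubbard
begin

definition site_sum :: "(nat ell2 \<Rightarrow> ennreal) \<Rightarrow> config ell2 \<Rightarrow> ennreal" where
  "site_sum h \<Psi> = (\<Sum>x\<in>\<Lambda>. \<Sum>\<^sub>\<infinity>r\<in>configs (\<Lambda> - {x}). h (extract_site x r \<Psi>))"

lemma site_sum_le:
  assumes "\<And>x r. h (extract_site x r Z) \<le> a * h1 (extract_site x r Y) + b * h2 (extract_site x r X)"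
  shows "site_sum h Z \<le> a * site_sum h1 Y + b * site_sum h2 X"
  unfolding site_sum_def sum_distrib_left sum.distrib[symmetric] infsum_cmult_ennreal[symmetric] infsum_add_ennreal[symmetric]
  by (intro sum_mono infsum_mono_ennreal assms)

lemma site_sum_norm:
  assumes "\<Psi> \<in> fock \<Lambda>"
  shows "site_sum (\<lambda>\<xi>. ennreal ((norm \<xi>)\<^sup>2)) \<Psi> = of_nat (card \<Lambda>) * ennreal ((norm \<Psi>)\<^sup>2)"
  unfolding site_sum_def using extract_norm_sum[OF _ assms] by simp

lemma extract_diff: "extract_site x r (a - b) = extract_site x r a - extract_site x r b"
  by (rule ell2_eqI) (simp add: coord_extract coord_diff)

lemma fock_diff: "a \<in> fock S \<Longrightarrow> b \<in> fock S \<Longrightarrow> a - b \<in> fock S"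
  by (simp add: fock_def coord_diff)

lemma site_sum_nform: "site_sum nform \<Psi> = (\<Sum>x\<in>\<Lambda>. \<Sum>\<^sub>\<infinity>s\<in>configs \<Lambda>. ennreal (real (s x) + 1) * ennreal ((cmod (coord \<Psi> s))\<^sup>2))"
  unfolding site_sum_def by (intro sum.cong refl) (simp add: slice_infsum nform_def coord_extract)

text \<open>One \<open>M\<close> serves the whole family: the double sum is rearranged as a sum over
  configurations, whose tail beyond a finite set is small, and finite sets lie in some
  \<open>SM M\<close>.\<close>

lemma site_sum_tail:
  assumes fin: "(\<Sum>\<^sub>\<infinity>i. site_sum nform (\<eta> i)) < \<infinity>" and "\<delta> > (0::real)"
  shows "\<exists>M. (\<Sum>\<^sub>\<infinity>i. site_sum nform (\<eta> i - Pi M (\<eta> i))) \<le> ennreal \<delta>"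
proof -
  define g where "g s = (\<Sum>x\<in>\<Lambda>. \<Sum>\<^sub>\<infinity>i. ennreal (real (s x) + 1) * ennreal ((cmod (coord (\<eta> i) s))\<^sup>2))" for s
  have swap: "(\<Sum>\<^sub>\<infinity>i. site_sum nform (\<zeta> i)) = (\<Sum>\<^sub>\<infinity>s\<in>configs \<Lambda>. \<Sum>x\<in>\<Lambda>. \<Sum>\<^sub>\<infinity>i. ennreal (real (s x) + 1) * ennreal ((cmod (coord (\<zeta> i) s))\<^sup>2))"
    for \<zeta> :: "'a \<Rightarrow> config ell2"
    unfolding site_sum_nform infsum_sum_ennreal by (subst infsum_swap_ennreal) (rule refl)
  have "infsum g (configs \<Lambda>) < \<infinity>" using fin unfolding swap g_def .
  from infsum_tail_ennreal[OF this assms(2)] obtain F where F: "finite F" "F \<subseteq> configs \<Lambda>"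
    "\<And>F'. finite F' \<Longrightarrow> F \<subseteq> F' \<Longrightarrow> F' \<subseteq> configs \<Lambda> \<Longrightarrow> infsum g (configs \<Lambda> - F') \<le> ennreal \<delta>" by metis
  obtain M where M: "F \<subseteq> SM M" using SM_covers[OF F(1,2)] by (auto simp: eventually_sequentially)
  have "(\<Sum>\<^sub>\<infinity>i. site_sum nform (\<eta> i - Pi M (\<eta> i))) = infsum g (configs \<Lambda> - SM M)"
    unfolding swap by (rule infsum_cong_neutral) (auto simp: g_def coord_diff coord_Pi)
  also have "\<dots> \<le> ennreal \<delta>" by (rule F(3)[OF finite_SM M]) (auto simp: SM_def)
  finally show ?thesis by blast
qed

end

locale fock_path = bose_hubbard J \<mu> U d L + mf_path J \<mu> U \<phi> for J \<mu> U d L \<phi> +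
  fixes \<Psi> :: "config ell2" and M :: nat
  assumes fock: "\<Psi> \<in> fock \<Lambda>"
begin

sublocale full_path J \<mu> U d L \<phi> "coord \<Psi>" M
  by unfold_locales (rule bdd_coord)

text \<open>The way back from the finite functional to the Fock space: slices with labels outside
  \<open>slices M x\<close> vanish, and the others are the completed squares of
  \<open>FF_sums\<close>.\<close>

lemma FF_form:
  assumes x: "x \<in> \<Lambda>" and supp: "\<And>s. s \<notin> SM M \<Longrightarrow> coord \<Phi> s = 0"
  shows "(\<Sum>\<^sub>\<infinity>r\<in>configs (\<Lambda> - {x}). nform (coproj (\<phi> t) (extract_site x r \<Phi>))) = ennreal (FF M x (c t) (mass 0) (coord \<Phi>))"
proof -
  define T where "T r = (\<Sum>n\<le>M. (real n + 1) * (cmod (coord \<Phi> (r(x := n))))\<^sup>2)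
     - 2 * Re (cnj (KK M x (c t) (coord \<Phi>) r) * KK M x (nw (c t)) (coord \<Phi>) r) + mass 0 * (cmod (KK M x (c t) (coord \<Phi>) r))\<^sup>2" for r
  have FF: "FF M x (c t) (mass 0) (coord \<Phi>) = (\<Sum>r\<in>slices M x. T r)"
    unfolding T_def by (rule FF_slices) (rule supp)
  have sm: "(\<lambda>n. (real n + 1) * (cmod (coord \<Phi> (r(x := n)) - KK M x (c t) (coord \<Phi>) r * c t n))\<^sup>2) sums T r" for r
    unfolding T_def by (rule FF_sums) (rule supp)
  have T0: "T r \<ge> 0" for r by (rule sums_le[OF _ sums_zero sm]) simp
  have K: "cinner (\<phi> t) (extract_site x r \<Phi>) = KK M x (c t) (coord \<Phi>) r" for r
  proof -
    have "cinner (\<phi> t) (extract_site x r \<Phi>) = (\<Sum>\<^sub>\<infinity>n\<in>{..M}. cnj (coord (\<phi> t) n) * coord \<Phi> (r(x := n)))"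
      unfolding cinner_def coord_extract
    proof (rule infsum_cong_neutral)
      fix n assume "n \<in> UNIV - {..M}"
      then have "r(x := n) \<notin> SM M" using SM_le[of "r(x := n)" M x] by auto
      then show "cnj (coord (\<phi> t) n) * coord \<Phi> (r(x := n)) = 0" by (simp add: supp)
    qed auto
    then show ?thesis by (simp add: KK_def c_def)
  qed
  have each: "nform (coproj (\<phi> t) (extract_site x r \<Phi>)) = ennreal (T r)" for r
  proof -
    have "nform (coproj (\<phi> t) (extract_site x r \<Phi>)) =
       (\<Sum>\<^sub>\<infinity>n. ennreal ((real n + 1) * (cmod (coord \<Phi> (r(x := n)) - KK M x (c t) (coord \<Phi>) r * c t n))\<^sup>2))"
      by (simp add: nform_def coproj_def proj_def coord_simps coord_extract K c_def ennreal_mult)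
    also have "\<dots> = ennreal (T r)" by (rule ennreal_infsum_sums[OF sm]) simp
    finally show ?thesis .
  qed
  have "(\<Sum>\<^sub>\<infinity>r\<in>configs (\<Lambda> - {x}). nform (coproj (\<phi> t) (extract_site x r \<Phi>))) = (\<Sum>\<^sub>\<infinity>r\<in>slices M x. ennreal (T r))"
  proof (rule infsum_cong_neutral)
    fix r assume r: "r \<in> configs (\<Lambda> - {x}) - slices M x"
    have "r(x := n) \<notin> SM M" for n
    proof
      assume "r(x := n) \<in> SM M"
      from SM_reset[OF this, of x] have "r(x := 0) \<in> slices M x" by simp
      moreover have "r(x := 0) = r" using r by (simp add: configs_def fun_upd_idem_iff)
      ultimately show False using r by simp
    qed
    then have "extract_site x r \<Phi> = 0" by (intro ell2_eqI) (simp add: coord_extract supp coord_simps)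
    then show "nform (coproj (\<phi> t) (extract_site x r \<Phi>)) = 0"
      by (simp add: coproj_def proj_def nform_def coord_simps)
  next
    fix r assume "r \<in> slices M x - configs (\<Lambda> - {x})"
    then show "ennreal (T r) = 0" by (auto simp: slices_def SM_def configs_def)
  qed (rule each)
  also have "\<dots> = (\<Sum>r\<in>slices M x. ennreal (T r))" by (rule infsum_finite[OF finite_slices])
  also have "\<dots> = ennreal (\<Sum>r\<in>slices M x. T r)" by (rule sum_ennreal) (rule T0)
  finally show ?thesis unfolding FF .
qed

lemma G_form: "site_sum (\<lambda>\<xi>. nform (coproj (\<phi> t) \<xi>)) (Pi M (Ut t \<Psi>)) = ennreal (G t)"
proof -
  have e: "coord (Pi M (Ut t \<Psi>)) = fc (Ps t)"
    by (rule ext) (simp add: Pi_def Ps_def coord_emb coord_Ut[OF fock])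
  have "site_sum (\<lambda>\<xi>. nform (coproj (\<phi> t) \<xi>)) (Pi M (Ut t \<Psi>)) = (\<Sum>x\<in>\<Lambda>. ennreal (FF M x (c t) (mass 0) (fc (Ps t))))"
    unfolding site_sum_def
  proof (rule sum.cong[OF refl])
    fix x assume x: "x \<in> \<Lambda>"
    have s: "coord (Pi M (Ut t \<Psi>)) s = 0" if "s \<notin> SM M" for s using that by (simp add: coord_Pi)
    show "(\<Sum>\<^sub>\<infinity>r\<in>configs (\<Lambda> - {x}). nform (coproj (\<phi> t) (extract_site x r (Pi M (Ut t \<Psi>))))) =
        ennreal (FF M x (c t) (mass 0) (fc (Ps t)))"
      unfolding e[symmetric] by (rule FF_form[OF x s])
  qed
  also have "\<dots> = ennreal (G t)" unfolding G_def by (rule sum_ennreal) (rule FF_nonneg[OF Ps_supp])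
  finally show ?thesis .
qed

lemma P0_le: "P0 \<le> (norm \<Psi>)\<^sup>2" unfolding P0_def by (rule sum_coord_le[OF finite_SM])

text \<open>The full vector differs from its cut by a tail whose norm the evolution preserves. The
  tail is therefore measured at time 0 only, where its \<open>nform\<close> can be made
  small.\<close>

theorem state_bound:
  assumes t: "t \<ge> 0" and A: "A \<ge> 0" "\<And>s. s \<ge> 0 \<Longrightarrow> sqrt (mom2 s) \<le> A * (1 + s)"
  shows "site_sum (\<lambda>\<xi>. ennreal ((norm (coproj (\<phi> t) \<xi>))\<^sup>2)) (Ut t \<Psi>)
    \<le> ennreal (8 * exp (27 * \<bar>J\<bar> * A ^ 3 * (1 + t) ^ 4)) *
       (site_sum (\<lambda>\<xi>. wform (coproj (\<phi> 0) \<xi>)) \<Psi> + ennreal (2 + mass 0) * site_sum nform (\<Psi> - Pi M \<Psi>)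
        + ennreal (card \<Lambda> / d) * ennreal ((norm \<Psi>)\<^sup>2))"
proof -
  define E where "E = exp (27 * \<bar>J\<bar> * A ^ 3 * (1 + t) ^ 4)"
  define e where "e = ennreal E"
  define W where "W = site_sum (\<lambda>\<xi>. wform (coproj (\<phi> 0) \<xi>)) \<Psi>"
  define \<tau> where "\<tau> = site_sum nform (\<Psi> - Pi M \<Psi>)"
  define \<kappa> where "\<kappa> = ennreal (card \<Lambda> / d) * ennreal ((norm \<Psi>)\<^sup>2)"
  define m where "m = mass 0"
  have m0: "m \<ge> 0" unfolding m_def by (rule mass_nonneg)
  have E1: "E \<ge> 1" unfolding E_def using A t by simp
  have nphi: "norm (\<phi> s) = 1" for s by (rule norm_phi)
  let ?Z = "Ut t \<Psi>" and ?Y = "Pi M (Ut t \<Psi>)"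
  have "site_sum (\<lambda>\<xi>. ennreal ((norm (coproj (\<phi> t) \<xi>))\<^sup>2)) ?Z
      \<le> 2 * site_sum (\<lambda>\<xi>. nform (coproj (\<phi> t) \<xi>)) ?Y + 2 * site_sum (\<lambda>\<xi>. ennreal ((norm \<xi>)\<^sup>2)) (?Z - ?Y)"
  proof (rule site_sum_le)
    fix x r
    let ?z = "extract_site x r ?Z" and ?y = "extract_site x r ?Y"
    have "norm (coproj (\<phi> t) ?z) \<le> norm (coproj (\<phi> t) ?y) + norm (coproj (\<phi> t) (?z - ?y))"
      unfolding coproj_diff by (rule norm_triangle_sub)
    also have "norm (coproj (\<phi> t) (?z - ?y)) \<le> norm (?z - ?y)"
    proof (rule power2_le_imp_le)
      show "(norm (coproj (\<phi> t) (?z - ?y)))\<^sup>2 \<le> (norm (?z - ?y))\<^sup>2"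
        using coproj_norm[OF nphi, of "?z - ?y" t] by simp
    qed simp
    finally have "ennreal ((norm (coproj (\<phi> t) ?z))\<^sup>2) \<le> 2 * ennreal ((norm (coproj (\<phi> t) ?y))\<^sup>2) + 2 * ennreal ((norm (?z - ?y))\<^sup>2)"
      by (rule ennreal_square_add_le) auto
    also have "\<dots> \<le> 2 * nform (coproj (\<phi> t) ?y) + 2 * ennreal ((norm (?z - ?y))\<^sup>2)"
      by (intro add_right_mono mult_left_mono norm_le_nform) auto
    finally show "ennreal ((norm (coproj (\<phi> t) ?z))\<^sup>2) \<le> 2 * nform (coproj (\<phi> t) ?y) + 2 * ennreal ((norm (extract_site x r (?Z - ?Y)))\<^sup>2)"
      by (simp only: extract_diff)
  qed
  also have "site_sum (\<lambda>\<xi>. ennreal ((norm \<xi>)\<^sup>2)) (?Z - ?Y) = site_sum (\<lambda>\<xi>. ennreal ((norm \<xi>)\<^sup>2)) (\<Psi> - Pi M \<Psi>)"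
    by (simp only: site_sum_norm[OF fock_diff[OF Ut_fock[OF fock] Pi_fock]] site_sum_norm[OF fock_diff[OF fock Pi_fock]] norm_Pi_Ut[OF fock])
  also have "\<dots> \<le> \<tau>"
    using site_sum_le[of "\<lambda>\<xi>. ennreal ((norm \<xi>)\<^sup>2)" "\<Psi> - Pi M \<Psi>" 1 nform "\<Psi> - Pi M \<Psi>" 0 nform 0] norm_le_nform
    by (simp add: \<tau>_def)
  finally have 1: "site_sum (\<lambda>\<xi>. ennreal ((norm (coproj (\<phi> t) \<xi>))\<^sup>2)) ?Z \<le> 2 * ennreal (G t) + 2 * \<tau>"
    by (simp add: G_form mult_left_mono add_left_mono)
  have U0: "Ut 0 \<Psi> = \<Psi>" by (rule ell2_eqI) (simp add: coord_Ut[OF fock] ev_0)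
  \<comment> \<open>At time 0 the cut has to be undone underneath \<open>q\<close>; in the form of
    \<open>1 + N\<close> the projection \<open>q\<close> is bounded only up to a factor depending on
    \<open>m\<close>.\<close>
  have 2: "ennreal (G 0) \<le> 4 * W + ennreal (4 + 4 * m) * \<tau>"
    unfolding G_form[symmetric] U0 W_def \<tau>_def
  proof (rule site_sum_le)
    fix x r
    let ?z = "extract_site x r \<Psi>" and ?y = "extract_site x r (Pi M \<Psi>)"
    have d: "coproj (\<phi> 0) ?y = coproj (\<phi> 0) ?z - coproj (\<phi> 0) (?z - ?y)" by (simp add: coproj_diff)
    have "nform (coproj (\<phi> 0) ?y) \<le> 2 * nform (coproj (\<phi> 0) ?z) + 2 * nform (coproj (\<phi> 0) (?z - ?y))"
      by (rule nform_quasi_add) (simp only: d coord_diff norm_triangle_ineq4)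
    also have "\<dots> \<le> 2 * (2 * wform (coproj (\<phi> 0) ?z)) + 2 * ((2 + 2 * nform (\<phi> 0)) * nform (?z - ?y))"
      by (intro add_mono mult_left_mono nform_le_wform nform_coproj nphi) auto
    also have "\<dots> = 4 * wform (coproj (\<phi> 0) ?z) + ennreal (4 + 4 * m) * nform (?z - ?y)"
    proof -
      have "ennreal (4 + 4 * m) = 2 * (2 + 2 * nform (\<phi> 0))"
        using m0 by (simp add: nform_phi m_def[symmetric] ennreal_mult distrib_left)
      then show ?thesis by (simp only: mult.assoc[symmetric]) simp
    qed
    finally show "nform (coproj (\<phi> 0) ?y) \<le> 4 * wform (coproj (\<phi> 0) ?z) + ennreal (4 + 4 * m) * nform (extract_site x r (\<Psi> - Pi M \<Psi>))"
      by (simp only: extract_diff)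
  qed
  have Gn: "G s \<ge> 0" for s unfolding G_def by (intro sum_nonneg FF_nonneg Ps_supp)
  have P0n: "P0 \<ge> 0" by (simp add: P0_def sum_nonneg)
  have 3: "ennreal (G t) \<le> e * (ennreal (G 0) + \<kappa>)"
  proof -
    have "G t \<le> G t + card \<Lambda> * P0 / d" using P0n by simp
    also have "\<dots> \<le> (G 0 + card \<Lambda> * P0 / d) * E" unfolding E_def by (rule gronwall[OF t A])
    also have "\<dots> \<le> (G 0 + card \<Lambda> * (norm \<Psi>)\<^sup>2 / d) * E"
      using E1 P0_le by (intro mult_right_mono add_left_mono divide_right_mono mult_left_mono) auto
    finally have "ennreal (G t) \<le> ennreal (E * (G 0 + card \<Lambda> / d * (norm \<Psi>)\<^sup>2))"
      by (intro ennreal_leI) (simp add: mult.commute)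
    also have "\<dots> = e * (ennreal (G 0) + \<kappa>)"
    proof -
      have "ennreal (card \<Lambda> / d * (norm \<Psi>)\<^sup>2) = \<kappa>" unfolding \<kappa>_def by (rule ennreal_mult) auto
      then show ?thesis using E1 Gn[of 0] by (simp only: e_def) (subst ennreal_mult, auto)
    qed
    finally show ?thesis .
  qed
  have e1: "1 \<le> e" unfolding e_def using E1 by simp
  have "site_sum (\<lambda>\<xi>. ennreal ((norm (coproj (\<phi> t) \<xi>))\<^sup>2)) ?Z \<le> 2 * (e * ((4 * W + ennreal (4 + 4 * m) * \<tau>) + \<kappa>)) + 2 * (e * \<tau>)"
  proof (rule order_trans[OF 1], rule add_mono)
    show "2 * ennreal (G t) \<le> 2 * (e * ((4 * W + ennreal (4 + 4 * m) * \<tau>) + \<kappa>))"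
      by (rule mult_left_mono[OF order_trans[OF 3]]) (auto intro!: mult_left_mono add_right_mono 2)
    show "2 * \<tau> \<le> 2 * (e * \<tau>)" using mult_right_mono[OF e1, of \<tau>] by (intro mult_left_mono) auto
  qed
  also have "\<dots> = e * (8 * W + ennreal (10 + 8 * m) * \<tau> + 2 * \<kappa>)"
  proof -
    have "ennreal (10 + 8 * m) = 2 * ennreal (4 + 4 * m) + 2"
    proof -
      have "ennreal (10 + 8 * m) = ennreal (2 * (4 + 4 * m) + 2)" by (simp add: algebra_simps)
      also have "\<dots> = ennreal (2 * (4 + 4 * m)) + ennreal 2" by (rule ennreal_plus) (use m0 in auto)
      also have "ennreal (2 * (4 + 4 * m)) = ennreal 2 * ennreal (4 + 4 * m)" by (rule ennreal_mult) (use m0 in auto)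
      finally show ?thesis by simp
    qed
    then show ?thesis by (simp only:) (simp add: distrib_left distrib_right mult_ac add_ac)
  qed
  \<comment> \<open>The coefficients 8, \<open>10 + 8 m\<close> and 2 are brought to a common factor
    8 by \<open>10 + 8 m \<le> 8 (2 + m)\<close>.\<close>
  also have "\<dots> \<le> e * (8 * W + 8 * (ennreal (2 + m) * \<tau>) + 8 * \<kappa>)"
  proof (intro mult_left_mono add_mono order_refl)
    have "ennreal (10 + 8 * m) \<le> ennreal (8 * (2 + m))" by (intro ennreal_leI) simp
    also have "\<dots> = 8 * ennreal (2 + m)" using m0 by (simp only: ennreal_mult) simp
    finally show "ennreal (10 + 8 * m) * \<tau> \<le> 8 * (ennreal (2 + m) * \<tau>)"
      unfolding mult.assoc[symmetric] by (intro mult_right_mono) auto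
    show "2 * \<kappa> \<le> 8 * \<kappa>" by (intro mult_right_mono) auto
  qed auto
  also have "\<dots> = (8 * e) * (W + ennreal (2 + m) * \<tau> + \<kappa>)" by (simp only: distrib_left mult_ac)
  also have "8 * e = ennreal (8 * E)" unfolding e_def using E1 by (simp add: ennreal_mult)
  finally show ?thesis unfolding E_def W_def \<tau>_def \<kappa>_def m_def .
qed

end

section \<open>Initial data, constants and the estimate for mixed states\<close>

lemma positive_op_proj: "positive_op (proj \<phi>)"
proof (rule positive_opI[of _ "\<lambda>\<psi>. (cmod (cinner \<phi> \<psi>))\<^sup>2"])
  show "bounded_clinear (proj \<phi>)"
  proof (rule bounded_clinearI)
    fix \<psi> show "norm (proj \<phi> \<psi>) \<le> (norm \<phi> * norm \<phi>) * norm \<psi>"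
      using mult_right_mono[OF cmod_cinner_le[of \<phi> \<psi>], of "norm \<phi>"] by (simp add: proj_def norm_cscale mult_ac)
  qed (auto intro!: ell2_eqI simp: proj_def coord_simps cinner_add_right cinner_scale_right algebra_simps)
  fix \<psi>
  show "cinner \<psi> (proj \<phi> \<psi>) = complex_of_real ((cmod (cinner \<phi> \<psi>))\<^sup>2)"
    using cinner_cnj[of \<psi> \<phi>] by (simp only: proj_def cinner_scale_right complex_norm_square)
qed simp

lemma sqrt_op_proj:
  assumes "norm \<phi> = 1"
  shows "sqrt_op (proj \<phi>) = proj \<phi>"
proof (rule sqrt_op_unique[OF positive_op_proj])
  have "cinner \<phi> \<phi> = 1" using assms by (simp add: cinner_self)
  then show "proj \<phi> \<circ> proj \<phi> = proj \<phi>" by (auto simp: proj_def cinner_scale_right fun_eq_iff)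
qed

lemma trace_form_proj:
  assumes "norm \<phi> = 1"
  shows "trace_form (proj \<phi>) (num_form k) = num_form k \<phi>"
proof -
  have "num_form k (proj \<phi> (ket i)) = ennreal ((cmod (coord \<phi> i))\<^sup>2) * num_form k \<phi>" for i
    unfolding num_form_eq infsum_cmult_ennreal[symmetric]
    by (intro infsum_cong)
       (simp add: proj_def cinner_ket_right coord_simps norm_mult power_mult_distrib ennreal_mult[symmetric] mult.left_commute)
  then have "trace_form (proj \<phi>) (num_form k) = (\<Sum>\<^sub>\<infinity>i. ennreal ((cmod (coord \<phi> i))\<^sup>2)) * num_form k \<phi>"
    unfolding trace_form_def sqrt_op_proj[OF assms] by (simp add: mult.commute[of _ "num_form k \<phi>"] infsum_cmult_ennreal)
  then show ?thesis by (simp add: ennreal_norm_eq[symmetric] assms)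
qed

text \<open>Termwise \<open>(n + 1)^2 \<le> 2 n^2 + 2 \<le> 2 n^4 + 2\<close>, summed against
  probabilities of total weight one.\<close>

lemma (in mf_path) mom2_0_le:
  assumes C: "C \<ge> 0" and "trace_form (proj (\<phi> 0)) (num_form 4) \<le> ennreal C"
  shows "mom2 0 \<le> 2 + 2 * C"
proof -
  have n1: "(\<Sum>\<^sub>\<infinity>n. ennreal ((cmod (c 0 n))\<^sup>2)) = 1"
    using ennreal_norm_eq[of "\<phi> 0"] by (simp add: c_def init)
  have "ennreal (mom2 0) = (\<Sum>\<^sub>\<infinity>n. ennreal ((real n + 1)\<^sup>2 * (cmod (c 0 n))\<^sup>2))"
    by (rule ennreal_infsum_sums[OF mom2_sums, symmetric]) simp
  also have "\<dots> \<le> (\<Sum>\<^sub>\<infinity>n. ennreal 2 * ennreal ((cmod (c 0 n))\<^sup>2) + ennreal 2 * ennreal (real n ^ 4 * (cmod (c 0 n))\<^sup>2))"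
  proof (rule infsum_mono_ennreal)
    fix n
    have "(real n + 1)\<^sup>2 \<le> 2 + 2 * real n ^ 4"
    proof -
      have "(real n)\<^sup>2 \<le> real n ^ 4" by (cases "n = 0") (auto intro: power_increasing)
      moreover have "2 * real n \<le> (real n)\<^sup>2 + 1" using sum_squares_bound[of "real n" 1] by simp
      ultimately show ?thesis by (simp add: power2_sum)
    qed
    then have "(real n + 1)\<^sup>2 * (cmod (c 0 n))\<^sup>2 \<le> (2 + 2 * real n ^ 4) * (cmod (c 0 n))\<^sup>2" by (rule mult_right_mono) simp
    then have "ennreal ((real n + 1)\<^sup>2 * (cmod (c 0 n))\<^sup>2) \<le> ennreal (2 * (cmod (c 0 n))\<^sup>2 + 2 * (real n ^ 4 * (cmod (c 0 n))\<^sup>2))"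
      by (intro ennreal_leI) (simp add: algebra_simps)
    also have "\<dots> = ennreal 2 * ennreal ((cmod (c 0 n))\<^sup>2) + ennreal 2 * ennreal (real n ^ 4 * (cmod (c 0 n))\<^sup>2)"
      by (subst ennreal_plus) (simp_all add: ennreal_mult del: ennreal_numeral)
    finally show "ennreal ((real n + 1)\<^sup>2 * (cmod (c 0 n))\<^sup>2)
      \<le> ennreal 2 * ennreal ((cmod (c 0 n))\<^sup>2) + ennreal 2 * ennreal (real n ^ 4 * (cmod (c 0 n))\<^sup>2)" .
  qed
  also have "\<dots> = ennreal 2 * 1 + ennreal 2 * num_form 4 (\<phi> 0)"
    unfolding infsum_add_ennreal infsum_cmult_ennreal n1 num_form_eq by (simp only: c_def)
  also have "\<dots> \<le> ennreal 2 * 1 + ennreal 2 * ennreal C"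
    using assms(2) unfolding trace_form_proj[OF init] by (intro add_left_mono mult_left_mono) auto
  also have "\<dots> = ennreal (2 + 2 * C)" using C by (simp add: ennreal_mult)
  finally show ?thesis using C by (subst (asm) ennreal_le_iff) auto
qed

lemma infsum_slices:
  fixes \<eta> :: "'k \<Rightarrow> config ell2"
  shows "(\<Sum>\<^sub>\<infinity>k\<in>cells (lattice d L). h (slice \<eta> k)) =
    (\<Sum>\<^sub>\<infinity>i. \<Sum>x\<in>lattice d L. \<Sum>\<^sub>\<infinity>r\<in>configs (lattice d L - {x}). h (extract_site x r (\<eta> i)) :: ennreal)"
  unfolding infsum_cells[OF finite_lattice] infsum_sum_ennreal by simp

text \<open>Instantiated twice, for the initial family of pure states and for its evolution.\<close>

locale slice_density =
  fixes d L :: nat and \<eta> :: "'k \<Rightarrow> config ell2"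
  assumes fock: "\<And>i. \<eta> i \<in> fock (lattice d L)" and unit: "(\<Sum>\<^sub>\<infinity>i. ennreal ((norm (\<eta> i))\<^sup>2)) = 1"
    and nonempty: "card (lattice d L) > 0"
begin

abbreviation dens :: "nat ell2 \<Rightarrow> nat ell2" where
  "dens \<equiv> (\<lambda>z. (1 / real (card (lattice d L))) *\<^sub>R gram (cells (lattice d L)) (slice \<eta>) z)"

lemma summable: "(\<lambda>k. (norm (slice \<eta> k))\<^sup>2) summable_on cells (lattice d L)"
  by (rule slice_summable[OF finite_lattice fock]) (simp add: unit)

lemma positive_op_dens: "positive_op dens"
  by (rule positive_op_scaleR[OF positive_op_gram[OF summable]]) simp

lemma dens_weighted:
  fixes w :: "nat \<Rightarrow> ennreal"
  assumes Q: "\<And>x y. cinner x (Q y) = cinner (Q x) y"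
  shows "(\<Sum>\<^sub>\<infinity>n. w n * ennreal (Re (cinner (Q (ket n)) (dens (Q (ket n)))))) =
    ennreal (1 / real (card (lattice d L))) * (\<Sum>\<^sub>\<infinity>k\<in>cells (lattice d L). \<Sum>\<^sub>\<infinity>n. w n * ennreal ((cmod (coord (Q (slice \<eta> k)) n))\<^sup>2))"
proof -
  have "ennreal (Re (cinner z (dens z))) =
      ennreal (1 / real (card (lattice d L))) * ennreal (Re (cinner z (gram (cells (lattice d L)) (slice \<eta>) z)))" for z
    by (simp only: cinner_scaleR_right times_complex.sel Re_complex_of_real Im_complex_of_real mult_zero_left diff_zero)
       (rule ennreal_mult, auto simp: positive_op_form(1)[OF positive_op_gram[OF summable]])
  then show ?thesis
    unfolding gram_weighted[OF summable Q, symmetric] infsum_cmult_ennreal[symmetric]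
    by (simp only: mult.left_commute)
qed

lemma trace_dens: "trace_pos dens = 1"
proof -
  have "trace_pos dens = (\<Sum>\<^sub>\<infinity>n. 1 * ennreal (Re (cinner (ket n) (dens (ket n)))))" by (simp add: trace_pos_def)
  also have "\<dots> = ennreal (1 / real (card (lattice d L))) * (\<Sum>\<^sub>\<infinity>k\<in>cells (lattice d L). ennreal ((norm (slice \<eta> k))\<^sup>2))"
    using dens_weighted[of "\<lambda>x. x" "\<lambda>_. 1"] by (simp only: ennreal_norm_eq mult_1_left)
  also have "\<dots> = ennreal (1 / real (card (lattice d L))) * ennreal (real (card (lattice d L)))"
    by (simp add: slice_norm_sum[OF finite_lattice fock] unit ennreal_of_nat_eq_real_of_nat)
  also have "\<dots> = 1" using nonempty by (simp add: ennreal_mult[symmetric])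
  finally show ?thesis .
qed

end

lemma card_lattice: "card (lattice d L) = L ^ d"
  by (simp add: lattice_def card_PiE)

lemma one_add_power4_le:
  assumes "(0::real) \<le> t"
  shows "(1 + t) ^ 4 \<le> 16 * (1 + t ^ 7)"
proof (cases "t \<le> 1")
  case True
  then have "(1 + t) ^ 4 \<le> 2 ^ 4" using assms by (intro power_mono) auto
  also have "\<dots> \<le> 16 * (1 + t ^ 7)" using assms by simp
  finally show ?thesis .
next
  case False
  then have "(1 + t) ^ 4 \<le> (2 * t) ^ 4" by (intro power_mono) auto
  also have "\<dots> = 16 * t ^ 4" by (simp add: power_mult_distrib)
  also have "t ^ 4 \<le> t ^ 7" using False by (intro power_increasing) auto
  finally show ?thesis by simp
qed

text \<open>\<open>16 + 16 a\<close> serves in two places: as prefactor it covers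
  \<open>4 * sqrt 16 = 16\<close>, and in the exponent the \<open>16 a\<close> from
  \<open>(1 + t)^4 \<le> 16 (1 + t^7)\<close>. The root of the exponential is bounded by the
  exponential itself.\<close>

lemma final_constant:
  assumes "t \<ge> 0" "a \<ge> 0" "z \<ge> 0"
  shows "4 * sqrt (16 * exp (a * (1 + t) ^ 4) * z) \<le> (16 + 16 * a) * exp ((16 + 16 * a) * (1 + t ^ 7)) * sqrt z"
proof -
  let ?K = "16 + 16 * a"
  have "a * (1 + t) ^ 4 \<le> a * (16 * (1 + t ^ 7))" by (intro mult_left_mono one_add_power4_le assms)
  also have "\<dots> \<le> ?K * (1 + t ^ 7)" using assms by (simp add: algebra_simps)
  finally have 1: "exp (a * (1 + t) ^ 4) \<le> exp (?K * (1 + t ^ 7))" by simp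
  have "sqrt (exp (a * (1 + t) ^ 4)) \<le> exp (a * (1 + t) ^ 4)"
  proof (rule real_le_lsqrt[THEN order_trans[OF _ order_refl]])
    have "1 \<le> exp (a * (1 + t) ^ 4)" using assms by simp
    then have "exp (a * (1 + t) ^ 4) * 1 \<le> exp (a * (1 + t) ^ 4) * exp (a * (1 + t) ^ 4)" by (intro mult_left_mono) auto
    then show "exp (a * (1 + t) ^ 4) \<le> (exp (a * (1 + t) ^ 4))\<^sup>2" by (simp add: power2_eq_square)
  qed auto
  also note 1
  finally have "sqrt (exp (a * (1 + t) ^ 4)) \<le> exp (?K * (1 + t ^ 7))" .
  then have "16 * sqrt (exp (a * (1 + t) ^ 4)) * sqrt z \<le> ?K * exp (?K * (1 + t ^ 7)) * sqrt z"
    using assms by (intro mult_right_mono mult_mono) auto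
  then show ?thesis by (simp add: real_sqrt_mult)
qed

context bose_hubbard
begin

theorem mean_field_estimate:
  assumes on: "op_on_fock \<Lambda> \<gamma>0" and pos: "positive_op \<gamma>0" and tr: "trace_pos \<gamma>0 = 1"
    and sol: "mf_solution J \<mu> U \<phi>" and init: "norm (\<phi> 0) = 1"
    and C: "C > 0" "trace_form (proj (\<phi> 0)) (num_form 4) \<le> ennreal C"
    and t: "t \<ge> 0" and T: "T = trace_form (reduced_density d L \<gamma>0) (qNNq_plus_q_form (\<phi> 0))" "T < \<infinity>"
    and a: "a = 27 * \<bar>J\<bar> * ((2 + 2 * C) * (1 + 3 * \<bar>J\<bar>)) ^ 3"
  shows "trace_norm (\<lambda>\<psi>. reduced_density d L (von_neumann J \<mu> U d L \<gamma>0 t) \<psi> - proj (\<phi> t) \<psi>)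
    \<le> ennreal (4 * sqrt (16 * exp (a * (1 + t) ^ 4) * (enn2real T + 1 / d)))"
proof -
  interpret mf: mf_path J \<mu> U \<phi> by unfold_locales (fact sol init)+
  define \<eta> where "\<eta> i = sqrt_op \<gamma>0 (ket i)" for i
  have fock: "\<eta> i \<in> fock \<Lambda>" for i unfolding \<eta>_def by (rule sqrt_op_fock[OF on pos])
  have unit: "(\<Sum>\<^sub>\<infinity>i. ennreal ((norm (\<eta> i))\<^sup>2)) = 1"
    unfolding \<eta>_def using sqrt_op_gram(1)[OF pos] tr by simp
  have gr: "\<gamma>0 = gram UNIV \<eta>" unfolding \<eta>_def[abs_def] using sqrt_op_gram(2)[OF pos] tr by simp
  have gf: "\<gamma>0 Y \<in> fock \<Lambda>" for Y using on by (simp add: op_on_fock_def)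
  have card: "card \<Lambda> > 0" using L by (simp add: card_lattice)
  interpret D0: slice_density d L \<eta> by unfold_locales (fact fock unit card)+
  have fock': "Ut t (\<eta> i) \<in> fock \<Lambda>" for i by (rule Ut_fock[OF fock])
  have unit': "(\<Sum>\<^sub>\<infinity>i. ennreal ((norm (Ut t (\<eta> i)))\<^sup>2)) = 1" by (simp only: norm_Ut[OF fock] unit)
  interpret Dt: slice_density d L "\<lambda>i. Ut t (\<eta> i)" by unfold_locales (fact fock' unit' card)+
  have R0: "reduced_density d L \<gamma>0 = D0.dens"
    by (rule reduced_density_gram[OF fock]) (use unit gr in auto)
  have Rt: "reduced_density d L (von_neumann J \<mu> U d L \<gamma>0 t) = Dt.dens"
  proof (rule reduced_density_gram[OF fock'])
    show "(\<Sum>\<^sub>\<infinity>i. ennreal ((norm (Ut t (\<eta> i)))\<^sup>2)) < \<infinity>" by (simp add: unit')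
    show "von_neumann J \<mu> U d L \<gamma>0 t Y = gram UNIV (\<lambda>i. Ut t (\<eta> i)) Y" if "Y \<in> fock \<Lambda>" for Y
      by (rule von_neumann_gram[OF fock _ _ gf that]) (use unit gr in auto)
  qed
  let ?n = "real (card \<Lambda>)"
  define W where "W = (\<Sum>\<^sub>\<infinity>i. site_sum (\<lambda>\<xi>. wform (coproj (\<phi> 0) \<xi>)) (\<eta> i))"
  have nn: "ennreal ?n * ennreal (1 / ?n) = 1" using card by (simp add: ennreal_mult[symmetric])
  have TW: "T = ennreal (1 / ?n) * W"
  proof -
    have "T = ennreal (1 / ?n) * (\<Sum>\<^sub>\<infinity>k\<in>cells \<Lambda>. wform (coproj (\<phi> 0) (slice \<eta> k)))"
      unfolding T(1) R0 qNNq_form_eq[OF init] trace_form_weighted[OF D0.positive_op_dens coproj_sym[OF init]]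
        D0.dens_weighted[OF coproj_sym[OF init]] wform_def ..
    also have "(\<Sum>\<^sub>\<infinity>k\<in>cells \<Lambda>. wform (coproj (\<phi> 0) (slice \<eta> k))) = W"
      unfolding W_def site_sum_def by (rule infsum_slices[where h = "\<lambda>\<xi>. wform (coproj (\<phi> 0) \<xi>)"])
    finally show ?thesis .
  qed
  then have WT: "W = ennreal ?n * T" by (simp add: mult.assoc[symmetric] nn)
  define m where "m = mf.mass 0"
  have m0: "m \<ge> 0" unfolding m_def by (rule mf.mass_nonneg)
  \<comment> \<open>Finiteness of \<open>T\<close> bounds the \<open>q\<close> part of the number
    form, and the conserved mass supplies the component along \<open>\<phi> 0\<close>; only then is
    a cut at finite \<open>M\<close> a small change.\<close>
  have Nfin: "(\<Sum>\<^sub>\<infinity>i. site_sum nform (\<eta> i)) < \<infinity>"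
  proof -
    have "(\<Sum>\<^sub>\<infinity>i. site_sum nform (\<eta> i)) \<le> (\<Sum>\<^sub>\<infinity>i. 4 * site_sum (\<lambda>\<xi>. wform (coproj (\<phi> 0) \<xi>)) (\<eta> i)
        + (2 * ennreal m) * site_sum (\<lambda>\<xi>. ennreal ((norm \<xi>)\<^sup>2)) (\<eta> i))"
      by (intro infsum_mono_ennreal site_sum_le)
         (use nform_le_coproj[OF init] in \<open>simp add: mf.nform_phi m_def\<close>)
    also have "\<dots> = 4 * W + (2 * ennreal m) * (of_nat (card \<Lambda>) * 1)"
      by (simp only: infsum_add_ennreal infsum_cmult_ennreal W_def site_sum_norm[OF fock] unit)
    also have "\<dots> < \<infinity>" using T(2) by (simp add: WT ennreal_mult_less_top of_nat_less_top)
    finally show ?thesis .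
  qed
  \<comment> \<open>Chosen so that the weighted tail \<open>(2 + m) \<delta>\<close> equals the
    \<open>1/d\<close> contribution. The cut then merely doubles that term and turns 8 into
    16.\<close>
  define \<delta> where "\<delta> = ?n / (d * (2 + m))"
  have d0: "\<delta> > 0" unfolding \<delta>_def using card d m0 by simp
  obtain M where M: "(\<Sum>\<^sub>\<infinity>i. site_sum nform (\<eta> i - Pi M (\<eta> i))) \<le> ennreal \<delta>"
    using site_sum_tail[OF Nfin d0] by blast
  \<comment> \<open>From \<open>mass 0 \<le> mom2 0 \<le> 2 + 2 C\<close> and
    \<open>sqrt y \<le> y\<close> for \<open>y \<ge> 1\<close>: both the initial value and the slope
    of the root of the second moment are at most \<open>A\<close>.\<close>
  define A where "A = (2 + 2 * C) * (1 + 3 * \<bar>J\<bar>)"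
  have A0: "A \<ge> 0" unfolding A_def using C by simp
  have A: "sqrt (mf.mom2 s) \<le> A * (1 + s)" if s: "s \<ge> 0" for s
  proof -
    have b: "mf.mom2 0 \<le> 2 + 2 * C" by (rule mf.mom2_0_le) (use C in auto)
    have "1 \<le> mf.mom2 0" by (rule mf.mom2_ge)
    then have "sqrt (mf.mom2 0) \<le> mf.mom2 0" by (intro real_le_lsqrt) (auto simp: power2_eq_square)
    then have "sqrt (mf.mom2 s) \<le> (2 + 2 * C) + 3 * \<bar>J\<bar> * (2 + 2 * C) * s"
      using mf.sqrt_mom2_le[OF s] b mf.mom2_ge(2)[of 0] s
        mult_right_mono[OF mult_left_mono[of "mf.mass 0" "2 + 2 * C" "3 * \<bar>J\<bar>"] s] by linarith
    also have "\<dots> \<le> A * (1 + s)" unfolding A_def using C s by (simp add: algebra_simps)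
    finally show ?thesis .
  qed
  define E where "E = exp (a * (1 + t) ^ 4)"
  have E0: "E > 0" by (simp add: E_def)
  have aE: "exp (27 * \<bar>J\<bar> * A ^ 3 * (1 + t) ^ 4) = E" by (simp add: E_def a A_def)
  have "(\<Sum>\<^sub>\<infinity>i. site_sum (\<lambda>\<xi>. ennreal ((norm (coproj (\<phi> t) \<xi>))\<^sup>2)) (Ut t (\<eta> i)))
    \<le> (\<Sum>\<^sub>\<infinity>i. ennreal (8 * E) * (site_sum (\<lambda>\<xi>. wform (coproj (\<phi> 0) \<xi>)) (\<eta> i)
        + ennreal (2 + m) * site_sum nform (\<eta> i - Pi M (\<eta> i)) + ennreal (?n / d) * ennreal ((norm (\<eta> i))\<^sup>2)))"
  proof (rule infsum_mono_ennreal)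
    fix i
    interpret fp: fock_path J \<mu> U d L \<phi> "\<eta> i" M by unfold_locales (rule fock)
    show "site_sum (\<lambda>\<xi>. ennreal ((norm (coproj (\<phi> t) \<xi>))\<^sup>2)) (Ut t (\<eta> i))
      \<le> ennreal (8 * E) * (site_sum (\<lambda>\<xi>. wform (coproj (\<phi> 0) \<xi>)) (\<eta> i)
        + ennreal (2 + m) * site_sum nform (\<eta> i - Pi M (\<eta> i)) + ennreal (?n / d) * ennreal ((norm (\<eta> i))\<^sup>2))"
      using fp.state_bound[OF t A0 A] unfolding aE m_def .
  qed
  also have "\<dots> = ennreal (8 * E) * (W + ennreal (2 + m) * (\<Sum>\<^sub>\<infinity>i. site_sum nform (\<eta> i - Pi M (\<eta> i))) + ennreal (?n / d) * 1)"
    by (simp only: infsum_cmult_ennreal infsum_add_ennreal W_def unit)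
  also have "\<dots> \<le> ennreal (8 * E) * (W + ennreal (2 + m) * ennreal \<delta> + ennreal (?n / d) * 1)"
    by (intro mult_left_mono add_right_mono add_left_mono M) auto
  also have "ennreal (2 + m) * ennreal \<delta> = ennreal (?n / d)"
  proof -
    have "ennreal (2 + m) * ennreal \<delta> = ennreal ((2 + m) * \<delta>)"
      by (rule ennreal_mult[symmetric]) (use m0 d0 in auto)
    also have "(2 + m) * \<delta> = ?n / d" using m0 unfolding \<delta>_def by simp
    finally show ?thesis .
  qed
  finally have main: "(\<Sum>\<^sub>\<infinity>i. site_sum (\<lambda>\<xi>. ennreal ((norm (coproj (\<phi> t) \<xi>))\<^sup>2)) (Ut t (\<eta> i)))
     \<le> ennreal (8 * E) * (W + ennreal (?n / d) + ennreal (?n / d))" by simp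
  have nphi: "norm (\<phi> t) = 1" by (rule mf.norm_phi)
  have eps: "(\<Sum>\<^sub>\<infinity>n. ennreal (Re (cinner (coproj (\<phi> t) (ket n)) (Dt.dens (coproj (\<phi> t) (ket n))))))
    \<le> ennreal (16 * E * (enn2real T + 1 / d))"
  proof -
    have "(\<Sum>\<^sub>\<infinity>n. 1 * ennreal (Re (cinner (coproj (\<phi> t) (ket n)) (Dt.dens (coproj (\<phi> t) (ket n)))))) =
       ennreal (1 / ?n) * (\<Sum>\<^sub>\<infinity>k\<in>cells \<Lambda>. ennreal ((norm (coproj (\<phi> t) (slice (\<lambda>i. Ut t (\<eta> i)) k)))\<^sup>2))"
      unfolding Dt.dens_weighted[OF coproj_sym[OF nphi]] ennreal_norm_eq by (simp only: mult_1_left)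
    also have "\<dots> = ennreal (1 / ?n) * (\<Sum>\<^sub>\<infinity>i. site_sum (\<lambda>\<xi>. ennreal ((norm (coproj (\<phi> t) \<xi>))\<^sup>2)) (Ut t (\<eta> i)))"
      unfolding site_sum_def infsum_slices[where h = "\<lambda>\<xi>. ennreal ((norm (coproj (\<phi> t) \<xi>))\<^sup>2)"] ..
    also have "\<dots> \<le> ennreal (1 / ?n) * (ennreal (8 * E) * (W + ennreal (?n / d) + ennreal (?n / d)))"
      by (rule mult_left_mono[OF main]) simp
    also have "\<dots> = ennreal (8 * E) * (T + ennreal (1 / d) + ennreal (1 / d))"
    proof -
      have "ennreal (1 / ?n) * ennreal (?n / d) = ennreal (1 / d)"
        using card by (simp add: ennreal_mult[symmetric])
      then show ?thesis unfolding TW by (simp only: distrib_left mult.left_commute[of "ennreal (1 / ?n)"])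
    qed
    also have "T = ennreal (enn2real T)" using T(2) by (simp add: less_top)
    also have "ennreal (8 * E) * (ennreal (enn2real T) + ennreal (1 / d) + ennreal (1 / d))
       = ennreal (8 * E * (enn2real T + 1 / d + 1 / d))"
    proof -
      have "ennreal (8 * E * (enn2real T + 1 / d + 1 / d)) = ennreal (8 * E) * ennreal (enn2real T + 1 / d + 1 / d)"
        using E0 by (intro ennreal_mult) auto
      also have "ennreal (enn2real T + 1 / d + 1 / d) = ennreal (enn2real T) + ennreal (1 / d) + ennreal (1 / d)"
        by (simp only: ennreal_plus enn2real_nonneg divide_nonneg_nonneg zero_le_one of_nat_0_le_iff add_nonneg_nonneg)
      finally show ?thesis by (rule sym)
    qed
    also have "\<dots> \<le> ennreal (16 * E * (enn2real T + 1 / d))"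
    proof (rule ennreal_leI)
      have "8 * E * (enn2real T + 1 / d + 1 / d) \<le> 8 * E * (2 * (enn2real T + 1 / d))"
        using E0 by (intro mult_left_mono) auto
      also have "\<dots> = 16 * E * (enn2real T + 1 / d)" by (simp only: mult.assoc)
      finally show "8 * E * (enn2real T + 1 / d + 1 / d) \<le> 16 * E * (enn2real T + 1 / d)" .
    qed
    finally show ?thesis by simp
  qed
  show ?thesis
    unfolding Rt E_def[symmetric]
    by (rule trace_norm_diff_proj_le[OF Dt.positive_op_dens Dt.trace_dens nphi eps]) (use E0 in simp)
qed

end

theorem theorem2p2:
  fixes J \<mu> U C :: real
  assumes "U > 0" and "C > 0"
  shows "\<exists>K::real. K > 0 \<and>
    (\<forall>(d::nat) (L::nat) (\<gamma>0 :: config ell2 \<Rightarrow> config ell2) (\<phi> :: real \<Rightarrow> nat ell2).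
       d \<ge> 1 \<longrightarrow> L \<ge> 3 \<longrightarrow>
       op_on_fock (lattice d L) \<gamma>0 \<longrightarrow>
       positive_op \<gamma>0 \<longrightarrow> trace_class \<gamma>0 \<longrightarrow> trace_pos \<gamma>0 = 1 \<longrightarrow>
       mf_solution J \<mu> U \<phi> \<longrightarrow> norm (\<phi> 0) = 1 \<longrightarrow>
       trace_form (proj (\<phi> 0)) (num_form 4) \<le> ennreal C \<longrightarrow>
       (\<forall>t\<ge>0.
          let T = trace_form (reduced_density d L \<gamma>0) (qNNq_plus_q_form (\<phi> 0)) in
          T < \<infinity> \<longrightarrow>
          trace_norm (\<lambda>\<psi>. reduced_density d L (von_neumann J \<mu> U d L \<gamma>0 t) \<psi> - proj (\<phi> t) \<psi>)
            \<le> ennreal (K * exp (K * (1 + t ^ 7)) * sqrt (enn2real T + 1 / real d))))"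
proof -
  define a where "a = 27 * \<bar>J\<bar> * ((2 + 2 * C) * (1 + 3 * \<bar>J\<bar>)) ^ 3"
  have a0: "a \<ge> 0" unfolding a_def using assms by simp
  show ?thesis
  proof (intro exI[of _ "16 + 16 * a"] conjI allI impI)
    show "16 + 16 * a > 0" using a0 by simp
    fix d L :: nat and \<gamma>0 :: "config ell2 \<Rightarrow> config ell2" and \<phi> :: "real \<Rightarrow> nat ell2" and t :: real
    assume h: "d \<ge> 1" "L \<ge> 3" "op_on_fock (lattice d L) \<gamma>0" "positive_op \<gamma>0" "trace_class \<gamma>0" "trace_pos \<gamma>0 = 1"
      "mf_solution J \<mu> U \<phi>" "norm (\<phi> 0) = 1" "trace_form (proj (\<phi> 0)) (num_form 4) \<le> ennreal C" and t: "t \<ge> 0"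
    interpret bose_hubbard J \<mu> U d L by unfold_locales (fact h)+
    show "let T = trace_form (reduced_density d L \<gamma>0) (qNNq_plus_q_form (\<phi> 0)) in
          T < \<infinity> \<longrightarrow>
          trace_norm (\<lambda>\<psi>. reduced_density d L (von_neumann J \<mu> U d L \<gamma>0 t) \<psi> - proj (\<phi> t) \<psi>)
            \<le> ennreal ((16 + 16 * a) * exp ((16 + 16 * a) * (1 + t ^ 7)) * sqrt (enn2real T + 1 / real d))"
      unfolding Let_def
    proof
      let ?T = "trace_form (reduced_density d L \<gamma>0) (qNNq_plus_q_form (\<phi> 0))"
      assume fin: "?T < \<infinity>"
      have "trace_norm (\<lambda>\<psi>. reduced_density d L (von_neumann J \<mu> U d L \<gamma>0 t) \<psi> - proj (\<phi> t) \<psi>)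
          \<le> ennreal (4 * sqrt (16 * exp (a * (1 + t) ^ 4) * (enn2real ?T + 1 / d)))"
        by (rule mean_field_estimate[OF h(3,4,6,7,8) assms(2) h(9) t refl fin a_def])
      also have "\<dots> \<le> ennreal ((16 + 16 * a) * exp ((16 + 16 * a) * (1 + t ^ 7)) * sqrt (enn2real ?T + 1 / real d))"
        by (rule ennreal_leI[OF final_constant[OF t a0]]) simp
      finally show "trace_norm (\<lambda>\<psi>. reduced_density d L (von_neumann J \<mu> U d L \<gamma>0 t) \<psi> - proj (\<phi> t) \<psi>)
          \<le> ennreal ((16 + 16 * a) * exp ((16 + 16 * a) * (1 + t ^ 7)) * sqrt (enn2real ?T + 1 / real d))" .
    qed
  qed
qed

end
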